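(* Let $\Lambda$ be a non-channel Guichard surface in the conformal geometry $\langle\mathfrak{p}\rangle^\perp$ ($\mathfrak{p}\in\mathbb{R}^{4,2}$ neither lightlike nor zero) with umbilic-free Legendre lift $f$. Then the Eisenhart transforms $\hat\Lambda$ of $\Lambda$ constitute (via $\hat\Lambda\mapsto\hat f=(f\cap\hat\Lambda^\perp)\oplus\hat\Lambda$) a $4$-parameter family of Darboux transforms of the Legendre lift $f$ of $\Lambda$.
   Context: $\mathbb{R}^{4,2}$ is a 6-dimensional real vector space with a non-degenerate symmetric bilinear form $(\,,\,)$ of signature $(4,2)$, $\mathcal{L}$ its lightcone; $\wedge^2\mathbb{R}^{4,2}\cong\mathfrak{o}(4,2)$ via $a\wedge b\,(c)=(a,c)b-(b,c)a$. $\Sigma$ is a smooth 2-manifold, $d$ the trivial connection on $\underline{\mathbb{R}}^{4,2}=\Sigma\times\mathbb{R}^{4,2}$; $W^{(1)}$ is spanned by sections of a subbundle $W$ and their derivatives. A smooth isotropic rank 2 subbundle $f$ is a Legendre map if $f^{(1)}\le f^\perp$ and no non-zero $X\in T\Sigma$ satisfies $d_X\sigma\in f$ for all $\sigma\in\Gamma f$. Curvature spheres at $p$ are lines $s(p)\le f(p)$ killed by $\sigma\mapsto d_X\sigma\bmod f$ for all $X$ in some non-zero subspace of $T_p\Sigma$; $f$ is umbilic-free if there are exactly two at each point. A Legendre lift of $\Lambda:\Sigma\to\mathbb{P}(\mathcal{L}\cap\langle\mathfrak{p}\rangle^\perp)$ is a Legendre map $f$ with $\Lambda\le f$. Gauge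 potentials: closed $\eta\in\Omega^1(f\wedge f^\perp)$ with $[\eta\wedge\eta]=0$ such that $q(X,Y)=\mathrm{tr}(\sigma\mapsto\eta(X)d_Y\sigma:f\to f)$ is non-zero (of constant signature); $f$ is an $\Omega$-surface if $q$ is non-degenerate on a dense open set. The gauge orbit is $\{\eta-d\tau:\tau\in\Gamma(\wedge^2f)\}$. For $m'\in\mathbb{R}\setminus\{0\}$ and a null rank 1 subbundle $\hat s$ parallel for the flat connection $d+m'\eta$ and nowhere orthogonal to the curvature spheres of $f$, $\hat f:=(f\cap\hat s^\perp)\oplus\hat s$ is a Darboux transform of $f$ with parameter $m'$; the set of Darboux transforms depends only on the gauge orbit. Parameters are counted as one for $m'$ plus the number of parameters in the choice of the parallel line $\hat s$ (equivalently of a constant point of $\mathbb{P}(\mathcal{L})$ via a trivialisation of $d+m'\eta$); all Darboux transforms form a 5-parameter family. Guichard surfaces: a sphere congruence is a rank 4 subbundle $V$ of $\Sigma\times\langle\mathfrak{p}\rangle^\perp$ of signature $(3,1)$; write $d=\mathcal{D}^V+\mathcal{N}^V$ with $\mathcal{D}^V$ the sum of the induced connections on $V$ and $V^\perp$ and $\mathcal{N}^V\in\Omega^1(V\wedge V^\perp)$. $\Lambda$ envelops $V$ if $\Lambda^{(1)}\subset V$. $\Lambda$ is a Guichard surface if for some (equivalently any) enveloped $V$ there is $\chi^V\in\Omega^1(\Lambda\wedge\Lambda^{(1)})$ with $d^V_t:=\mathcal{D}^V+t\mathcal{N}^V+(t^2-1)\chi^V$ flat for all $t\in\mathbb{R}$.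 It is non-channel if $q^\Lambda(X,Y)=2\,\mathrm{tr}(\Lambda\to\Lambda,\sigma\mapsto\chi^V_X\mathcal{D}^V_Y\sigma)+\mathrm{tr}(\mathcal{N}^V_X\circ\mathcal{N}^V_Y|_{V^\perp})$ (independent of $V$) is non-degenerate. Given an enveloped $V$, let $s=f\cap V^\perp$ and let $\tilde s$ be the other null line subbundle of $V^\perp$ (so $f=\Lambda\oplus s$), and let $\mathcal{N}^{\tilde s}$ be the component of $\mathcal{N}^V$ in $\Omega^1(s\wedge V)$. Then $\eta=2(\chi^V+\mathcal{N}^{\tilde s})$ is a gauge potential with $q=q^\Lambda$, making $f$ an $\Omega$-surface; $f$ is equipped with its gauge orbit. An Eisenhart transform of $\Lambda$ with parameter $m$ is a null line subbundle $\hat\Lambda$ for which there is a sphere congruence $V$ enveloped by both $\Lambda$ and $\hat\Lambda$ such that $\hat\Lambda$ is parallel for $d^V_m$ (with $m\ne 0,\pm1$, and $\hat\Lambda$ nowhere orthogonal to the curvature spheres of $f$, as for all Darboux transforms here). *)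

theory Defs
  imports "HOL-Analysis.Analysis"
begin

section \<open>Smooth maps, submanifolds and smooth surfaces\<close>

text \<open>In finite dimensions a map is of class C\<open>\<^sup>n\<^sup>+\<^sup>1\<close> iff it is differentiable and all its directional
  derivatives are of class C\<open>\<^sup>n\<close>. The set \<open>S\<close> is always open below.\<close>

primrec Ck_on :: "nat \<Rightarrow> 'v::euclidean_space set \<Rightarrow> ('v \<Rightarrow> 'w::real_normed_vector) \<Rightarrow> bool" where
  "Ck_on 0 S g \<longleftrightarrow> continuous_on S g"
| "Ck_on (Suc n) S g \<longleftrightarrow> (\<forall>x\<in>S. g differentiable (at x)) \<and>
     (\<forall>v. Ck_on n S (\<lambda>x. frechet_derivative g (at x) v))"

definition smooth_on :: "'v::euclidean_space set \<Rightarrow> ('v \<Rightarrow> 'w::real_normed_vector) \<Rightarrow> bool" where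
  "smooth_on S g \<longleftrightarrow> (\<forall>n. Ck_on n S g)"

text \<open>Embedded \<open>k\<close>-dimensional submanifolds of a Euclidean space, as local regular level sets.\<close>

definition submanifold :: "nat \<Rightarrow> 'v::euclidean_space set \<Rightarrow> bool" where
  "submanifold k C \<longleftrightarrow> k \<le> DIM('v) \<and>
     (\<forall>x\<in>C. \<exists>W (g :: nat \<Rightarrow> 'v \<Rightarrow> real). open W \<and> x \<in> W \<and>
        (\<forall>i < DIM('v) - k. smooth_on W (g i)) \<and>
        C \<inter> W = {y \<in> W. \<forall>i < DIM('v) - k. g i y = 0} \<and>
        (\<forall>a :: nat \<Rightarrow> real.
           (\<forall>v. (\<Sum>i < DIM('v) - k. a i * frechet_derivative (g i) (at x) v) = 0)
           \<longrightarrow> (\<forall>i < DIM('v) - k. a i = 0)))"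

text \<open>A smooth surface is a type of class \<open>t2_space\<close> and \<open>second_countable_topology\<close> with an atlas
  of pairs of an open domain and a coordinate map.\<close>

type_synonym 'a chart = "'a set \<times> ('a \<Rightarrow> real^2)"

abbreviation chart_inv :: "'a chart \<Rightarrow> real^2 \<Rightarrow> 'a" where
  "chart_inv c \<equiv> inv_into (fst c) (snd c)"

definition is_chart :: "'a::topological_space chart \<Rightarrow> bool" where
  "is_chart c \<longleftrightarrow> open (fst c) \<and> open (snd c ` fst c) \<and>
     homeomorphism (fst c) (snd c ` fst c) (snd c) (chart_inv c)"

definition smooth_atlas :: "'a::topological_space chart set \<Rightarrow> bool" where
  "smooth_atlas A \<longleftrightarrow> (\<forall>c\<in>A. is_chart c) \<and> (\<Union>c\<in>A. fst c) = UNIV \<and>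
     (\<forall>c\<in>A. \<forall>c'\<in>A. smooth_on (snd c ` (fst c \<inter> fst c')) (snd c' \<circ> chart_inv c))"

definition smooth_map ::
  "'a::topological_space chart set \<Rightarrow> 'a set \<Rightarrow> ('a \<Rightarrow> 'w::real_normed_vector) \<Rightarrow> bool" where
  "smooth_map A N \<sigma> \<longleftrightarrow> (\<forall>c\<in>A. smooth_on (snd c ` (N \<inter> fst c)) (\<sigma> \<circ> chart_inv c))"

text \<open>The tangent space at every point \<open>x\<close> is identified with \<open>real^2\<close> by means of one chart
  \<open>chart_at A x\<close> chosen for \<open>x\<close>; \<open>coord_field A c v y\<close> is then the value at \<open>y\<close> of the
  vector field that has the constant components \<open>v\<close> in the chart \<open>c\<close>.\<close>

definition chart_at :: "'a chart set \<Rightarrow> 'a \<Rightarrow> 'a chart" where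
  "chart_at A x = (SOME c. c \<in> A \<and> x \<in> fst c)"

definition coord_field :: "'a chart set \<Rightarrow> 'a chart \<Rightarrow> real^2 \<Rightarrow> 'a \<Rightarrow> real^2" where
  "coord_field A c v y = frechet_derivative (snd (chart_at A y) \<circ> chart_inv c) (at (snd c y)) v"

text \<open>The trivial connection: \<open>dd A \<sigma> x X\<close> is the derivative of \<open>\<sigma>\<close> at \<open>x\<close> along \<open>X\<close>.\<close>

definition dd :: "'a chart set \<Rightarrow> ('a \<Rightarrow> 'w::real_normed_vector) \<Rightarrow> 'a \<Rightarrow> real^2 \<Rightarrow> 'w" where
  "dd A \<sigma> x X =
     frechet_derivative (\<sigma> \<circ> chart_inv (chart_at A x)) (at (snd (chart_at A x) x)) X"

section \<open>Linear algebra of the space of signature (4,2)\<close>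

type_synonym R42 = "(real^4) \<times> (real^2)"

definition form42 :: "R42 \<Rightarrow> R42 \<Rightarrow> real" where
  "form42 a b = fst a \<bullet> fst b - snd a \<bullet> snd b"

definition perp :: "R42 set \<Rightarrow> R42 set" where
  "perp S = {w. \<forall>v\<in>S. form42 v w = 0}"

definition isotropic :: "R42 set \<Rightarrow> bool" where
  "isotropic S \<longleftrightarrow> (\<forall>a\<in>S. \<forall>b\<in>S. form42 a b = 0)"

text \<open>The points of the projective lightcone.\<close>

definition null_line :: "R42 set \<Rightarrow> bool" where
  "null_line l \<longleftrightarrow> subspace l \<and> dim l = 1 \<and> isotropic l"

text \<open>A set of points of the projective lightcone is a submanifold of dimension \<open>k\<close> iff the union of
  these lines with the origin removed is one of dimension \<open>k + 1\<close>.\<close>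

definition lightcone_submanifold :: "nat \<Rightarrow> R42 set set \<Rightarrow> bool" where
  "lightcone_submanifold k Q \<longleftrightarrow> Q \<noteq> {} \<and> (\<forall>l\<in>Q. null_line l) \<and> submanifold (k + 1) (\<Union>Q - {0})"

definition wedge :: "R42 \<Rightarrow> R42 \<Rightarrow> R42 \<Rightarrow> R42" where
  "wedge a b c = form42 a c *\<^sub>R b - form42 b c *\<^sub>R a"

definition wedge_space :: "R42 set \<Rightarrow> R42 set \<Rightarrow> (R42 \<Rightarrow> R42) set" where
  "wedge_space S S' = {T. \<exists>(n::nat) a b. (\<forall>i<n. a i \<in> S \<and> b i \<in> S') \<and>
     T = (\<lambda>w. \<Sum>i<n. wedge (a i) (b i) w)}"

definition orth_proj :: "R42 set \<Rightarrow> R42 \<Rightarrow> R42" where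
  "orth_proj S w = (THE v. v \<in> S \<and> w - v \<in> perp S)"

definition pos_index :: "('v::euclidean_space \<Rightarrow> 'v \<Rightarrow> real) \<Rightarrow> 'v set \<Rightarrow> nat" where
  "pos_index b S = Max {dim P |P. subspace P \<and> P \<subseteq> S \<and> (\<forall>v\<in>P. v \<noteq> 0 \<longrightarrow> b v v > 0)}"

definition signature :: "('v::euclidean_space \<Rightarrow> 'v \<Rightarrow> real) \<Rightarrow> 'v set \<Rightarrow> nat \<times> nat" where
  "signature b S = (pos_index b S, pos_index (\<lambda>v w. - b v w) S)"

definition nondegenerate :: "('v::euclidean_space \<Rightarrow> 'v \<Rightarrow> real) \<Rightarrow> bool" where
  "nondegenerate b \<longleftrightarrow> (\<forall>X. (\<forall>Y. b X Y = 0) \<longrightarrow> X = 0)"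

definition trace_on :: "R42 set \<Rightarrow> (R42 \<Rightarrow> R42) \<Rightarrow> real" where
  "trace_on S T =
     (let E = (SOME E. independent E \<and> span E = S) in \<Sum>e\<in>E. representation E (T e) e)"

section \<open>Subbundles, sections, forms and connections\<close>

text \<open>A subbundle is a map from points to subspaces. Sections are taken to be local
  ones: \<open>sections A W x\<close> consists of the smooth sections of \<open>W\<close> defined near \<open>x\<close>.\<close>

type_synonym 'a vbundle = "'a \<Rightarrow> R42 set"
type_synonym 'a end_form = "'a \<Rightarrow> real^2 \<Rightarrow> R42 \<Rightarrow> R42"
type_synonym 'a connection = "('a \<Rightarrow> R42) \<Rightarrow> 'a \<Rightarrow> real^2 \<Rightarrow> R42"

definition subbundle ::
  "'a::topological_space chart set \<Rightarrow> 'a set \<Rightarrow> nat \<Rightarrow> 'a vbundle \<Rightarrow> bool" where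
  "subbundle A U k W \<longleftrightarrow> (\<forall>x\<in>U. \<exists>N (e :: nat \<Rightarrow> 'a \<Rightarrow> R42). open N \<and> x \<in> N \<and> N \<subseteq> U \<and>
     (\<forall>i<k. smooth_map A N (e i)) \<and>
     (\<forall>y\<in>N. W y = span ((\<lambda>i. e i y) ` {..<k}) \<and> dim (W y) = k))"

definition sections ::
  "'a::topological_space chart set \<Rightarrow> 'a vbundle \<Rightarrow> 'a \<Rightarrow> ('a \<Rightarrow> R42) set" where
  "sections A W x = {\<sigma>. \<exists>N. open N \<and> x \<in> N \<and> smooth_map A N \<sigma> \<and> (\<forall>y\<in>N. \<sigma> y \<in> W y)}"

definition derived :: "'a::topological_space chart set \<Rightarrow> 'a vbundle \<Rightarrow> 'a vbundle" where
  "derived A W x = span ({\<sigma> x |\<sigma>. \<sigma> \<in> sections A W x} \<union> {dd A \<sigma> x X |\<sigma> X. \<sigma> \<in> sections A W x})"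

text \<open>Trace of the endomorphism of \<open>W x\<close> induced by an operator \<open>T\<close> on sections of \<open>W\<close>, where
  \<open>T \<sigma>\<close> (an element of \<open>W x\<close>) depends only on \<open>\<sigma> x\<close>.\<close>

definition section_trace ::
  "'a::topological_space chart set \<Rightarrow> 'a vbundle \<Rightarrow> 'a \<Rightarrow> (('a \<Rightarrow> R42) \<Rightarrow> R42) \<Rightarrow> real" where
  "section_trace A W x T = trace_on (W x) (\<lambda>a. T (SOME \<sigma>. \<sigma> \<in> sections A W x \<and> \<sigma> x = a))"

text \<open>\<open>form1 A U S \<omega>\<close>: \<open>\<omega>\<close> is a smooth 1-form on \<open>U\<close> whose values at \<open>x\<close> lie in the subspace \<open>S x\<close> of
  the exterior square, realised as skew endomorphisms.\<close>

definition form1 :: "'a::topological_space chart set \<Rightarrow> 'a set \<Rightarrow> ('a \<Rightarrow> (R42 \<Rightarrow> R42) set)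
    \<Rightarrow> 'a end_form \<Rightarrow> bool" where
  "form1 A U S \<omega> \<longleftrightarrow> (\<forall>x\<in>U. (\<forall>X. \<omega> x X \<in> S x) \<and> (\<forall>w. linear (\<lambda>X. \<omega> x X w))) \<and>
     (\<forall>c\<in>A. \<forall>v w. smooth_map A (U \<inter> fst c) (\<lambda>y. \<omega> y (coord_field A c v y) w))"

text \<open>Closedness and flatness are expressed with the commuting coordinate fields of the charts.\<close>

definition closed_form :: "'a::topological_space chart set \<Rightarrow> 'a set \<Rightarrow> 'a end_form \<Rightarrow> bool" where
  "closed_form A U \<omega> \<longleftrightarrow> (\<forall>c\<in>A. \<forall>x \<in> U \<inter> fst c. \<forall>u v w.
     dd A (\<lambda>y. \<omega> y (coord_field A c v y) w) x (coord_field A c u x) =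
     dd A (\<lambda>y. \<omega> y (coord_field A c u y) w) x (coord_field A c v x))"

definition flat :: "'a::topological_space chart set \<Rightarrow> 'a set \<Rightarrow> 'a connection \<Rightarrow> bool" where
  "flat A U D \<longleftrightarrow> (\<forall>N \<sigma>. open N \<and> N \<subseteq> U \<and> smooth_map A N \<sigma> \<longrightarrow>
     (\<forall>c\<in>A. \<forall>x \<in> N \<inter> fst c. \<forall>u v.
        D (\<lambda>y. D \<sigma> y (coord_field A c v y)) x (coord_field A c u x) =
        D (\<lambda>y. D \<sigma> y (coord_field A c u y)) x (coord_field A c v x)))"

definition parallel ::
  "'a::topological_space chart set \<Rightarrow> 'a set \<Rightarrow> 'a connection \<Rightarrow> 'a vbundle \<Rightarrow> bool" where
  "parallel A U D W \<longleftrightarrow> (\<forall>x\<in>U. \<forall>\<sigma> \<in> sections A W x. \<forall>X. D \<sigma> x X \<in> W x)"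

definition null_line_bundle ::
  "'a::topological_space chart set \<Rightarrow> 'a set \<Rightarrow> 'a vbundle \<Rightarrow> bool" where
  "null_line_bundle A U L \<longleftrightarrow> subbundle A U 1 L \<and> (\<forall>x\<in>U. null_line (L x))"

section \<open>Legendre maps, gauge potentials and Darboux transforms\<close>

definition legendre_map ::
  "'a::topological_space chart set \<Rightarrow> 'a set \<Rightarrow> 'a vbundle \<Rightarrow> bool" where
  "legendre_map A U f \<longleftrightarrow> subbundle A U 2 f \<and>
     (\<forall>x\<in>U. isotropic (f x) \<and> derived A f x \<subseteq> perp (f x) \<and>
        (\<forall>X. (\<forall>\<sigma> \<in> sections A f x. dd A \<sigma> x X \<in> f x) \<longrightarrow> X = 0))"

definition curvature_sphere ::
  "'a::topological_space chart set \<Rightarrow> 'a vbundle \<Rightarrow> 'a \<Rightarrow> R42 set \<Rightarrow> bool" where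
  "curvature_sphere A f x s \<longleftrightarrow> subspace s \<and> dim s = 1 \<and> s \<subseteq> f x \<and>
     (\<exists>T :: (real^2) set. subspace T \<and> T \<noteq> {0} \<and>
        (\<forall>X\<in>T. \<forall>\<sigma> \<in> sections A f x. \<sigma> x \<in> s \<longrightarrow> dd A \<sigma> x X \<in> f x))"

definition umbilic_free ::
  "'a::topological_space chart set \<Rightarrow> 'a set \<Rightarrow> 'a vbundle \<Rightarrow> bool" where
  "umbilic_free A U f \<longleftrightarrow> (\<forall>x\<in>U. card {s. curvature_sphere A f x s} = 2)"

definition nowhere_orthogonal ::
  "'a::topological_space chart set \<Rightarrow> 'a set \<Rightarrow> 'a vbundle \<Rightarrow> 'a vbundle \<Rightarrow> bool" where
  "nowhere_orthogonal A U f L \<longleftrightarrow>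
     (\<forall>x\<in>U. \<forall>s. curvature_sphere A f x s \<longrightarrow> \<not> s \<subseteq> perp (L x))"

definition quad_diff ::
  "'a::topological_space chart set \<Rightarrow> 'a vbundle \<Rightarrow> 'a end_form \<Rightarrow> 'a \<Rightarrow> real^2 \<Rightarrow> real^2 \<Rightarrow> real" where
  "quad_diff A f \<eta> x X Y = section_trace A f x (\<lambda>\<sigma>. \<eta> x X (dd A \<sigma> x Y))"

text \<open>The bracket condition on \<open>\<eta>\<close> says that the values of \<open>\<eta>\<close> at each point commute. The signature of the
  quadratic differential is required to be locally constant, that is, constant on components.\<close>

definition gauge_potential ::
  "'a::topological_space chart set \<Rightarrow> 'a set \<Rightarrow> 'a vbundle \<Rightarrow> 'a end_form \<Rightarrow> bool" where
  "gauge_potential A U f \<eta> \<longleftrightarrow>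
     form1 A U (\<lambda>x. wedge_space (f x) (perp (f x))) \<eta> \<and> closed_form A U \<eta> \<and>
     (\<forall>x\<in>U. \<forall>X Y w. \<eta> x X (\<eta> x Y w) = \<eta> x Y (\<eta> x X w)) \<and>
     (\<forall>x\<in>U. \<exists>X Y. quad_diff A f \<eta> x X Y \<noteq> 0) \<and>
     (\<forall>x\<in>U. \<exists>N. open N \<and> x \<in> N \<and> N \<subseteq> U \<and> (\<forall>y\<in>N.
        signature (quad_diff A f \<eta> y) UNIV = signature (quad_diff A f \<eta> x) UNIV))"

definition Omega_surface ::
  "'a::topological_space chart set \<Rightarrow> 'a set \<Rightarrow> 'a vbundle \<Rightarrow> 'a end_form \<Rightarrow> bool" where
  "Omega_surface A U f \<eta> \<longleftrightarrow> legendre_map A U f \<and> gauge_potential A U f \<eta> \<and>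
     (\<exists>W. open W \<and> W \<subseteq> U \<and> U \<subseteq> closure W \<and> (\<forall>x\<in>W. nondegenerate (quad_diff A f \<eta> x)))"

definition gauge_orbit ::
  "'a::topological_space chart set \<Rightarrow> 'a set \<Rightarrow> 'a vbundle \<Rightarrow> 'a end_form \<Rightarrow> 'a end_form set" where
  "gauge_orbit A U f \<eta> = {\<eta>'. \<exists>\<tau> :: 'a \<Rightarrow> R42 \<Rightarrow> R42.
     (\<forall>x\<in>U. \<tau> x \<in> wedge_space (f x) (f x)) \<and> (\<forall>w. smooth_map A U (\<lambda>x. \<tau> x w)) \<and>
     (\<forall>x\<in>U. \<forall>X w. \<eta>' x X w = \<eta> x X w - dd A (\<lambda>y. \<tau> y w) x X)}"

definition darboux_connection :: "'a chart set \<Rightarrow> 'a end_form \<Rightarrow> real \<Rightarrow> 'a connection" where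
  "darboux_connection A \<eta> m' \<sigma> x X = dd A \<sigma> x X + m' *\<^sub>R \<eta> x X (\<sigma> x)"

definition darboux_line :: "'a::topological_space chart set \<Rightarrow> 'a set \<Rightarrow> 'a vbundle \<Rightarrow> 'a end_form
    \<Rightarrow> real \<Rightarrow> 'a vbundle \<Rightarrow> bool" where
  "darboux_line A U f \<eta> m' s \<longleftrightarrow> null_line_bundle A U s \<and>
     parallel A U (darboux_connection A \<eta> m') s \<and> nowhere_orthogonal A U f s"

definition transform_bundle :: "'a vbundle \<Rightarrow> 'a vbundle \<Rightarrow> 'a vbundle" where
  "transform_bundle f s x = {a + b |a b. a \<in> f x \<inter> perp (s x) \<and> b \<in> s x}"

text \<open>Darboux transforms of the restriction to \<open>U\<close> of the \<open>\<Omega>\<close>-surface \<open>f\<close> equipped with the gauge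
  orbit of \<open>\<eta>\<close>.\<close>

definition darboux_transform :: "'a::topological_space chart set \<Rightarrow> 'a set \<Rightarrow> 'a vbundle
    \<Rightarrow> 'a end_form \<Rightarrow> real \<Rightarrow> 'a vbundle \<Rightarrow> bool" where
  "darboux_transform A U f \<eta> m' fhat \<longleftrightarrow> Omega_surface A U f \<eta> \<and> m' \<noteq> 0 \<and>
     (\<exists>\<eta>' \<in> gauge_orbit A U f \<eta>. \<exists>s. darboux_line A U f \<eta>' m' s \<and>
        (\<forall>x\<in>U. fhat x = transform_bundle f s x))"

text \<open>A family of Darboux transforms assigns to an open set \<open>U\<close> and a parameter \<open>m'\<close> the set
  \<open>F U m'\<close> of those members over \<open>U\<close> that are Darboux transforms with parameter \<open>m'\<close>.
  It is an \<open>n\<close>-parameter family if \<open>n = 1 + k\<close>, where the values of \<open>m'\<close> that occur fill a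
  non-empty open set of non-zero reals (one parameter) and, for each of them and each gauge potential
  in the orbit, the parallel lines \<open>s\<close> yielding members of the family depend on \<open>k\<close> parameters.
  The latter is read locally: near any point \<open>x0\<close> the flat connection has a unique trivialisation
  equal to the identity at \<open>x0\<close>, so that the constant point of the projective lightcone
  that corresponds to \<open>s\<close> is \<open>s x0\<close>; these points have to form a \<open>k\<close>-dimensional submanifold.
  The localisation is essential: flat connections need not have global trivialisations, and the open
  condition of being nowhere orthogonal to the curvature spheres may fail away from \<open>x0\<close>. In this sense
  all Darboux transforms form a 5-parameter family.\<close>

definition darboux_family :: "'a::topological_space chart set \<Rightarrow> 'a vbundle \<Rightarrow> 'a end_form
    \<Rightarrow> nat \<Rightarrow> ('a set \<Rightarrow> real \<Rightarrow> 'a vbundle set) \<Rightarrow> bool" where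
  "darboux_family A f \<eta> n F \<longleftrightarrow>
     (\<forall>U m'. open U \<longrightarrow> (\<forall>fhat \<in> F U m'. darboux_transform A U f \<eta> m' fhat)) \<and>
     (\<exists>k M. n = 1 + k \<and> M = {m'. \<exists>U. open U \<and> U \<noteq> {} \<and> F U m' \<noteq> {}} \<and>
        open M \<and> M \<noteq> {} \<and> 0 \<notin> M \<and>
        (\<forall>\<eta>' \<in> gauge_orbit A UNIV f \<eta>. \<forall>m'\<in>M. \<forall>x0.
           lightcone_submanifold k {s x0 |U s. open U \<and> x0 \<in> U \<and> darboux_line A U f \<eta>' m' s \<and>
              (\<exists>fhat \<in> F U m'. \<forall>x\<in>U. fhat x = transform_bundle f s x)}))"

section \<open>Guichard surfaces and Eisenhart transforms\<close>

definition sphere_congruence ::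
  "'a::topological_space chart set \<Rightarrow> 'a set \<Rightarrow> R42 \<Rightarrow> 'a vbundle \<Rightarrow> bool" where
  "sphere_congruence A U p V \<longleftrightarrow> subbundle A U 4 V \<and>
     (\<forall>x\<in>U. V x \<subseteq> perp {p} \<and> signature form42 (V x) = (3, 1))"

definition envelops ::
  "'a::topological_space chart set \<Rightarrow> 'a set \<Rightarrow> 'a vbundle \<Rightarrow> 'a vbundle \<Rightarrow> bool" where
  "envelops A U L V \<longleftrightarrow> (\<forall>x\<in>U. derived A L x \<subseteq> V x)"

definition D_conn :: "'a chart set \<Rightarrow> 'a vbundle \<Rightarrow> 'a connection" where
  "D_conn A V \<sigma> x X =
     orth_proj (V x) (dd A (\<lambda>y. orth_proj (V y) (\<sigma> y)) x X) +
     orth_proj (perp (V x)) (dd A (\<lambda>y. orth_proj (perp (V y)) (\<sigma> y)) x X)"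

text \<open>The tensorial difference of the trivial connection and \<open>D_conn A V\<close>, evaluated on constant sections.\<close>

definition N_form :: "'a chart set \<Rightarrow> 'a vbundle \<Rightarrow> 'a end_form" where
  "N_form A V x X w = dd A (\<lambda>y. w) x X - D_conn A V (\<lambda>y. w) x X"

definition guichard_connection ::
  "'a chart set \<Rightarrow> 'a vbundle \<Rightarrow> 'a end_form \<Rightarrow> real \<Rightarrow> 'a connection" where
  "guichard_connection A V chi t \<sigma> x X =
     D_conn A V \<sigma> x X + t *\<^sub>R N_form A V x X (\<sigma> x) + (t\<^sup>2 - 1) *\<^sub>R chi x X (\<sigma> x)"

text \<open>\<open>V\<close> is a sphere congruence enveloped by \<open>L\<close>, and \<open>chi\<close> is a form \<open>chi\<^sup>V\<close> that makes the connections flat.\<close>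

definition guichard_potential :: "'a::topological_space chart set \<Rightarrow> 'a set \<Rightarrow> R42
    \<Rightarrow> 'a vbundle \<Rightarrow> 'a vbundle \<Rightarrow> 'a end_form \<Rightarrow> bool" where
  "guichard_potential A U p L V chi \<longleftrightarrow> sphere_congruence A U p V \<and> envelops A U L V \<and>
     form1 A U (\<lambda>x. wedge_space (L x) (derived A L x)) chi \<and>
     (\<forall>t. flat A U (guichard_connection A V chi t))"

definition guichard_quad_diff :: "'a::topological_space chart set \<Rightarrow> 'a vbundle \<Rightarrow> 'a vbundle
    \<Rightarrow> 'a end_form \<Rightarrow> 'a \<Rightarrow> real^2 \<Rightarrow> real^2 \<Rightarrow> real" where
  "guichard_quad_diff A L V chi x X Y =
     2 * section_trace A L x (\<lambda>\<sigma>. chi x X (D_conn A V \<sigma> x Y)) +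
     trace_on (perp (V x)) (\<lambda>w. N_form A V x X (N_form A V x Y w))"

text \<open>A surface in the conformal geometry of \<open>p\<close>: an immersion into its projective lightcone. The last
  clause expresses the immersion property; it makes \<open>derived A L\<close> a bundle of rank 3.\<close>

definition conformal_surface ::
  "'a::topological_space chart set \<Rightarrow> 'a set \<Rightarrow> R42 \<Rightarrow> 'a vbundle \<Rightarrow> bool" where
  "conformal_surface A U p L \<longleftrightarrow> null_line_bundle A U L \<and> (\<forall>x\<in>U. L x \<subseteq> perp {p}) \<and>
     (\<forall>x\<in>U. \<forall>X. (\<forall>\<sigma> \<in> sections A L x. dd A \<sigma> x X \<in> L x) \<longrightarrow> X = 0)"

text \<open>The gauge potential of the Legendre lift \<open>f\<close> of a Guichard surface: \<open>s = f \<inter> V\<^sup>\<bottom>\<close>,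
  \<open>other_null_line\<close> is the second null line of \<open>V\<^sup>\<bottom>\<close>, and \<open>N_tilde\<close> is the \<open>s \<and> V\<close>-component of
  \<open>N_form A V\<close>.\<close>

definition other_null_line :: "'a vbundle \<Rightarrow> 'a vbundle \<Rightarrow> 'a vbundle" where
  "other_null_line f V x = (THE l. null_line l \<and> l \<subseteq> perp (V x) \<and> l \<noteq> f x \<inter> perp (V x))"

definition N_tilde :: "'a chart set \<Rightarrow> 'a vbundle \<Rightarrow> 'a vbundle \<Rightarrow> 'a end_form" where
  "N_tilde A f V x X = (THE T. T \<in> wedge_space (f x \<inter> perp (V x)) (V x) \<and>
     (\<lambda>w. N_form A V x X w - T w) \<in> wedge_space (other_null_line f V x) (V x))"

definition guichard_gauge_potential ::
  "'a chart set \<Rightarrow> 'a vbundle \<Rightarrow> 'a vbundle \<Rightarrow> 'a end_form \<Rightarrow> 'a end_form" where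
  "guichard_gauge_potential A f V chi x X w = 2 *\<^sub>R (chi x X w + N_tilde A f V x X w)"

text \<open>Eisenhart transforms over \<open>U\<close> of a Guichard surface \<open>L\<close> with Legendre lift \<open>f\<close> and quadratic
  differential \<open>q\<close>. The forms \<open>chi\<^sup>V\<close> belonging to the various enveloped \<open>V\<close> are those
  with the given \<open>q\<close>: if \<open>L\<close> is also isothermic, flatness alone does not determine \<open>chi\<^sup>V\<close>.\<close>

definition eisenhart_transform :: "'a::topological_space chart set \<Rightarrow> 'a set \<Rightarrow> R42 \<Rightarrow> 'a vbundle
    \<Rightarrow> 'a vbundle \<Rightarrow> ('a \<Rightarrow> real^2 \<Rightarrow> real^2 \<Rightarrow> real) \<Rightarrow> real \<Rightarrow> 'a vbundle \<Rightarrow> bool" where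
  "eisenhart_transform A U p L f q m Lhat \<longleftrightarrow> m \<noteq> 0 \<and> m \<noteq> 1 \<and> m \<noteq> -1 \<and>
     null_line_bundle A U Lhat \<and> nowhere_orthogonal A U f Lhat \<and>
     (\<exists>V chi. guichard_potential A U p L V chi \<and>
        (\<forall>x\<in>U. \<forall>X Y. guichard_quad_diff A L V chi x X Y = q x X Y) \<and>
        envelops A U Lhat V \<and> parallel A U (guichard_connection A V chi m) Lhat)"

text \<open>The family of the transforms \<open>(f \<inter> Lhat\<^sup>\<bottom>) \<oplus> Lhat\<close>, for Eisenhart transforms \<open>Lhat\<close> with a parameter
  \<open>m\<close> corresponding to \<open>m'\<close> under \<open>\<mu>\<close>.\<close>

definition eisenhart_family :: "'a::topological_space chart set \<Rightarrow> R42 \<Rightarrow> 'a vbundle \<Rightarrow> 'a vbundle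
    \<Rightarrow> ('a \<Rightarrow> real^2 \<Rightarrow> real^2 \<Rightarrow> real) \<Rightarrow> (real \<Rightarrow> real) \<Rightarrow> 'a set \<Rightarrow> real \<Rightarrow> 'a vbundle set" where
  "eisenhart_family A p L f q \<mu> U m' = {fhat. \<exists>m Lhat. \<mu> m = m' \<and>
     eisenhart_transform A U p L f q m Lhat \<and> (\<forall>x\<in>U. fhat x = transform_bundle f Lhat x)}"

end

(*
Write K = (p, p). A sphere congruence V enveloped by \<Lambda> has the form <p, \<sigma>>^perp, where \<sigma> is the
section of f in V^perp with (\<sigma>, p) = 1. Then N^V = (p - K \<sigma>) \<and> d\<sigma> and \<eta> = 2 \<chi> - K \<sigma> \<and> d\<sigma>; the
connections d^V_t are flat for all t exactly if d\<chi> = K d\<sigma> \<and> d\<sigma> and \<chi>_X d_Y \<sigma> is symmetric in X and Y.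
All other enveloped sphere congruences arise by replacing \<sigma> by \<sigma> + l with l a section of \<Lambda>, which
replaces \<eta> by the element \<eta> - d(K \<sigma> \<and> l) of its gauge orbit.

Let m' = (m^2 - 1) / 2. A null line subbundle of V envelops V and is parallel for d^V_m exactly if it is
parallel for d + m' \<eta>, and p + m' K \<sigma> is a parallel section of d + m' \<eta> of constant length
K (1 + 2 m') = K m^2. A null line orthogonal to this section becomes orthogonal to p and \<sigma> separately
after a gauge transformation as above, so the Eisenhart transforms with parameter m amount to the
parallel null lines orthogonal to a non-null parallel vector. Their initial values form a 3-dimensional
quadric, and m' is the fourth parameter.
*)

theory Submission
  imports Defs
begin

subsection \<open>Smooth maps between Euclidean spaces\<close>

text \<open>The parameters count parallel lines, whereas the family consists of the bundles
  \<open>fhat\<close>. Two facts connect them. A transform determines its parallel line in a given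
  gauge: two different lines would differ by a section of \<open>f\<close> spanning a curvature
  sphere orthogonal to one of them. And \<open>exp (m' \<tau>)\<close> carries a parallel line to
  the gauge changed by \<open>\<tau>\<close> without changing the transform. The gauge of an
  Eisenhart transform depends on the transform: \<open>l\<close> is solved from
  \<open>(\<sigma> + l, s) = 0\<close>, which is possible where the line \<open>s\<close> is not
  orthogonal to \<open>\<Lambda>\<close>. This open condition is automatic for an Eisenhart
  transform, since orthogonal null lines of the Lorentzian space V coincide and a line inside
  \<open>f\<close> is orthogonal to all of \<open>f\<close>. It therefore removes points from the
  quadric without lowering its dimension. The factor 1/2 in m' compares
  \<open>(m^2 - 1) \<chi>\<close> with \<open>m' (2 \<chi>)\<close>. The sign of m is lost, and m =
  0 corresponds to m' = -1/2, the value at which the parallel vector becomes null and the quadric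
  degenerates.\<close>

lemma Ck_on_subset: "Ck_on n S g \<Longrightarrow> T \<subseteq> S \<Longrightarrow> Ck_on n T g"
proof (induction n arbitrary: g)
  case 0 then show ?case by (auto intro: continuous_on_subset)
next
  case (Suc n) then show ?case by (simp, meson subsetD)
qed

lemma frechet_derivative_cong:
  assumes "open S" "x \<in> S" "\<And>y. y \<in> S \<Longrightarrow> g y = h y"
  shows "frechet_derivative g (at x) = frechet_derivative h (at x)"
proof -
  have "(g has_derivative D) (at x) \<longleftrightarrow> (h has_derivative D) (at x)" for D
    using assms has_derivative_transform_within_open[of g D x UNIV S h]
      has_derivative_transform_within_open[of h D x UNIV S g] by (metis)
  then show ?thesis unfolding frechet_derivative_def by simp
qed

lemma differentiable_cong:
  assumes "open S" "x \<in> S" "\<And>y. y \<in> S \<Longrightarrow> g y = h y" "g differentiable (at x)"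
  shows "h differentiable (at x)"
  using assms has_derivative_transform_within_open[of g _ x UNIV S h]
  unfolding differentiable_def by blast

text \<open>Openness of \<open>S\<close> enters through the derivatives: agreement on
  \<open>S\<close> fixes the derivative at a point only if a whole neighbourhood of it lies in
  \<open>S\<close>.\<close>

lemma Ck_on_cong:
  "Ck_on n S g \<Longrightarrow> open S \<Longrightarrow> (\<And>y. y \<in> S \<Longrightarrow> g y = h y) \<Longrightarrow> Ck_on n S h"
proof (induction n arbitrary: g h)
  case 0 then show ?case by (auto cong: continuous_on_cong)
next
  case (Suc n)
  have "Ck_on n S (\<lambda>x. frechet_derivative h (at x) v)" for v
    by (rule Suc.IH[where g = "\<lambda>x. frechet_derivative g (at x) v"])
      (use Suc.prems frechet_derivative_cong[OF Suc.prems(2), of _ g h] in auto)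
  moreover have "h differentiable (at x)" if "x \<in> S" for x
    using differentiable_cong[OF Suc.prems(2) that Suc.prems(3)] Suc.prems(1) that by simp
  ultimately show ?case by simp
qed

text \<open>\<open>frechet_derivative\<close> is a choice operator. Uniqueness of derivatives lets
  the closure lemmas below work with an explicit formula for the derivative instead.\<close>

lemma Ck_on_SucI:
  assumes "open S" "\<And>x. x \<in> S \<Longrightarrow> (g has_derivative g' x) (at x)"
    "\<And>v. Ck_on n S (\<lambda>x. g' x v)"
  shows "Ck_on (Suc n) S g"
proof -
  have "frechet_derivative g (at x) = g' x" if "x \<in> S" for x
    using frechet_derivative_at[OF assms(2)[OF that]] by simp
  then have "Ck_on n S (\<lambda>x. frechet_derivative g (at x) v)" for v
    using Ck_on_cong[OF assms(3) assms(1), of v] by auto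
  then show ?thesis using assms(2) by (auto simp: differentiable_def)
qed

lemma Ck_on_SucD:
  assumes "Ck_on (Suc n) S g" "x \<in> S"
  shows "(g has_derivative frechet_derivative g (at x)) (at x)"
  using assms frechet_derivative_works by auto

lemma Ck_on_Suc_imp: "Ck_on (Suc n) S g \<Longrightarrow> Ck_on n S g"
proof (induction n arbitrary: g)
  case 0 then show ?case
    by (metis Ck_on.simps differentiable_at_imp_differentiable_on differentiable_imp_continuous_on)
next
  case (Suc n)
  then show ?case by (subst Ck_on.simps, subst (asm) (2) Ck_on.simps) blast
qed

lemma Ck_on_local:
  assumes "\<And>x. x \<in> S \<Longrightarrow> \<exists>T. open T \<and> x \<in> T \<and> Ck_on n T g"
  shows "Ck_on n S g"
  using assms
proof (induction n arbitrary: g)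
  case 0 then show ?case
    by (auto intro!: continuous_at_imp_continuous_on) (metis continuous_on_eq_continuous_at)
next
  case (Suc n)
  have "g differentiable (at x)" if "x \<in> S" for x
    using Suc.prems[OF that] by auto
  moreover have "Ck_on n S (\<lambda>x. frechet_derivative g (at x) v)" for v
    using Suc.prems by (intro Suc.IH) (metis Ck_on.simps(2))
  ultimately show ?case by simp
qed

section \<open>Closure properties of the classes C^n\<close>

lemma Ck_on_const: "Ck_on n S (\<lambda>x. c)"
  by (induction n arbitrary: c) (auto simp: frechet_derivative_const)

lemma Ck_on_linear:
  assumes "open S" "bounded_linear f" "Ck_on n S g"
  shows "Ck_on n S (\<lambda>x. f (g x))"
  using assms(3)
proof (induction n arbitrary: g)
  case 0 then show ?case using assms(2) by (auto intro: bounded_linear.continuous_on)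
next
  case (Suc n)
  show ?case
    by (rule Ck_on_SucI[OF assms(1), where g' = "\<lambda>x v. f (frechet_derivative g (at x) v)"])
      (use Suc bounded_linear.has_derivative[OF assms(2) Ck_on_SucD[OF Suc.prems]] in auto)
qed

lemma Ck_on_add:
  assumes "open S" "Ck_on n S g" "Ck_on n S h"
  shows "Ck_on n S (\<lambda>x. g x + h x)"
  using assms(2,3)
proof (induction n arbitrary: g h)
  case 0 then show ?case by (auto intro: continuous_on_add)
next
  case (Suc n)
  show ?case
    by (rule Ck_on_SucI[OF assms(1), where g' = "\<lambda>x v. frechet_derivative g (at x) v + frechet_derivative h (at x) v"])
      (use Suc has_derivative_add[OF Ck_on_SucD[OF Suc.prems(1)] Ck_on_SucD[OF Suc.prems(2)]] in auto)
qed

text \<open>One Leibniz rule serves products, scaling and \<open>form42\<close>. Both factors are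
  generalised in the induction because the rule pairs each factor with the derivative of the
  other.\<close>

lemma Ck_on_bilinear:
  assumes "open S" "bounded_bilinear B" "Ck_on n S g" "Ck_on n S h"
  shows "Ck_on n S (\<lambda>x. B (g x) (h x))"
  using assms(3,4)
proof (induction n arbitrary: g h)
  case 0 then show ?case using assms(2) by (auto intro: bounded_bilinear.continuous_on)
next
  case (Suc n)
  have "Ck_on n S g" "Ck_on n S h" using Suc.prems Ck_on_Suc_imp by auto
  then show ?case
    by (intro Ck_on_SucI[OF assms(1), where g' = "\<lambda>x v. B (g x) (frechet_derivative h (at x) v) + B (frechet_derivative g (at x) v) (h x)"]
        bounded_bilinear.FDERIV[OF assms(2)] Ck_on_SucD[OF Suc.prems(1)] Ck_on_SucD[OF Suc.prems(2)]
        Ck_on_add assms(1) Suc.IH)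
      (use Suc.prems in auto)
qed

lemma Ck_on_sum:
  assumes "open S" "\<And>i. i \<in> I \<Longrightarrow> Ck_on n S (g i)"
  shows "Ck_on n S (\<lambda>x. \<Sum>i\<in>I. g i x)"
  using assms(2)
  by (induction I rule: infinite_finite_induct) (auto simp: Ck_on_const intro!: Ck_on_add[OF assms(1)])

text \<open>The derivative of \<open>1/g\<close> is a product of \<open>1/g\<close> with derivatives
  of \<open>g\<close>, so each class for \<open>1/g\<close> follows from the preceding one.\<close>

lemma Ck_on_inverse:
  fixes g :: "'v::euclidean_space \<Rightarrow> real"
  assumes "open S" "Ck_on n S g" "\<And>x. x \<in> S \<Longrightarrow> g x \<noteq> 0"
  shows "Ck_on n S (\<lambda>x. inverse (g x))"
  using assms(2)
proof (induction n)
  case 0 then show ?case using assms(3) by (auto intro: continuous_on_inverse)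
next
  case (Suc n)
  have 1: "Ck_on n S (\<lambda>x. inverse (g x))" using Suc Ck_on_Suc_imp by blast
  have "((\<lambda>x. inverse (g x)) has_derivative (\<lambda>v. - (inverse (g x) * frechet_derivative g (at x) v * inverse (g x)))) (at x)"
    if "x \<in> S" for x
    using Deriv.has_derivative_inverse[OF assms(3)[OF that] Ck_on_SucD[OF Suc.prems that]] .
  moreover have "Ck_on n S (\<lambda>x. - (inverse (g x) * frechet_derivative g (at x) v * inverse (g x)))" for v
    using Suc.prems 1 by (intro Ck_on_linear[OF assms(1), where f = uminus]
        Ck_on_bilinear[OF assms(1) bounded_bilinear_mult] bounded_linear_minus bounded_linear_ident) auto
  ultimately show ?case
    by (intro Ck_on_SucI[OF assms(1), where g' = "\<lambda>x v. - (inverse (g x) * frechet_derivative g (at x) v * inverse (g x))"])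
qed

lemma Ck_on_compose:
  fixes T :: "'v::euclidean_space \<Rightarrow> 'u::euclidean_space"
  assumes "open S" "open S'" "Ck_on n S T" "Ck_on n S' g" "T ` S \<subseteq> S'"
  shows "Ck_on n S (\<lambda>x. g (T x))"
  using assms(3,4)
proof (induction n arbitrary: g)
  case 0 then show ?case using assms(5) by (auto intro: continuous_on_compose2)
next
  case (Suc n)
  \<comment> \<open>Expanding the direction \<open>frechet_derivative T (at x) v\<close> in the
    basis leaves scalar coefficients times partial derivatives of \<open>g\<close> composed with
    \<open>T\<close>, to which the induction hypothesis applies.\<close>
  let ?D = "\<lambda>x v. \<Sum>i\<in>Basis. (frechet_derivative T (at x) v \<bullet> i) *\<^sub>R frechet_derivative g (at (T x)) i"
  have "((\<lambda>x. g (T x)) has_derivative ?D x) (at x)" if "x \<in> S" for x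
  proof -
    have Tx: "T x \<in> S'" using that assms(5) by auto
    have dg: "(g has_derivative frechet_derivative g (at (T x))) (at (T x))"
      using Ck_on_SucD[OF Suc.prems(2) Tx] .
    then have lin: "linear (frechet_derivative g (at (T x)))"
      by (rule has_derivative_linear)
    have "?D x = (\<lambda>v. frechet_derivative g (at (T x)) (frechet_derivative T (at x) v))"
    proof
      fix v
      show "?D x v = frechet_derivative g (at (T x)) (frechet_derivative T (at x) v)"
        by (subst (2) euclidean_representation[symmetric])
          (simp add: linear_sum[OF lin] linear_cmul[OF lin])
    qed
    then show ?thesis
      using has_derivative_compose[OF Ck_on_SucD[OF Suc.prems(1) that] dg] by simp
  qed
  moreover have "Ck_on n S (\<lambda>x. ?D x v)" for v
  proof (intro Ck_on_sum[OF assms(1)] Ck_on_bilinear[OF assms(1) bounded_bilinear_scaleR])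
    fix i :: 'u
    show "Ck_on n S (\<lambda>x. frechet_derivative T (at x) v \<bullet> i)"
      using Suc.prems by (intro Ck_on_linear[OF assms(1) bounded_linear_inner_left]) auto
    show "Ck_on n S (\<lambda>x. frechet_derivative g (at (T x)) i)"
      using Suc.prems Ck_on_Suc_imp by (intro Suc.IH) (auto simp del: Ck_on.simps, auto)
  qed
  ultimately show ?case by (intro Ck_on_SucI[OF assms(1), where g' = ?D])
qed

lemma smooth_on_deriv: "smooth_on S g \<Longrightarrow> smooth_on S (\<lambda>x. frechet_derivative g (at x) v)"
  unfolding smooth_on_def by (metis Ck_on.simps(2))

lemma smooth_on_has_derivative:
  "smooth_on S g \<Longrightarrow> x \<in> S \<Longrightarrow> (g has_derivative frechet_derivative g (at x)) (at x)"
  unfolding smooth_on_def by (metis Ck_on_SucD)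

lemma smooth_on_continuous_on: "smooth_on S g \<Longrightarrow> continuous_on S g"
  unfolding smooth_on_def by (metis Ck_on.simps(1))

section \<open>Symmetry of second derivatives\<close>

text \<open>The left side is symmetric in the two variables, while two applications of the mean
  value theorem single out one order of differentiation. Using the lemma in both orders compares the
  two mixed derivatives.\<close>

lemma mixed_difference_mvt:
  fixes g :: "real \<Rightarrow> real \<Rightarrow> real"
  assumes "h > 0"
    and d1: "\<And>s t. \<bar>s\<bar> \<le> h \<Longrightarrow> \<bar>t\<bar> \<le> h \<Longrightarrow> ((\<lambda>s. g s t) has_real_derivative g1 s t) (at s)"
    and d2: "\<And>s t. \<bar>s\<bar> \<le> h \<Longrightarrow> \<bar>t\<bar> \<le> h \<Longrightarrow> ((\<lambda>t. g1 s t) has_real_derivative g12 s t) (at t)"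
  shows "\<exists>s t. \<bar>s\<bar> \<le> h \<and> \<bar>t\<bar> \<le> h \<and> g h h - g h 0 - g 0 h + g 0 0 = h * h * g12 s t"
proof -
  have "\<exists>z>0. z < h \<and> (g h h - g h 0) - (g 0 h - g 0 0) = (h - 0) * (g1 z h - g1 z 0)"
    by (rule MVT2[where f = "\<lambda>s. g s h - g s 0"])
      (use assms(1) in \<open>auto intro!: DERIV_diff d1\<close>)
  then obtain z where z: "0 < z" "z < h" "(g h h - g h 0) - (g 0 h - g 0 0) = h * (g1 z h - g1 z 0)"
    by auto
  have "\<exists>y>0. y < h \<and> g1 z h - g1 z 0 = (h - 0) * g12 z y"
    by (rule MVT2) (use assms(1) z in \<open>auto intro!: d2\<close>)
  then obtain y where "0 < y" "y < h" "g1 z h - g1 z 0 = h * g12 z y" by auto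
  then show ?thesis using z by (intro exI[of _ z] exI[of _ y]) auto
qed

lemma smooth_on_linear:
  assumes "open S" "bounded_linear f" "smooth_on S g" shows "smooth_on S (\<lambda>x. f (g x))"
  using assms Ck_on_linear unfolding smooth_on_def by blast

lemma frechet_derivative_linear:
  assumes "bounded_linear f" "(g has_derivative D) (at x)"
  shows "frechet_derivative (\<lambda>x. f (g x)) (at x) v = f (D v)"
  using frechet_derivative_at[OF bounded_linear.has_derivative[OF assms]] by metis

text \<open>Both mixed derivatives, taken at possibly different points near \<open>x\<close>, equal
  the same mixed difference divided by \<open>h^2\<close>. Their continuity at \<open>x\<close>
  closes the gap.\<close>

lemma second_derivative_symmetric_real:
  fixes g :: "'v::euclidean_space \<Rightarrow> real"
  assumes S: "open S" "x \<in> S" and g: "smooth_on S g"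
  shows "frechet_derivative (\<lambda>y. frechet_derivative g (at y) v) (at x) u =
    frechet_derivative (\<lambda>y. frechet_derivative g (at y) u) (at x) v" (is "?L = ?R")
proof -
  define G where "G = (\<lambda>u v y. frechet_derivative (\<lambda>y. frechet_derivative g (at y) v) (at y) u)"
  have sm: "smooth_on S (G u v)" for u v
    unfolding G_def by (intro smooth_on_deriv g)
  have line: "((\<lambda>s. k (y + s *\<^sub>R u)) has_real_derivative frechet_derivative k (at (y + s *\<^sub>R u)) u) (at s)"
    if "smooth_on S k" "y + s *\<^sub>R u \<in> S" for k :: "'v \<Rightarrow> real" and y s u
  proof -
    have "((\<lambda>s. y + s *\<^sub>R u) has_derivative (\<lambda>r. r *\<^sub>R u)) (at s)"
      by (auto intro!: derivative_eq_intros)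
    from has_derivative_compose[OF this smooth_on_has_derivative[OF that]]
    show ?thesis
      unfolding has_field_derivative_def
      using linear_cmul[OF has_derivative_linear[OF smooth_on_has_derivative[OF that]]]
      by (simp add: mult.commute[of _ "frechet_derivative k _ _"])
  qed
  obtain r where r: "r > 0" "\<And>y. dist y x < r \<Longrightarrow> y \<in> S"
    using S by (meson open_dist)
  have main: "\<bar>G u v x - G v u x\<bar> < e" if e: "e > 0" for e
  proof -
    have c: "isCont (G u v) x" for u v
      using smooth_on_continuous_on[OF sm] S continuous_on_eq_continuous_at by blast
    obtain d1 where d1: "d1 > 0" "\<And>y. dist y x < d1 \<Longrightarrow> dist (G u v y) (G u v x) < e/2"
      using c[of u v] e unfolding continuous_at_eps_delta by (metis half_gt_zero)
    obtain d2 where d2: "d2 > 0" "\<And>y. dist y x < d2 \<Longrightarrow> dist (G v u y) (G v u x) < e/2"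
      using c[of v u] e unfolding continuous_at_eps_delta by (metis half_gt_zero)
    define d where "d = min r (min d1 d2)"
    \<comment> \<open>All points \<open>x + s u + t v\<close> with \<open>|s|, |t| \<le> h\<close>
      stay within distance \<open>d / 2\<close> of \<open>x\<close>; the summand 1 keeps the
      quotient meaningful when \<open>u\<close> and \<open>v\<close> vanish.\<close>
    define h where "h = d / (2 * (norm u + norm v + 1))"
    have pos: "norm u + norm v + 1 > 0" by (smt (verit) norm_ge_zero)
    have h: "h > 0" unfolding h_def d_def using r d1 d2 pos by auto
    have near: "dist (x + s *\<^sub>R u + t *\<^sub>R v) x < d" if "\<bar>s\<bar> \<le> h" "\<bar>t\<bar> \<le> h" for s t
    proof -
      have "dist (x + s *\<^sub>R u + t *\<^sub>R v) x = norm (s *\<^sub>R u + t *\<^sub>R v)"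
        by (simp add: dist_norm add.assoc)
      also have "\<dots> \<le> \<bar>s\<bar> * norm u + \<bar>t\<bar> * norm v"
        by (metis norm_scaleR norm_triangle_ineq)
      also have "\<dots> \<le> h * norm u + h * norm v"
        using that by (intro add_mono mult_right_mono) auto
      also have "\<dots> \<le> h * (norm u + norm v + 1)" using h by (simp add: algebra_simps)
      also have "\<dots> = d / 2" unfolding h_def using pos by (simp add: field_simps)
      also have "\<dots> < d" using h pos by (simp add: h_def zero_less_divide_iff)
      finally show ?thesis .
    qed
    have inS: "x + s *\<^sub>R u + t *\<^sub>R v \<in> S" if "\<bar>s\<bar> \<le> h" "\<bar>t\<bar> \<le> h" for s t
      using near[OF that] r(2) by (simp add: d_def)
    define F where "F = (\<lambda>s t. g (x + s *\<^sub>R u + t *\<^sub>R v))"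
    have "\<exists>s t. \<bar>s\<bar> \<le> h \<and> \<bar>t\<bar> \<le> h \<and> F h h - F h 0 - F 0 h + F 0 0 = h * h * G v u (x + s *\<^sub>R u + t *\<^sub>R v)"
    proof (rule mixed_difference_mvt[OF h])
      fix s t assume st: "\<bar>s\<bar> \<le> h" "\<bar>t\<bar> \<le> h"
      show "((\<lambda>s. F s t) has_real_derivative frechet_derivative g (at (x + s *\<^sub>R u + t *\<^sub>R v)) u) (at s)"
        unfolding F_def using line[OF g, of "x + t *\<^sub>R v" s u] inS[OF st] by (simp add: ac_simps)
      show "((\<lambda>t. frechet_derivative g (at (x + s *\<^sub>R u + t *\<^sub>R v)) u) has_real_derivative G v u (x + s *\<^sub>R u + t *\<^sub>R v)) (at t)"
        unfolding G_def using line[OF smooth_on_deriv[OF g], of "x + s *\<^sub>R u" t v] inS[OF st] by simp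
    qed
    then obtain s t where st: "\<bar>s\<bar> \<le> h" "\<bar>t\<bar> \<le> h"
      "F h h - F h 0 - F 0 h + F 0 0 = h * h * G v u (x + s *\<^sub>R u + t *\<^sub>R v)" by blast
    have "\<exists>t s. \<bar>t\<bar> \<le> h \<and> \<bar>s\<bar> \<le> h \<and> F h h - F 0 h - F h 0 + F 0 0 = h * h * G u v (x + s *\<^sub>R u + t *\<^sub>R v)"
    proof (rule mixed_difference_mvt[OF h, where g = "\<lambda>t s. F s t"])
      fix t s assume "\<bar>t\<bar> \<le> h" "\<bar>s\<bar> \<le> h"
      then have st: "\<bar>s\<bar> \<le> h" "\<bar>t\<bar> \<le> h" by auto
      show "((\<lambda>t. F s t) has_real_derivative frechet_derivative g (at (x + s *\<^sub>R u + t *\<^sub>R v)) v) (at t)"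
        unfolding F_def using line[OF g, of "x + s *\<^sub>R u" t v] inS[OF st] by (simp add: ac_simps)
      show "((\<lambda>s. frechet_derivative g (at (x + s *\<^sub>R u + t *\<^sub>R v)) v) has_real_derivative G u v (x + s *\<^sub>R u + t *\<^sub>R v)) (at s)"
        unfolding G_def using line[OF smooth_on_deriv[OF g], of "x + t *\<^sub>R v" s u] inS[OF st]
        by (simp add: ac_simps)
    qed
    then obtain s' t' where st': "\<bar>s'\<bar> \<le> h" "\<bar>t'\<bar> \<le> h"
      "F h h - F 0 h - F h 0 + F 0 0 = h * h * G u v (x + s' *\<^sub>R u + t' *\<^sub>R v)" by blast
    have "h * h * G v u (x + s *\<^sub>R u + t *\<^sub>R v) = h * h * G u v (x + s' *\<^sub>R u + t' *\<^sub>R v)"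
      using st(3) st'(3) by linarith
    then have eq: "G v u (x + s *\<^sub>R u + t *\<^sub>R v) = G u v (x + s' *\<^sub>R u + t' *\<^sub>R v)"
      using h by simp
    have "dist (G v u (x + s *\<^sub>R u + t *\<^sub>R v)) (G v u x) < e/2"
      using d2(2) near[OF st(1,2)] by (simp add: d_def)
    moreover have "dist (G u v (x + s' *\<^sub>R u + t' *\<^sub>R v)) (G u v x) < e/2"
      using d1(2) near[OF st'(1,2)] by (simp add: d_def)
    ultimately show ?thesis using eq unfolding dist_real_def by linarith
  qed
  have "G u v x = G v u x" using main[of "\<bar>G u v x - G v u x\<bar>"] by fastforce
  then show ?thesis by (simp add: G_def)
qed

lemma second_derivative_symmetric:
  fixes g :: "'v::euclidean_space \<Rightarrow> 'w::euclidean_space"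
  assumes S: "open S" "x \<in> S" and g: "smooth_on S g"
  shows "frechet_derivative (\<lambda>y. frechet_derivative g (at y) v) (at x) u =
    frechet_derivative (\<lambda>y. frechet_derivative g (at y) u) (at x) v"
proof (rule euclidean_eqI)
  fix b :: 'w
  let ?B = "\<lambda>w::'w. w \<bullet> b"
  have bl: "bounded_linear ?B" by (rule bounded_linear_inner_left)
  have 1: "frechet_derivative (\<lambda>y. ?B (g y)) (at y) v = ?B (frechet_derivative g (at y) v)" if "y \<in> S" for y v
    using frechet_derivative_linear[OF bl smooth_on_has_derivative[OF g that]] .
  have 2: "frechet_derivative (\<lambda>y. frechet_derivative (\<lambda>y. ?B (g y)) (at y) v) (at x) u =
      ?B (frechet_derivative (\<lambda>y. frechet_derivative g (at y) v) (at x) u)" for u v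
    using frechet_derivative_cong[OF S, of "\<lambda>y. frechet_derivative (\<lambda>y. ?B (g y)) (at y) v"
        "\<lambda>y. ?B (frechet_derivative g (at y) v)", OF 1]
      frechet_derivative_linear[OF bl smooth_on_has_derivative[OF smooth_on_deriv[OF g, of v] S(2)], of u]
    by simp
  show "frechet_derivative (\<lambda>y. frechet_derivative g (at y) v) (at x) u \<bullet> b =
    frechet_derivative (\<lambda>y. frechet_derivative g (at y) u) (at x) v \<bullet> b"
    using second_derivative_symmetric_real[OF S smooth_on_linear[OF S(1) bl g], of v u]
    unfolding 2 .
qed

section \<open>Closure properties of smooth maps\<close>

lemma smooth_onI: "(\<And>n. Ck_on n S g) \<Longrightarrow> smooth_on S g"
  by (simp add: smooth_on_def)

lemma smooth_onD: "smooth_on S g \<Longrightarrow> Ck_on n S g"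
  by (simp add: smooth_on_def)

lemma smooth_on_subset:
  assumes "smooth_on S g" "T \<subseteq> S"
  shows "smooth_on T g"
  by (rule smooth_onI) (rule Ck_on_subset[OF smooth_onD[OF assms(1)] assms(2)])

lemma smooth_on_cong:
  assumes "smooth_on S g" "open S" "\<And>y. y \<in> S \<Longrightarrow> g y = h y"
  shows "smooth_on S h"
  by (rule smooth_onI) (rule Ck_on_cong[OF smooth_onD[OF assms(1)] assms(2,3)])

lemma smooth_on_local:
  assumes "\<And>x. x \<in> S \<Longrightarrow> \<exists>T. open T \<and> x \<in> T \<and> smooth_on T g"
  shows "smooth_on S g"
proof (intro smooth_onI Ck_on_local)
  fix n x assume "x \<in> S"
  then show "\<exists>T. open T \<and> x \<in> T \<and> Ck_on n T g"
    using assms smooth_onD by blast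
qed

lemma smooth_on_const: "smooth_on S (\<lambda>x. c)"
  by (simp add: smooth_on_def Ck_on_const)

lemma smooth_on_add:
  assumes "open S" "smooth_on S g" "smooth_on S h"
  shows "smooth_on S (\<lambda>x. g x + h x)"
  by (rule smooth_onI) (rule Ck_on_add[OF assms(1) assms(2,3)[THEN smooth_onD]])

lemma smooth_on_bilinear:
  assumes "open S" "bounded_bilinear B" "smooth_on S g" "smooth_on S h"
  shows "smooth_on S (\<lambda>x. B (g x) (h x))"
  by (rule smooth_onI) (rule Ck_on_bilinear[OF assms(1,2) assms(3,4)[THEN smooth_onD]])

lemma smooth_on_sum:
  assumes "open S" "\<And>i. i \<in> I \<Longrightarrow> smooth_on S (g i)"
  shows "smooth_on S (\<lambda>x. \<Sum>i\<in>I. g i x)"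
  by (rule smooth_onI) (rule Ck_on_sum[OF assms(1) assms(2)[THEN smooth_onD]])

lemma smooth_on_inverse:
  fixes g :: "'v::euclidean_space \<Rightarrow> real"
  assumes "open S" "smooth_on S g" "\<And>x. x \<in> S \<Longrightarrow> g x \<noteq> 0"
  shows "smooth_on S (\<lambda>x. inverse (g x))"
  by (rule smooth_onI) (rule Ck_on_inverse[OF assms(1) assms(2)[THEN smooth_onD] assms(3)])

lemma smooth_on_compose:
  fixes T :: "'v::euclidean_space \<Rightarrow> 'u::euclidean_space"
  assumes "open S" "open S'" "smooth_on S T" "smooth_on S' g" "T ` S \<subseteq> S'"
  shows "smooth_on S (\<lambda>x. g (T x))"
  by (rule smooth_onI) (rule Ck_on_compose[OF assms(1,2) smooth_onD[OF assms(3)] smooth_onD[OF assms(4)] assms(5)])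

lemma smooth_onI_derivative:
  assumes "open S" "\<And>x. x \<in> S \<Longrightarrow> (g has_derivative g' x) (at x)" "\<And>v. smooth_on S (\<lambda>x. g' x v)"
  shows "smooth_on S g"
  by (rule smooth_onI) (rule Ck_on_Suc_imp[OF Ck_on_SucI[OF assms(1,2) assms(3)[THEN smooth_onD]]])

lemma smooth_on_ident: "open S \<Longrightarrow> smooth_on S (\<lambda>x. x)"
  by (rule smooth_onI_derivative[where g' = "\<lambda>x v. v"]) (auto simp: smooth_on_const intro: has_derivative_ident)

subsection \<open>Closed forms and parallel sections on a ball\<close>

lemma linear_expand_Basis:
  assumes "linear f"
  shows "f v = (\<Sum>i\<in>Basis. (v \<bullet> i) *\<^sub>R f i)"
  by (subst euclidean_representation[of v, symmetric]) (simp add: linear_sum[OF assms] linear_cmul[OF assms])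

text \<open>Operator-valued maps are known to be smooth only at each fixed argument. Linearity
  reduces a variable argument to the finitely many basis vectors.\<close>

lemma smooth_on_apply:
  fixes a :: "'v::euclidean_space \<Rightarrow> 'w::euclidean_space \<Rightarrow> 'u::real_normed_vector"
  assumes "open S" "\<And>w. smooth_on S (\<lambda>z. a z w)" "\<And>z. z \<in> S \<Longrightarrow> linear (a z)" "smooth_on S g"
  shows "smooth_on S (\<lambda>z. a z (g z))"
proof (rule smooth_on_cong[OF _ assms(1)])
  show "smooth_on S (\<lambda>z. \<Sum>i\<in>Basis. (g z \<bullet> i) *\<^sub>R a z i)"
    by (rule smooth_on_sum[OF assms(1)])
      (rule smooth_on_bilinear[OF assms(1) bounded_bilinear_scaleR
          smooth_on_linear[OF assms(1) bounded_linear_inner_left assms(4)] assms(2)])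
  show "(\<Sum>i\<in>Basis. (g z \<bullet> i) *\<^sub>R a z i) = a z (g z)" if "z \<in> S" for z
    by (rule linear_expand_Basis[OF assms(3)[OF that], symmetric])
qed

lemma has_derivative_apply:
  fixes a :: "'v::euclidean_space \<Rightarrow> 'w::euclidean_space \<Rightarrow> 'u::real_normed_vector"
  assumes S: "open S" "z \<in> S"
    and da: "\<And>w. ((\<lambda>z. a z w) has_derivative (\<lambda>u. a' u w)) (at z)"
    and lin: "\<And>z. z \<in> S \<Longrightarrow> linear (a z)"
    and g: "(g has_derivative g') (at z)"
  shows "((\<lambda>z. a z (g z)) has_derivative (\<lambda>u. a' u (g z) + a z (g' u))) (at z)"
proof -
  \<comment> \<open>Linearity of \<open>a'\<close> in its second argument is not assumed; it is
    inherited from \<open>a\<close> by uniqueness of the derivative.\<close>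
  have lin': "a' u (g z) = (\<Sum>i\<in>Basis. (g z \<bullet> i) *\<^sub>R a' u i)" for u
  proof -
    have "((\<lambda>y. \<Sum>i\<in>Basis. (g z \<bullet> i) *\<^sub>R a y i) has_derivative (\<lambda>u. \<Sum>i\<in>Basis. (g z \<bullet> i) *\<^sub>R a' u i)) (at z)"
      by (intro has_derivative_sum has_derivative_scaleR_right da)
    then have "((\<lambda>y. a y (g z)) has_derivative (\<lambda>u. \<Sum>i\<in>Basis. (g z \<bullet> i) *\<^sub>R a' u i)) (at z)"
      by (rule has_derivative_transform_within_open[OF _ S]) (simp add: linear_expand_Basis[OF lin, symmetric])
    from has_derivative_unique[OF da[of "g z"] this] show ?thesis by (rule fun_cong)
  qed
  have "((\<lambda>y. \<Sum>i\<in>Basis. (g y \<bullet> i) *\<^sub>R a y i) has_derivative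
      (\<lambda>u. \<Sum>i\<in>Basis. (g z \<bullet> i) *\<^sub>R a' u i + (g' u \<bullet> i) *\<^sub>R a z i)) (at z)"
    by (intro has_derivative_sum bounded_bilinear.FDERIV[OF bounded_bilinear_scaleR] da
        bounded_linear.has_derivative[OF bounded_linear_inner_left] g)
  then have "((\<lambda>y. a y (g y)) has_derivative
      (\<lambda>u. \<Sum>i\<in>Basis. (g z \<bullet> i) *\<^sub>R a' u i + (g' u \<bullet> i) *\<^sub>R a z i)) (at z)"
    by (rule has_derivative_transform_within_open[OF _ S]) (simp add: linear_expand_Basis[OF lin, symmetric])
  moreover have "(\<Sum>i\<in>Basis. (g z \<bullet> i) *\<^sub>R a' u i + (g' u \<bullet> i) *\<^sub>R a z i) = a' u (g z) + a z (g' u)" for u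
    unfolding sum.distrib using lin'[of u] linear_expand_Basis[OF lin[OF S(2)], of "g' u"] by simp
  ultimately show ?thesis by simp
qed

text \<open>The radial homotopy operator: \<open>F z\<close> integrates, over \<open>t\<close> from
  0 to 1, the form at \<open>z0 + t (z - z0)\<close> applied to \<open>z - z0\<close>. Closedness
  turns the \<open>z\<close>-derivative of the integrand into the \<open>t\<close>-derivative of
  \<open>t\<close> times the form at that point, so that differentiation under the integral returns
  \<open>b z\<close>.\<close>

lemma poincare_ball:
  fixes b :: "'v::euclidean_space \<Rightarrow> 'v \<Rightarrow> 'w::euclidean_space"
  assumes sm: "\<And>v. smooth_on (ball z0 r) (\<lambda>z. b z v)"
    and lin: "\<And>z. z \<in> ball z0 r \<Longrightarrow> linear (b z)"
    and closed: "\<And>z u v. z \<in> ball z0 r \<Longrightarrow>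
      frechet_derivative (\<lambda>z. b z v) (at z) u = frechet_derivative (\<lambda>z. b z u) (at z) v"
  shows "\<exists>F. F z0 = 0 \<and> (\<forall>z\<in>ball z0 r. (F has_derivative b z) (at z))"
proof -
  let ?B = "ball z0 r"
  let ?p = "\<lambda>z t. z0 + t *\<^sub>R (z - z0)"
  define f where "f = (\<lambda>z t. b (?p z t) (z - z0))"
  \<comment> \<open>The derivative of \<open>f z t\<close> in \<open>z\<close> after closedness has
    exchanged the two directions. In this shape it is a total derivative in
    \<open>t\<close>.\<close>
  define fx where "fx = (\<lambda>z t u. t *\<^sub>R frechet_derivative (\<lambda>z. b z u) (at (?p z t)) (z - z0) + b (?p z t) u)"
  have pB: "?p z t \<in> ?B" if "z \<in> ?B" "t \<in> cbox 0 (1::real)" for z t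
  proof -
    have "dist z0 (?p z t) = \<bar>t\<bar> * dist z0 z"
      by (simp add: dist_norm norm_minus_commute)
    also have "\<dots> \<le> 1 * dist z0 z" using that by (intro mult_right_mono) auto
    finally show ?thesis using that by auto
  qed
  have D: "((\<lambda>z. b z v) has_derivative frechet_derivative (\<lambda>z. b z v) (at z)) (at z)" if "z \<in> ?B" for z v
    using smooth_on_has_derivative[OF sm that] .
  have fx_alt: "fx z t u = frechet_derivative (\<lambda>y. b y (z - z0)) (at (?p z t)) (t *\<^sub>R u) + b (?p z t) u"
    if "z \<in> ?B" "t \<in> cbox 0 1" for z t u
    using closed[OF pB[OF that], of u "z - z0"] linear_cmul[OF has_derivative_linear[OF D[OF pB[OF that]]]]
    unfolding fx_def by simp
  have df: "((\<lambda>z. f z t) has_derivative fx z t) (at z)" if "z \<in> ?B" "t \<in> cbox 0 1" for z t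
  proof -
    have ev: "((\<lambda>z. ?p z t) has_derivative (\<lambda>u. t *\<^sub>R u)) (at z)"
      by (auto intro!: derivative_eq_intros)
    have op: "open {y. ?p y t \<in> ?B}"
    proof -
      have "continuous_on UNIV (\<lambda>y. ?p y t)" by (intro continuous_intros)
      from open_vimage[OF open_ball this] show ?thesis by (simp add: vimage_def)
    qed
    have "((\<lambda>y. b (?p y t) (y - z0)) has_derivative
        (\<lambda>u. frechet_derivative (\<lambda>y. b y (z - z0)) (at (?p z t)) (t *\<^sub>R u) + b (?p z t) u)) (at z)"
    proof (rule has_derivative_apply[where a = "\<lambda>y. b (?p y t)" and
          a' = "\<lambda>u w. frechet_derivative (\<lambda>y. b y w) (at (?p z t)) (t *\<^sub>R u)" and g' = "\<lambda>u. u"])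
      show "open {y. ?p y t \<in> ?B}" by (rule op)
      show "z \<in> {y. ?p y t \<in> ?B}" using pB[OF that] by simp
      show "((\<lambda>y. b (?p y t) w) has_derivative (\<lambda>u. frechet_derivative (\<lambda>y. b y w) (at (?p z t)) (t *\<^sub>R u))) (at z)" for w
        by (rule has_derivative_compose[OF ev D[OF pB[OF that]]])
      show "linear (b (?p y t))" if "y \<in> {y. ?p y t \<in> ?B}" for y using that lin by auto
      show "((\<lambda>y. y - z0) has_derivative (\<lambda>u. u)) (at z)" by (auto intro!: derivative_eq_intros)
    qed
    then show ?thesis unfolding f_def using fx_alt[OF that] by presburger
  qed
  have blf: "bounded_linear (fx z t)" if "z \<in> ?B" "t \<in> cbox 0 1" for z t
    using df[OF that] has_derivative_bounded_linear by blast
  \<comment> \<open>Differentiation under the integral asks for the derivative as a bounded operator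
    that is continuous in both variables together.\<close>
  define Fx where "Fx = (\<lambda>z t. Blinfun (fx z t))"
  have Fx: "blinfun_apply (Fx z t) = fx z t" if "z \<in> ?B" "t \<in> cbox 0 1" for z t
    unfolding Fx_def using bounded_linear_Blinfun_apply[OF blf[OF that]] by simp
  have contp: "continuous_on (?B \<times> cbox 0 1) (\<lambda>x. ?p (fst x) (snd x))"
    by (intro continuous_intros)
  have compp: "continuous_on (?B \<times> cbox 0 1) (\<lambda>x. h (?p (fst x) (snd x)))"
    if "continuous_on ?B h" for h :: "'v \<Rightarrow> 'w"
    by (rule continuous_on_compose2[OF that contp]) (use pB in auto)
  have cfx: "continuous_on (?B \<times> cbox 0 1) (\<lambda>(z, t). Fx z t)"
  proof (rule continuous_on_blinfun_componentwise)
    fix u :: 'v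
    let ?s = "\<lambda>x. snd x *\<^sub>R (\<Sum>i\<in>Basis. ((fst x - z0) \<bullet> i) *\<^sub>R
        frechet_derivative (\<lambda>z. b z u) (at (?p (fst x) (snd x))) i) + b (?p (fst x) (snd x)) u"
    have "continuous_on (?B \<times> cbox 0 1) ?s"
      by (intro continuous_intros compp smooth_on_continuous_on smooth_on_deriv sm)
    moreover have "?s x = blinfun_apply ((\<lambda>(z, t). Fx z t) x) u" if "x \<in> ?B \<times> cbox 0 1" for x
    proof -
      have x: "fst x \<in> ?B" "snd x \<in> cbox 0 1" using that by auto
      show ?thesis
        unfolding split_beta Fx[OF x] fx_def
        by (simp only: linear_expand_Basis[OF has_derivative_linear[OF D[OF pB[OF x]]], of u "fst x - z0"])
    qed
    ultimately show "continuous_on (?B \<times> cbox 0 1) (\<lambda>x. blinfun_apply ((\<lambda>(z, t). Fx z t) x) u)"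
      by (simp cong: continuous_on_cong)
  qed
  have fint: "f z integrable_on cbox 0 1" if "z \<in> ?B" for z
  proof (rule integrable_continuous)
    have "continuous_on (cbox 0 1) (\<lambda>t. \<Sum>i\<in>Basis. ((z - z0) \<bullet> i) *\<^sub>R b (?p z t) i)"
    proof (intro continuous_intros)
      fix i :: 'v
      show "continuous_on (cbox 0 1) (\<lambda>t. b (?p z t) i)"
        by (rule continuous_on_compose2[OF smooth_on_continuous_on[OF sm]])
          (use pB[OF that] in \<open>auto intro!: continuous_intros\<close>)
    qed
    then show "continuous_on (cbox 0 1) (f z)"
      unfolding f_def
      by (rule continuous_on_eq) (rule linear_expand_Basis[OF lin[OF pB[OF that]], symmetric])
  qed
  have int: "integral (cbox 0 1) (\<lambda>t. fx z t u) = b z u" if z: "z \<in> ?B" for z u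
  proof -
    have "((\<lambda>t. fx z t u) has_integral (1 *\<^sub>R b (?p z 1) u - 0 *\<^sub>R b (?p z 0) u)) {0..1}"
    proof (rule fundamental_theorem_of_calculus)
      fix t :: real assume t: "t \<in> {0..1}"
      then have pz: "?p z t \<in> ?B" using pB[OF z] by auto
      have "((\<lambda>t. ?p z t) has_derivative (\<lambda>h. h *\<^sub>R (z - z0))) (at t)"
        by (auto intro!: derivative_eq_intros)
      from has_derivative_compose[OF this D[OF pz, of u]]
      have "((\<lambda>t. t *\<^sub>R b (?p z t) u) has_derivative
        (\<lambda>h. t *\<^sub>R frechet_derivative (\<lambda>z. b z u) (at (?p z t)) (h *\<^sub>R (z - z0)) + h *\<^sub>R b (?p z t) u)) (at t)"
        by (intro bounded_bilinear.FDERIV[OF bounded_bilinear_scaleR] has_derivative_ident)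
      then have "((\<lambda>t. t *\<^sub>R b (?p z t) u) has_vector_derivative fx z t u) (at t)"
        unfolding has_vector_derivative_def fx_def
        unfolding linear_cmul[OF has_derivative_linear[OF D[OF pz]]]
        by (rule has_derivative_eq_rhs) (simp add: fun_eq_iff scaleR_add_right mult.commute)
      then show "((\<lambda>t. t *\<^sub>R b (?p z t) u) has_vector_derivative fx z t u) (at t within {0..1})"
        by (rule has_vector_derivative_at_within)
    qed simp
    then show ?thesis by (simp add: integral_unique)
  qed
  define F where "F = (\<lambda>z. integral (cbox 0 1) (f z))"
  have "(F has_derivative b z) (at z)" if z: "z \<in> ?B" for z
  proof -
    have "((\<lambda>z. integral (cbox 0 1) (f z)) has_derivative integral (cbox 0 1) (Fx z)) (at z within ?B)"
    proof (rule leibniz_rule)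
      show "((\<lambda>x. f x t) has_derivative blinfun_apply (Fx x t)) (at x within ?B)"
        if "x \<in> ?B" "t \<in> cbox 0 1" for x t
        using df[OF that] Fx[OF that] has_derivative_at_withinI by metis
    qed (use fint cfx z in auto)
    moreover have "blinfun_apply (integral (cbox 0 1) (Fx z)) u = b z u" for u
    proof -
      have "continuous_on (cbox 0 1) (\<lambda>t. Fx z t)"
        using continuous_on_compose2[OF cfx, of "cbox 0 1" "\<lambda>t. (z, t)"] z
          continuous_on_Pair[OF continuous_on_const continuous_on_id, of "cbox 0 (1::real)" z]
        by force
      then have "Fx z integrable_on cbox 0 1" by (rule integrable_continuous)
      then have "blinfun_apply (integral (cbox 0 1) (Fx z)) u = integral (cbox 0 1) (\<lambda>t. blinfun_apply (Fx z t) u)"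
        by (rule blinfun_apply_integral)
      also have "\<dots> = integral (cbox 0 1) (\<lambda>t. fx z t u)"
        by (rule integral_cong) (simp add: Fx[OF z])
      finally show ?thesis using int[OF z] by simp
    qed
    ultimately show ?thesis
      unfolding F_def at_within_open[OF z open_ball] by (elim has_derivative_eq_rhs) (rule ext)
  qed
  moreover have "F z0 = 0" if r: "r > 0"
  proof -
    have "f z0 t = 0" if "t \<in> cbox 0 1" for t
      using linear_0[OF lin[of z0]] \<open>r > 0\<close> by (simp add: f_def)
    then show ?thesis unfolding F_def using integral_cong[of "cbox 0 1" "f z0" "\<lambda>_. 0"] by simp
  qed
  moreover have "?B = {}" if "\<not> r > 0" using that by auto
  ultimately show ?thesis
  proof (cases "r > 0")
    case False
    with \<open>\<not> r > 0 \<Longrightarrow> ?B = {}\<close> have "?B = {}" .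
    then show ?thesis by (intro exI[of _ "\<lambda>_. 0"]) (simp only: ball_empty simp_thms ball_simps)
  qed blast
qed


text \<open>Summing all matrix entries is a crude bound, but it varies continuously with the form
  and therefore gives one constant near a given point.\<close>

lemma linear_norm_bound_Basis:
  fixes a :: "'v::euclidean_space \<Rightarrow> 'w::euclidean_space \<Rightarrow> 'u::real_normed_vector"
  assumes "linear (\<lambda>u. a u w)" "\<And>u. linear (a u)"
  shows "norm (a u w) \<le> (\<Sum>i\<in>Basis. \<Sum>j\<in>Basis. norm (a i j)) * norm u * norm w"
proof -
  have "a u w = (\<Sum>i\<in>Basis. (u \<bullet> i) *\<^sub>R (\<Sum>j\<in>Basis. (w \<bullet> j) *\<^sub>R a i j))"
    using linear_expand_Basis[OF assms(1), where v = u] linear_expand_Basis[OF assms(2), where v = w] by simp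
  also have "norm \<dots> \<le> (\<Sum>i\<in>Basis. \<bar>u \<bullet> i\<bar> * (\<Sum>j\<in>Basis. \<bar>w \<bullet> j\<bar> * norm (a i j)))"
    by (rule sum_norm_le) (auto intro!: mult_left_mono sum_norm_le)
  also have "\<dots> \<le> (\<Sum>i\<in>Basis. norm u * (\<Sum>j\<in>Basis. norm w * norm (a i j)))"
    by (intro sum_mono mult_mono) (auto simp: Basis_le_norm intro!: sum_nonneg)
  also have "\<dots> = (\<Sum>i\<in>Basis. \<Sum>j\<in>Basis. norm (a i j)) * norm u * norm w"
    by (simp add: sum_distrib_left sum_distrib_right mult_ac)
  finally show ?thesis .
qed

text \<open>Since the values of \<open>a\<close> commute, each term of the Picard series is itself a primitive of a
  closed form.\<close>

lemma parallel_section_ball: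
  fixes a :: "'v::euclidean_space \<Rightarrow> 'v \<Rightarrow> 'w::euclidean_space \<Rightarrow> 'w"
  assumes sm: "\<And>v w. smooth_on (ball z0 r) (\<lambda>z. a z v w)"
    and r: "r > 0"
    and lin1: "\<And>z w. z \<in> ball z0 r \<Longrightarrow> linear (\<lambda>v. a z v w)"
    and lin2: "\<And>z v. z \<in> ball z0 r \<Longrightarrow> linear (a z v)"
    and closed: "\<And>z u v w. z \<in> ball z0 r \<Longrightarrow>
      frechet_derivative (\<lambda>z. a z v w) (at z) u = frechet_derivative (\<lambda>z. a z u w) (at z) v"
    and comm: "\<And>z u v w. z \<in> ball z0 r \<Longrightarrow> a z u (a z v w) = a z v (a z u w)"
    and K: "\<And>z u w. z \<in> ball z0 r \<Longrightarrow> norm (a z u w) \<le> K * norm u * norm w" "K * r \<le> 1/2" "K \<ge> 0"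
  shows "\<exists>g. smooth_on (ball z0 r) g \<and> g z0 = w0 \<and>
    (\<forall>z\<in>ball z0 r. (g has_derivative (\<lambda>u. - a z u (g z))) (at z))"
proof -
  let ?B = "ball z0 r"
  \<comment> \<open>The symmetry clause says that the part of \<open>d (a \<psi>)\<close> coming
    from \<open>d\<psi>\<close> vanishes. Together with the closedness of \<open>a\<close> it makes
    \<open>a \<psi>\<close> closed, so the next term exists as a primitive. The factor
    \<open>1/2\<close> per term comes from \<open>K r \<le> 1/2\<close>.\<close>
  define P where "P = (\<lambda>n \<psi>. smooth_on ?B \<psi> \<and>
    (\<forall>z\<in>?B. \<forall>u v. a z v (frechet_derivative \<psi> (at z) u) = a z u (frechet_derivative \<psi> (at z) v)) \<and>
    (\<forall>z\<in>?B. norm (\<psi> z) \<le> norm w0 * (1/2)^n) \<and> (n = 0 \<longrightarrow> \<psi> = (\<lambda>_. w0)))"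
  define Q where "Q = (\<lambda>\<psi> \<psi>'. \<psi>' z0 = (0::'w) \<and>
    (\<forall>z\<in>?B. (\<psi>' has_derivative (\<lambda>u. - a z u (\<psi> z))) (at z)))"
  have smb: "smooth_on ?B (\<lambda>z. - a z v (\<psi> z))" if "smooth_on ?B \<psi>" for \<psi> v
    by (rule smooth_on_linear[OF open_ball bounded_linear_minus[OF bounded_linear_ident]])
      (rule smooth_on_apply[OF open_ball sm lin2 that])
  have "\<exists>\<psi>. \<forall>n. P n (\<psi> n) \<and> Q (\<psi> n) (\<psi> (Suc n))"
  proof (rule dependent_nat_choice)
    show "\<exists>x. P 0 x"
      unfolding P_def
      by (intro exI[of _ "\<lambda>_. w0"])
        (simp add: smooth_on_const frechet_derivative_const linear_0[OF lin2])
  next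
    fix \<psi> n assume "P n \<psi>"
    then have \<psi>: "smooth_on ?B \<psi>"
      and sym: "\<And>z u v. z \<in> ?B \<Longrightarrow> a z v (frechet_derivative \<psi> (at z) u) = a z u (frechet_derivative \<psi> (at z) v)"
      and bd: "\<And>z. z \<in> ?B \<Longrightarrow> norm (\<psi> z) \<le> norm w0 * (1/2)^n"
      unfolding P_def by blast+
    have d: "frechet_derivative (\<lambda>z. - a z v (\<psi> z)) (at z) u =
        - (frechet_derivative (\<lambda>z. a z v (\<psi> y)) (at z) u + a z v (frechet_derivative \<psi> (at z) u))"
      if "z \<in> ?B" "y = z" for z y u v
    proof -
      have "((\<lambda>z. a z v (\<psi> z)) has_derivative (\<lambda>u. frechet_derivative (\<lambda>z. a z v (\<psi> z')) (at z) u +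
          a z v (frechet_derivative \<psi> (at z) u))) (at z)" if "z' = z" for z'
        unfolding that
        by (rule has_derivative_apply[where a' = "\<lambda>u w. frechet_derivative (\<lambda>z. a z v w) (at z) u",
              OF open_ball \<open>z \<in> ?B\<close> smooth_on_has_derivative[OF sm \<open>z \<in> ?B\<close>] lin2
              smooth_on_has_derivative[OF \<psi> \<open>z \<in> ?B\<close>]])
      from fun_cong[OF frechet_derivative_at[OF has_derivative_minus[OF this[OF that(2)]]], of u]
      show ?thesis by simp
    qed
    have "\<exists>F. F z0 = 0 \<and> (\<forall>z\<in>?B. (F has_derivative (\<lambda>u. - a z u (\<psi> z))) (at z))"
    proof (rule poincare_ball[OF smb[OF \<psi>]])
      show "linear (\<lambda>u. - a z u (\<psi> z))" if "z \<in> ?B" for z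
        using linear_compose_neg[OF lin1[OF that]] .
      show "frechet_derivative (\<lambda>z. - a z v (\<psi> z)) (at z) u = frechet_derivative (\<lambda>z. - a z u (\<psi> z)) (at z) v"
        if "z \<in> ?B" for z u v
        unfolding d[OF that refl] using closed[OF that, of v "\<psi> z" u] sym[OF that, of v u] by simp
    qed
    then obtain F where F: "F z0 = 0" "\<And>z. z \<in> ?B \<Longrightarrow> (F has_derivative (\<lambda>u. - a z u (\<psi> z))) (at z)"
      by blast
    have smF: "smooth_on ?B F"
      by (rule smooth_onI_derivative[OF open_ball F(2) smb[OF \<psi>]])
    have fF: "frechet_derivative F (at z) u = - a z u (\<psi> z)" if "z \<in> ?B" for z u
      by (rule fun_cong[OF frechet_derivative_at[OF F(2)[OF that]], symmetric])
    have "norm (F z) \<le> norm w0 * (1/2)^Suc n" if z: "z \<in> ?B" for z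
    proof -
      have C: "norm (- a y u (\<psi> y)) \<le> (K * (norm w0 * (1/2)^n)) * norm u" if "y \<in> ?B" for y u
      proof -
        have "norm (a y u (\<psi> y)) \<le> K * norm u * norm (\<psi> y)" by (rule K(1)[OF that])
        also have "\<dots> \<le> K * norm u * (norm w0 * (1/2)^n)"
          by (intro mult_left_mono bd that mult_nonneg_nonneg K(3)) auto
        finally show ?thesis by (simp add: mult_ac)
      qed
      have "norm (F z - F z0) \<le> (K * (norm w0 * (1/2)^n)) * norm (z - z0)"
        by (rule differentiable_bound[where S = ?B and f' = "\<lambda>z u. - a z u (\<psi> z)", OF convex_ball has_derivative_at_withinI[OF F(2)]])
          (use z r C in \<open>auto intro!: onorm_le\<close>)
      also have "\<dots> \<le> (K * (norm w0 * (1/2)^n)) * r"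
        using z K(3) by (intro mult_left_mono) (auto simp: dist_norm norm_minus_commute)
      also have "\<dots> = (K * r) * (norm w0 * (1/2)^n)" by (simp add: mult_ac)
      also have "\<dots> \<le> (1/2) * (norm w0 * (1/2)^n)"
        by (intro mult_right_mono K(2)) auto
      finally show ?thesis using F(1) by simp
    qed
    \<comment> \<open>The new term has derivative \<open>- a \<psi>\<close>, so commutation of the
      values of \<open>a\<close> reproduces the symmetry clause.\<close>
    moreover have "a z v (frechet_derivative F (at z) u) = a z u (frechet_derivative F (at z) v)"
      if "z \<in> ?B" for z u v
      unfolding fF[OF that] using comm[OF that] linear_neg[OF lin2[OF that]] by simp
    ultimately show "\<exists>y. P (Suc n) y \<and> Q \<psi> y"
      unfolding P_def Q_def using smF F by blast
  qed
  then obtain \<psi> where P: "\<And>n. P n (\<psi> n)" and Q: "\<And>n. Q (\<psi> n) (\<psi> (Suc n))" by blast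
  have bd: "norm (\<psi> n z) \<le> norm w0 * (1/2)^n" if "z \<in> ?B" for n z
    using P[of n] that unfolding P_def by blast
  have geo: "summable (\<lambda>n. norm w0 * (1/2::real)^n)" by (intro summable_mult summable_geometric) auto
  have summ: "summable (\<lambda>n. \<psi> n z)" if "z \<in> ?B" for z
    using summable_comparison_test[OF _ geo, of "\<lambda>n. \<psi> n z"] bd[OF that] by blast
  define f' where "f' = (\<lambda>n z u. case n of 0 \<Rightarrow> 0 | Suc k \<Rightarrow> - a z u (\<psi> k z))"
  define S where "S = (\<lambda>z. \<Sum>n. \<psi> n z)"
  have z0: "z0 \<in> ?B" using r by simp
  have s0: "(\<lambda>n. \<psi> n z0) sums w0"
  proof -
    have "\<psi> n z0 = (if n = 0 then w0 else 0)" for n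
      using P[of 0] Q[of "n - 1"] unfolding P_def Q_def by (cases n) auto
    then show ?thesis using sums_single[of 0 "\<lambda>_. w0"] by simp
  qed
  have tail: "norm (S z - (\<Sum>k<n. \<psi> k z)) \<le> 2 * norm w0 * (1/2)^n" if z: "z \<in> ?B" for z n
  proof -
    have "S z - (\<Sum>k<n. \<psi> k z) = (\<Sum>k. \<psi> (k + n) z)"
      unfolding S_def using suminf_minus_initial_segment[OF summ[OF z]] by simp
    also have "norm \<dots> \<le> (\<Sum>k. norm w0 * (1/2)^n * (1/2)^k)"
    proof (rule norm_suminf_le)
      show "norm (\<psi> (k + n) z) \<le> norm w0 * (1/2)^n * (1/2)^k" for k
        using bd[OF z, of "k + n"] by (simp add: power_add mult_ac)
      show "summable (\<lambda>k. norm w0 * (1/2::real)^n * (1/2)^k)"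
        by (intro summable_mult summable_geometric) auto
    qed
    also have "\<dots> = norm w0 * (1/2)^n * (\<Sum>k. (1/2)^k)"
      by (intro suminf_mult summable_geometric) auto
    also have "(\<Sum>k. (1/2::real)^k) = 2" using suminf_geometric[of "1/2::real"] by simp
    finally show ?thesis by (simp add: mult_ac)
  qed
  have "\<exists>g. \<forall>z\<in>?B. (\<lambda>n. \<psi> n z) sums (g z) \<and> (g has_derivative (\<lambda>u. - a z u (S z))) (at z within ?B)"
  proof (rule has_derivative_series[OF convex_ball, where f' = f'])
    show "(\<psi> n has_derivative f' n z) (at z within ?B)" if "z \<in> ?B" for n z
    proof (cases n)
      case 0
      then show ?thesis using P[of 0] unfolding P_def f'_def by (simp add: has_derivative_const)
    next
      case (Suc k)
      then show ?thesis
        using Q[of k] that unfolding Q_def f'_def by (auto intro: has_derivative_at_withinI)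
    qed
  next
    fix e :: real assume e: "e > 0"
    have "(\<lambda>n. K * (4 * norm w0) * (1/2::real)^n) \<longlonglongrightarrow> K * (4 * norm w0) * 0"
      by (intro tendsto_mult tendsto_const LIMSEQ_realpow_zero) auto
    then have ev: "\<forall>\<^sub>F n in sequentially. K * (4 * norm w0) * (1/2::real)^n < e"
      using e by (auto dest: order_tendstoD)
    \<comment> \<open>The differentiated partial sum lags by one term, which turns the factor 2 of
      the tail estimate into 4.\<close>
    have *: "norm (sum (\<lambda>i. f' i z h) {..<n} - - a z h (S z)) \<le> K * (4 * norm w0) * (1/2)^n * norm h"
      if "z \<in> ?B" "n > 0" for n z h
    proof -
      obtain m where n: "n = Suc m" using \<open>n > 0\<close> gr0_implies_Suc by blast
      have "sum (\<lambda>i. f' i z h) {..<n} = - a z h (\<Sum>k<m. \<psi> k z)"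
        unfolding n sum.lessThan_Suc_shift
        by (simp add: f'_def linear_sum[OF lin2[OF that(1)]] sum_negf)
      then have "sum (\<lambda>i. f' i z h) {..<n} - - a z h (S z) = a z h (S z - (\<Sum>k<m. \<psi> k z))"
        by (simp add: linear_diff[OF lin2[OF that(1)]])
      also have "norm \<dots> \<le> K * norm h * norm (S z - (\<Sum>k<m. \<psi> k z))"
        by (rule K(1)[OF that(1)])
      also have "\<dots> \<le> K * norm h * (2 * norm w0 * (1/2)^m)"
        by (intro mult_left_mono tail that mult_nonneg_nonneg K(3)) auto
      finally show ?thesis by (simp add: n mult_ac)
    qed
    show "\<forall>\<^sub>F n in sequentially. \<forall>z\<in>?B. \<forall>h.
        norm (sum (\<lambda>i. f' i z h) {..<n} - - a z h (S z)) \<le> e * norm h"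
      using ev eventually_gt_at_top[of 0]
    proof eventually_elim
      case (elim n)
      show ?case
      proof (intro ballI allI)
        fix z h assume "z \<in> ?B"
        from order_trans[OF *[OF this elim(2)] mult_right_mono[OF less_imp_le[OF elim(1)] norm_ge_zero]]
        show "norm (sum (\<lambda>i. f' i z h) {..<n} - - a z h (S z)) \<le> e * norm h" .
      qed
    qed
  qed (use z0 s0 in auto)
  then obtain g where g: "\<And>z. z \<in> ?B \<Longrightarrow> (\<lambda>n. \<psi> n z) sums (g z)"
    "\<And>z. z \<in> ?B \<Longrightarrow> (g has_derivative (\<lambda>u. - a z u (S z))) (at z within ?B)" by blast
  have "S z = g z" if "z \<in> ?B" for z
    using g(1)[OF that] sums_unique unfolding S_def by metis
  then have g': "(g has_derivative (\<lambda>u. - a z u (g z))) (at z)" if "z \<in> ?B" for z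
    using g(2)[OF that] at_within_open[OF that open_ball] that by simp
  \<comment> \<open>The equation \<open>dg = - a g\<close> raises the class of \<open>g\<close> by
    one at each step.\<close>
  have "Ck_on n ?B g" for n
  proof (induction n)
    case 0
    show ?case
      using g' by (auto intro!: continuous_at_imp_continuous_on has_derivative_continuous)
  next
    case (Suc n)
    show ?case
    proof (rule Ck_on_SucI[OF open_ball g'])
      fix v
      show "Ck_on n ?B (\<lambda>z. - a z v (g z))"
    proof (rule Ck_on_cong)
      show "Ck_on n ?B (\<lambda>z. - (\<Sum>i\<in>Basis. (g z \<bullet> i) *\<^sub>R a z v i))"
        by (rule Ck_on_linear[OF open_ball bounded_linear_minus[OF bounded_linear_ident]],
            rule Ck_on_sum[OF open_ball])
          (rule Ck_on_bilinear[OF open_ball bounded_bilinear_scaleR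
              Ck_on_linear[OF open_ball bounded_linear_inner_left Suc] smooth_onD[OF sm]])
      show "- (\<Sum>i\<in>Basis. (g z \<bullet> i) *\<^sub>R a z v i) = - a z v (g z)" if "z \<in> ?B" for z
        using linear_expand_Basis[OF lin2[OF that], of v "g z"] by simp
      qed simp
    qed
  qed
  moreover have "g z0 = w0" using g(1)[OF z0] s0 sums_unique2 by blast
  ultimately show ?thesis using g' smooth_onI by blast
qed

subsection \<open>Smooth maps on surfaces\<close>

text \<open>Smoothness of germs: once neighbourhoods are absorbed into \<open>eventually\<close>
  over \<open>nhds x\<close>, local conditions combine without explicit intersections of open
  sets.\<close>

definition smooth_at :: "'a::topological_space chart set \<Rightarrow> 'a \<Rightarrow> ('a \<Rightarrow> 'w::real_normed_vector) \<Rightarrow> bool" where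
  "smooth_at A x g \<longleftrightarrow> (\<exists>N. open N \<and> x \<in> N \<and> smooth_map A N g)"

locale smooth_surface =
  fixes A :: "'a::t2_space chart set"
  assumes atlas: "smooth_atlas A"
begin

lemma is_chart: "c \<in> A \<Longrightarrow> is_chart c"
  using atlas by (simp add: smooth_atlas_def)

lemma transition_smooth:
  "c \<in> A \<Longrightarrow> c' \<in> A \<Longrightarrow> smooth_on (snd c ` (fst c \<inter> fst c')) (\<lambda>z. snd c' (chart_inv c z))"
  using atlas by (simp add: smooth_atlas_def comp_def)

lemma chart_inv_snd: "c \<in> A \<Longrightarrow> y \<in> fst c \<Longrightarrow> chart_inv c (snd c y) = y"
  using is_chart[of c] by (auto simp: is_chart_def homeomorphism_def)

lemma snd_chart_inv: "c \<in> A \<Longrightarrow> z \<in> snd c ` fst c \<Longrightarrow> snd c (chart_inv c z) = z"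
  by (rule f_inv_into_f)

lemma chart_inv_in: "c \<in> A \<Longrightarrow> z \<in> snd c ` fst c \<Longrightarrow> chart_inv c z \<in> fst c"
  by (rule inv_into_into)

lemma open_chart_image:
  assumes "c \<in> A" "open N" shows "open (snd c ` (N \<inter> fst c))"
proof -
  have c: "open (snd c ` fst c)" "continuous_on (snd c ` fst c) (chart_inv c)"
    using is_chart[OF assms(1)] by (auto simp: is_chart_def homeomorphism_def)
  have "snd c ` (N \<inter> fst c) = snd c ` fst c \<inter> chart_inv c -` N"
    using chart_inv_snd[OF assms(1)] by auto
  then show ?thesis using continuous_open_preimage[OF c(2,1) assms(2)] by simp
qed

lemma open_chart_preimage:
  assumes "c \<in> A" "open T" "T \<subseteq> snd c ` fst c" shows "open (chart_inv c ` T)"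
proof -
  have c: "open (fst c)" "continuous_on (fst c) (snd c)"
    using is_chart[OF assms(1)] by (auto simp: is_chart_def homeomorphism_def)
  have "chart_inv c ` T = fst c \<inter> snd c -` T"
    using chart_inv_snd[OF assms(1)] snd_chart_inv[OF assms(1)] assms(3)
      chart_inv_in[OF assms(1)] by (auto simp: image_iff subset_iff) metis+
  then show ?thesis using continuous_open_preimage[OF c(2,1) assms(2)] by simp
qed

lemma open_chart: "c \<in> A \<Longrightarrow> open (fst c)"
  using is_chart by (auto simp: is_chart_def)

lemma isCont_chart:
  assumes "c \<in> A" "x \<in> fst c" shows "(snd c \<longlongrightarrow> snd c x) (nhds x)"
proof -
  have "continuous_on (fst c) (snd c)"
    using is_chart[OF assms(1)] by (auto simp: is_chart_def homeomorphism_def)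
  then have "isCont (snd c) x"
    using assms(2) open_chart[OF assms(1)] continuous_on_eq_continuous_at by blast
  then show ?thesis by (simp add: isCont_def tendsto_at_iff_tendsto_nhds)
qed

lemma chart_at: "chart_at A x \<in> A" "x \<in> fst (chart_at A x)"
proof -
  have "x \<in> (\<Union>c\<in>A. fst c)" using atlas by (simp add: smooth_atlas_def)
  then have "\<exists>c. c \<in> A \<and> x \<in> fst c" by blast
  from someI_ex[OF this] show "chart_at A x \<in> A" "x \<in> fst (chart_at A x)"
    unfolding chart_at_def by auto
qed

lemma smooth_map_mono: "smooth_map A N g \<Longrightarrow> N' \<subseteq> N \<Longrightarrow> smooth_map A N' g"
  unfolding smooth_map_def by (meson Int_mono image_mono smooth_on_subset subset_refl)

lemma smooth_map_iff:
  assumes "open N" shows "smooth_map A N g \<longleftrightarrow> (\<forall>x\<in>N. smooth_at A x g)"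
proof
  show "smooth_map A N g \<Longrightarrow> \<forall>x\<in>N. smooth_at A x g"
    using assms unfolding smooth_at_def by blast
next
  assume *: "\<forall>x\<in>N. smooth_at A x g"
  show "smooth_map A N g"
    unfolding smooth_map_def
  proof (intro ballI smooth_on_local)
    fix c z assume c: "c \<in> A" and "z \<in> snd c ` (N \<inter> fst c)"
    then obtain x where x: "x \<in> N" "x \<in> fst c" "z = snd c x" by auto
    then obtain M where M: "open M" "x \<in> M" "smooth_map A M g" using * unfolding smooth_at_def by blast
    show "\<exists>T. open T \<and> z \<in> T \<and> smooth_on T (g \<circ> chart_inv c)"
      using M x c open_chart_image[OF c M(1)] unfolding smooth_map_def by blast
  qed
qed

lemma smooth_at_eventually:
  assumes "smooth_at A x g" shows "\<forall>\<^sub>F y in nhds x. smooth_at A y g"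
proof -
  obtain N where "open N" "x \<in> N" "smooth_map A N g" using assms unfolding smooth_at_def by blast
  then show ?thesis unfolding eventually_nhds using smooth_map_iff by blast
qed

lemma smooth_at_chart:
  assumes "smooth_at A x g" "c \<in> A" "x \<in> fst c"
  obtains T where "open T" "snd c x \<in> T" "T \<subseteq> snd c ` fst c" "smooth_on T (\<lambda>z. g (chart_inv c z))"
proof -
  obtain N where N: "open N" "x \<in> N" "smooth_map A N g" using assms(1) unfolding smooth_at_def by blast
  show ?thesis
    by (rule that[of "snd c ` (N \<inter> fst c)"])
      (use N assms open_chart_image in \<open>auto simp: smooth_map_def comp_def\<close>)
qed

text \<open>One chart is enough because transition maps are smooth. The neighbourhood is cut down to
  the part of this chart on which the formula \<open>G\<close> holds.\<close>

lemma smooth_at_chartI: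
  assumes c: "c \<in> A" "x \<in> fst c" and T: "open T" "snd c x \<in> T" "smooth_on T G"
    and eq: "\<forall>\<^sub>F y in nhds x. g y = G (snd c y)"
  shows "smooth_at A x g"
proof -
  obtain M where M: "open M" "x \<in> M" "\<And>y. y \<in> M \<Longrightarrow> g y = G (snd c y)"
    using eq unfolding eventually_nhds by blast
  define T' where "T' = T \<inter> snd c ` (M \<inter> fst c)"
  define N where "N = chart_inv c ` T'"
  have T': "open T'" "snd c x \<in> T'" "T' \<subseteq> snd c ` fst c" "smooth_on T' G"
    unfolding T'_def using T M c open_chart_image[OF c(1) M(1)] smooth_on_subset[OF T(3)] by auto
  have NM: "N \<subseteq> M" "N \<subseteq> fst c"
    unfolding N_def T'_def using chart_inv_snd[OF c(1)] by auto
  have "smooth_map A N g"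
    unfolding smooth_map_def
  proof
    fix c' assume c': "c' \<in> A"
    have op: "open (snd c' ` (N \<inter> fst c'))"
      using open_chart_image[OF c'] open_chart_preimage[OF c(1) T'(1,3)] N_def by simp
    show "smooth_on (snd c' ` (N \<inter> fst c')) (g \<circ> chart_inv c')"
    proof (rule smooth_on_cong[OF _ op])
      show "smooth_on (snd c' ` (N \<inter> fst c')) (\<lambda>z. G (snd c (chart_inv c' z)))"
      proof (rule smooth_on_compose[OF op T'(1) _ T'(4)])
        show "smooth_on (snd c' ` (N \<inter> fst c')) (\<lambda>z. snd c (chart_inv c' z))"
          by (rule smooth_on_subset[OF transition_smooth[OF c' c(1)]]) (use NM in auto)
        show "(\<lambda>z. snd c (chart_inv c' z)) ` snd c' ` (N \<inter> fst c') \<subseteq> T'"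
          using chart_inv_snd[OF c'] snd_chart_inv[OF c(1)] T'(3) unfolding N_def by auto
      qed
      show "G (snd c (chart_inv c' z)) = (g \<circ> chart_inv c') z" if "z \<in> snd c' ` (N \<inter> fst c')" for z
        using that M(3) NM chart_inv_snd[OF c'] by auto
    qed
  qed
  moreover have "x \<in> N" unfolding N_def using T'(2) chart_inv_snd[OF c] by force
  ultimately show ?thesis
    unfolding smooth_at_def using open_chart_preimage[OF c(1) T'(1,3)] N_def by blast
qed

lemma smooth_at_cong:
  assumes "smooth_at A x g" "\<forall>\<^sub>F y in nhds x. g y = h y" shows "smooth_at A x h"
proof -
  obtain T where "open T" "snd (chart_at A x) x \<in> T" "T \<subseteq> snd (chart_at A x) ` fst (chart_at A x)"
    "smooth_on T (\<lambda>z. g (chart_inv (chart_at A x) z))"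
    using smooth_at_chart[OF assms(1) chart_at] .
  moreover have "\<forall>\<^sub>F y in nhds x. h y = g (chart_inv (chart_at A x) (snd (chart_at A x) y))"
    using assms(2) eventually_nhds_in_open[OF open_chart[OF chart_at(1)] chart_at(2)]
    by eventually_elim (simp add: chart_inv_snd[OF chart_at(1)])
  ultimately show ?thesis by (intro smooth_at_chartI[OF chart_at])
qed

text \<open>Carries any binary closure property of smooth maps on open sets of the plane over to the
  surface, by reading both maps in one chart.\<close>

lemma smooth_at_combine:
  assumes "smooth_at A x g" "smooth_at A x h"
    and op: "\<And>(T :: (real^2) set) g h. open T \<Longrightarrow> smooth_on T g \<Longrightarrow> smooth_on T h \<Longrightarrow> smooth_on T (\<lambda>z. F (g z) (h z))"
  shows "smooth_at A x (\<lambda>y. F (g y) (h y))"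
proof -
  let ?c = "chart_at A x"
  obtain T where T: "open T" "snd ?c x \<in> T" "T \<subseteq> snd ?c ` fst ?c" "smooth_on T (\<lambda>z. g (chart_inv ?c z))"
    using smooth_at_chart[OF assms(1) chart_at] .
  obtain S where S: "open S" "snd ?c x \<in> S" "S \<subseteq> snd ?c ` fst ?c" "smooth_on S (\<lambda>z. h (chart_inv ?c z))"
    using smooth_at_chart[OF assms(2) chart_at] .
  show ?thesis
  proof (rule smooth_at_chartI[OF chart_at])
    show "open (T \<inter> S)" "snd ?c x \<in> T \<inter> S" using T S by auto
    show "smooth_on (T \<inter> S) (\<lambda>z. F (g (chart_inv ?c z)) (h (chart_inv ?c z)))"
    proof (rule op)
      show "open (T \<inter> S)" using T S by auto
      show "smooth_on (T \<inter> S) (\<lambda>z. g (chart_inv ?c z))" by (rule smooth_on_subset[OF T(4)]) simp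
      show "smooth_on (T \<inter> S) (\<lambda>z. h (chart_inv ?c z))" by (rule smooth_on_subset[OF S(4)]) simp
    qed
    show "\<forall>\<^sub>F y in nhds x. F (g y) (h y) = F (g (chart_inv ?c (snd ?c y))) (h (chart_inv ?c (snd ?c y)))"
      using eventually_nhds_in_open[OF open_chart[OF chart_at(1)] chart_at(2)]
      by eventually_elim (simp add: chart_inv_snd[OF chart_at(1)])
  qed
qed

lemma smooth_at_const: "smooth_at A x (\<lambda>y. k)"
  by (rule smooth_at_chartI[OF chart_at open_UNIV _ smooth_on_const]) auto

lemma smooth_at_add: "smooth_at A x g \<Longrightarrow> smooth_at A x h \<Longrightarrow> smooth_at A x (\<lambda>y. g y + h y)"
  by (rule smooth_at_combine[where F = "(+)"]) (assumption | rule smooth_on_add)+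

lemma smooth_at_bilinear:
  assumes "bounded_bilinear B" "smooth_at A x g" "smooth_at A x h"
  shows "smooth_at A x (\<lambda>y. B (g y) (h y))"
  by (rule smooth_at_combine[where F = B, OF assms(2,3)]) (rule smooth_on_bilinear[OF _ assms(1)])

lemma smooth_at_linear:
  assumes "bounded_linear B" "smooth_at A x g" shows "smooth_at A x (\<lambda>y. B (g y))"
  by (rule smooth_at_combine[where F = "\<lambda>a b. B a", OF assms(2,2)]) (rule smooth_on_linear[OF _ assms(1)])

lemma smooth_at_minus: "smooth_at A x g \<Longrightarrow> smooth_at A x (\<lambda>y. - g y)"
  by (rule smooth_at_linear[OF bounded_linear_minus[OF bounded_linear_ident]])

lemma smooth_at_diff: "smooth_at A x g \<Longrightarrow> smooth_at A x h \<Longrightarrow> smooth_at A x (\<lambda>y. g y - h y)"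
  using smooth_at_add[OF _ smooth_at_minus, of x g h] by simp

lemmas smooth_at_scaleR = smooth_at_bilinear[OF bounded_bilinear_scaleR]
lemmas smooth_at_mult = smooth_at_bilinear[OF bounded_bilinear_mult]

lemma smooth_at_sum:
  "(\<And>i. i \<in> I \<Longrightarrow> smooth_at A x (g i)) \<Longrightarrow> smooth_at A x (\<lambda>y. \<Sum>i\<in>I. g i y)"
  by (induction I rule: infinite_finite_induct) (auto intro: smooth_at_const smooth_at_add)

lemma smooth_at_tendsto:
  assumes "smooth_at A x g" shows "(g \<longlongrightarrow> g x) (nhds x)"
proof -
  let ?c = "chart_at A x"
  obtain T where T: "open T" "snd ?c x \<in> T" "T \<subseteq> snd ?c ` fst ?c" "smooth_on T (\<lambda>z. g (chart_inv ?c z))"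
    using smooth_at_chart[OF assms(1) chart_at] .
  have "isCont (\<lambda>z. g (chart_inv ?c z)) (snd ?c x)"
    using smooth_on_continuous_on[OF T(4)] T(1,2) continuous_on_eq_continuous_at by blast
  then have "((\<lambda>y. g (chart_inv ?c (snd ?c y))) \<longlongrightarrow> g (chart_inv ?c (snd ?c x))) (nhds x)"
    using isCont_tendsto_compose[OF _ isCont_chart[OF chart_at]] by blast
  then have "((\<lambda>y. g (chart_inv ?c (snd ?c y))) \<longlongrightarrow> g x) (nhds x)"
    by (simp add: chart_inv_snd[OF chart_at])
  moreover have "\<forall>\<^sub>F y in nhds x. g (chart_inv ?c (snd ?c y)) = g y"
    using eventually_nhds_in_open[OF open_chart[OF chart_at(1)] chart_at(2)]
    by eventually_elim (simp add: chart_inv_snd[OF chart_at(1)])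
  ultimately show ?thesis by (rule Lim_transform_eventually)
qed

lemma smooth_at_nonzero:
  fixes g :: "'a \<Rightarrow> 'w::real_normed_vector"
  assumes "smooth_at A x g" "g x \<noteq> 0" shows "\<forall>\<^sub>F y in nhds x. g y \<noteq> 0"
  using tendsto_imp_eventually_ne[OF smooth_at_tendsto] assms by blast

lemma smooth_at_inverse:
  fixes g :: "'a \<Rightarrow> real"
  assumes "smooth_at A x g" "g x \<noteq> 0" shows "smooth_at A x (\<lambda>y. inverse (g y))"
proof -
  let ?c = "chart_at A x"
  obtain T where T: "open T" "snd ?c x \<in> T" "T \<subseteq> snd ?c ` fst ?c" "smooth_on T (\<lambda>z. g (chart_inv ?c z))"
    using smooth_at_chart[OF assms(1) chart_at] .
  define S where "S = T \<inter> (\<lambda>z. g (chart_inv ?c z)) -` (- {0})"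
  have S: "open S" unfolding S_def
    by (rule continuous_open_preimage[OF smooth_on_continuous_on[OF T(4)] T(1)]) auto
  show ?thesis
  proof (rule smooth_at_chartI[OF chart_at S])
    show "snd ?c x \<in> S" using T(2) assms(2) by (simp add: S_def chart_inv_snd[OF chart_at])
    show "smooth_on S (\<lambda>z. inverse (g (chart_inv ?c z)))"
      by (rule smooth_on_inverse[OF S smooth_on_subset[OF T(4)]]) (auto simp: S_def)
    show "\<forall>\<^sub>F y in nhds x. inverse (g y) = inverse (g (chart_inv ?c (snd ?c y)))"
      using eventually_nhds_in_open[OF open_chart[OF chart_at(1)] chart_at(2)]
      by eventually_elim (simp add: chart_inv_snd[OF chart_at(1)])
  qed
qed

lemma smooth_at_divide:
  fixes g :: "'a \<Rightarrow> real"
  assumes "smooth_at A x h" "smooth_at A x g" "g x \<noteq> 0" shows "smooth_at A x (\<lambda>y. h y / g y)"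
  using smooth_at_mult[OF assms(1) smooth_at_inverse[OF assms(2,3)]] by (simp add: field_simps)

lemma smooth_at_apply:
  fixes a :: "'a \<Rightarrow> 'w::euclidean_space \<Rightarrow> 'u::real_normed_vector"
  assumes "\<And>w. smooth_at A x (\<lambda>z. a z w)" "\<forall>\<^sub>F z in nhds x. linear (a z)" "smooth_at A x g"
  shows "smooth_at A x (\<lambda>z. a z (g z))"
proof (rule smooth_at_cong)
  show "smooth_at A x (\<lambda>z. \<Sum>i\<in>Basis. (g z \<bullet> i) *\<^sub>R a z i)"
    by (rule smooth_at_sum)
      (rule smooth_at_scaleR[OF smooth_at_linear[OF bounded_linear_inner_left assms(3)] assms(1)])
  show "\<forall>\<^sub>F z in nhds x. (\<Sum>i\<in>Basis. (g z \<bullet> i) *\<^sub>R a z i) = a z (g z)"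
    using assms(2) by eventually_elim (rule linear_expand_Basis[symmetric])
qed

section \<open>The trivial connection and coordinate fields\<close>

lemma eventually_chart_inv:
  assumes "c \<in> A" "x \<in> fst c" "\<forall>\<^sub>F y in nhds x. P y"
  obtains S where "open S" "snd c x \<in> S" "S \<subseteq> snd c ` fst c" "\<And>z. z \<in> S \<Longrightarrow> P (chart_inv c z)"
proof -
  obtain M where M: "open M" "x \<in> M" "\<And>y. y \<in> M \<Longrightarrow> P y"
    using assms(3) unfolding eventually_nhds by blast
  show ?thesis
    by (rule that[of "snd c ` (M \<inter> fst c)"])
      (use M assms open_chart_image[OF assms(1) M(1)] chart_inv_snd[OF assms(1)] in auto)
qed

lemma dd_cong:
  assumes "\<forall>\<^sub>F y in nhds x. g y = h y" shows "dd A g x = dd A h x"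
proof
  fix X
  let ?c = "chart_at A x"
  obtain S where "open S" "snd ?c x \<in> S" "\<And>z. z \<in> S \<Longrightarrow> g (chart_inv ?c z) = h (chart_inv ?c z)"
    using eventually_chart_inv[OF chart_at assms] by metis
  then show "dd A g x X = dd A h x X"
    unfolding dd_def using frechet_derivative_cong[of S "snd ?c x" "g \<circ> chart_inv ?c" "h \<circ> chart_inv ?c"]
    by simp
qed

lemma has_derivative_dd:
  assumes "smooth_at A x g"
  shows "((\<lambda>z. g (chart_inv (chart_at A x) z)) has_derivative dd A g x) (at (snd (chart_at A x) x))"
proof -
  let ?c = "chart_at A x"
  obtain T where T: "open T" "snd ?c x \<in> T" "smooth_on T (\<lambda>z. g (chart_inv ?c z))"
    using smooth_at_chart[OF assms(1) chart_at] .
  from smooth_on_has_derivative[OF T(3,2)] show ?thesis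
    unfolding dd_def by (simp add: comp_def)
qed

lemma dd_eqI:
  assumes "((\<lambda>z. g (chart_inv (chart_at A x) z)) has_derivative D) (at (snd (chart_at A x) x))"
  shows "dd A g x X = D X"
  using frechet_derivative_at[OF assms] unfolding dd_def by (simp add: comp_def)

lemma linear_dd: "smooth_at A x g \<Longrightarrow> linear (dd A g x)"
  using has_derivative_dd has_derivative_linear by blast

lemma dd_const: "dd A (\<lambda>y. k) x X = 0"
  by (rule dd_eqI) (rule has_derivative_const)

lemma dd_add: "smooth_at A x g \<Longrightarrow> smooth_at A x h \<Longrightarrow> dd A (\<lambda>y. g y + h y) x X = dd A g x X + dd A h x X"
  by (rule dd_eqI) (intro has_derivative_add has_derivative_dd)

lemma dd_diff: "smooth_at A x g \<Longrightarrow> smooth_at A x h \<Longrightarrow> dd A (\<lambda>y. g y - h y) x X = dd A g x X - dd A h x X"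
  by (rule dd_eqI) (intro has_derivative_diff has_derivative_dd)

lemma dd_linear: "bounded_linear B \<Longrightarrow> smooth_at A x g \<Longrightarrow> dd A (\<lambda>y. B (g y)) x X = B (dd A g x X)"
  by (rule dd_eqI) (rule bounded_linear.has_derivative[OF _ has_derivative_dd])

lemma dd_bilinear:
  assumes "bounded_bilinear B" "smooth_at A x g" "smooth_at A x h"
  shows "dd A (\<lambda>y. B (g y) (h y)) x X = B (g x) (dd A h x X) + B (dd A g x X) (h x)"
  using bounded_bilinear.FDERIV[OF assms(1) has_derivative_dd[OF assms(2)] has_derivative_dd[OF assms(3)]]
  by (subst dd_eqI) (auto simp: chart_inv_snd[OF chart_at])

lemmas dd_scaleR = dd_bilinear[OF bounded_bilinear_scaleR]

lemma dd_scaleR_const: "smooth_at A x g \<Longrightarrow> dd A (\<lambda>y. k *\<^sub>R g y) x X = k *\<^sub>R dd A g x X"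
  by (rule dd_linear[OF bounded_linear_scaleR_right])

lemma dd_apply:
  fixes a :: "'a \<Rightarrow> 'w::euclidean_space \<Rightarrow> 'u::real_normed_vector"
  assumes "\<And>w. smooth_at A x (\<lambda>z. a z w)" "\<forall>\<^sub>F z in nhds x. linear (a z)" "smooth_at A x g"
  shows "dd A (\<lambda>z. a z (g z)) x X = dd A (\<lambda>z. a z (g x)) x X + a x (dd A g x X)"
proof -
  let ?c = "chart_at A x"
  obtain S where S: "open S" "snd ?c x \<in> S" "\<And>z. z \<in> S \<Longrightarrow> linear (a (chart_inv ?c z))"
    using eventually_chart_inv[OF chart_at assms(2)] by metis
  from has_derivative_apply[where a = "\<lambda>z. a (chart_inv ?c z)" and a' = "\<lambda>u w. dd A (\<lambda>z. a z w) x u",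
      OF S(1,2) has_derivative_dd[OF assms(1)] S(3) has_derivative_dd[OF assms(3)]]
  show ?thesis by (subst dd_eqI) (auto simp: chart_inv_snd[OF chart_at])
qed

text \<open>A tangent vector at \<open>x\<close> is stored by its components in the chosen chart at
  \<open>x\<close>, so a field constant in \<open>c\<close> is read off from the derivative of a
  transition map.\<close>

lemma coord_field_has_derivative:
  assumes "c \<in> A" "x \<in> fst c"
  shows "((\<lambda>z. snd (chart_at A x) (chart_inv c z)) has_derivative (\<lambda>v. coord_field A c v x)) (at (snd c x))"
  using smooth_on_has_derivative[OF transition_smooth[OF assms(1) chart_at(1)], of "snd c x"]
    assms(2) chart_at(2)[of x] unfolding coord_field_def by (simp add: comp_def)

lemma coord_field_chart_at: "coord_field A (chart_at A x) v x = v"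
proof -
  let ?c = "chart_at A x"
  have op: "open (snd ?c ` (UNIV \<inter> fst ?c))" by (rule open_chart_image[OF chart_at(1) open_UNIV])
  have "((\<lambda>z. snd ?c (chart_inv ?c z)) has_derivative (\<lambda>v. v)) (at (snd ?c x))"
    by (rule has_derivative_transform_within_open[OF has_derivative_ident op])
      (use chart_at snd_chart_inv in auto)
  from has_derivative_unique[OF this coord_field_has_derivative[OF chart_at]]
  show ?thesis by metis
qed

text \<open>The chain rule through the chosen chart. It makes the arbitrary choice
  \<open>chart_at\<close> harmless: computing in any chart along a constant vector amounts to
  \<open>dd\<close> along the coordinate field.\<close>

lemma has_derivative_coord:
  assumes "c \<in> A" "x \<in> fst c" "smooth_at A x g"
  shows "((\<lambda>z. g (chart_inv c z)) has_derivative (\<lambda>v. dd A g x (coord_field A c v x))) (at (snd c x))"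
proof -
  let ?c = "chart_at A x"
  have "((\<lambda>z. g (chart_inv ?c z)) has_derivative dd A g x) (at (snd ?c (chart_inv c (snd c x))))"
    using has_derivative_dd[OF assms(3)] by (simp add: chart_inv_snd[OF assms(1,2)])
  from has_derivative_compose[OF coord_field_has_derivative[OF assms(1,2)] this]
  have 1: "((\<lambda>z. g (chart_inv ?c (snd ?c (chart_inv c z)))) has_derivative (\<lambda>v. dd A g x (coord_field A c v x))) (at (snd c x))" .
  have op: "open (snd c ` (fst ?c \<inter> fst c))" by (rule open_chart_image[OF assms(1) open_chart[OF chart_at(1)]])
  show ?thesis
    by (rule has_derivative_transform_within_open[OF 1 op])
      (use assms chart_at chart_inv_snd in auto)
qed

lemma frechet_coord:
  assumes "c \<in> A" "x \<in> fst c" "smooth_at A x g"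
  shows "frechet_derivative (\<lambda>z. g (chart_inv c z)) (at (snd c x)) v = dd A g x (coord_field A c v x)"
  by (rule fun_cong[OF frechet_derivative_at[OF has_derivative_coord[OF assms]], symmetric])

lemma linear_coord_field:
  assumes "c \<in> A" "x \<in> fst c" shows "linear (\<lambda>v. coord_field A c v x)"
  using coord_field_has_derivative[OF assms] has_derivative_linear by blast

lemma smooth_at_chart_map:
  assumes "c \<in> A" "x \<in> fst c" shows "smooth_at A x (snd c)"
  by (rule smooth_at_chartI[OF assms open_UNIV _ smooth_on_ident]) auto

text \<open>The coordinate map, read in its own chart, differentiates to the identity, and by the
  chain rule this derivative factors through \<open>coord_field\<close>.\<close>

lemma coord_field_inj:
  assumes "c \<in> A" "x \<in> fst c" "coord_field A c v x = 0" shows "v = 0"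
proof -
  have op: "open (snd c ` (UNIV \<inter> fst c))" by (rule open_chart_image[OF assms(1) open_UNIV])
  have "((\<lambda>z. snd c (chart_inv c z)) has_derivative (\<lambda>v. v)) (at (snd c x))"
    by (rule has_derivative_transform_within_open[OF has_derivative_ident op])
      (use assms snd_chart_inv in auto)
  from has_derivative_unique[OF this has_derivative_coord[OF assms(1,2) smooth_at_chart_map[OF assms(1,2)]]]
  have "v = dd A (snd c) x (coord_field A c v x)" by metis
  then show ?thesis
    using assms(3) linear_0[OF linear_dd[OF smooth_at_chart_map[OF assms(1,2)]]] by simp
qed

lemma coord_field_surj:
  assumes "c \<in> A" "x \<in> fst c" obtains v where "coord_field A c v x = X"
proof -
  have "inj (\<lambda>v. coord_field A c v x)"
    using linear_injective_0[OF linear_coord_field[OF assms]] coord_field_inj[OF assms] by blast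
  then have "surj (\<lambda>v. coord_field A c v x)"
    using linear_injective_imp_surjective[OF linear_coord_field[OF assms]] by blast
  then show ?thesis using that by (metis surjD)
qed

text \<open>For a fixed component vector \<open>X\<close> the map \<open>dd A g y X\<close> need not
  even be continuous in \<open>y\<close>, since the chart that identifies the tangent space may jump
  with \<open>y\<close>. Coordinate fields compensate for the jump.\<close>

lemma smooth_at_dd:
  assumes "c \<in> A" "x \<in> fst c" "smooth_at A x g"
  shows "smooth_at A x (\<lambda>y. dd A g y (coord_field A c v y))"
proof -
  obtain T where T: "open T" "snd c x \<in> T" "T \<subseteq> snd c ` fst c" "smooth_on T (\<lambda>z. g (chart_inv c z))"
    using smooth_at_chart[OF assms(3,1,2)] .
  show ?thesis
  proof (rule smooth_at_chartI[OF assms(1,2) T(1,2) smooth_on_deriv[OF T(4), of v]])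
    show "\<forall>\<^sub>F y in nhds x. dd A g y (coord_field A c v y) =
        frechet_derivative (\<lambda>z. g (chart_inv c z)) (at (snd c y)) v"
      using smooth_at_eventually[OF assms(3)] eventually_nhds_in_open[OF open_chart[OF assms(1)] assms(2)]
      by eventually_elim (simp add: frechet_coord[OF assms(1)])
  qed
qed

lemma dd_commute:
  fixes g :: "'a \<Rightarrow> 'w::euclidean_space"
  assumes "c \<in> A" "x \<in> fst c" "smooth_at A x g"
  shows "dd A (\<lambda>y. dd A g y (coord_field A c v y)) x (coord_field A c u x) =
    dd A (\<lambda>y. dd A g y (coord_field A c u y)) x (coord_field A c v x)"
proof -
  obtain T where T: "open T" "snd c x \<in> T" "T \<subseteq> snd c ` fst c" "smooth_on T (\<lambda>z. g (chart_inv c z))"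
    using smooth_at_chart[OF assms(3,1,2)] .
  obtain S where S: "open S" "snd c x \<in> S" "S \<subseteq> snd c ` fst c" "\<And>z. z \<in> S \<Longrightarrow> smooth_at A (chart_inv c z) g"
    using eventually_chart_inv[OF assms(1,2) smooth_at_eventually[OF assms(3)]] by metis
  have "dd A (\<lambda>y. dd A g y (coord_field A c v y)) x (coord_field A c u x) =
    frechet_derivative (\<lambda>z. frechet_derivative (\<lambda>z. g (chart_inv c z)) (at z) v) (at (snd c x)) u" for u v
  proof -
    have "dd A g (chart_inv c z) (coord_field A c v (chart_inv c z)) =
        frechet_derivative (\<lambda>z. g (chart_inv c z)) (at z) v" if "z \<in> S" for z
      using frechet_coord[OF assms(1) _ S(4)[OF that], of v] S(3) that
        snd_chart_inv[OF assms(1), of z] chart_inv_in[OF assms(1), of z] by auto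
    from frechet_derivative_cong[OF S(1,2) this] show ?thesis
      using frechet_coord[OF assms(1,2) smooth_at_dd[OF assms], of v u] by simp
  qed
  then show ?thesis using second_derivative_symmetric[OF T(1,2,4)] by simp
qed

lemma sections_iff:
  "\<sigma> \<in> sections A W x \<longleftrightarrow> smooth_at A x \<sigma> \<and> (\<forall>\<^sub>F y in nhds x. \<sigma> y \<in> W y)"
proof
  assume "\<sigma> \<in> sections A W x"
  then show "smooth_at A x \<sigma> \<and> (\<forall>\<^sub>F y in nhds x. \<sigma> y \<in> W y)"
    unfolding sections_def smooth_at_def eventually_nhds by blast
next
  assume *: "smooth_at A x \<sigma> \<and> (\<forall>\<^sub>F y in nhds x. \<sigma> y \<in> W y)"
  then obtain N M where "open N" "x \<in> N" "smooth_map A N \<sigma>" "open M" "x \<in> M" "\<And>y. y \<in> M \<Longrightarrow> \<sigma> y \<in> W y"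
    unfolding smooth_at_def eventually_nhds by blast
  then have "open (N \<inter> M) \<and> x \<in> N \<inter> M \<and> smooth_map A (N \<inter> M) \<sigma> \<and> (\<forall>y\<in>N \<inter> M. \<sigma> y \<in> W y)"
    using smooth_map_mono[of N \<sigma> "N \<inter> M"] by auto
  then show "\<sigma> \<in> sections A W x" unfolding sections_def by blast
qed

text \<open>The neighbourhoods are coordinate balls, on which functions with vanishing derivative are constant.\<close>

lemma parallel_section_exists:
  fixes \<eta> :: "'a end_form"
  assumes sm: "\<And>c v w x. c \<in> A \<Longrightarrow> x \<in> fst c \<Longrightarrow> smooth_at A x (\<lambda>y. \<eta> y (coord_field A c v y) w)"
    and lin1: "\<And>x w. linear (\<lambda>X. \<eta> x X w)" and lin2: "\<And>x X. linear (\<eta> x X)"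
    and closed: "closed_form A UNIV \<eta>"
    and comm: "\<And>x X Y w. \<eta> x X (\<eta> x Y w) = \<eta> x Y (\<eta> x X w)"
  obtains N \<xi> where "open N" "x0 \<in> N" "\<xi> x0 = w0"
    "\<And>x. x \<in> N \<Longrightarrow> smooth_at A x \<xi>" "\<And>x X. x \<in> N \<Longrightarrow> dd A \<xi> x X = - \<eta> x X (\<xi> x)"
    "\<And>(h :: 'a \<Rightarrow> real) x. (\<And>x. x \<in> N \<Longrightarrow> smooth_at A x h) \<Longrightarrow> (\<And>x X. x \<in> N \<Longrightarrow> dd A h x X = 0) \<Longrightarrow>
      x \<in> N \<Longrightarrow> h x = h x0"
proof -
  let ?c = "chart_at A x0"
  note c = chart_at[of x0]
  \<comment> \<open>The form read in the chart, on constant fields. Closedness along coordinate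
    fields becomes closedness in the usual sense.\<close>
  define a where "a = (\<lambda>z v. \<eta> (chart_inv ?c z) (coord_field A ?c v (chart_inv ?c z)))"
  let ?S = "snd ?c ` fst ?c"
  let ?z0 = "snd ?c x0"
  have S: "open ?S" using open_chart_image[OF c(1) open_UNIV] by simp
  have sma: "smooth_on ?S (\<lambda>z. a z v w)" for v w
  proof -
    have "smooth_map A (fst ?c) (\<lambda>y. \<eta> y (coord_field A ?c v y) w)"
      using smooth_map_iff[OF open_chart[OF c(1)]] sm[OF c(1)] by blast
    then show ?thesis using c(1) unfolding smooth_map_def a_def by (auto simp: comp_def)
  qed
  have la1: "linear (\<lambda>v. a z v w)" if "z \<in> ?S" for z w
    using linear_compose[OF linear_coord_field[OF c(1) chart_inv_in[OF c(1) that]] lin1[of "chart_inv ?c z" w]]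
    by (simp add: a_def comp_def)
  have la2: "linear (a z v)" for z v unfolding a_def by (rule lin2)
  have cl: "frechet_derivative (\<lambda>z. a z v w) (at z) u = frechet_derivative (\<lambda>z. a z u w) (at z) v"
    if z: "z \<in> ?S" for z u v w
  proof -
    have y: "chart_inv ?c z \<in> fst ?c" "snd ?c (chart_inv ?c z) = z"
      using chart_inv_in[OF c(1) z] snd_chart_inv[OF c(1) z] by auto
    show ?thesis
      using frechet_coord[OF c(1) y(1) sm[OF c(1) y(1)], of v w u] frechet_coord[OF c(1) y(1) sm[OF c(1) y(1)], of u w v]
        closed y c(1) unfolding closed_form_def a_def by simp
  qed
  define h where "h = (\<lambda>z. \<Sum>i\<in>Basis. \<Sum>j\<in>Basis. norm (a z i j))"
  have "continuous_on ?S h"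
    unfolding h_def by (intro continuous_intros smooth_on_continuous_on sma)
  then have "isCont h ?z0" using S c(2) continuous_on_eq_continuous_at by blast
  then have "\<exists>d>0. \<forall>z. dist z ?z0 < d \<longrightarrow> dist (h z) (h ?z0) < 1"
    unfolding continuous_at_eps_delta using zero_less_one by blast
  then obtain d where d: "d > 0" "\<And>z. dist z ?z0 < d \<Longrightarrow> dist (h z) (h ?z0) < 1" by blast
  obtain e where e: "e > 0" "ball ?z0 e \<subseteq> ?S" using S c(2) open_contains_ball by blast
  define K where "K = h ?z0 + 1"
  have K0: "K > 0" unfolding K_def h_def by (smt (verit) sum_nonneg norm_ge_zero)
  \<comment> \<open>Small enough to stay in the chart, to keep the bound \<open>K\<close> valid, and
    to satisfy \<open>K r \<le> 1/2\<close>, the convergence condition of the series.\<close>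
  define r where "r = min (min d e) (1 / (2 * K))"
  have r: "r > 0" "K * r \<le> 1/2"
  proof -
    show "r > 0" unfolding r_def using d e K0 by simp
    have "K * r \<le> K * (1 / (2 * K))" unfolding r_def using K0 by (intro mult_left_mono) auto
    then show "K * r \<le> 1/2" using K0 by simp
  qed
  have BS: "ball ?z0 r \<subseteq> ?S" using e(2) unfolding r_def by (auto simp: subset_eq)
  have bd: "norm (a z u w) \<le> K * norm u * norm w" if "z \<in> ball ?z0 r" for z u w
  proof -
    have "h z \<le> K" using d(2)[of z] that unfolding K_def r_def dist_real_def by (auto simp: dist_commute)
    have "norm (a z u w) \<le> h z * norm u * norm w"
      unfolding h_def using linear_norm_bound_Basis[where a = "a z" and u = u and w = w] la1 la2 that BS by blast
    also have "\<dots> \<le> K * norm u * norm w" using \<open>h z \<le> K\<close> by (intro mult_right_mono) auto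
    finally show ?thesis .
  qed
  have "\<exists>g. smooth_on (ball ?z0 r) g \<and> g ?z0 = w0 \<and>
    (\<forall>z\<in>ball ?z0 r. (g has_derivative (\<lambda>u. - a z u (g z))) (at z))"
  proof (rule parallel_section_ball[where K = K])
    show "smooth_on (ball ?z0 r) (\<lambda>z. a z v w)" for v w by (rule smooth_on_subset[OF sma BS])
    show "a z u (a z v w) = a z v (a z u w)" for z u v w unfolding a_def by (rule comm)
    show "frechet_derivative (\<lambda>z. a z v w) (at z) u = frechet_derivative (\<lambda>z. a z u w) (at z) v"
      if "z \<in> ball ?z0 r" for z u v w using cl that BS by blast
  qed (use r K0 bd la1 la2 BS in auto)
  then obtain g where g: "smooth_on (ball ?z0 r) g" "g ?z0 = w0"
    "\<And>z. z \<in> ball ?z0 r \<Longrightarrow> (g has_derivative (\<lambda>u. - a z u (g z))) (at z)" by blast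
  define N where "N = chart_inv ?c ` ball ?z0 r"
  have oN: "open N" unfolding N_def by (rule open_chart_preimage[OF c(1) open_ball BS])
  have xN: "x0 \<in> N" unfolding N_def using chart_inv_snd[OF c] r by (intro image_eqI[where x = ?z0]) auto
  have NB: "x \<in> fst ?c" "snd ?c x \<in> ball ?z0 r" if "x \<in> N" for x
    using that chart_inv_in[OF c(1)] snd_chart_inv[OF c(1)] BS unfolding N_def by auto
  define \<xi> where "\<xi> = (\<lambda>y. g (snd ?c y))"
  have sm\<xi>: "smooth_at A x \<xi>" if "x \<in> N" for x
    by (rule smooth_at_chartI[OF c(1) NB(1)[OF that] open_ball NB(2)[OF that] g(1)]) (simp add: \<xi>_def)
  have inN: "chart_inv ?c z \<in> N" "snd ?c (chart_inv ?c z) = z" if "z \<in> ball ?z0 r" for z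
    using that snd_chart_inv[OF c(1), of z] BS unfolding N_def by auto
  show ?thesis
  proof (rule that[OF oN xN _ sm\<xi>])
    show "\<xi> x0 = w0" by (simp add: \<xi>_def g(2))
    show "dd A \<xi> x X = - \<eta> x X (\<xi> x)" if x: "x \<in> N" for x X
    proof -
      obtain v where v: "coord_field A ?c v x = X" using coord_field_surj[OF c(1) NB(1)[OF x]] .
      have "((\<lambda>z. \<xi> (chart_inv ?c z)) has_derivative (\<lambda>u. - a (snd ?c x) u (g (snd ?c x)))) (at (snd ?c x))"
        by (rule has_derivative_transform_within_open[OF g(3)[OF NB(2)[OF x]] open_ball NB(2)[OF x]])
          (simp add: \<xi>_def inN del: mem_ball)
      from has_derivative_unique[OF has_derivative_coord[OF c(1) NB(1)[OF x] sm\<xi>[OF x]] this]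
      have "dd A \<xi> x (coord_field A ?c v x) = - a (snd ?c x) v (g (snd ?c x))" by meson
      then show ?thesis by (simp add: v a_def chart_inv_snd[OF c(1) NB(1)[OF x]] \<xi>_def)
    qed
    show "h x = h x0" if h: "\<And>x. x \<in> N \<Longrightarrow> smooth_at A x h" "\<And>x X. x \<in> N \<Longrightarrow> dd A h x X = 0" and x: "x \<in> N"
      for h :: "'a \<Rightarrow> real" and x
    proof -
      have "\<exists>k. \<forall>z\<in>ball ?z0 r. h (chart_inv ?c z) = k"
      proof (rule has_derivative_zero_constant[OF convex_ball])
        fix z assume z: "z \<in> ball ?z0 r"
        show "((\<lambda>z. h (chart_inv ?c z)) has_derivative (\<lambda>h. 0)) (at z within ball ?z0 r)"
          using has_derivative_coord[OF c(1) NB(1)[OF inN(1)[OF z]] h(1)[OF inN(1)[OF z]]]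
            h(2)[OF inN(1)[OF z]] inN(2)[OF z] by (auto intro: has_derivative_at_withinI)
      qed
      then show ?thesis
        using NB[OF x] NB[OF xN] chart_inv_snd[OF c(1)] by metis
    qed
  qed
qed

end

subsection \<open>Linear algebra of $\mathbb{R}^{4,2}$\<close>

lemma form42_commute: "form42 a b = form42 b a"
  by (simp add: form42_def inner_commute)

lemma form42_add: "form42 (a + b) c = form42 a c + form42 b c" "form42 c (a + b) = form42 c a + form42 c b"
  by (simp_all add: form42_def inner_add_left inner_add_right)

lemma form42_diff: "form42 (a - b) c = form42 a c - form42 b c" "form42 c (a - b) = form42 c a - form42 c b"
  by (simp_all add: form42_def inner_diff_left inner_diff_right)

lemma form42_scaleR: "form42 (k *\<^sub>R a) c = k * form42 a c" "form42 c (k *\<^sub>R a) = k * form42 c a"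
  by (simp_all add: form42_def right_diff_distrib)

lemma form42_minus: "form42 (- a) c = - form42 a c" "form42 c (- a) = - form42 c a"
  by (simp_all add: form42_def)

lemma form42_zero: "form42 0 c = 0" "form42 c 0 = 0"
  by (simp_all add: form42_def)

lemmas form42_simps = form42_add form42_diff form42_scaleR form42_minus form42_zero

lemma bounded_bilinear_form42: "bounded_bilinear form42"
proof (rule bilinear_conv_bounded_bilinear[THEN iffD1], unfold bilinear_def, intro conjI allI)
  show "linear (form42 x)" for x by (rule linearI) (simp_all add: form42_simps)
  show "linear (\<lambda>x. form42 x y)" for y by (rule linearI) (simp_all add: form42_simps)
qed

text \<open>The reflection that turns \<open>form42\<close> into the Euclidean inner product, so
  that orthogonal complements can be counted by Euclidean lemmas.\<close>

definition conj42 :: "R42 \<Rightarrow> R42" where "conj42 v = (fst v, - snd v)"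

lemma form42_inner: "form42 v w = conj42 v \<bullet> w"
  by (cases v; cases w) (simp add: form42_def conj42_def)

lemma linear_conj42: "linear conj42"
  by (rule linearI) (auto simp: conj42_def)

lemma inj_conj42: "inj conj42"
  by (rule injI) (auto simp: conj42_def prod_eq_iff)

lemma subspace_perp: "subspace (perp S)"
  by (auto simp: subspace_def perp_def form42_simps)

lemma perp_span: "perp (span S) = perp S"
proof
  show "perp (span S) \<subseteq> perp S" by (auto simp: perp_def span_base)
  show "perp S \<subseteq> perp (span S)"
  proof
    fix w assume "w \<in> perp S"
    then have "S \<subseteq> {v. form42 v w = 0}" by (auto simp: perp_def)
    moreover have "subspace {v. form42 v w = 0}" by (auto simp: subspace_def form42_simps)
    ultimately show "w \<in> perp (span S)" using span_minimal unfolding perp_def by blast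
  qed
qed

lemma dim_perp: "dim (perp S) + dim S = 6"
proof -
  have "perp S = perp (span S)" by (rule perp_span[symmetric])
  also have "\<dots> = {y \<in> UNIV. \<forall>x \<in> conj42 ` span S. orthogonal x y}"
    by (auto simp: perp_def form42_inner orthogonal_def)
  finally have eq: "perp S = {y \<in> UNIV. \<forall>x \<in> conj42 ` span S. orthogonal x y}" .
  have "dim (perp S) + dim (conj42 ` span S) = dim (UNIV :: R42 set)"
    unfolding eq
    by (rule dim_subspace_orthogonal_to_vectors)
      (auto intro: linear_subspace_image[OF linear_conj42])
  moreover have "dim (conj42 ` span S) = dim S"
    using dim_image_eq[OF linear_conj42, of "span S"] inj_on_subset[OF inj_conj42] by simp
  ultimately show ?thesis by simp
qed

text \<open>One inclusion is the symmetry of the form; counting dimensions with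
  \<open>dim_perp\<close> twice gives equality.\<close>

lemma perp_perp: "perp (perp S) = span S"
proof -
  have "span S \<subseteq> perp (perp S)"
  proof
    fix v assume v: "v \<in> span S"
    have "form42 w v = 0" if "w \<in> perp S" for w
      using that v unfolding perp_span[of S, symmetric] by (simp add: perp_def form42_commute)
    then show "v \<in> perp (perp S)" by (simp add: perp_def)
  qed
  moreover have "dim (perp (perp S)) = dim (span S)"
    using dim_perp[of S] dim_perp[of "perp S"] by simp
  ultimately show ?thesis
    using subspace_dim_equal[OF subspace_span subspace_perp] by (metis order_refl)
qed

lemma form42_nondegenerate: "(\<And>w. form42 v w = 0) \<Longrightarrow> v = 0"
proof -
  assume *: "\<And>w. form42 v w = 0"
  have "conj42 v = 0" using *[of "conj42 v"] by (simp add: form42_inner)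
  then show "v = 0" by (auto simp: conj42_def prod_eq_iff)
qed

section \<open>The exterior square as skew endomorphisms\<close>

lemma wedge_linear_left: "wedge (a + a') b c = wedge a b c + wedge a' b c" "wedge (k *\<^sub>R a) b c = k *\<^sub>R wedge a b c"
  by (simp_all add: wedge_def form42_simps algebra_simps)

lemma wedge_linear_right: "wedge a (b + b') c = wedge a b c + wedge a b' c" "wedge a (k *\<^sub>R b) c = k *\<^sub>R wedge a b c"
  by (simp_all add: wedge_def form42_simps algebra_simps)

lemma linear_wedge: "linear (wedge a b)"
  by (rule linearI) (simp_all add: wedge_def form42_simps algebra_simps)

lemma wedge_skew: "form42 (wedge a b v) w = - form42 v (wedge a b w)"
  by (simp add: wedge_def form42_simps form42_commute[of v] algebra_simps)

text \<open>Arbitrary finite index sets replace the initial segments of the definition, so that sums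
  of two elements can be indexed by a disjoint union.\<close>

lemma wedge_spaceI:
  assumes "T = (\<lambda>w. \<Sum>i\<in>I. wedge (a i) (b i) w)" "finite I" "\<And>i. i \<in> I \<Longrightarrow> a i \<in> S" "\<And>i. i \<in> I \<Longrightarrow> b i \<in> S'"
  shows "T \<in> wedge_space S S'"
proof -
  obtain h where h: "bij_betw h {..<card I} I"
    using ex_bij_betw_nat_finite[OF assms(2)] by (auto simp: atLeast0LessThan)
  have "T = (\<lambda>w. \<Sum>i<card I. wedge (a (h i)) (b (h i)) w)"
    unfolding assms(1) by (rule ext) (rule sum.reindex_bij_betw[OF h, symmetric])
  moreover have "\<forall>i<card I. a (h i) \<in> S \<and> b (h i) \<in> S'"
    using h assms(3,4) by (auto simp: bij_betw_def)
  ultimately show ?thesis unfolding wedge_space_def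
    by (intro CollectI exI[of _ "card I"] exI[of _ "\<lambda>i. a (h i)"] exI[of _ "\<lambda>i. b (h i)"]) simp
qed

lemma wedge_spaceE:
  assumes "T \<in> wedge_space S S'"
  obtains n :: nat and a b where "\<And>i. i < n \<Longrightarrow> a i \<in> S" "\<And>i. i < n \<Longrightarrow> b i \<in> S'"
    "T = (\<lambda>w. \<Sum>i<n. wedge (a i) (b i) w)"
  using assms unfolding wedge_space_def by blast

lemma wedge_in_wedge_space: "a \<in> S \<Longrightarrow> b \<in> S' \<Longrightarrow> wedge a b \<in> wedge_space S S'"
  by (rule wedge_spaceI[where I = "{0::nat}" and a = "\<lambda>_. a" and b = "\<lambda>_. b"]) auto

lemma wedge_space_add:
  assumes "T \<in> wedge_space S S'" "T' \<in> wedge_space S S'"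
  shows "(\<lambda>w. T w + T' w) \<in> wedge_space S S'"
proof -
  obtain n :: nat and a b where 1: "\<And>i. i < n \<Longrightarrow> a i \<in> S" "\<And>i. i < n \<Longrightarrow> b i \<in> S'"
    "T = (\<lambda>w. \<Sum>i<n. wedge (a i) (b i) w)" using assms(1) by (rule wedge_spaceE) blast
  obtain m :: nat and c d where 2: "\<And>i. i < m \<Longrightarrow> c i \<in> S" "\<And>i. i < m \<Longrightarrow> d i \<in> S'"
    "T' = (\<lambda>w. \<Sum>i<m. wedge (c i) (d i) w)" using assms(2) by (rule wedge_spaceE) blast
  show ?thesis
  proof (rule wedge_spaceI[where I = "{..<n} <+> {..<m}" and a = "case_sum a c" and b = "case_sum b d"])
    show "(\<lambda>w. T w + T' w) = (\<lambda>w. \<Sum>i\<in>{..<n} <+> {..<m}. wedge (case_sum a c i) (case_sum b d i) w)"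
      by (simp add: 1(3) 2(3) sum.Plus)
  qed (use 1 2 in auto)
qed

lemma wedge_space_scaleR:
  assumes "T \<in> wedge_space S S'" "subspace S"
  shows "(\<lambda>w. k *\<^sub>R T w) \<in> wedge_space S S'"
proof -
  obtain n :: nat and a b where 1: "\<And>i. i < n \<Longrightarrow> a i \<in> S" "\<And>i. i < n \<Longrightarrow> b i \<in> S'"
    "T = (\<lambda>w. \<Sum>i<n. wedge (a i) (b i) w)" using assms(1) by (rule wedge_spaceE) blast
  show ?thesis
    by (rule wedge_spaceI[where I = "{..<n}" and a = "\<lambda>i. k *\<^sub>R a i" and b = b])
      (use 1 assms(2) in \<open>auto simp: wedge_linear_left scaleR_sum_right subspace_scale\<close>)
qed

lemma wedge_space_mono: "T \<in> wedge_space S S' \<Longrightarrow> S \<subseteq> R \<Longrightarrow> S' \<subseteq> R' \<Longrightarrow> T \<in> wedge_space R R'"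
  unfolding wedge_space_def by blast

lemma wedge_space_linear: "T \<in> wedge_space S S' \<Longrightarrow> linear T"
  by (erule wedge_spaceE) (simp add: linear_compose_sum linear_wedge)

lemma wedge_space_skew: "T \<in> wedge_space S S' \<Longrightarrow> form42 (T v) w = - form42 v (T w)"
proof (erule wedge_spaceE)
  fix n :: nat and a b assume T: "T = (\<lambda>w. \<Sum>i<n. wedge (a i) (b i) w)"
  have *: "form42 (\<Sum>i<n. g i) w = (\<Sum>i<n. form42 (g i) w)" "form42 w (\<Sum>i<n. g i) = (\<Sum>i<n. form42 w (g i))" for g w
    by (induction n) (auto simp: form42_simps)
  show ?thesis unfolding T * by (simp add: wedge_skew sum_negf)
qed

text \<open>When the first factor is a line, bilinearity collects a sum of decomposable elements
  into a single one.\<close>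

lemma wedge_space_line:
  assumes "T \<in> wedge_space (span {l}) S'" "subspace S'"
  obtains b where "b \<in> S'" "T = wedge l b"
proof -
  obtain n :: nat and a b where 1: "\<And>i. i < n \<Longrightarrow> a i \<in> span {l}" "\<And>i. i < n \<Longrightarrow> b i \<in> S'"
    "T = (\<lambda>w. \<Sum>i<n. wedge (a i) (b i) w)" using assms(1) by (rule wedge_spaceE) blast
  have "\<forall>i. \<exists>k. i < n \<longrightarrow> a i = k *\<^sub>R l" using 1(1) unfolding span_singleton by blast
  then obtain k where k: "\<And>i. i < n \<Longrightarrow> a i = k i *\<^sub>R l" by metis
  have lin: "linear (\<lambda>c. wedge l c w)" for w by (rule linearI) (simp_all add: wedge_linear_right)
  have "T = wedge l (\<Sum>i<n. k i *\<^sub>R b i)"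
    unfolding 1(3) by (rule ext) (simp add: linear_sum[OF lin] k wedge_linear_left wedge_linear_right)
  moreover have "(\<Sum>i<n. k i *\<^sub>R b i) \<in> S'"
    by (intro subspace_sum subspace_scale assms(2) 1(2)) auto
  ultimately show ?thesis using that by blast
qed

lemma wedge_space_range:
  assumes "T \<in> wedge_space S S'" "subspace W" "S \<subseteq> W" "S' \<subseteq> W" shows "T w \<in> W"
proof -
  obtain n :: nat and a b where 1: "\<And>i. i < n \<Longrightarrow> a i \<in> S" "\<And>i. i < n \<Longrightarrow> b i \<in> S'"
    "T = (\<lambda>w. \<Sum>i<n. wedge (a i) (b i) w)" using assms(1) by (rule wedge_spaceE) blast
  show ?thesis unfolding 1(3) wedge_def
    using 1(1,2) assms by (intro subspace_sum subspace_diff subspace_scale) auto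
qed

lemma wedge_space_kernel:
  assumes "T \<in> wedge_space S S'" "w \<in> perp S" "w \<in> perp S'" shows "T w = 0"
proof -
  obtain n :: nat and a b where 1: "\<And>i. i < n \<Longrightarrow> a i \<in> S" "\<And>i. i < n \<Longrightarrow> b i \<in> S'"
    "T = (\<lambda>w. \<Sum>i<n. wedge (a i) (b i) w)" using assms(1) by (rule wedge_spaceE) blast
  show ?thesis unfolding 1(3) wedge_def
    using 1(1,2) assms(2,3) by (intro sum.neutral) (auto simp: perp_def)
qed

section \<open>Lines and planes given by generators\<close>

lemma in_span_2: "v \<in> span {a, b} \<longleftrightarrow> (\<exists>x y. v = x *\<^sub>R a + y *\<^sub>R b)"
proof -
  have "v \<in> span {a, b} \<longleftrightarrow> (\<exists>x. v - x *\<^sub>R a \<in> span {b})" by (rule span_breakdown_eq)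
  also have "\<dots> \<longleftrightarrow> (\<exists>x y. v - x *\<^sub>R a = y *\<^sub>R b)" by (auto simp: span_singleton)
  finally show ?thesis by (simp add: diff_eq_eq add.commute)
qed

lemma in_span_3: "v \<in> span {a, b, c} \<longleftrightarrow> (\<exists>x y z. v = x *\<^sub>R a + y *\<^sub>R b + z *\<^sub>R c)"
proof -
  have "v \<in> span {a, b, c} \<longleftrightarrow> (\<exists>x. v - x *\<^sub>R a \<in> span {b, c})" by (rule span_breakdown_eq)
  also have "\<dots> \<longleftrightarrow> (\<exists>x y z. v = x *\<^sub>R a + y *\<^sub>R b + z *\<^sub>R c)"
    by (simp add: in_span_2 diff_eq_eq ac_simps)
  finally show ?thesis .
qed

lemma in_span_singletonI:
  fixes a b :: "'v::real_vector"
  assumes "k *\<^sub>R a = j *\<^sub>R b" "k \<noteq> 0" shows "a \<in> span {b}"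
proof -
  have "a = (1 / k) *\<^sub>R (k *\<^sub>R a)" using assms(2) by simp
  then show ?thesis unfolding assms(1) by (metis span_base span_scale singletonI)
qed

lemma span_singleton_eqI:
  fixes a b :: "'v::real_vector"
  assumes "a \<in> span {b}" "a \<noteq> 0" shows "span {a} = span {b}"
proof -
  obtain k where k: "a = k *\<^sub>R b" using assms(1) by (auto simp: span_singleton)
  then have "b = (1/k) *\<^sub>R a" using assms(2) by auto
  then have "b \<in> span {a}" by (auto simp: span_singleton)
  then show ?thesis using assms(1) by (intro span_eq[THEN iffD2]) auto
qed

lemma dim_span_singleton: "(a::'v::euclidean_space) \<noteq> 0 \<Longrightarrow> dim (span {a}) = 1"
  by (simp add: dim_eq_card_independent)

lemma dim1_span:
  fixes S :: "'v::euclidean_space set"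
  assumes "subspace S" "dim S = 1" "a \<in> S" "a \<noteq> 0" shows "S = span {a}"
proof -
  have "span {a} \<subseteq> S" using assms by (intro span_minimal) auto
  then show ?thesis
    using subspace_dim_equal[OF subspace_span assms(1), of "{a}"] assms(2) dim_span_singleton[OF assms(4)] by auto
qed

lemma dim1_obtain:
  fixes S :: "'v::euclidean_space set"
  assumes "subspace S" "dim S = 1" obtains a where "a \<noteq> 0" "S = span {a}"
proof -
  obtain a where "a \<in> S" "a \<noteq> 0"
    using assms(2) dim_eq_0[of S] by (metis one_neq_zero singletonI subset_singletonD subsetI insertCI empty_subsetI)
  then show ?thesis using dim1_span[OF assms] that by blast
qed

lemma null_line_span: "a \<noteq> 0 \<Longrightarrow> form42 a a = 0 \<Longrightarrow> null_line (span {a})"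
  unfolding null_line_def isotropic_def
  by (simp add: dim_span_singleton del: dim_span) (simp add: span_singleton form42_simps)

lemma null_line_obtain:
  assumes "null_line l" obtains a where "a \<noteq> 0" "form42 a a = 0" "l = span {a}"
proof -
  obtain a where a: "a \<noteq> 0" "l = span {a}"
    using assms dim1_obtain unfolding null_line_def by metis
  then show ?thesis using assms that[of a] by (auto simp: null_line_def isotropic_def span_base)
qed

section \<open>Projections for the plane of \<open>p\<close> and a null vector\<close>

text \<open>In use \<open>s\<close> is a value of \<open>\<sigma>\<close>. With
  \<open>K = (p, p)\<close> the dual basis of \<open>p, s\<close> is \<open>s, p - K s\<close>,
  whatever the value of \<open>K\<close>. This is the origin of the combination
  \<open>p - K s\<close> in the projection formulas and in everything derived from them.\<close>

locale null_pair =
  fixes p s :: R42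
  assumes ps: "form42 s p = 1" and ss: "form42 s s = 0"
begin

lemma ps': "form42 p s = 1" using ps by (simp add: form42_commute)

lemma perp_perp_ps: "w \<in> perp (perp {p, s}) \<longleftrightarrow> (\<exists>x y. w = x *\<^sub>R p + y *\<^sub>R s)"
  by (simp add: perp_perp in_span_2)

lemma dim_ps: "dim {p, s} = 2"
proof -
  have "p \<notin> span {s}" using ps' ss by (auto simp: span_singleton form42_simps)
  moreover have "s \<noteq> 0" using ps by (auto simp: form42_simps)
  ultimately have "independent {p, s}" "p \<noteq> s" by (auto simp: independent_insert span_base)
  then show ?thesis by (simp add: dim_eq_card_independent)
qed

lemma dim_perp_ps: "dim (perp {p, s}) = 4"
  using dim_perp[of "{p, s}"] dim_ps by simp

lemma orth_proj_perp_perp: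
  "orth_proj (perp (perp {p, s})) w = form42 w (p - form42 p p *\<^sub>R s) *\<^sub>R s + form42 w s *\<^sub>R p"
proof -
  have p3: "perp (perp (perp {p, s})) = perp {p, s}" by (simp add: perp_perp perp_span)
  show ?thesis unfolding orth_proj_def p3
  proof (rule the_equality)
    show "form42 w (p - form42 p p *\<^sub>R s) *\<^sub>R s + form42 w s *\<^sub>R p \<in> perp (perp {p, s}) \<and>
      w - (form42 w (p - form42 p p *\<^sub>R s) *\<^sub>R s + form42 w s *\<^sub>R p) \<in> perp {p, s}"
      using ps ps' ss
      by (simp add: perp_perp in_span_2, intro conjI)
        (metis add.commute, simp add: perp_def form42_simps form42_commute[of p w] form42_commute[of s w])
  next
    fix v assume v: "v \<in> perp (perp {p, s}) \<and> w - v \<in> perp {p, s}"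
    then obtain x y where xy: "v = x *\<^sub>R p + y *\<^sub>R s" by (auto simp: perp_perp_ps)
    from v have "form42 s w = x" "form42 p w = x * form42 p p + y"
      using ps ps' ss by (auto simp: xy perp_def form42_simps)
    then show "v = form42 w (p - form42 p p *\<^sub>R s) *\<^sub>R s + form42 w s *\<^sub>R p"
      by (simp add: xy form42_simps form42_commute[of w] algebra_simps)
  qed
qed

lemma orth_proj_perp:
  "orth_proj (perp {p, s}) w = w - (form42 w (p - form42 p p *\<^sub>R s) *\<^sub>R s + form42 w s *\<^sub>R p)"
  unfolding orth_proj_def
proof (rule the_equality)
  show "w - (form42 w (p - form42 p p *\<^sub>R s) *\<^sub>R s + form42 w s *\<^sub>R p) \<in> perp {p, s} \<and>
    w - (w - (form42 w (p - form42 p p *\<^sub>R s) *\<^sub>R s + form42 w s *\<^sub>R p)) \<in> perp (perp {p, s})"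
    using ps ps' ss
    by (simp add: perp_perp in_span_2, intro conjI)
      (simp add: perp_def form42_simps form42_commute[of p w] form42_commute[of s w], metis add.commute)
next
  fix v assume v: "v \<in> perp {p, s} \<and> w - v \<in> perp (perp {p, s})"
  then obtain x y where xy: "w - v = x *\<^sub>R p + y *\<^sub>R s" by (auto simp: perp_perp_ps)
  then have w: "w = v + (x *\<^sub>R p + y *\<^sub>R s)" by (simp add: diff_eq_eq)
  from v have v0: "form42 v s = 0" "form42 v p = 0" by (auto simp: perp_def form42_commute)
  have "form42 w s = x" "form42 w p = x * form42 p p + y"
    unfolding w using v0 ps ps' ss by (auto simp: form42_simps)
  then have "form42 w (p - form42 p p *\<^sub>R s) *\<^sub>R s + form42 w s *\<^sub>R p = x *\<^sub>R p + y *\<^sub>R s"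
    by (simp add: form42_simps algebra_simps)
  then show "v = w - (form42 w (p - form42 p p *\<^sub>R s) *\<^sub>R s + form42 w s *\<^sub>R p)" using w by simp
qed

end

text \<open>In use \<open>l\<close> spans the line of the surface at a point. The radical of
  \<open>perp {p, s, l}\<close> is the line of \<open>l\<close>, so a vector of this space is
  recovered from its pairings only up to multiples of \<open>l\<close>.\<close>

locale null_triple = null_pair +
  fixes l :: R42
  assumes ll: "form42 l l = 0" and ls: "form42 l s = 0" and lp: "form42 l p = 0" and l0: "l \<noteq> 0"
begin

lemma l_notin: "l \<notin> span {p, s}"
proof
  assume "l \<in> span {p, s}"
  then obtain x y where l: "l = x *\<^sub>R p + y *\<^sub>R s" by (auto simp: in_span_2)
  have "x = 0" using ls ps' ss unfolding l by (simp add: form42_simps)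
  moreover have "y = 0" using lp ps calculation unfolding l by (simp add: form42_simps)
  ultimately show False using l l0 by simp
qed

lemma dim_psl: "dim {p, s, l} = 3"
proof -
  have "dim (insert l {p, s}) = 3" using l_notin dim_ps by (simp add: dim_insert)
  then show ?thesis by (simp add: insert_commute)
qed

lemma dim_perp_psl: "dim (perp {p, s, l}) = 3"
  using dim_perp[of "{p, s, l}"] dim_psl by simp

lemma perp_perp_line:
  assumes "b \<in> perp {p, s, l}" "\<And>w. w \<in> perp {p, s, l} \<Longrightarrow> form42 b w = 0"
  shows "b \<in> span {l}"
proof -
  have "b \<in> perp (perp {p, s, l})" using assms(2) by (auto simp: perp_def form42_commute)
  then obtain x y z where b: "b = x *\<^sub>R p + y *\<^sub>R s + z *\<^sub>R l" by (auto simp: perp_perp in_span_3)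
  have "x = 0" using assms(1) ps ps' ss ls lp unfolding b by (auto simp: perp_def form42_simps form42_commute[of s l] form42_commute[of p l])
  moreover have "y = 0" using assms(1) ps ps' ss ls lp calculation unfolding b by (auto simp: perp_def form42_simps form42_commute[of s l] form42_commute[of p l])
  ultimately show ?thesis unfolding b by (simp add: span_scale span_base)
qed

text \<open>A vector of \<open>perp {p, s}\<close> not orthogonal to \<open>l\<close> is scaled to
  pairing 1 with \<open>l\<close>. Subtracting half its square times \<open>l\<close> makes it null
  and leaves the other pairings unchanged.\<close>

lemma null_partner:
  obtains v where "form42 v p = 0" "form42 v s = 0" "form42 v v = 0" "form42 v l = 1"
proof -
  have "l \<notin> perp (perp {p, s})" using l_notin by (simp add: perp_perp)
  then obtain w where w: "w \<in> perp {p, s}" "form42 w l \<noteq> 0" by (auto simp: perp_def)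
  define w' where "w' = (1 / form42 w l) *\<^sub>R w"
  have w': "form42 w' p = 0" "form42 w' s = 0" "form42 w' l = 1"
    using w by (auto simp: w'_def perp_def form42_simps form42_commute[of w])
  define v where "v = w' - (form42 w' w' / 2) *\<^sub>R l"
  have "form42 v p = 0" "form42 v s = 0" "form42 v v = 0" "form42 v l = 1"
    using w' ll ls lp unfolding v_def by (auto simp: form42_simps form42_commute[of l w'])
  then show ?thesis by (rule that)
qed

end

subsection \<open>Signatures and traces\<close>

text \<open>\<open>Max\<close> carries meaning only for a finite non-empty set: the dimensions are
  bounded, and the zero subspace always qualifies.\<close>

lemma pos_index_set:
  fixes S :: "'v::euclidean_space set"
  assumes "S \<noteq> {}" "0 \<in> S"
  shows "finite {dim P |P. subspace P \<and> P \<subseteq> S \<and> (\<forall>v\<in>P. v \<noteq> 0 \<longrightarrow> b v v > (0::real))}" (is "finite ?D")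
    "{dim P |P. subspace P \<and> P \<subseteq> S \<and> (\<forall>v\<in>P. v \<noteq> 0 \<longrightarrow> b v v > (0::real))} \<noteq> {}"
proof -
  have "?D \<subseteq> {..DIM('v)}" by (auto intro: dim_subset_UNIV)
  then show "finite ?D" using finite_subset by blast
  have "dim {0::'v} \<in> ?D" using assms(2) by (intro CollectI exI[of _ "{0}"]) auto
  then show "?D \<noteq> {}" by blast
qed

lemma pos_index_witness:
  fixes S :: "'v::euclidean_space set"
  assumes "0 \<in> S"
  obtains P where "subspace P" "P \<subseteq> S" "dim P = pos_index b S" "\<And>v. v \<in> P \<Longrightarrow> v \<noteq> 0 \<Longrightarrow> b v v > 0"
proof -
  have "pos_index b S \<in> {dim P |P. subspace P \<and> P \<subseteq> S \<and> (\<forall>v\<in>P. v \<noteq> 0 \<longrightarrow> b v v > (0::real))}"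
    unfolding pos_index_def by (rule Max_in) (use pos_index_set[of S b] assms in auto)
  then show ?thesis using that by auto
qed

lemma pos_index_eqI:
  fixes S :: "'v::euclidean_space set"
  assumes "subspace P" "P \<subseteq> S" "\<And>v. v \<in> P \<Longrightarrow> v \<noteq> 0 \<Longrightarrow> b v v > 0" "dim P = k"
    "\<And>P. subspace P \<Longrightarrow> P \<subseteq> S \<Longrightarrow> (\<And>v. v \<in> P \<Longrightarrow> v \<noteq> 0 \<Longrightarrow> b v v > 0) \<Longrightarrow> dim P \<le> k"
  shows "pos_index b S = k"
  unfolding pos_index_def
proof (rule Max_eqI)
  have "0 \<in> S" using assms(1,2) subspace_0 by blast
  then show "finite {dim P |P. subspace P \<and> P \<subseteq> S \<and> (\<forall>v\<in>P. v \<noteq> 0 \<longrightarrow> 0 < b v v)}"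
    using pos_index_set[of S b] by auto
  show "k \<in> {dim P |P. subspace P \<and> P \<subseteq> S \<and> (\<forall>v\<in>P. v \<noteq> 0 \<longrightarrow> 0 < b v v)}"
    using assms(1-4) by blast
qed (use assms(5) in auto)

text \<open>Definite subspaces correspond under \<open>T\<close> by image and preimage, with equal
  dimensions.\<close>

lemma pos_index_isometry:
  fixes T :: "'v::euclidean_space \<Rightarrow> 'w::euclidean_space"
  assumes "linear T" "subspace S" "inj_on T S" "T ` S = S'" "\<And>v. v \<in> S \<Longrightarrow> b' (T v) (T v) = b v v"
  shows "pos_index b' S' = pos_index b S"
proof -
  have "{dim P |P. subspace P \<and> P \<subseteq> S' \<and> (\<forall>v\<in>P. v \<noteq> 0 \<longrightarrow> b' v v > 0)} =
    {dim P |P. subspace P \<and> P \<subseteq> S \<and> (\<forall>v\<in>P. v \<noteq> 0 \<longrightarrow> b v v > 0)}"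
  proof (intro set_eqI iffI; clarsimp)
    fix P assume P: "subspace P" "P \<subseteq> S'" "\<forall>v\<in>P. v \<noteq> 0 \<longrightarrow> b' v v > 0"
    define R where "R = {v \<in> S. T v \<in> P}"
    have "subspace R" unfolding R_def
      using assms(1,2) P(1) by (auto simp: subspace_def linear_add linear_cmul linear_0)
    moreover have TR: "T ` R = P" unfolding R_def using P(2) assms(4) by auto
    moreover have "inj_on T R" using assms(3) by (rule inj_on_subset) (auto simp: R_def)
    moreover have "\<forall>v\<in>R. v \<noteq> 0 \<longrightarrow> b v v > 0"
    proof (intro ballI impI)
      fix v assume v: "v \<in> R" "v \<noteq> 0"
      then have "T v \<noteq> T 0" using assms(3) subspace_0[OF assms(2)] unfolding R_def inj_on_def by blast
      then show "b v v > 0"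
        using v P(3) assms(5)[of v] linear_0[OF assms(1)] by (auto simp: R_def)
    qed
    ultimately show "\<exists>Q. dim P = dim Q \<and> subspace Q \<and> Q \<subseteq> S \<and> (\<forall>v\<in>Q. v \<noteq> 0 \<longrightarrow> b v v > 0)"
      using dim_image_eq[OF assms(1), of R] by (intro exI[of _ R]) (auto simp: R_def span_eq_iff[THEN iffD2])
  next
    fix P assume P: "subspace P" "P \<subseteq> S" "\<forall>v\<in>P. v \<noteq> 0 \<longrightarrow> b v v > 0"
    have "inj_on T P" using assms(3) P(2) by (rule inj_on_subset)
    then have "dim (T ` P) = dim P"
      using dim_image_eq[OF assms(1), of P] span_eq_iff[THEN iffD2, OF P(1)] by simp
    moreover have "\<forall>w\<in>T ` P. w \<noteq> 0 \<longrightarrow> b' w w > 0"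
      using P(2,3) assms(5) linear_0[OF assms(1)] by (auto simp: subset_eq)
    ultimately show "\<exists>Q. dim P = dim Q \<and> subspace Q \<and> Q \<subseteq> S' \<and> (\<forall>v\<in>Q. v \<noteq> 0 \<longrightarrow> b' v v > 0)"
      using linear_subspace_image[OF assms(1) P(1)] P(2) assms(4) by (intro exI[of _ "T ` P"]) auto
  qed
  then show ?thesis unfolding pos_index_def by simp
qed

lemma signature_isometry:
  fixes T :: "'v::euclidean_space \<Rightarrow> 'w::euclidean_space"
  assumes "linear T" "subspace S" "inj_on T S" "T ` S = S'" "\<And>v. v \<in> S \<Longrightarrow> b' (T v) (T v) = b v v"
  shows "signature b' S' = signature b S"
  unfolding signature_def
  using pos_index_isometry[OF assms(1-4), of b' b] pos_index_isometry[OF assms(1-4), of "\<lambda>v w. - b' v w" "\<lambda>v w. - b v w"]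
    assms(5) by simp

text \<open>A positive definite 3-space and a negative definite line fill \<open>S\<close>, so there
  is no radical. Every plane of \<open>S\<close> meets the positive 3-space because 3 + 2 exceeds 4,
  so no plane of \<open>S\<close> is totally null.\<close>

lemma signature_31:
  assumes "signature form42 S = (3, 1)" "subspace S" "dim S = 4"
  shows "\<And>v. v \<in> S \<Longrightarrow> v \<in> perp S \<Longrightarrow> v = 0"
    "\<And>a b. a \<in> S \<Longrightarrow> b \<in> S \<Longrightarrow> a \<noteq> 0 \<Longrightarrow> form42 a a = 0 \<Longrightarrow> form42 b b = 0 \<Longrightarrow> form42 a b = 0 \<Longrightarrow> b \<in> span {a}"
proof -
  have 0: "0 \<in> S" using assms(2) subspace_0 by blast
  have sig: "pos_index form42 S = 3" "pos_index (\<lambda>v w. - form42 v w) S = 1"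
    using assms(1) by (auto simp: signature_def)
  obtain P where P: "subspace P" "P \<subseteq> S" "dim P = 3" "\<And>v. v \<in> P \<Longrightarrow> v \<noteq> 0 \<Longrightarrow> form42 v v > 0"
    using pos_index_witness[OF 0, of form42] sig by metis
  obtain N where N: "subspace N" "N \<subseteq> S" "dim N = 1" "\<And>v. v \<in> N \<Longrightarrow> v \<noteq> 0 \<Longrightarrow> - form42 v v > 0"
    using pos_index_witness[OF 0, of "\<lambda>v w. - form42 v w"] sig by metis
  have meet: "\<exists>x\<in>P \<inter> M. x \<noteq> 0" if M: "subspace M" "M \<subseteq> S" "dim M \<ge> 2" for M
  proof (rule ccontr)
    assume "\<not> ?thesis"
    then have "P \<inter> M = {0}" using P(1) M(1) subspace_0 by blast
    then have "dim {x + y |x y. x \<in> P \<and> y \<in> M} = dim P + dim M"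
      using dim_sums_Int[OF P(1) M(1)] by simp
    moreover have "{x + y |x y. x \<in> P \<and> y \<in> M} \<subseteq> S"
      using P(2) M(2) subspace_add[OF assms(2)] by blast
    ultimately show False using dim_subset[of "{x + y |x y. x \<in> P \<and> y \<in> M}" S] assms(3) P(3) M(3) by linarith
  qed
  have "P \<inter> N = {0}"
    using P(4) N(4) subspace_0[OF P(1)] subspace_0[OF N(1)] by fastforce
  then have "dim {x + y |x y. x \<in> P \<and> y \<in> N} = 4"
    using dim_sums_Int[OF P(1) N(1)] P(3) N(3) by simp
  moreover have "{x + y |x y. x \<in> P \<and> y \<in> N} \<subseteq> S"
    using P(2) N(2) subspace_add[OF assms(2)] by blast
  ultimately have PN: "{x + y |x y. x \<in> P \<and> y \<in> N} = S"
    using subspace_dim_equal[OF subspace_sums[OF P(1) N(1)] assms(2)] assms(3) by auto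
  show "v = 0" if v: "v \<in> S" "v \<in> perp S" for v
  proof -
    obtain x y where xy: "x \<in> P" "y \<in> N" "v = x + y" using v(1) PN by blast
    have "form42 x v = 0" "form42 y v = 0" using v(2) xy P(2) N(2) by (auto simp: perp_def)
    then have "form42 x x = form42 y y" unfolding xy(3) by (auto simp: form42_simps form42_commute[of y x])
    then have "x = 0" "y = 0" using P(4)[OF xy(1)] N(4)[OF xy(2)] by (auto simp: form42_zero) (metis form42_zero(1) less_irrefl neg_0_less_iff_less less_trans)+
    then show ?thesis using xy by simp
  qed
  show "b \<in> span {a}" if ab: "a \<in> S" "b \<in> S" "a \<noteq> 0" "form42 a a = 0" "form42 b b = 0" "form42 a b = 0" for a b
  proof (rule ccontr)
    assume nb: "b \<notin> span {a}"
    have "dim (insert b {a}) = 2" using nb dim_span_singleton[OF ab(3)] by (simp add: dim_insert)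
    then have "dim (span {b, a}) \<ge> 2" by simp
    moreover have "span {b, a} \<subseteq> S" using ab assms(2) by (intro span_minimal) auto
    ultimately obtain x where x: "x \<in> P" "x \<in> span {b, a}" "x \<noteq> 0"
      using meet[OF subspace_span] by blast
    then obtain y z where "x = y *\<^sub>R b + z *\<^sub>R a" by (auto simp: in_span_2)
    then have "form42 x x = 0" using ab by (auto simp: form42_simps form42_commute[of b a])
    then show False using P(4)[OF x(1,3)] by simp
  qed
qed

section \<open>Traces on lines and planes\<close>

lemma trace_on_1:
  assumes "e \<noteq> 0" "\<And>x. T (x *\<^sub>R e) = (x * a) *\<^sub>R e"
  shows "trace_on (span {e}) T = a"
proof -
  define E where "E = (SOME E. independent E \<and> span E = span {e})"
  have "\<exists>E. independent E \<and> span E = span {e}" using assms(1) by (intro exI[of _ "{e}"]) auto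
  then have E: "independent E" "span E = span {e}" unfolding E_def by (metis (mono_tags, lifting) someI_ex)+
  have "card E = 1" using E assms(1) dim_eq_card_independent[OF E(1)] dim_span_singleton[OF assms(1)] by (metis dim_span)
  then obtain g where g: "E = {g}" by (auto simp: card_1_singleton_iff)
  then obtain k where k: "g = k *\<^sub>R e" using E(2) span_base[of g E] by (auto simp: span_singleton)
  have Tg: "T g = a *\<^sub>R g" by (simp add: k assms(2))
  have "representation E (T g) g = a"
    unfolding Tg using representation_scale[OF E(1), of g] span_base[of g E] representation_basis[OF E(1), of g]
    by (simp add: g)
  then show ?thesis unfolding trace_on_def Let_def E_def[symmetric] by (simp add: g)
qed

text \<open>\<open>trace_on\<close> uses an unspecified basis, so independence of the basis has to
  be proved. The chosen basis is expressed through \<open>e1, e2\<close>, and its matrix entries are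
  compared by elimination.\<close>

lemma trace_on_2:
  assumes ind: "e1 \<notin> span {e2}" "e2 \<noteq> 0"
    and T: "\<And>x y. T (x *\<^sub>R e1 + y *\<^sub>R e2) = x *\<^sub>R (a *\<^sub>R e1 + b *\<^sub>R e2) + y *\<^sub>R (c *\<^sub>R e1 + d *\<^sub>R e2)"
  shows "trace_on (span {e1, e2}) T = a + d"
proof -
  have uniq: "x = x' \<and> y = y'" if "x *\<^sub>R e1 + y *\<^sub>R e2 = x' *\<^sub>R e1 + y' *\<^sub>R e2" for x y x' y'
  proof -
    have eq: "(x - x') *\<^sub>R e1 = (y' - y) *\<^sub>R e2" using that by (simp add: algebra_simps)
    have "x = x'"
    proof (rule ccontr)
      assume "x \<noteq> x'"
      then show False using in_span_singletonI[OF eq] ind(1) by simp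
    qed
    then show ?thesis using eq ind(2) by auto
  qed
  define E where "E = (SOME E. independent E \<and> span E = span {e1, e2})"
  have ind2: "independent {e1, e2}" "e1 \<noteq> e2" using ind by (auto simp: independent_insert span_base)
  then have "\<exists>E. independent E \<and> span E = span {e1, e2}" by blast
  then have E: "independent E" "span E = span {e1, e2}" unfolding E_def by (metis (mono_tags, lifting) someI_ex)+
  have "card E = 2"
    using dim_eq_card_independent[OF E(1)] dim_eq_card_independent[OF ind2(1)] E(2) ind2(2) by (metis card_2_iff dim_span)
  then obtain g h where gh: "E = {g, h}" "g \<noteq> h" by (auto simp: card_2_iff)
  obtain x1 y1 where g: "g = x1 *\<^sub>R e1 + y1 *\<^sub>R e2" using E(2) span_base[of g E] gh by (auto simp: in_span_2)
  obtain x2 y2 where h: "h = x2 *\<^sub>R e1 + y2 *\<^sub>R e2" using E(2) span_base[of h E] gh by (auto simp: in_span_2)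
  have rep: "w = representation E w g *\<^sub>R g + representation E w h *\<^sub>R h" if "w \<in> span E" for w
    using sum_representation_eq[OF E(1) that, of E] gh by simp
  have TE: "T w \<in> span E" if "w \<in> span E" for w
  proof -
    obtain x y where "w = x *\<^sub>R e1 + y *\<^sub>R e2" using \<open>w \<in> span E\<close> E(2) by (auto simp: in_span_2)
    then show ?thesis unfolding E(2) using T by (auto intro!: span_add span_scale simp: span_base)
  qed
  define r11 where "r11 = representation E (T g) g"
  define r12 where "r12 = representation E (T g) h"
  define r21 where "r21 = representation E (T h) g"
  define r22 where "r22 = representation E (T h) h"
  have Tg: "T g = r11 *\<^sub>R g + r12 *\<^sub>R h" unfolding r11_def r12_def by (rule rep, rule TE) (simp add: gh span_base)
  have Th: "T h = r21 *\<^sub>R g + r22 *\<^sub>R h" unfolding r21_def r22_def by (rule rep, rule TE) (simp add: gh span_base)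
  have "(x1 * a + y1 * c) *\<^sub>R e1 + (x1 * b + y1 * d) *\<^sub>R e2 = (r11 * x1 + r12 * x2) *\<^sub>R e1 + (r11 * y1 + r12 * y2) *\<^sub>R e2"
    using Tg unfolding g h T by (simp add: algebra_simps)
  from uniq[OF this] have 1: "x1 * a + y1 * c = r11 * x1 + r12 * x2" "x1 * b + y1 * d = r11 * y1 + r12 * y2" by auto
  have "(x2 * a + y2 * c) *\<^sub>R e1 + (x2 * b + y2 * d) *\<^sub>R e2 = (r21 * x1 + r22 * x2) *\<^sub>R e1 + (r21 * y1 + r22 * y2) *\<^sub>R e2"
    using Th unfolding g h T by (simp add: algebra_simps)
  from uniq[OF this] have 2: "x2 * a + y2 * c = r21 * x1 + r22 * x2" "x2 * b + y2 * d = r21 * y1 + r22 * y2" by auto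
  \<comment> \<open>The determinant of the change of basis, which is cancelled at the end.\<close>
  have D: "x1 * y2 - x2 * y1 \<noteq> 0"
  proof
    assume D: "x1 * y2 - x2 * y1 = 0"
    have e: "y2 *\<^sub>R g + (- y1) *\<^sub>R h = (x1 * y2 - x2 * y1) *\<^sub>R e1" "x2 *\<^sub>R g + (- x1) *\<^sub>R h = (x2 * y1 - x1 * y2) *\<^sub>R e2"
      unfolding g h by (simp_all add: algebra_simps)
    then have z: "y2 *\<^sub>R g + (- y1) *\<^sub>R h = 0" "x2 *\<^sub>R g + (- x1) *\<^sub>R h = 0" using D by (simp_all add: algebra_simps)
    have indE: "r = 0 \<and> r' = 0" if "r *\<^sub>R g + r' *\<^sub>R h = 0" for r r'
    proof -
      have "g \<notin> span {h}" "h \<noteq> 0" using E(1) gh by (auto simp: independent_insert dependent_zero split: if_splits)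
      then show ?thesis
      proof -
        have "r = 0"
        proof (rule ccontr)
          assume "r \<noteq> 0"
          moreover have "r *\<^sub>R g = (- r') *\<^sub>R h" using that by (simp add: eq_neg_iff_add_eq_0)
          ultimately show False using in_span_singletonI[of r g "- r'" h] \<open>g \<notin> span {h}\<close> by simp
        qed
        then show ?thesis using that \<open>h \<noteq> 0\<close> by simp
      qed
    qed
    have "y2 = 0 \<and> - y1 = 0" "x2 = 0 \<and> - x1 = 0" using indE z by blast+
    then have "g = h" unfolding g h by simp
    then show False using gh by simp
  qed
  \<comment> \<open>This combination of the four equations eliminates the off-diagonal entries
    \<open>r12\<close> and \<open>r21\<close>.\<close>
  have "(r11 + r22) * (x1 * y2 - x2 * y1) = (r11 * x1 + r12 * x2) * y2 - (r11 * y1 + r12 * y2) * x2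
      + (r21 * y1 + r22 * y2) * x1 - (r21 * x1 + r22 * x2) * y1" by algebra
  also have "\<dots> = (a + d) * (x1 * y2 - x2 * y1)" unfolding 1[symmetric] 2[symmetric] by algebra
  finally have "r11 + r22 = a + d" using D by simp
  then show ?thesis
    unfolding trace_on_def Let_def E_def[symmetric] using gh by (simp add: r11_def r22_def)
qed

section \<open>Signatures of symmetric forms on the plane\<close>

lemma pos_index_plane:
  fixes b :: "real^2 \<Rightarrow> real^2 \<Rightarrow> real"
  shows "(\<And>v. v \<noteq> 0 \<Longrightarrow> b v v > 0) \<Longrightarrow> pos_index b UNIV = 2"
    "(\<And>v. v \<noteq> 0 \<Longrightarrow> b v v \<le> 0) \<Longrightarrow> pos_index b UNIV = 0"
    "bilinear b \<Longrightarrow> b v v > 0 \<Longrightarrow> w \<noteq> 0 \<Longrightarrow> b w w \<le> 0 \<Longrightarrow> pos_index b UNIV = 1"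
proof -
  have le: "dim P \<le> 2" for P :: "(real^2) set" using dim_subset_UNIV[of P] by simp
  show "pos_index b UNIV = 2" if "\<And>v. v \<noteq> 0 \<Longrightarrow> b v v > 0"
    by (rule pos_index_eqI[where P = UNIV]) (use that le in auto)
  show "pos_index b UNIV = 0" if b: "\<And>v. v \<noteq> 0 \<Longrightarrow> b v v \<le> 0"
  proof (rule pos_index_eqI[where P = "{0}"])
    fix P :: "(real^2) set" assume "subspace P" "\<And>v. v \<in> P \<Longrightarrow> v \<noteq> 0 \<Longrightarrow> b v v > 0"
    then have "P \<subseteq> {0}" using b by force
    then show "dim P \<le> 0" by simp
  qed auto
  show "pos_index b UNIV = 1" if b: "bilinear b" "b v v > 0" "w \<noteq> 0" "b w w \<le> 0" for v w
  proof (rule pos_index_eqI[where P = "span {v}"])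
    have v0: "v \<noteq> 0" using b(1,2) by (auto simp: bilinear_lzero)
    then show "dim (span {v}) = 1" by (rule dim_span_singleton)
    show "b x x > 0" if x: "x \<in> span {v}" "x \<noteq> 0" for x
    proof -
      obtain k where k: "x = k *\<^sub>R v" using x(1) by (auto simp: span_singleton)
      then have "b x x = k * k * b v v" using b(1) by (simp add: bilinear_lmul bilinear_rmul)
      moreover have "k * k > 0" using k x(2) by (simp add: zero_less_mult_iff linorder_neq_iff[symmetric])
      ultimately show ?thesis using b(2) by simp
    qed
    show "dim P \<le> 1" if P: "subspace P" "\<And>v. v \<in> P \<Longrightarrow> v \<noteq> 0 \<Longrightarrow> b v v > 0" for P
    proof (rule ccontr)
      assume "\<not> dim P \<le> 1"
      then have "dim P = dim (UNIV :: (real^2) set)" using le[of P] by simp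
      then have "P = UNIV" using subspace_dim_equal[OF P(1) subspace_UNIV] by auto
      then show False using P(2)[of w] b by simp
    qed
  qed auto
qed

text \<open>Completing the square: \<open>b e e\<close> times the quadratic form is a square plus
  \<open>D\<close> times a square. The signature is thus read off from strict inequalities, which
  persist under small changes of the form.\<close>

lemma signature_plane:
  fixes b :: "real^2 \<Rightarrow> real^2 \<Rightarrow> real" and e f :: "real^2"
  assumes b: "bilinear b" and sym: "\<And>v w. b v w = b w v"
    and basis: "\<And>v. \<exists>x y. v = x *\<^sub>R e + y *\<^sub>R f" and ind: "\<And>x y. x *\<^sub>R e + y *\<^sub>R f = 0 \<Longrightarrow> x = 0 \<and> y = 0"
  defines "D \<equiv> b e e * b f f - (b e f)\<^sup>2"
  shows "D > 0 \<Longrightarrow> b e e > 0 \<Longrightarrow> signature b UNIV = (2, 0)"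
    "D > 0 \<Longrightarrow> b e e < 0 \<Longrightarrow> signature b UNIV = (0, 2)"
    "D < 0 \<Longrightarrow> signature b UNIV = (1, 1)"
proof -
  have ex: "b (x *\<^sub>R e + y *\<^sub>R f) (x *\<^sub>R e + y *\<^sub>R f) = x\<^sup>2 * b e e + 2 * x * y * b e f + y\<^sup>2 * b f f" for x y
    using sym[of f e]
    by (simp add: bilinear_ladd[OF b] bilinear_radd[OF b] bilinear_lmul[OF b] bilinear_rmul[OF b] power2_eq_square algebra_simps)
  have bneg: "bilinear (\<lambda>v w. - b v w)"
    using b unfolding bilinear_def by (auto intro: linear_compose_neg)
  have key: "b e e * b (x *\<^sub>R e + y *\<^sub>R f) (x *\<^sub>R e + y *\<^sub>R f) = (x * b e e + y * b e f)\<^sup>2 + D * y\<^sup>2" for x y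
    unfolding ex D_def by (simp add: power2_eq_square algebra_simps)
  have pos: "b e e * b v v > 0" if "D > 0" "b e e \<noteq> 0" "v \<noteq> 0" for v
  proof -
    obtain x y where v: "v = x *\<^sub>R e + y *\<^sub>R f" using basis by blast
    show ?thesis
    proof (cases "y = 0")
      case True
      then have "x \<noteq> 0" using that(3) v by auto
      then show ?thesis unfolding v key using that True by simp
    next
      case False
      then show ?thesis unfolding v key using that(1) by (simp add: add_nonneg_pos)
    qed
  qed
  show "signature b UNIV = (2, 0)" if "D > 0" "b e e > 0"
  proof -
    have 1: "b v v > 0" if "v \<noteq> 0" for v using pos[of v] that \<open>D > 0\<close> \<open>b e e > 0\<close> by (simp add: zero_less_mult_iff)
    show ?thesis unfolding signature_def
      using pos_index_plane(1)[of b, OF 1] pos_index_plane(2)[of "\<lambda>v w. - b v w"] 1 by (simp add: less_imp_le)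
  qed
  show "signature b UNIV = (0, 2)" if "D > 0" "b e e < 0"
  proof -
    have 1: "b v v < 0" if "v \<noteq> 0" for v using pos[of v] that \<open>D > 0\<close> \<open>b e e < 0\<close> by (simp add: zero_less_mult_iff)
    show ?thesis unfolding signature_def
      using pos_index_plane(2)[of b] pos_index_plane(1)[of "\<lambda>v w. - b v w"] 1 by (simp add: less_imp_le)
  qed
  show "signature b UNIV = (1, 1)" if D: "D < 0"
  proof -
    have "\<exists>v w. b v v > 0 \<and> b w w < 0"
    proof (cases "b e e = 0")
      case True
      then have h: "b e f \<noteq> 0" using D unfolding D_def by auto
      \<comment> \<open>If \<open>b e e = 0\<close>, the form is affine in the coefficient of
        \<open>e\<close> once that of \<open>f\<close> is 1, so it attains every value
        \<open>t\<close>, in particular 1 and -1.\<close>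
      have "b (((t - b f f) / (2 * b e f)) *\<^sub>R e + 1 *\<^sub>R f) (((t - b f f) / (2 * b e f)) *\<^sub>R e + 1 *\<^sub>R f) = t" for t
        unfolding ex using True h by (simp add: diff_divide_distrib left_diff_distrib)
      from this[of 1] this[of "-1"] show ?thesis by (metis neg_less_0_iff_less zero_less_one)
    next
      case False
      \<comment> \<open>The vector orthogonal to \<open>e\<close> with respect to
        \<open>b\<close>.\<close>
      let ?w = "(- b e f) *\<^sub>R e + b e e *\<^sub>R f"
      have "b e e * b ?w ?w = D * (b e e)\<^sup>2" unfolding key by simp
      then have "b e e * b ?w ?w < 0" using D False by (simp add: mult_neg_pos)
      then show ?thesis by (metis mult_less_0_iff)
    qed
    then obtain v w where vw: "b v v > 0" "b w w < 0" by blast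
    have "v \<noteq> 0" "w \<noteq> 0" using vw by (auto simp: bilinear_lzero[OF b])
    then show ?thesis unfolding signature_def
      using pos_index_plane(3)[of b v w] pos_index_plane(3)[of "\<lambda>v w. - b v w" w v] vw b bneg by (simp add: less_imp_le)
  qed
qed

subsection \<open>Enveloped sphere congruences\<close>

context smooth_surface begin

lemmas smooth_at_form42 = smooth_at_bilinear[OF bounded_bilinear_form42]
lemmas dd_form42 = dd_bilinear[OF bounded_bilinear_form42]

lemma smooth_at_wedge:
  "smooth_at A x g \<Longrightarrow> smooth_at A x h \<Longrightarrow> smooth_at A x k \<Longrightarrow> smooth_at A x (\<lambda>y. wedge (g y) (h y) (k y))"
  unfolding wedge_def by (intro smooth_at_diff smooth_at_scaleR smooth_at_form42)

lemma dd_wedge: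
  assumes "smooth_at A x g" "smooth_at A x h"
  shows "dd A (\<lambda>y. wedge (g y) (h y) w) x X = wedge (dd A g x X) (h x) w + wedge (g x) (dd A h x X) w"
proof -
  have "dd A (\<lambda>y. form42 (g y) w *\<^sub>R h y - form42 (h y) w *\<^sub>R g y) x X =
    (form42 (g x) w *\<^sub>R dd A h x X + form42 (dd A g x X) w *\<^sub>R h x) -
    (form42 (h x) w *\<^sub>R dd A g x X + form42 (dd A h x X) w *\<^sub>R g x)"
    by (simp add: dd_diff dd_scaleR dd_form42 dd_const smooth_at_scaleR smooth_at_form42 smooth_at_const assms form42_zero)
  then show ?thesis by (simp add: wedge_def algebra_simps)
qed

lemma dd_form42_const:
  assumes "smooth_at A x g" "smooth_at A x h" "\<forall>\<^sub>F y in nhds x. form42 (g y) (h y) = k"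
  shows "form42 (g x) (dd A h x X) = - form42 (dd A g x X) (h x)"
  using dd_form42[OF assms(1,2), of X] dd_cong[OF assms(3)] dd_const[of k x X] by simp

text \<open>For \<open>D = d + \<Omega>\<close> the second derivatives of a section cancel by
  symmetry and its first derivatives cancel in pairs. What remains is the curvature of
  \<open>\<Omega>\<close>, which depends only on the value of the section, so constant sections
  already detect it.\<close>

lemma flat_connection_iff:
  fixes D :: "'a connection" and \<Omega> :: "'a end_form"
  assumes U: "open U"
    and D: "\<And>\<xi> x X. x \<in> U \<Longrightarrow> smooth_at A x \<xi> \<Longrightarrow> D \<xi> x X = dd A \<xi> x X + \<Omega> x X (\<xi> x)"
    and lin: "\<And>x X. x \<in> U \<Longrightarrow> linear (\<Omega> x X)"
    and sm: "\<And>c x v w. c \<in> A \<Longrightarrow> x \<in> U \<Longrightarrow> x \<in> fst c \<Longrightarrow> smooth_at A x (\<lambda>y. \<Omega> y (coord_field A c v y) w)"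
  shows "flat A U D \<longleftrightarrow> (\<forall>c\<in>A. \<forall>x \<in> U \<inter> fst c. \<forall>u v w.
    dd A (\<lambda>y. \<Omega> y (coord_field A c v y) w) x (coord_field A c u x) + \<Omega> x (coord_field A c u x) (\<Omega> x (coord_field A c v x) w) =
    dd A (\<lambda>y. \<Omega> y (coord_field A c u y) w) x (coord_field A c v x) + \<Omega> x (coord_field A c v x) (\<Omega> x (coord_field A c u x) w))"
proof -
  have expand: "D (\<lambda>y. D \<xi> y (coord_field A c v y)) x (coord_field A c u x) =
      dd A (\<lambda>y. dd A \<xi> y (coord_field A c v y)) x (coord_field A c u x) +
      (dd A (\<lambda>y. \<Omega> y (coord_field A c v y) (\<xi> x)) x (coord_field A c u x) + \<Omega> x (coord_field A c v x) (dd A \<xi> x (coord_field A c u x)))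
      + (\<Omega> x (coord_field A c u x) (dd A \<xi> x (coord_field A c v x)) + \<Omega> x (coord_field A c u x) (\<Omega> x (coord_field A c v x) (\<xi> x)))"
    if c: "c \<in> A" "x \<in> fst c" "x \<in> U" and \<xi>: "smooth_at A x \<xi>" for c x u v \<xi>
  proof -
    have evU: "\<forall>\<^sub>F y in nhds x. y \<in> U" by (rule eventually_nhds_in_open[OF U c(3)])
    have ev: "\<forall>\<^sub>F y in nhds x. dd A \<xi> y (coord_field A c v y) + \<Omega> y (coord_field A c v y) (\<xi> y) = D \<xi> y (coord_field A c v y)"
      using smooth_at_eventually[OF \<xi>] evU by eventually_elim (simp add: D)
    have evl: "\<forall>\<^sub>F y in nhds x. linear (\<Omega> y (coord_field A c v y))"
      using evU by eventually_elim (rule lin)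
    have s1: "smooth_at A x (\<lambda>y. \<Omega> y (coord_field A c v y) (\<xi> y))"
      by (rule smooth_at_apply[OF sm[OF c(1,3,2)] evl \<xi>])
    have s2: "smooth_at A x (\<lambda>y. dd A \<xi> y (coord_field A c v y))" by (rule smooth_at_dd[OF c(1,2) \<xi>])
    have s3: "smooth_at A x (\<lambda>y. D \<xi> y (coord_field A c v y))"
      by (rule smooth_at_cong[OF smooth_at_add[OF s2 s1] ev])
    have "D (\<lambda>y. D \<xi> y (coord_field A c v y)) x (coord_field A c u x) =
        dd A (\<lambda>y. D \<xi> y (coord_field A c v y)) x (coord_field A c u x) + \<Omega> x (coord_field A c u x) (D \<xi> x (coord_field A c v x))"
      by (rule D[OF c(3) s3])
    also have "dd A (\<lambda>y. D \<xi> y (coord_field A c v y)) x = dd A (\<lambda>y. dd A \<xi> y (coord_field A c v y) + \<Omega> y (coord_field A c v y) (\<xi> y)) x"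
      by (rule dd_cong[OF ev, symmetric])
    finally show ?thesis
      unfolding dd_add[OF s2 s1] dd_apply[OF sm[OF c(1,3,2)] evl \<xi>] D[OF c(3) \<xi>] linear_add[OF lin[OF c(3)]] .
  qed
  show ?thesis
  proof
    assume fl: "flat A U D"
    show "\<forall>c\<in>A. \<forall>x \<in> U \<inter> fst c. \<forall>u v w.
    dd A (\<lambda>y. \<Omega> y (coord_field A c v y) w) x (coord_field A c u x) + \<Omega> x (coord_field A c u x) (\<Omega> x (coord_field A c v x) w) =
    dd A (\<lambda>y. \<Omega> y (coord_field A c u y) w) x (coord_field A c v x) + \<Omega> x (coord_field A c v x) (\<Omega> x (coord_field A c u x) w)"
    proof (intro ballI allI)
      fix c x u v and w :: R42 assume c: "c \<in> A" and x: "x \<in> U \<inter> fst c"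
      have "smooth_map A U (\<lambda>y. w)" using smooth_map_iff[OF U] smooth_at_const by blast
      then have "D (\<lambda>y. D (\<lambda>y. w) y (coord_field A c v y)) x (coord_field A c u x) =
        D (\<lambda>y. D (\<lambda>y. w) y (coord_field A c u y)) x (coord_field A c v x)"
        using fl U c x unfolding flat_def by blast
      then show "dd A (\<lambda>y. \<Omega> y (coord_field A c v y) w) x (coord_field A c u x) + \<Omega> x (coord_field A c u x) (\<Omega> x (coord_field A c v x) w) =
        dd A (\<lambda>y. \<Omega> y (coord_field A c u y) w) x (coord_field A c v x) + \<Omega> x (coord_field A c v x) (\<Omega> x (coord_field A c u x) w)"
        using x by (simp add: expand[OF c _ _ smooth_at_const] dd_const linear_0[OF lin])
    qed
  next
    assume R: "\<forall>c\<in>A. \<forall>x \<in> U \<inter> fst c. \<forall>u v w.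
    dd A (\<lambda>y. \<Omega> y (coord_field A c v y) w) x (coord_field A c u x) + \<Omega> x (coord_field A c u x) (\<Omega> x (coord_field A c v x) w) =
    dd A (\<lambda>y. \<Omega> y (coord_field A c u y) w) x (coord_field A c v x) + \<Omega> x (coord_field A c v x) (\<Omega> x (coord_field A c u x) w)"
    show "flat A U D" unfolding flat_def
    proof (intro allI impI ballI, elim conjE)
      fix N c x u v and \<xi> :: "'a \<Rightarrow> R42"
      assume N: "open N" "N \<subseteq> U" "smooth_map A N \<xi>" and c: "c \<in> A" and x: "x \<in> N \<inter> fst c"
      then have x': "x \<in> fst c" "x \<in> U" "smooth_at A x \<xi>" using smooth_map_iff[OF N(1)] by auto
      show "D (\<lambda>y. D \<xi> y (coord_field A c v y)) x (coord_field A c u x) =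
            D (\<lambda>y. D \<xi> y (coord_field A c u y)) x (coord_field A c v x)"
        unfolding expand[OF c x'] dd_commute[OF c x'(1,3), of v u]
        using R[rule_format, OF c, of x v "\<xi> x" u] x'(1,2) by (simp add: algebra_simps)
    qed
  qed
qed

end

section \<open>Legendre lifts and their local sections\<close>

locale legendre_lift = smooth_surface A for A :: "'a::t2_space chart set" +
  fixes p :: R42 and L f :: "'a vbundle"
  assumes pp: "form42 p p \<noteq> 0"
    and conf: "conformal_surface A UNIV p L"
    and leg: "legendre_map A UNIV f"
    and Lf: "\<And>x. L x \<subseteq> f x"
begin

abbreviation K :: real where "K \<equiv> form42 p p"

definition gen :: "'a \<Rightarrow> ('a \<Rightarrow> R42) \<Rightarrow> bool" where
  "gen x lam \<longleftrightarrow> smooth_at A x lam \<and> (\<forall>\<^sub>F y in nhds x. lam y \<noteq> 0 \<and> L y = span {lam y})"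

lemma line_bundle_gen:
  assumes "null_line_bundle A U M" "open U" "x \<in> U"
  obtains e where "smooth_at A x e" "\<forall>\<^sub>F y in nhds x. e y \<noteq> 0 \<and> M y = span {e y} \<and> form42 (e y) (e y) = 0"
proof -
  from assms obtain N and e :: "nat \<Rightarrow> 'a \<Rightarrow> R42" where N: "open N" "x \<in> N" "N \<subseteq> U"
    "\<forall>i<1. smooth_map A N (e i)" "\<forall>y\<in>N. M y = span ((\<lambda>i. e i y) ` {..<1}) \<and> dim (M y) = 1"
    unfolding null_line_bundle_def subbundle_def by metis
  have im: "(\<lambda>i. e i y) ` {..<1::nat} = {e 0 y}" for y by auto
  have "e 0 y \<noteq> 0 \<and> M y = span {e 0 y} \<and> form42 (e 0 y) (e 0 y) = 0" if "y \<in> N" for y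
  proof -
    have M: "M y = span {e 0 y}" "dim (M y) = 1" using N(5) that unfolding im by auto
    have "e 0 y \<noteq> 0" using M by (auto simp: span_singleton)
    moreover have "null_line (M y)" using assms(1) N(3) that unfolding null_line_bundle_def by blast
    ultimately show ?thesis using M(1) by (auto simp: null_line_def isotropic_def span_base)
  qed
  then show ?thesis
    using N(1,2,4) smooth_map_iff[OF N(1)] by (intro that[of "e 0"]) (auto simp: eventually_nhds)
qed

lemma L_gen: obtains lam where "gen x lam"
proof -
  have "null_line_bundle A UNIV L" using conf by (simp add: conformal_surface_def)
  from line_bundle_gen[OF this open_UNIV UNIV_I, of x] obtain e where "smooth_at A x e"
    "\<forall>\<^sub>F y in nhds x. e y \<noteq> 0 \<and> L y = span {e y} \<and> form42 (e y) (e y) = 0" .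
  then have "gen x e" unfolding gen_def by (auto elim: eventually_mono)
  then show ?thesis by (rule that)
qed

lemma genD:
  assumes "gen x lam"
  shows "smooth_at A x lam" "lam x \<noteq> 0" "L x = span {lam x}" "lam x \<in> L x" "\<forall>\<^sub>F y in nhds x. lam y \<in> L y"
proof -
  show sm: "smooth_at A x lam" using assms by (simp add: gen_def)
  have ev: "\<forall>\<^sub>F y in nhds x. lam y \<noteq> 0 \<and> L y = span {lam y}" using assms by (simp add: gen_def)
  from eventually_nhds_x_imp_x[OF ev] show "lam x \<noteq> 0" "L x = span {lam x}" "lam x \<in> L x" by (auto simp: span_base)
  show "\<forall>\<^sub>F y in nhds x. lam y \<in> L y" using ev by eventually_elim (simp add: span_base)
qed

lemma Lf_in: "l \<in> L x \<Longrightarrow> l \<in> f x"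
  using Lf by blast

lemma isotropic_f: "a \<in> f x \<Longrightarrow> b \<in> f x \<Longrightarrow> form42 a b = 0"
  using leg by (auto simp: legendre_map_def isotropic_def)

lemma f_subbundle: "subbundle A UNIV 2 f"
  using leg by (simp add: legendre_map_def)

lemma f_subspace: "subspace (f x)" and dim_f: "dim (f x) = 2"
  using f_subbundle unfolding subbundle_def by (metis UNIV_I subspace_span)+

lemma L_subspace: "subspace (L x)"
  using conf by (auto simp: conformal_surface_def null_line_bundle_def null_line_def)

lemma L_p: "l \<in> L x \<Longrightarrow> form42 l p = 0" "l \<in> L x \<Longrightarrow> form42 p l = 0"
  using conf by (auto simp: conformal_surface_def perp_def form42_commute[of l p])

lemma f_subset_perp: "a \<in> f x \<Longrightarrow> a \<in> perp (f x)"
  using isotropic_f by (simp add: perp_def)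

definition fsec :: "'a \<Rightarrow> ('a \<Rightarrow> R42) \<Rightarrow> bool" where
  "fsec x a \<longleftrightarrow> smooth_at A x a \<and> (\<forall>\<^sub>F y in nhds x. a y \<in> f y)"

lemma fsec_dd: "fsec x a \<Longrightarrow> dd A a x X \<in> perp (f x)"
proof -
  assume "fsec x a"
  then have "a \<in> sections A f x" by (simp add: fsec_def sections_iff)
  then have "dd A a x X \<in> derived A f x" unfolding derived_def by (intro span_base) blast
  then show ?thesis using leg by (auto simp: legendre_map_def)
qed

lemma fsec_in: "fsec x a \<Longrightarrow> a x \<in> f x"
  unfolding fsec_def using eventually_nhds_x_imp_x by blast

lemma fsec_dd_orth: "fsec x a \<Longrightarrow> b \<in> f x \<Longrightarrow> form42 (dd A a x X) b = 0" "fsec x a \<Longrightarrow> b \<in> f x \<Longrightarrow> form42 b (dd A a x X) = 0"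
  using fsec_dd by (auto simp: perp_def form42_commute[of _ b])

lemma Lsec_fsec: "smooth_at A x ell \<Longrightarrow> \<forall>\<^sub>F y in nhds x. ell y \<in> L y \<Longrightarrow> fsec x ell"
  unfolding fsec_def by (intro conjI) (assumption, erule eventually_mono, rule Lf_in)

lemma gen_fsec: "gen x lam \<Longrightarrow> fsec x lam"
  using genD Lsec_fsec by blast

lemma Lsec_dd_p:
  assumes "smooth_at A x ell" "\<forall>\<^sub>F y in nhds x. ell y \<in> L y"
  shows "form42 (dd A ell x X) p = 0" "form42 p (dd A ell x X) = 0"
proof -
  have "\<forall>\<^sub>F y in nhds x. form42 p (ell y) = 0" using assms(2) by eventually_elim (rule L_p)
  from dd_form42_const[OF smooth_at_const assms(1) this, of X]
  show "form42 p (dd A ell x X) = 0" by (simp add: dd_const form42_zero)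
  then show "form42 (dd A ell x X) p = 0" by (simp add: form42_commute)
qed

text \<open>Pairing with a fixed vector that is not orthogonal to \<open>lam x\<close> reads off the
  coefficient by a smooth formula.\<close>

lemma gen_coefficient:
  assumes "gen x lam" "smooth_at A x ell" "\<forall>\<^sub>F y in nhds x. ell y \<in> L y"
  obtains g where "smooth_at A x g" "\<forall>\<^sub>F y in nhds x. ell y = g y *\<^sub>R lam y"
proof -
  obtain w where w: "form42 (lam x) w \<noteq> 0" using form42_nondegenerate genD(2)[OF assms(1)] by blast
  have s: "smooth_at A x (\<lambda>y. form42 (lam y) w)" by (intro smooth_at_form42 genD(1)[OF assms(1)] smooth_at_const)
  show ?thesis
  proof (rule that[of "\<lambda>y. form42 (ell y) w / form42 (lam y) w"])
    show "smooth_at A x (\<lambda>y. form42 (ell y) w / form42 (lam y) w)"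
      by (intro smooth_at_divide s smooth_at_form42 assms smooth_at_const w)
    have "\<forall>\<^sub>F y in nhds x. lam y \<noteq> 0 \<and> L y = span {lam y}" using assms(1) by (simp add: gen_def)
    then show "\<forall>\<^sub>F y in nhds x. ell y = (form42 (ell y) w / form42 (lam y) w) *\<^sub>R lam y"
      using assms(3) smooth_at_nonzero[OF s w]
    proof eventually_elim
      case (elim y)
      then obtain k where "ell y = k *\<^sub>R lam y" by (auto simp: span_singleton)
      then show ?case using elim by (simp add: form42_simps)
    qed
  qed
qed

lemma Lsec_dd:
  assumes "gen x lam" "smooth_at A x ell" "\<forall>\<^sub>F y in nhds x. ell y \<in> L y"
  obtains g h where "ell x = g *\<^sub>R lam x" "\<And>X. dd A ell x X = g *\<^sub>R dd A lam x X + h X *\<^sub>R lam x"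
proof -
  obtain g where g: "smooth_at A x g" "\<forall>\<^sub>F y in nhds x. ell y = g y *\<^sub>R lam y"
    by (rule gen_coefficient[OF assms])
  show ?thesis
  proof (rule that[of "g x" "\<lambda>X. dd A g x X"])
    show "ell x = g x *\<^sub>R lam x" using eventually_nhds_x_imp_x[OF g(2)] .
    show "dd A ell x X = g x *\<^sub>R dd A lam x X + dd A g x X *\<^sub>R lam x" for X
      using dd_cong[OF g(2)] dd_scaleR[OF g(1) genD(1)[OF assms(1)], of X] by simp
  qed
qed

text \<open>A single generator tests the immersion condition, since the derivative of any other
  section is a multiple of that of the generator up to an element of \<open>L x\<close>.\<close>

lemma L_immersed: assumes "gen x lam" "dd A lam x X \<in> L x" shows "X = 0"
proof -
  have "dd A \<sigma> x X \<in> L x" if "\<sigma> \<in> sections A L x" for \<sigma>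
  proof -
    have \<sigma>: "smooth_at A x \<sigma>" "\<forall>\<^sub>F y in nhds x. \<sigma> y \<in> L y" using that by (auto simp: sections_iff)
    obtain g h where gh: "\<sigma> x = g *\<^sub>R lam x" "\<And>X. dd A \<sigma> x X = g *\<^sub>R dd A lam x X + h X *\<^sub>R lam x"
      by (rule Lsec_dd[OF assms(1) \<sigma>]) blast
    show ?thesis unfolding gh(2)
      using assms(2) genD(4)[OF assms(1)] L_subspace by (intro subspace_add subspace_scale)
  qed
  then show ?thesis using conf unfolding conformal_surface_def by blast
qed

text \<open>The derived bundle at \<open>x\<close> with explicit generators;
  \<open>derived_eq_L1\<close> gives the agreement.\<close>

definition L1 :: "'a \<Rightarrow> ('a \<Rightarrow> R42) \<Rightarrow> R42 set" where
  "L1 x lam = span (insert (lam x) (range (dd A lam x)))"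

lemma dim_L1: assumes "gen x lam" shows "dim (L1 x lam) = 3"
proof -
  have lin: "linear (dd A lam x)" by (rule linear_dd[OF genD(1)[OF assms]])
  have inj: "inj (dd A lam x)"
    using linear_injective_0[OF lin] L_immersed[OF assms] subspace_0[OF L_subspace] by metis
  have d2: "dim (range (dd A lam x)) = 2"
    using dim_image_eq[OF lin, of UNIV] inj by simp
  have sub: "subspace (range (dd A lam x))" using linear_subspace_image[OF lin subspace_UNIV] .
  have "lam x \<notin> range (dd A lam x)"
  proof
    assume "lam x \<in> range (dd A lam x)"
    then obtain X where X: "lam x = dd A lam x X" by blast
    then have "X = 0" using L_immersed[OF assms] genD(4)[OF assms] by metis
    then show False using X linear_0[OF lin] genD(2)[OF assms] by simp
  qed
  then show ?thesis unfolding L1_def dim_span dim_insert span_eq_iff[THEN iffD2, OF sub]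
    using d2 by simp
qed

lemma L1_subset_derived: assumes "gen x lam" shows "L1 x lam \<subseteq> derived A L x"
proof -
  have "lam \<in> sections A L x" using genD[OF assms] by (simp add: sections_iff)
  then show ?thesis unfolding L1_def derived_def by (intro span_mono) auto
qed

lemma derived_eq_L1: assumes "gen x lam" shows "derived A L x = L1 x lam"
proof
  show "derived A L x \<subseteq> L1 x lam"
    unfolding derived_def
  proof (rule span_minimal)
    have base: "lam x \<in> L1 x lam" "\<And>X. dd A lam x X \<in> L1 x lam" unfolding L1_def by (auto intro: span_base)
    have sub: "subspace (L1 x lam)" by (simp add: L1_def)
    have "\<sigma> x \<in> L1 x lam \<and> dd A \<sigma> x X \<in> L1 x lam" if "\<sigma> \<in> sections A L x" for \<sigma> X
    proof -
      have \<sigma>: "smooth_at A x \<sigma>" "\<forall>\<^sub>F y in nhds x. \<sigma> y \<in> L y" using that by (auto simp: sections_iff)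
      obtain g h where gh: "\<sigma> x = g *\<^sub>R lam x" "\<And>X. dd A \<sigma> x X = g *\<^sub>R dd A lam x X + h X *\<^sub>R lam x"
        by (rule Lsec_dd[OF assms(1) \<sigma>]) blast
      show ?thesis unfolding gh using base sub by (auto intro!: subspace_add subspace_scale)
    qed
    then show "{\<sigma> x |\<sigma>. \<sigma> \<in> sections A L x} \<union> {dd A \<sigma> x X |\<sigma> X. \<sigma> \<in> sections A L x} \<subseteq> L1 x lam" by blast
    show "subspace (L1 x lam)" by (rule sub)
  qed
qed (rule L1_subset_derived[OF assms])

lemma f_perp_L1: assumes "gen x lam" shows "f x \<subseteq> perp (L1 x lam)"
  unfolding L1_def perp_span
proof
  fix a assume a: "a \<in> f x"
  show "a \<in> perp (insert (lam x) (range (dd A lam x)))"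
    using isotropic_f[OF Lf_in[OF genD(4)[OF assms]] a] fsec_dd_orth(1)[OF gen_fsec[OF assms] a]
    by (auto simp: perp_def simp del: split_paired_All)
qed

text \<open>Normalised sections of \<open>f\<close>; they correspond to the sphere congruences enveloped by \<open>L\<close>.\<close>

definition normalized :: "'a set \<Rightarrow> ('a \<Rightarrow> R42) \<Rightarrow> bool" where
  "normalized U \<sigma> \<longleftrightarrow> (\<forall>x\<in>U. smooth_at A x \<sigma> \<and> \<sigma> x \<in> f x \<and> form42 (\<sigma> x) p = 1)"

lemma null_triple:
  assumes "s \<in> f x" "form42 s p = 1" "l \<in> L x" "l \<noteq> 0" shows "null_triple p s l"
  using assms(2,4) isotropic_f[OF assms(1,1)] isotropic_f[OF Lf_in[OF assms(3)] Lf_in[OF assms(3)]]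
    isotropic_f[OF Lf_in[OF assms(3)] assms(1)] L_p(1)[OF assms(3)] by unfold_locales

lemma f_span:
  assumes "s \<in> f x" "form42 s p = 1" "gen x lam" shows "f x = span {s, lam x}"
proof -
  interpret null_triple p s "lam x" using null_triple genD[OF assms(3)] assms by blast
  have "s \<notin> span {lam x}" using ps lp by (auto simp: span_singleton form42_simps)
  then have "dim {s, lam x} = 2" using dim_span_singleton[OF l0] by (simp add: dim_insert)
  moreover have "span {s, lam x} \<subseteq> f x"
    using assms(1) genD(4)[OF assms(3)] Lf f_subspace by (intro span_minimal) auto
  ultimately show ?thesis using subspace_dim_equal[OF subspace_span f_subspace, of "{s, lam x}" x] dim_f by simp
qed

text \<open>\<open>L x\<close> is the part of \<open>f x\<close> orthogonal to \<open>p\<close>.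
  Hence two normalised sections differ by a section of \<open>L\<close>.\<close>

lemma f_decompose:
  assumes "s \<in> f x" "form42 s p = 1" "a \<in> f x" shows "a - form42 a p *\<^sub>R s \<in> L x"
proof -
  obtain lam where g: "gen x lam" by (rule L_gen)
  obtain y z where a: "a = y *\<^sub>R s + z *\<^sub>R lam x" using assms f_span[OF assms(1,2) g] by (auto simp: in_span_2)
  have "form42 a p = y" using assms(2) L_p genD(4)[OF g] unfolding a by (simp add: form42_simps)
  then have "a - form42 a p *\<^sub>R s = z *\<^sub>R lam x" unfolding a by simp
  then show ?thesis using genD(4)[OF g] L_subspace subspace_scale by metis
qed

text \<open>Both \<open>f x\<close> and \<open>perp (V x)\<close> are planes in the 3-dimensional
  space \<open>perp (L1 x lam)\<close>, so they share a non-zero vector, and it can be normalised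
  against \<open>p\<close>. The pointwise choice says nothing about smoothness, which is obtained by
  computing the vector from local frames of \<open>f\<close> and \<open>V\<close>.\<close>

lemma normal_section_exists:
  assumes U: "open U" and V: "sphere_congruence A U p V" "envelops A U L V"
  obtains \<sigma> where "normalized U \<sigma>" "\<And>x. x \<in> U \<Longrightarrow> V x = perp {p, \<sigma> x}"
proof -
  have Vx: "subspace (V x) \<and> dim (V x) = 4 \<and> V x \<subseteq> perp {p} \<and> signature form42 (V x) = (3, 1)" if "x \<in> U" for x
    using V(1) that unfolding sphere_congruence_def subbundle_def by (metis subspace_span)
  have ex: "\<exists>s. s \<in> f x \<and> form42 s p = 1 \<and> V x = perp {p, s}" if x: "x \<in> U" for x
  proof -
    obtain lam where g: "gen x lam" by (rule L_gen)
    have L1V: "L1 x lam \<subseteq> V x" using V(2) x L1_subset_derived[OF g] unfolding envelops_def by blast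
    have dpV: "dim (perp (V x)) = 2" using dim_perp[of "V x"] Vx[OF x] by simp
    have dp: "dim (perp (L1 x lam)) = 3" using dim_perp[of "L1 x lam"] dim_L1[OF g] by simp
    have sub: "perp (V x) \<subseteq> perp (L1 x lam)" using L1V by (auto simp: perp_def)
    have "\<exists>w\<in>f x \<inter> perp (V x). w \<noteq> 0"
    proof (rule ccontr)
      assume "\<not> ?thesis"
      then have "f x \<inter> perp (V x) = {0}" using subspace_0[OF f_subspace] subspace_0[OF subspace_perp] by blast
      then have "dim {a + b |a b. a \<in> f x \<and> b \<in> perp (V x)} = 4"
        using dim_sums_Int[OF f_subspace subspace_perp, of x "V x"] dim_f[of x] dpV by simp
      moreover have "{a + b |a b. a \<in> f x \<and> b \<in> perp (V x)} \<subseteq> perp (L1 x lam)"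
        using f_perp_L1[OF g] sub subspace_add[OF subspace_perp] by blast
      ultimately show False using dim_subset[of "{a + b |a b. a \<in> f x \<and> b \<in> perp (V x)}" "perp (L1 x lam)"] dp by simp
    qed
    then obtain w where w: "w \<in> f x" "w \<in> perp (V x)" "w \<noteq> 0" by blast
    have pV: "p \<in> perp (V x)" using Vx[OF x] by (auto simp: perp_def form42_commute)
    \<comment> \<open>Otherwise \<open>p\<close> and \<open>w\<close> span \<open>perp (V x)\<close>
      and \<open>w\<close> is orthogonal to both, so that \<open>w\<close> lies in
      \<open>V x\<close> as well as in \<open>perp (V x)\<close>.\<close>
    have "form42 w p \<noteq> 0"
    proof
      assume wp: "form42 w p = 0"
      have ww: "form42 w w = 0" using isotropic_f w(1) by blast
      have "p \<notin> span {w}" using pp ww by (auto simp: span_singleton form42_simps)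
      then have "dim {p, w} = 2" using dim_span_singleton[OF w(3)] by (simp add: dim_insert)
      moreover have "span {p, w} \<subseteq> perp (V x)" using w pV subspace_perp by (intro span_minimal) auto
      ultimately have "perp (V x) = span {p, w}"
        using subspace_dim_equal[OF subspace_span subspace_perp, of "{p, w}" "V x"] dpV by simp
      moreover have "w \<in> perp {p, w}" using ww wp by (auto simp: perp_def form42_commute)
      ultimately have "w \<in> perp (perp (V x))" by (simp add: perp_span)
      then have "w \<in> V x" using Vx[OF x] by (simp add: perp_perp span_eq_iff[THEN iffD2])
      then show False using signature_31(1)[of "V x" w] Vx[OF x] w by blast
    qed
    define s where "s = (1 / form42 w p) *\<^sub>R w"
    have s: "s \<in> f x" "form42 s p = 1" "s \<in> perp (V x)"
      using w \<open>form42 w p \<noteq> 0\<close> f_subspace subspace_perp by (auto simp: s_def form42_simps subspace_scale)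
    interpret null_pair p s using s isotropic_f by unfold_locales auto
    have "V x \<subseteq> perp {p, s}" using pV s(3) by (auto simp: perp_def form42_commute)
    then have "V x = perp {p, s}"
      using subspace_dim_equal[OF _ subspace_perp, of "V x"] Vx[OF x] dim_perp_ps by simp
    then show ?thesis using s by blast
  qed
  define \<sigma> where "\<sigma> = (\<lambda>x. SOME s. s \<in> f x \<and> form42 s p = 1 \<and> V x = perp {p, s})"
  have \<sigma>: "\<sigma> x \<in> f x" "form42 (\<sigma> x) p = 1" "V x = perp {p, \<sigma> x}" if "x \<in> U" for x
    using someI_ex[OF ex[OF that]] unfolding \<sigma>_def by auto
  have "smooth_at A x \<sigma>" if x: "x \<in> U" for x
  proof -
    obtain lam where g: "gen x lam" by (rule L_gen)
    from f_subbundle obtain N and e :: "nat \<Rightarrow> 'a \<Rightarrow> R42" where N: "open N" "x \<in> N"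
      "\<forall>i<2. smooth_map A N (e i)" "\<forall>y\<in>N. f y = span ((\<lambda>i. e i y) ` {..<2}) \<and> dim (f y) = 2"
      unfolding subbundle_def by (metis UNIV_I)
    from V(1) x obtain M and v :: "nat \<Rightarrow> 'a \<Rightarrow> R42" where M: "open M" "x \<in> M" "M \<subseteq> U"
      "\<forall>i<4. smooth_map A M (v i)" "\<forall>y\<in>M. V y = span ((\<lambda>i. v i y) ` {..<4}) \<and> dim (V y) = 4"
      unfolding sphere_congruence_def subbundle_def by metis
    have se: "smooth_at A x (e i)" if "i < 2" for i using N smooth_map_iff[OF N(1)] that by blast
    have sv: "smooth_at A x (v i)" if "i < 4" for i using M smooth_map_iff[OF M(1)] that by blast
    have "\<exists>i<2. form42 (e i x) p \<noteq> 0"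
    proof (rule ccontr)
      assume "\<not> ?thesis"
      then have "(\<lambda>i. e i x) ` {..<2::nat} \<subseteq> perp {p}" by (auto simp: perp_def form42_commute)
      then have "f x \<subseteq> perp {p}" using N(2,4) span_minimal[OF _ subspace_perp] by metis
      then show False using \<sigma>(1,2)[OF x] by (auto simp: perp_def form42_commute)
    qed
    then obtain i where i: "i < 2" "form42 (e i x) p \<noteq> 0" by blast
    have "\<exists>j<4. form42 (lam x) (v j x) \<noteq> 0"
    proof (rule ccontr)
      assume "\<not> ?thesis"
      then have "(\<lambda>i. v i x) ` {..<4::nat} \<subseteq> perp {lam x}" by (auto simp: perp_def)
      then have "V x \<subseteq> perp {lam x}" using M(2,5) span_minimal[OF _ subspace_perp] by metis
      then have "lam x \<in> perp (V x)" by (auto simp: perp_def form42_commute)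
      moreover have "lam x \<in> V x"
        using V(2) x L1_subset_derived[OF g] unfolding envelops_def L1_def by (metis insertI1 span_base subsetD)
      ultimately show False using signature_31(1)[of "V x" "lam x"] Vx[OF x] genD(2)[OF g] by blast
    qed
    then obtain j where j: "j < 4" "form42 (lam x) (v j x) \<noteq> 0" by blast
    define a where "a = (\<lambda>y. (1 / form42 (e i y) p) *\<^sub>R e i y)"
    have sep: "smooth_at A x (\<lambda>y. form42 (e i y) p)" by (intro smooth_at_form42 se i smooth_at_const)
    have sa: "smooth_at A x a" unfolding a_def
      by (intro smooth_at_scaleR smooth_at_divide smooth_at_const sep se i)
    have slv: "smooth_at A x (\<lambda>y. form42 (lam y) (v j y))" by (intro smooth_at_form42 genD(1)[OF g] sv j)
    \<comment> \<open>A normalised section of \<open>f\<close>, corrected along \<open>lam\<close>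
      until it is orthogonal to the frame vector \<open>v j\<close>. Since \<open>\<sigma> y\<close>
      is normalised and orthogonal to all of \<open>V y\<close>, the two agree.\<close>
    have "smooth_at A x (\<lambda>y. a y - (form42 (a y) (v j y) / form42 (lam y) (v j y)) *\<^sub>R lam y)"
      by (intro smooth_at_diff sa smooth_at_scaleR smooth_at_divide smooth_at_form42 sv j slv genD(1)[OF g])
    moreover have "\<forall>\<^sub>F y in nhds x. a y - (form42 (a y) (v j y) / form42 (lam y) (v j y)) *\<^sub>R lam y = \<sigma> y"
    proof -
      have "\<forall>\<^sub>F y in nhds x. lam y \<noteq> 0 \<and> L y = span {lam y}" using g by (simp add: gen_def)
      then show ?thesis
        using smooth_at_nonzero[OF sep i(2)] smooth_at_nonzero[OF slv j(2)]
          eventually_nhds_in_open[OF N(1,2)] eventually_nhds_in_open[OF M(1,2)]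
      proof eventually_elim
        case (elim y)
        have yU: "y \<in> U" using elim M(3) by blast
        have ay: "a y \<in> f y" "form42 (a y) p = 1"
        proof -
          have "e i y \<in> f y" using N(4) elim i by (metis imageI lessThan_iff span_base)
          then show "a y \<in> f y" unfolding a_def using subspace_scale[OF f_subspace] by blast
          show "form42 (a y) p = 1" unfolding a_def using elim by (simp add: form42_simps)
        qed
        have vj: "v j y \<in> perp {p, \<sigma> y}" using M(5) elim j \<sigma>(3)[OF yU] by (metis imageI lessThan_iff span_base)
        have "a y - \<sigma> y \<in> L y" using f_decompose[OF \<sigma>(1,2)[OF yU] ay(1)] ay(2) by simp
        then obtain k where k: "a y - \<sigma> y = k *\<^sub>R lam y" using elim by (auto simp: span_singleton)
        then have a: "a y = \<sigma> y + k *\<^sub>R lam y" by (simp add: diff_eq_eq add.commute)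
        have "form42 (a y) (v j y) = k * form42 (lam y) (v j y)"
          unfolding a using vj by (simp add: form42_simps perp_def)
        then show ?case using elim a by simp
      qed
    qed
    ultimately show ?thesis by (rule smooth_at_cong)
  qed
  then show ?thesis using \<sigma> by (intro that[of \<sigma>]) (auto simp: normalized_def)
qed

end

declare split_paired_All [simp del] split_paired_Ex [simp del]

text \<open>The commutator of two values of a connection form built from \<open>wedge uu\<close> and
  \<open>wedge l\<close> terms. The terms in \<open>l\<close> commute because \<open>l\<close> is
  null, the mixed products give the term in \<open>wedge uu l\<close>, and the term in
  \<open>wedge a b\<close> stems from \<open>(uu, uu) = - (p, p)\<close>.\<close>

lemma commutator_identity:
  fixes p s l :: R42
  assumes "null_triple p s l"
    and a: "a \<in> perp {p, s, l}" and b: "b \<in> perp {p, s, l}" and b1: "b1 \<in> perp {p, s, l}" and b2: "b2 \<in> perp {p, s, l}"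
  defines "uu \<equiv> p - form42 p p *\<^sub>R s"
  shows "(x *\<^sub>R wedge uu a (x *\<^sub>R wedge uu b w + y *\<^sub>R wedge l b2 w) + y *\<^sub>R wedge l b1 (x *\<^sub>R wedge uu b w + y *\<^sub>R wedge l b2 w))
    - (x *\<^sub>R wedge uu b (x *\<^sub>R wedge uu a w + y *\<^sub>R wedge l b1 w) + y *\<^sub>R wedge l b2 (x *\<^sub>R wedge uu a w + y *\<^sub>R wedge l b1 w))
    = (x * y * (form42 a b2 - form42 b b1)) *\<^sub>R wedge uu l w - (x * x * form42 p p) *\<^sub>R wedge a b w"
proof -
  interpret null_triple p s l by fact
  have sp: "form42 a p = 0" "form42 a s = 0" "form42 a l = 0" "form42 b p = 0" "form42 b s = 0" "form42 b l = 0"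
    "form42 b1 p = 0" "form42 b1 s = 0" "form42 b1 l = 0" "form42 b2 p = 0" "form42 b2 s = 0" "form42 b2 l = 0"
    "form42 p a = 0" "form42 s a = 0" "form42 l a = 0" "form42 p b = 0" "form42 s b = 0" "form42 l b = 0"
    "form42 p b1 = 0" "form42 s b1 = 0" "form42 l b1 = 0" "form42 p b2 = 0" "form42 s b2 = 0" "form42 l b2 = 0"
    using a b b1 b2 by (simp_all add: perp_def form42_commute)
  have o: "form42 l l = 0" "form42 l s = 0" "form42 s l = 0" "form42 l p = 0" "form42 p l = 0" "form42 s s = 0" "form42 s p = 1" "form42 p s = 1"
    using ll ls lp ps ss by (simp_all add: form42_commute)
  have u: "form42 uu a = 0" "form42 uu b = 0" "form42 uu b1 = 0" "form42 uu b2 = 0" "form42 uu l = 0"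
    "form42 a uu = 0" "form42 b uu = 0" "form42 b1 uu = 0" "form42 b2 uu = 0" "form42 l uu = 0" "form42 uu uu = - form42 p p"
    by (simp_all add: uu_def form42_simps sp o)
  show ?thesis
    by (simp add: wedge_def form42_simps sp o u form42_commute[of b a] form42_commute[of b1 b] form42_commute[of b2 a]
        form42_commute[of b2 b1])
      (simp add: algebra_simps form42_commute)
qed

text \<open>The open set \<open>U\<close> varies because the transforms are local objects, while
  \<open>L\<close> and \<open>f\<close> live on the whole surface.\<close>

locale enveloped = legendre_lift A p L f for A :: "'a::t2_space chart set" and p L f +
  fixes U :: "'a set" and V :: "'a vbundle" and \<sigma> :: "'a \<Rightarrow> R42"
  assumes U: "open U" and norm\<sigma>: "normalized U \<sigma>" and V: "\<And>x. x \<in> U \<Longrightarrow> V x = perp {p, \<sigma> x}"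
begin

lemma \<sigma>D: "x \<in> U \<Longrightarrow> smooth_at A x \<sigma>" "x \<in> U \<Longrightarrow> \<sigma> x \<in> f x" "x \<in> U \<Longrightarrow> form42 (\<sigma> x) p = 1" "x \<in> U \<Longrightarrow> form42 p (\<sigma> x) = 1"
  "x \<in> U \<Longrightarrow> form42 (\<sigma> x) (\<sigma> x) = 0"
proof -
  show 1: "x \<in> U \<Longrightarrow> smooth_at A x \<sigma>" "x \<in> U \<Longrightarrow> \<sigma> x \<in> f x" "x \<in> U \<Longrightarrow> form42 (\<sigma> x) p = 1"
    using norm\<sigma> by (simp_all add: normalized_def)
  show "x \<in> U \<Longrightarrow> form42 p (\<sigma> x) = 1" using 1(3) by (simp add: form42_commute)
  show "x \<in> U \<Longrightarrow> form42 (\<sigma> x) (\<sigma> x) = 0" using isotropic_f 1(2) by blast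
qed

lemma evU: "x \<in> U \<Longrightarrow> \<forall>\<^sub>F y in nhds x. y \<in> U"
  by (rule eventually_nhds_in_open[OF U])

lemma \<sigma>_fsec: "x \<in> U \<Longrightarrow> fsec x \<sigma>"
  unfolding fsec_def using \<sigma>D(1) evU[of x] by (auto elim: eventually_mono simp: \<sigma>D(2))

lemma np: "x \<in> U \<Longrightarrow> null_pair p (\<sigma> x)"
  using \<sigma>D by unfold_locales auto

lemma nt: "x \<in> U \<Longrightarrow> gen x lam \<Longrightarrow> null_triple p (\<sigma> x) (lam x)"
  using null_triple[OF \<sigma>D(2,3)] genD by blast

lemma d\<sigma>: assumes "x \<in> U"
  shows "form42 (dd A \<sigma> x X) p = 0" "form42 p (dd A \<sigma> x X) = 0"
    "b \<in> f x \<Longrightarrow> form42 (dd A \<sigma> x X) b = 0" "b \<in> f x \<Longrightarrow> form42 b (dd A \<sigma> x X) = 0"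
    "form42 (dd A \<sigma> x X) (\<sigma> x) = 0" "form42 (\<sigma> x) (dd A \<sigma> x X) = 0"
proof -
  have "\<forall>\<^sub>F y in nhds x. form42 p (\<sigma> y) = 1" using evU[OF assms] by eventually_elim (rule \<sigma>D)
  from dd_form42_const[OF smooth_at_const \<sigma>D(1)[OF assms] this, of X]
  show 1: "form42 p (dd A \<sigma> x X) = 0" by (simp add: dd_const form42_zero)
  show "form42 (dd A \<sigma> x X) p = 0" using 1 by (simp add: form42_commute)
  show *: "b \<in> f x \<Longrightarrow> form42 (dd A \<sigma> x X) b = 0" "b \<in> f x \<Longrightarrow> form42 b (dd A \<sigma> x X) = 0" for b
    using fsec_dd_orth[OF \<sigma>_fsec[OF assms]] by blast+
  show "form42 (dd A \<sigma> x X) (\<sigma> x) = 0" "form42 (\<sigma> x) (dd A \<sigma> x X) = 0"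
    using * \<sigma>D(2)[OF assms] by blast+
qed

lemma d\<sigma>_perp: "x \<in> U \<Longrightarrow> gen x lam \<Longrightarrow> dd A \<sigma> x X \<in> perp {p, \<sigma> x, lam x}"
  using d\<sigma>(2,6)[of x X] d\<sigma>(4)[of x "lam x" X] Lf_in[OF genD(4)] by (simp add: perp_def)

lemma proj_V: "x \<in> U \<Longrightarrow> orth_proj (V x) w = w - (form42 w (p - K *\<^sub>R \<sigma> x) *\<^sub>R \<sigma> x + form42 w (\<sigma> x) *\<^sub>R p)"
  using null_pair.orth_proj_perp[OF np] V by simp

lemma proj_V_perp: "x \<in> U \<Longrightarrow> orth_proj (perp (V x)) w = form42 w (p - K *\<^sub>R \<sigma> x) *\<^sub>R \<sigma> x + form42 w (\<sigma> x) *\<^sub>R p"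
  using null_pair.orth_proj_perp_perp[OF np] V by simp

text \<open>Both projections are explicit in \<open>p\<close> and \<open>\<sigma>\<close>, and
  \<open>p\<close> is constant, so only derivatives of \<open>\<sigma>\<close> can separate
  \<open>D_conn\<close> from the trivial connection.\<close>

lemma D_conn_eq:
  assumes x: "x \<in> U" and \<xi>: "smooth_at A x \<xi>"
  shows "D_conn A V \<xi> x X = dd A \<xi> x X - wedge (p - K *\<^sub>R \<sigma> x) (dd A \<sigma> x X) (\<xi> x)"
proof -
  let ?h = "\<lambda>y. form42 (\<xi> y) (p - K *\<^sub>R \<sigma> y) *\<^sub>R \<sigma> y + form42 (\<xi> y) (\<sigma> y) *\<^sub>R p"
  let ?a = "dd A \<sigma> x X" and ?d = "dd A \<xi> x X"
  note s = \<sigma>D(1)[OF x] \<xi> smooth_at_const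
  have su: "smooth_at A x (\<lambda>y. p - K *\<^sub>R \<sigma> y)" by (intro smooth_at_diff smooth_at_scaleR s)
  have du: "dd A (\<lambda>y. p - K *\<^sub>R \<sigma> y) x X = - K *\<^sub>R ?a"
    by (simp add: dd_diff dd_scaleR_const dd_const s smooth_at_scaleR)
  have sh: "smooth_at A x ?h" by (intro smooth_at_add smooth_at_scaleR smooth_at_form42 su s)
  have dh: "dd A ?h x X = (form42 (\<xi> x) (p - K *\<^sub>R \<sigma> x)) *\<^sub>R ?a + (form42 (\<xi> x) (- K *\<^sub>R ?a) + form42 ?d (p - K *\<^sub>R \<sigma> x)) *\<^sub>R \<sigma> x
     + (form42 (\<xi> x) ?a + form42 ?d (\<sigma> x)) *\<^sub>R p"
    by (simp only: dd_add dd_scaleR dd_form42 dd_const du su s smooth_at_scaleR smooth_at_form42) simp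
  have e1: "\<forall>\<^sub>F y in nhds x. orth_proj (V y) (\<xi> y) = \<xi> y - ?h y"
    using evU[OF x] by eventually_elim (rule proj_V)
  have e2: "\<forall>\<^sub>F y in nhds x. orth_proj (perp (V y)) (\<xi> y) = ?h y"
    using evU[OF x] by eventually_elim (rule proj_V_perp)
  have "D_conn A V \<xi> x X = orth_proj (V x) (?d - dd A ?h x X) + orth_proj (perp (V x)) (dd A ?h x X)"
    unfolding D_conn_def dd_cong[OF e1] dd_cong[OF e2] dd_diff[OF \<xi> sh] ..
  also have "\<dots> = ?d - wedge (p - K *\<^sub>R \<sigma> x) ?a (\<xi> x)"
    unfolding proj_V[OF x] proj_V_perp[OF x] dh
    using \<sigma>D(3-5)[OF x] d\<sigma>(1,2,5,6)[OF x]
    by (simp add: wedge_def form42_simps form42_commute[of "\<xi> x"]) (simp add: algebra_simps)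
  finally show ?thesis .
qed

lemma N_form_eq: "x \<in> U \<Longrightarrow> N_form A V x X w = wedge (p - K *\<^sub>R \<sigma> x) (dd A \<sigma> x X) w"
  unfolding N_form_def D_conn_eq[OF _ smooth_at_const] dd_const by simp

text \<open>The coefficient of \<open>p\<close> in a vector of \<open>perp (V x)\<close> is its
  pairing with \<open>\<sigma> x\<close>, which vanishes on \<open>f x\<close>.\<close>

lemma f_meet_perp_V: assumes x: "x \<in> U" shows "f x \<inter> perp (V x) = span {\<sigma> x}"
proof
  show "span {\<sigma> x} \<subseteq> f x \<inter> perp (V x)"
    using \<sigma>D(2)[OF x] f_subspace subspace_perp V[OF x]
    by (intro span_minimal subspace_inter) (auto simp: perp_perp span_base)
  show "f x \<inter> perp (V x) \<subseteq> span {\<sigma> x}"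
  proof
    fix w assume w: "w \<in> f x \<inter> perp (V x)"
    then obtain y z where yz: "w = y *\<^sub>R p + z *\<^sub>R \<sigma> x" using V[OF x] by (auto simp: perp_perp in_span_2)
    have "form42 w (\<sigma> x) = 0" using w \<sigma>D(2)[OF x] isotropic_f by blast
    then have "y = 0" unfolding yz using \<sigma>D(3-5)[OF x] by (simp add: form42_simps)
    then show "w \<in> span {\<sigma> x}" unfolding yz by (simp add: span_scale span_base)
  qed
qed

text \<open>The square of \<open>p + z \<sigma>\<close> is \<open>K + 2 z\<close>, so
  \<open>z = - K / 2\<close> gives the only null direction besides that of
  \<open>\<sigma>\<close>.\<close>

lemma other_null_line_eq: assumes x: "x \<in> U" shows "other_null_line f V x = span {p - (K / 2) *\<^sub>R \<sigma> x}"
  unfolding other_null_line_def f_meet_perp_V[OF x] unfolding V[OF x]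
proof (rule the_equality)
  let ?t = "p - (K / 2) *\<^sub>R \<sigma> x"
  have tt: "form42 ?t ?t = 0" "form42 ?t (\<sigma> x) = 1" using \<sigma>D(3-5)[OF x] by (simp_all add: form42_simps)
  have t0: "?t \<noteq> 0" using tt(2) by (metis form42_zero(1) zero_neq_one)
  have "span {?t} \<noteq> span {\<sigma> x}"
  proof
    assume "span {?t} = span {\<sigma> x}"
    then obtain k where "?t = k *\<^sub>R \<sigma> x" using span_base[of ?t "{?t}"] by (auto simp: span_singleton)
    then show False using tt(2) \<sigma>D(5)[OF x] by (metis form42_scaleR(1) mult_zero_right zero_neq_one)
  qed
  moreover have "?t = 1 *\<^sub>R p + (- K / 2) *\<^sub>R \<sigma> x" by simp
  then have "?t \<in> perp (perp {p, \<sigma> x})" unfolding null_pair.perp_perp_ps[OF np[OF x]] by blast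
  then have "span {?t} \<subseteq> perp (perp {p, \<sigma> x})" using subspace_perp by (intro span_minimal) auto
  ultimately show "null_line (span {?t}) \<and> span {?t} \<subseteq> perp (perp {p, \<sigma> x}) \<and> span {?t} \<noteq> span {\<sigma> x}"
    using null_line_span[OF t0 tt(1)] by blast
  fix l assume l: "null_line l \<and> l \<subseteq> perp (perp {p, \<sigma> x}) \<and> l \<noteq> span {\<sigma> x}"
  then obtain e where e: "e \<noteq> 0" "form42 e e = 0" "l = span {e}" using null_line_obtain by metis
  then have "e \<in> perp (perp {p, \<sigma> x})" using l span_base by blast
  then obtain y z where yz: "e = y *\<^sub>R p + z *\<^sub>R \<sigma> x" unfolding null_pair.perp_perp_ps[OF np[OF x]] by blast
  have y: "y \<noteq> 0"
  proof
    assume "y = 0"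
    then have "e \<in> span {\<sigma> x}" unfolding yz by (simp add: span_scale span_base)
    then show False using span_singleton_eqI e(1,3) l by blast
  qed
  have "y * (y * K + 2 * z) = 0" using e(2) \<sigma>D(3-5)[OF x] unfolding yz by (simp add: form42_simps algebra_simps)
  then have "z = - (y * K / 2)" using y by simp
  then have "e = y *\<^sub>R ?t" unfolding yz by (simp add: algebra_simps)
  then have "e \<in> span {?t}" by (metis span_base span_scale singletonI)
  then show "l = span {?t}" using span_singleton_eqI e(1,3) by blast
qed

lemma d\<sigma>_V: "x \<in> U \<Longrightarrow> dd A \<sigma> x X \<in> V x"
  using d\<sigma>(2,6) V by (simp add: perp_def)

text \<open>Writing \<open>p - K \<sigma>\<close> as
  \<open>(p - (K / 2) \<sigma>) - (K / 2) \<sigma>\<close> separates the two null lines of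
  \<open>perp (V x)\<close>. For uniqueness, evaluation at \<open>\<sigma> x\<close> kills the
  component along \<open>\<sigma> x\<close> and isolates the other one.\<close>

lemma N_tilde_eq: assumes x: "x \<in> U"
  shows "N_tilde A f V x X = (\<lambda>w. - (K / 2) *\<^sub>R wedge (\<sigma> x) (dd A \<sigma> x X) w)"
  unfolding N_tilde_def f_meet_perp_V[OF x] other_null_line_eq[OF x]
proof (rule the_equality)
  let ?t = "p - (K / 2) *\<^sub>R \<sigma> x"
  have subV: "subspace (V x)" using V[OF x] subspace_perp by simp
  have split: "N_form A V x X w = wedge ?t (dd A \<sigma> x X) w + - (K / 2) *\<^sub>R wedge (\<sigma> x) (dd A \<sigma> x X) w" for w
  proof -
    have "p - K *\<^sub>R \<sigma> x = ?t + - (K / 2) *\<^sub>R \<sigma> x"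
      by (simp add: diff_diff_eq scaleR_add_left[symmetric])
    then show ?thesis unfolding N_form_eq[OF x] by (simp only: wedge_linear_left)
  qed
  have "(\<lambda>w. - (K / 2) *\<^sub>R wedge (\<sigma> x) (dd A \<sigma> x X) w) \<in> wedge_space (span {\<sigma> x}) (V x)"
    by (intro wedge_space_scaleR wedge_in_wedge_space d\<sigma>_V x subspace_span) (simp add: span_base)
  moreover have "(\<lambda>w. N_form A V x X w - - (K / 2) *\<^sub>R wedge (\<sigma> x) (dd A \<sigma> x X) w) = wedge ?t (dd A \<sigma> x X)"
    unfolding split by simp
  moreover have "wedge ?t (dd A \<sigma> x X) \<in> wedge_space (span {?t}) (V x)"
    by (intro wedge_in_wedge_space d\<sigma>_V x) (simp add: span_base)
  ultimately show "(\<lambda>w. - (K / 2) *\<^sub>R wedge (\<sigma> x) (dd A \<sigma> x X) w) \<in> wedge_space (span {\<sigma> x}) (V x) \<and>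
    (\<lambda>w. N_form A V x X w - - (K / 2) *\<^sub>R wedge (\<sigma> x) (dd A \<sigma> x X) w) \<in> wedge_space (span {?t}) (V x)" by simp
  fix T assume T: "T \<in> wedge_space (span {\<sigma> x}) (V x) \<and> (\<lambda>w. N_form A V x X w - T w) \<in> wedge_space (span {?t}) (V x)"
  obtain b where b: "b \<in> V x" "T = wedge (\<sigma> x) b" using wedge_space_line[OF conjunct1[OF T] subV] .
  obtain b' where b': "b' \<in> V x" "(\<lambda>w. N_form A V x X w - T w) = wedge ?t b'" using wedge_space_line[OF conjunct2[OF T] subV] .
  have orth: "form42 b (\<sigma> x) = 0" "form42 b' (\<sigma> x) = 0" "form42 b p = 0" "form42 b' p = 0"
    using b(1) b'(1) V[OF x] by (simp_all add: perp_def form42_commute)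
  have "N_form A V x X (\<sigma> x) - T (\<sigma> x) = wedge ?t b' (\<sigma> x)" using fun_cong[OF b'(2)] .
  then have "b' = dd A \<sigma> x X"
    unfolding b(2) N_form_eq[OF x] using orth \<sigma>D(3-5)[OF x] d\<sigma>(1,2,5,6)[OF x]
    by (simp add: wedge_def form42_simps)
  then have "T w = - (K / 2) *\<^sub>R wedge (\<sigma> x) (dd A \<sigma> x X) w" for w
    using fun_cong[OF b'(2), of w] unfolding split by (simp add: algebra_simps eq_neg_iff_add_eq_0)
  then show "T = (\<lambda>w. - (K / 2) *\<^sub>R wedge (\<sigma> x) (dd A \<sigma> x X) w)" by blast
qed

lemma L1_perp: assumes x: "x \<in> U" and g: "gen x lam" shows "L1 x lam = perp {p, \<sigma> x, lam x}"
proof -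
  interpret null_triple p "\<sigma> x" "lam x" by (rule nt[OF x g])
  have "dd A lam x X \<in> perp {p, \<sigma> x, lam x}" for X
    using Lsec_dd_p(2)[OF genD(1,5)[OF g], of X] fsec_dd_orth(2)[OF gen_fsec[OF g] \<sigma>D(2)[OF x], of X]
      fsec_dd_orth(2)[OF gen_fsec[OF g] Lf_in[OF genD(4)[OF g]], of X] by (simp add: perp_def)
  moreover have "lam x \<in> perp {p, \<sigma> x, lam x}" using ll ls lp by (simp add: perp_def form42_commute)
  ultimately have "L1 x lam \<subseteq> perp {p, \<sigma> x, lam x}"
    unfolding L1_def using subspace_perp by (intro span_minimal) auto
  then show ?thesis
    using subspace_dim_equal[OF _ subspace_perp, of "L1 x lam"] dim_L1[OF g] dim_perp_psl by (simp add: L1_def)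
qed

text \<open>\<open>L1 x lam\<close> is \<open>perp {p, \<sigma> x, lam x}\<close>, and the radical
  of this space is spanned by \<open>lam x\<close>.\<close>

lemma orth_dlam:
  assumes x: "x \<in> U" and g: "gen x lam" and b: "b \<in> perp {p, \<sigma> x, lam x}" "\<And>Y. form42 b (dd A lam x Y) = 0"
  shows "b \<in> span {lam x}"
proof (rule null_triple.perp_perp_line[OF nt[OF x g] b(1)])
  fix w assume "w \<in> perp {p, \<sigma> x, lam x}"
  then have "w \<in> span (insert (lam x) (range (dd A lam x)))" using L1_perp[OF x g] by (simp add: L1_def)
  moreover have "form42 b (lam x) = 0" using b(1) by (simp add: perp_def form42_commute)
  then have "form42 z b = 0" if "z \<in> insert (lam x) (range (dd A lam x))" for z
    using that b(2) form42_commute[of b] by auto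
  then have "b \<in> perp (span (insert (lam x) (range (dd A lam x))))" unfolding perp_span by (simp add: perp_def)
  ultimately show "form42 b w = 0" unfolding form42_commute[of b w] by (simp add: perp_def)
qed

end

subsection \<open>Guichard surfaces\<close>

text \<open>Flatness is left out so that the criterion \<open>flat_iff\<close> can be stated for an
  arbitrary \<open>chi\<close>, and so that competing forms for the same sphere congruence can be
  compared.\<close>

locale potential = enveloped A p L f U V \<sigma> for A :: "'a::t2_space chart set" and p L f U V \<sigma> +
  fixes chi :: "'a end_form"
  assumes chi: "form1 A U (\<lambda>x. wedge_space (L x) (derived A L x)) chi"
begin

lemma chi_wedge:
  assumes x: "x \<in> U" and g: "gen x lam"
  obtains b where "b \<in> perp {p, \<sigma> x, lam x}" "chi x X = wedge (lam x) b"
proof -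
  have "chi x X \<in> wedge_space (span {lam x}) (perp {p, \<sigma> x, lam x})"
    using chi x L1_perp[OF x g] derived_eq_L1[OF g] genD(3)[OF g] by (auto simp: form1_def)
  from wedge_space_line[OF this subspace_perp] show ?thesis using that by blast
qed

lemma chi_linear: "x \<in> U \<Longrightarrow> linear (chi x X)" "x \<in> U \<Longrightarrow> linear (\<lambda>X. chi x X w)"
  using chi unfolding form1_def by (metis wedge_space_linear, metis)

lemma chi_smooth: "c \<in> A \<Longrightarrow> x \<in> U \<Longrightarrow> x \<in> fst c \<Longrightarrow> smooth_at A x (\<lambda>y. chi y (coord_field A c v y) w)"
  using chi smooth_map_iff[OF open_Int[OF U open_chart]] unfolding form1_def by blast

text \<open>The values of \<open>chi\<close> have the form \<open>wedge (lam x) b\<close>, where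
  both factors are orthogonal to \<open>p\<close>, \<open>\<sigma> x\<close> and
  \<open>lam x\<close>.\<close>

lemma chi_zero:
  assumes x: "x \<in> U" shows "chi x X p = 0" "a \<in> f x \<Longrightarrow> chi x X a = 0"
proof -
  obtain lam where g: "gen x lam" by (rule L_gen)
  interpret null_triple p "\<sigma> x" "lam x" by (rule nt[OF x g])
  obtain b where b: "b \<in> perp {p, \<sigma> x, lam x}" "chi x X = wedge (lam x) b" by (rule chi_wedge[OF x g])
  have o: "form42 b p = 0" "form42 b (\<sigma> x) = 0" "form42 b (lam x) = 0" using b(1) by (simp_all add: perp_def form42_commute)
  show "chi x X p = 0" unfolding b(2) using lp o by (simp add: wedge_def form42_simps)
  assume "a \<in> f x"
  then obtain y z where a: "a = y *\<^sub>R \<sigma> x + z *\<^sub>R lam x" using f_span[OF \<sigma>D(2,3)[OF x] g] by (auto simp: in_span_2)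
  show "chi x X a = 0" unfolding b(2) a using ll ls o by (simp add: wedge_def form42_simps)
qed

lemma chi_in_L:
  assumes x: "x \<in> U" and w: "w \<in> perp (L x)" shows "chi x X w \<in> L x"
proof -
  obtain lam where g: "gen x lam" by (rule L_gen)
  obtain b where b: "b \<in> perp {p, \<sigma> x, lam x}" "chi x X = wedge (lam x) b" by (rule chi_wedge[OF x g])
  have "form42 (lam x) w = 0" using w genD(4)[OF g] by (simp add: perp_def)
  then have "chi x X w = (- form42 b w) *\<^sub>R lam x" unfolding b(2) by (simp add: wedge_def)
  then show ?thesis using genD(4)[OF g] L_subspace subspace_scale by metis
qed

lemma guichard_connection_eq:
  assumes "x \<in> U" "smooth_at A x \<xi>"
  shows "guichard_connection A V chi t \<xi> x X = dd A \<xi> x X +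
    ((t - 1) *\<^sub>R wedge (p - K *\<^sub>R \<sigma> x) (dd A \<sigma> x X) (\<xi> x) + (t\<^sup>2 - 1) *\<^sub>R chi x X (\<xi> x))"
  unfolding guichard_connection_def D_conn_eq[OF assms] N_form_eq[OF assms(1)] by (simp add: algebra_simps)

text \<open>The curvature with parameter \<open>t\<close> is \<open>(t^2 - 1) Z\<close> plus
  \<open>(t - 1) (t^2 - 1) C\<close> times \<open>wedge (p - K \<sigma>) lam\<close>, where
  \<open>Z\<close> is the defect in the equation for the derivative of \<open>chi\<close> and
  \<open>C\<close> the defect in its symmetry. Two values of \<open>t\<close> separate the
  defects.\<close>

lemma flat_iff:
  "(\<forall>t. flat A U (guichard_connection A V chi t)) \<longleftrightarrow>
    (\<forall>c\<in>A. \<forall>x \<in> U \<inter> fst c. \<forall>u v.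
      (\<forall>w. dd A (\<lambda>y. chi y (coord_field A c v y) w) x (coord_field A c u x) -
          dd A (\<lambda>y. chi y (coord_field A c u y) w) x (coord_field A c v x) =
          K *\<^sub>R wedge (dd A \<sigma> x (coord_field A c u x)) (dd A \<sigma> x (coord_field A c v x)) w) \<and>
      chi x (coord_field A c u x) (dd A \<sigma> x (coord_field A c v x)) =
      chi x (coord_field A c v x) (dd A \<sigma> x (coord_field A c u x)))" (is "_ \<longleftrightarrow> ?R")
proof -
  define \<Omega> where "\<Omega> = (\<lambda>t x X w. (t - 1) *\<^sub>R wedge (p - K *\<^sub>R \<sigma> x) (dd A \<sigma> x X) w + (t\<^sup>2 - 1) *\<^sub>R chi x X w)"
  define Z where "Z = (\<lambda>c x u v w. dd A (\<lambda>y. chi y (coord_field A c v y) w) x (coord_field A c u x) -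
          dd A (\<lambda>y. chi y (coord_field A c u y) w) x (coord_field A c v x) -
          K *\<^sub>R wedge (dd A \<sigma> x (coord_field A c u x)) (dd A \<sigma> x (coord_field A c v x)) w)"
  have su: "smooth_at A x (\<lambda>y. p - K *\<^sub>R \<sigma> y)" if "x \<in> U" for x
    by (intro smooth_at_diff smooth_at_scaleR \<sigma>D that smooth_at_const)
  have iff: "flat A U (guichard_connection A V chi t) \<longleftrightarrow> (\<forall>c\<in>A. \<forall>x \<in> U \<inter> fst c. \<forall>u v w.
    dd A (\<lambda>y. \<Omega> t y (coord_field A c v y) w) x (coord_field A c u x) + \<Omega> t x (coord_field A c u x) (\<Omega> t x (coord_field A c v x) w) =
    dd A (\<lambda>y. \<Omega> t y (coord_field A c u y) w) x (coord_field A c v x) + \<Omega> t x (coord_field A c v x) (\<Omega> t x (coord_field A c u x) w))" for t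
  proof (rule flat_connection_iff[OF U])
    show "guichard_connection A V chi t \<xi> x X = dd A \<xi> x X + \<Omega> t x X (\<xi> x)" if "x \<in> U" "smooth_at A x \<xi>" for \<xi> x X
      using guichard_connection_eq[OF that] by (simp add: \<Omega>_def)
    show "linear (\<Omega> t x X)" if "x \<in> U" for x X
      unfolding \<Omega>_def by (intro linear_compose_add linear_compose_scale_right linear_wedge chi_linear that)
    show "smooth_at A x (\<lambda>y. \<Omega> t y (coord_field A c v y) w)" if "c \<in> A" "x \<in> U" "x \<in> fst c" for c x v w
      unfolding \<Omega>_def
      by (intro smooth_at_add smooth_at_scaleR smooth_at_wedge smooth_at_const su smooth_at_dd \<sigma>D chi_smooth that)
  qed
  have key: "dd A (\<lambda>y. \<Omega> t y (coord_field A c v y) w) x (coord_field A c u x) + \<Omega> t x (coord_field A c u x) (\<Omega> t x (coord_field A c v x) w)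
    - (dd A (\<lambda>y. \<Omega> t y (coord_field A c u y) w) x (coord_field A c v x) + \<Omega> t x (coord_field A c v x) (\<Omega> t x (coord_field A c u x) w))
    = (t\<^sup>2 - 1) *\<^sub>R Z c x u v w + ((t - 1) * (t\<^sup>2 - 1) * (form42 (dd A \<sigma> x (coord_field A c u x)) b2 - form42 (dd A \<sigma> x (coord_field A c v x)) b1)) *\<^sub>R
      wedge (p - K *\<^sub>R \<sigma> x) (lam x) w"
    if c: "c \<in> A" "x \<in> fst c" and x: "x \<in> U" and g: "gen x lam"
      and b1: "b1 \<in> perp {p, \<sigma> x, lam x}" "chi x (coord_field A c u x) = wedge (lam x) b1"
      and b2: "b2 \<in> perp {p, \<sigma> x, lam x}" "chi x (coord_field A c v x) = wedge (lam x) b2"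
    for c x lam b1 b2 u v w t
  proof -
    let ?a = "dd A \<sigma> x (coord_field A c u x)" and ?b = "dd A \<sigma> x (coord_field A c v x)"
    let ?uu = "p - K *\<^sub>R \<sigma> x"
    have du: "dd A (\<lambda>y. p - K *\<^sub>R \<sigma> y) x X = - K *\<^sub>R dd A \<sigma> x X" for X
      by (simp add: dd_diff dd_scaleR_const dd_const \<sigma>D[OF x] smooth_at_const smooth_at_scaleR)
    have d\<Omega>: "dd A (\<lambda>y. \<Omega> t y (coord_field A c v y) w) x X =
      (t - 1) *\<^sub>R (wedge (- K *\<^sub>R dd A \<sigma> x X) (dd A \<sigma> x (coord_field A c v x)) w + wedge ?uu (dd A (\<lambda>y. dd A \<sigma> y (coord_field A c v y)) x X) w)
      + (t\<^sup>2 - 1) *\<^sub>R dd A (\<lambda>y. chi y (coord_field A c v y) w) x X" for v X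
    proof -
      have s1: "smooth_at A x (\<lambda>y. wedge (p - K *\<^sub>R \<sigma> y) (dd A \<sigma> y (coord_field A c v y)) w)"
        by (intro smooth_at_wedge smooth_at_const su smooth_at_dd \<sigma>D c x)
      show ?thesis
        unfolding \<Omega>_def
        by (simp only: dd_add[OF smooth_at_scaleR[OF smooth_at_const s1] smooth_at_scaleR[OF smooth_at_const chi_smooth[OF c(1) x c(2)]]]
            dd_scaleR_const[OF s1] dd_scaleR_const[OF chi_smooth[OF c(1) x c(2)]]
            dd_wedge[OF su[OF x] smooth_at_dd[OF c \<sigma>D(1)[OF x]]] du)
    qed
    have com: "\<Omega> t x (coord_field A c u x) (\<Omega> t x (coord_field A c v x) w) - \<Omega> t x (coord_field A c v x) (\<Omega> t x (coord_field A c u x) w)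
      = ((t - 1) * (t\<^sup>2 - 1) * (form42 ?a b2 - form42 ?b b1)) *\<^sub>R wedge ?uu (lam x) w - ((t - 1) * (t - 1) * K) *\<^sub>R wedge ?a ?b w"
      unfolding \<Omega>_def b1(2) b2(2)
      by (rule commutator_identity[OF nt[OF x g] d\<sigma>_perp[OF x g] d\<sigma>_perp[OF x g] b1(1) b2(1)])
    have sw: "wedge ?b ?a w = - wedge ?a ?b w" by (simp add: wedge_def)
    have "dd A (\<lambda>y. \<Omega> t y (coord_field A c v y) w) x (coord_field A c u x) - dd A (\<lambda>y. \<Omega> t y (coord_field A c u y) w) x (coord_field A c v x)
      = (t\<^sup>2 - 1) *\<^sub>R (dd A (\<lambda>y. chi y (coord_field A c v y) w) x (coord_field A c u x) - dd A (\<lambda>y. chi y (coord_field A c u y) w) x (coord_field A c v x))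
        - (2 * (t - 1) * K) *\<^sub>R wedge ?a ?b w"
      unfolding d\<Omega> dd_commute[OF c \<sigma>D(1)[OF x], of v u] wedge_linear_left sw
      by (rule euclidean_eqI) (simp add: inner_add_left inner_diff_left algebra_simps)
    note dif = this
    \<comment> \<open>The commutator contributes \<open>(t - 1)^2 K\<close> and the derivative of
      \<open>p - K \<sigma>\<close> contributes \<open>2 (t - 1) K\<close>. Their sum is
      \<open>(t^2 - 1) K\<close>, which allows the factor \<open>t^2 - 1\<close> to be taken
      out.\<close>
    have W: "((t - 1) * (t - 1) * K) *\<^sub>R wedge ?a ?b w + (2 * (t - 1) * K) *\<^sub>R wedge ?a ?b w = ((t\<^sup>2 - 1) * K) *\<^sub>R wedge ?a ?b w"
      unfolding scaleR_add_left[symmetric] by (simp add: power2_eq_square algebra_simps)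
    have gen: "(e - r) + (c - s) = (e - (s + r)) + c" for e r c s :: R42 by simp
    show ?thesis unfolding add_diff_add dif com Z_def
      unfolding scaleR_diff_right[of _ _ "K *\<^sub>R _"] scaleR_scaleR W[symmetric] by (rule gen)
  qed
  have C: "chi x (coord_field A c u x) (dd A \<sigma> x (coord_field A c v x)) = chi x (coord_field A c v x) (dd A \<sigma> x (coord_field A c u x))
      \<longleftrightarrow> form42 (dd A \<sigma> x (coord_field A c u x)) b2 - form42 (dd A \<sigma> x (coord_field A c v x)) b1 = 0"
    if x: "x \<in> U" and g: "gen x lam"
      and b1: "chi x (coord_field A c u x) = wedge (lam x) b1"
      and b2: "chi x (coord_field A c v x) = wedge (lam x) b2"
    for c x lam b1 b2 u v
  proof -
    have "form42 (lam x) (dd A \<sigma> x X) = 0" for X using d\<sigma>(4)[OF x Lf_in[OF genD(4)[OF g]]] .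
    then show ?thesis unfolding b1 b2 using genD(2)[OF g]
      by (auto simp: wedge_def form42_commute[of b1] form42_commute[of b2])
  qed
  show ?thesis
  proof
    assume fl: "\<forall>t. flat A U (guichard_connection A V chi t)"
    show ?R
    proof (intro ballI allI)
      fix c x u v assume c: "c \<in> A" and x: "x \<in> U \<inter> fst c"
      obtain lam where g: "gen x lam" by (rule L_gen)
      obtain b1 where b1: "b1 \<in> perp {p, \<sigma> x, lam x}" "chi x (coord_field A c u x) = wedge (lam x) b1" using chi_wedge[OF _ g] x by blast
      obtain b2 where b2: "b2 \<in> perp {p, \<sigma> x, lam x}" "chi x (coord_field A c v x) = wedge (lam x) b2" using chi_wedge[OF _ g] x by blast
      define C where "C = form42 (dd A \<sigma> x (coord_field A c u x)) b2 - form42 (dd A \<sigma> x (coord_field A c v x)) b1"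
      have eq: "(t\<^sup>2 - 1) *\<^sub>R Z c x u v w + ((t - 1) * (t\<^sup>2 - 1) * C) *\<^sub>R wedge (p - K *\<^sub>R \<sigma> x) (lam x) w = 0" for t w
        using key[OF c _ _ g b1 b2, where w = w and t = t] fl iff[of t] c x unfolding C_def by auto
      \<comment> \<open>The coefficients of the two defects are -1 and 1 at \<open>t = 0\<close>,
        but 3 and 3 at \<open>t = 2\<close>, so together they force \<open>Z = 0\<close>.\<close>
      have e0: "C *\<^sub>R wedge (p - K *\<^sub>R \<sigma> x) (lam x) w = Z c x u v w" for w using eq[of 0 w] by simp
      have "3 *\<^sub>R Z c x u v w + 3 *\<^sub>R (C *\<^sub>R wedge (p - K *\<^sub>R \<sigma> x) (lam x) w) = 0" for w using eq[of 2 w] by simp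
      then have "6 *\<^sub>R Z c x u v w = 0" for w unfolding e0 scaleR_add_left[symmetric] by simp
      then have Z0: "Z c x u v w = 0" for w by simp
      interpret null_triple p "\<sigma> x" "lam x" using nt[OF _ g] x by blast
      \<comment> \<open>Evaluation at \<open>\<sigma> x\<close> yields the non-zero vector
        \<open>lam x\<close>, which forces \<open>C = 0\<close> as well.\<close>
      have "wedge (p - K *\<^sub>R \<sigma> x) (lam x) (\<sigma> x) = lam x" using ps' ss ls by (simp add: wedge_def form42_simps)
      then have "C = 0" using e0[of "\<sigma> x"] Z0 l0 by simp
      then show "(\<forall>w. dd A (\<lambda>y. chi y (coord_field A c v y) w) x (coord_field A c u x) -
          dd A (\<lambda>y. chi y (coord_field A c u y) w) x (coord_field A c v x) =
          K *\<^sub>R wedge (dd A \<sigma> x (coord_field A c u x)) (dd A \<sigma> x (coord_field A c v x)) w) \<and>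
        chi x (coord_field A c u x) (dd A \<sigma> x (coord_field A c v x)) =
        chi x (coord_field A c v x) (dd A \<sigma> x (coord_field A c u x))"
        using Z0 C[OF _ g b1(2) b2(2)] x unfolding Z_def C_def by simp
    qed
  next
    assume R: ?R
    show "\<forall>t. flat A U (guichard_connection A V chi t)"
    proof (intro allI iff[THEN iffD2] ballI)
      fix t c x u v w assume c: "c \<in> A" and x: "x \<in> U \<inter> fst c"
      obtain lam where g: "gen x lam" by (rule L_gen)
      obtain b1 where b1: "b1 \<in> perp {p, \<sigma> x, lam x}" "chi x (coord_field A c u x) = wedge (lam x) b1" using chi_wedge[OF _ g] x by blast
      obtain b2 where b2: "b2 \<in> perp {p, \<sigma> x, lam x}" "chi x (coord_field A c v x) = wedge (lam x) b2" using chi_wedge[OF _ g] x by blast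
      have "Z c x u v w = 0" using R c x unfolding Z_def by simp
      moreover have "form42 (dd A \<sigma> x (coord_field A c u x)) b2 - form42 (dd A \<sigma> x (coord_field A c v x)) b1 = 0"
        using R c x C[OF _ g b1(2) b2(2)] by blast
      ultimately show "dd A (\<lambda>y. \<Omega> t y (coord_field A c v y) w) x (coord_field A c u x) + \<Omega> t x (coord_field A c u x) (\<Omega> t x (coord_field A c v x) w) =
        dd A (\<lambda>y. \<Omega> t y (coord_field A c u y) w) x (coord_field A c v x) + \<Omega> t x (coord_field A c v x) (\<Omega> t x (coord_field A c u x) w)"
        using key[OF c _ _ g b1 b2, where w = w and t = t] x by simp
    qed
  qed
qed

lemma chi_dlam:
  assumes x: "x \<in> U" and g: "gen x lam" obtains r where "chi x X (dd A lam x Y) = r *\<^sub>R lam x"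
proof -
  have "dd A lam x Y \<in> perp (L x)"
    using fsec_dd_orth(2)[OF gen_fsec[OF g] Lf_in] by (simp add: perp_def)
  then have "chi x X (dd A lam x Y) \<in> L x" by (rule chi_in_L[OF x])
  then show ?thesis using genD(3)[OF g] that by (auto simp: span_singleton)
qed

text \<open>Along \<open>L\<close> the difference of \<open>D_conn\<close> and \<open>dd\<close>
  vanishes and \<open>chi\<close> kills \<open>L\<close>, so the first trace is \<open>r\<close>. On
  \<open>perp (V x)\<close> the form \<open>N_form\<close> kills \<open>p\<close>, so only the
  diagonal entry at \<open>\<sigma> x\<close> contributes.\<close>

lemma guichard_quad_diff_eq:
  assumes x: "x \<in> U" and g: "gen x lam" and r: "chi x X (dd A lam x Y) = r *\<^sub>R lam x"
  shows "guichard_quad_diff A L V chi x X Y = 2 * r + K * form42 (dd A \<sigma> x X) (dd A \<sigma> x Y)"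
proof -
  interpret null_triple p "\<sigma> x" "lam x" by (rule nt[OF x g])
  have "section_trace A L x (\<lambda>\<zeta>. chi x X (D_conn A V \<zeta> x Y)) = r"
    unfolding section_trace_def genD(3)[OF g]
  proof (rule trace_on_1[OF genD(2)[OF g]])
    fix k
    let ?\<zeta> = "SOME \<zeta>. \<zeta> \<in> sections A L x \<and> \<zeta> x = k *\<^sub>R lam x"
    have "(\<lambda>y. k *\<^sub>R lam y) \<in> sections A L x"
      using genD(1,5)[OF g] L_subspace subspace_scale
      by (auto simp: sections_iff intro!: smooth_at_scaleR smooth_at_const elim!: eventually_mono simp del: split_paired_All)
    then have "\<exists>\<zeta>. \<zeta> \<in> sections A L x \<and> \<zeta> x = k *\<^sub>R lam x" by (intro exI[of _ "\<lambda>y. k *\<^sub>R lam y"]) simp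
    from someI_ex[OF this] have z: "?\<zeta> \<in> sections A L x" "?\<zeta> x = k *\<^sub>R lam x" by auto
    then have zs: "smooth_at A x ?\<zeta>" "\<forall>\<^sub>F y in nhds x. ?\<zeta> y \<in> L y" by (auto simp: sections_iff)
    obtain q h where qh: "?\<zeta> x = q *\<^sub>R lam x" "\<And>X. dd A ?\<zeta> x X = q *\<^sub>R dd A lam x X + h X *\<^sub>R lam x"
      by (rule Lsec_dd[OF g zs]) blast
    have q: "q = k" using qh(1) z(2) l0 by simp
    have "wedge (p - K *\<^sub>R \<sigma> x) (dd A \<sigma> x Y) (k *\<^sub>R lam x) = 0"
    proof -
      have "form42 p (lam x) = 0" "form42 (\<sigma> x) (lam x) = 0" using lp ls by (simp_all add: form42_commute)
      then show ?thesis using d\<sigma>(3)[OF x Lf_in[OF genD(4)[OF g]], of Y] by (simp add: wedge_def form42_simps)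
    qed
    then have "D_conn A V ?\<zeta> x Y = k *\<^sub>R dd A lam x Y + h Y *\<^sub>R lam x"
      unfolding D_conn_eq[OF x zs(1)] z(2) qh(2) q by simp
    then show "chi x X (D_conn A V ?\<zeta> x Y) = (k * r) *\<^sub>R lam x"
      using chi_linear(1)[OF x] chi_zero(2)[OF x Lf_in[OF genD(4)[OF g]]]
      by (simp add: linear_add linear_cmul r)
  qed
  moreover have "trace_on (perp (V x)) (\<lambda>w. N_form A V x X (N_form A V x Y w)) = K * form42 (dd A \<sigma> x X) (dd A \<sigma> x Y) + 0"
  proof -
    have h1: "perp (V x) = span {\<sigma> x, p}" using V[OF x] by (simp add: perp_perp insert_commute)
    have h2: "\<sigma> x \<notin> span {p}"
    proof
      assume "\<sigma> x \<in> span {p}"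
      then obtain k where k: "\<sigma> x = k *\<^sub>R p" by (auto simp: span_singleton)
      then have "k * k * K = 0" "k * K = 1" using ss ps by (simp_all add: form42_simps)
      then show False by auto
    qed
    have h3: "p \<noteq> 0" using pp by (auto simp: form42_zero)
    have h4: "N_form A V x X (N_form A V x Y (y *\<^sub>R \<sigma> x + z *\<^sub>R p)) =
        y *\<^sub>R ((K * form42 (dd A \<sigma> x X) (dd A \<sigma> x Y)) *\<^sub>R \<sigma> x + (- form42 (dd A \<sigma> x X) (dd A \<sigma> x Y)) *\<^sub>R p) + z *\<^sub>R (0 *\<^sub>R \<sigma> x + 0 *\<^sub>R p)" for y z
      unfolding N_form_eq[OF x] using ss ps ps' d\<sigma>(1,2,5,6)[OF x]
      by (simp add: wedge_def form42_simps) (simp add: algebra_simps)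
    show ?thesis unfolding h1 by (rule trace_on_2[OF h2 h3 h4])
  qed
  ultimately show ?thesis by (simp add: guichard_quad_diff_def)
qed

end

lemma wedge_swap: "wedge a b w = - wedge b a w"
  by (simp add: wedge_def)

context enveloped begin

text \<open>Differentiating \<open>(\<sigma>, d ell) = 0\<close> turns the pairing into minus the
  pairing of \<open>\<sigma>\<close> with a second derivative of \<open>ell\<close>, which is
  symmetric along coordinate fields.\<close>

lemma Lsec_sym:
  assumes x: "x \<in> U" and l: "smooth_at A x ell" "\<forall>\<^sub>F y in nhds x. smooth_at A y ell \<and> ell y \<in> L y"
  shows "form42 (dd A \<sigma> x X) (dd A ell x Y) = form42 (dd A \<sigma> x Y) (dd A ell x X)"
proof -
  let ?c = "chart_at A x"
  let ?E = "coord_field A ?c"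
  have l': "\<forall>\<^sub>F y in nhds x. \<forall>\<^sub>F z in nhds y. smooth_at A z ell \<and> ell z \<in> L z"
    using l(2) by (simp add: eventually_eventually)
  have zero: "\<forall>\<^sub>F y in nhds x. form42 (\<sigma> y) (dd A ell y (?E v y)) = 0" for v
    using l' evU[OF x]
  proof eventually_elim
    case (elim y)
    have "\<forall>\<^sub>F z in nhds y. ell z \<in> L z" using elim(1) by eventually_elim simp
    moreover have "smooth_at A y ell" using eventually_nhds_x_imp_x[OF elim(1)] by simp
    ultimately show ?case using fsec_dd_orth(2)[OF Lsec_fsec \<sigma>D(2)[OF elim(2)]] by blast
  qed
  have key: "form42 (dd A \<sigma> x (?E u x)) (dd A ell x (?E v x)) = - form42 (\<sigma> x) (dd A (\<lambda>y. dd A ell y (?E v y)) x (?E u x))" for u v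
    using dd_form42_const[OF \<sigma>D(1)[OF x] smooth_at_dd[OF chart_at l(1), of v] zero, of "?E u x"] by simp
  have "form42 (dd A \<sigma> x (?E u x)) (dd A ell x (?E v x)) = form42 (dd A \<sigma> x (?E v x)) (dd A ell x (?E u x))" for u v
    unfolding key using dd_commute[OF chart_at l(1), of v u] by simp
  from this[of X Y] show ?thesis by (simp add: coord_field_chart_at)
qed

lemma dell_perp:
  assumes x: "x \<in> U" and g: "gen x lam" and l: "smooth_at A x ell" "\<forall>\<^sub>F y in nhds x. ell y \<in> L y"
  shows "dd A ell x X \<in> perp {p, \<sigma> x, lam x}"
  using Lsec_dd_p(2)[OF l, of X] fsec_dd_orth(2)[OF Lsec_fsec[OF l] \<sigma>D(2)[OF x], of X]
      fsec_dd_orth(2)[OF Lsec_fsec[OF l] Lf_in[OF genD(4)[OF g]], of X] by (simp add: perp_def)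

end

section \<open>The gauge potential and its quadratic differential\<close>

context potential begin

definition eta :: "'a end_form" where
  "eta x X w = 2 *\<^sub>R chi x X w - K *\<^sub>R wedge (\<sigma> x) (dd A \<sigma> x X) w"

lemma chi_skew: "x \<in> U \<Longrightarrow> form42 (chi x X v) w = - form42 v (chi x X w)"
  using chi wedge_space_skew unfolding form1_def by blast

lemma chi_range: assumes x: "x \<in> U" and b: "b \<in> f x \<or> b = p" shows "form42 b (chi x X w) = 0"
proof -
  have "chi x X b = 0" using b chi_zero[OF x] by blast
  then show ?thesis using chi_skew[OF x, of X b w] by (simp add: form42_zero)
qed

lemma eta_linear: "x \<in> U \<Longrightarrow> linear (eta x X)" "x \<in> U \<Longrightarrow> linear (\<lambda>X. eta x X w)"
proof -
  assume x: "x \<in> U"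
  show "linear (eta x X)" unfolding eta_def
    by (intro linear_compose_sub linear_compose_scale_right linear_wedge chi_linear x)
  have "linear (\<lambda>X. wedge (\<sigma> x) (dd A \<sigma> x X) w)"
    using linear_dd[OF \<sigma>D(1)[OF x]] by (intro linearI) (simp_all add: linear_add linear_cmul wedge_linear_right)
  then show "linear (\<lambda>X. eta x X w)" unfolding eta_def
    by (intro linear_compose_sub linear_compose_scale_right chi_linear x)
qed

lemma eta_smooth:
  "c \<in> A \<Longrightarrow> x \<in> U \<Longrightarrow> x \<in> fst c \<Longrightarrow> smooth_at A x (\<lambda>y. eta y (coord_field A c v y) w)"
  unfolding eta_def
  by (intro smooth_at_diff smooth_at_scaleR smooth_at_const smooth_at_wedge smooth_at_dd \<sigma>D chi_smooth)

lemma eta_f: assumes x: "x \<in> U" and a: "a \<in> f x" shows "eta x X a = 0"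
  using chi_zero(2)[OF x a] d\<sigma>(3)[OF x a] isotropic_f[OF \<sigma>D(2)[OF x] a] by (simp add: eta_def wedge_def)

lemma eta_skew: "x \<in> U \<Longrightarrow> form42 (eta x X v) w = - form42 v (eta x X w)"
  unfolding eta_def using wedge_skew[of "\<sigma> x"] chi_skew by (simp add: form42_simps)

lemma eta_perp: assumes x: "x \<in> U" shows "eta x X w \<in> perp (f x)"
  using eta_skew[OF x] eta_f[OF x] by (simp add: perp_def form42_commute[of _ "eta x X w"] form42_zero)

lemma derived_subset_perp: assumes x: "x \<in> U" shows "derived A L x \<subseteq> perp (f x)"
proof -
  obtain lam where g: "gen x lam" by (rule L_gen)
  have "b \<in> perp (f x)" if "b \<in> perp {p, \<sigma> x, lam x}" for b
    using that unfolding f_span[OF \<sigma>D(2,3)[OF x] g] perp_span by (simp add: perp_def)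
  then show ?thesis using derived_eq_L1[OF g] L1_perp[OF x g] by blast
qed

lemma d\<sigma>_perp_f: "x \<in> U \<Longrightarrow> dd A \<sigma> x X \<in> perp (f x)"
  using d\<sigma>(4) by (simp add: perp_def)

lemma eta_form1: "form1 A U (\<lambda>x. wedge_space (f x) (perp (f x))) eta"
  unfolding form1_def
proof (intro conjI ballI allI)
  fix x X assume x: "x \<in> U"
  have "chi x X \<in> wedge_space (f x) (perp (f x))"
    using chi x wedge_space_mono[OF _ Lf derived_subset_perp] unfolding form1_def by blast
  then have 1: "(\<lambda>w. 2 *\<^sub>R chi x X w) \<in> wedge_space (f x) (perp (f x))" by (rule wedge_space_scaleR[OF _ f_subspace])
  have 2: "(\<lambda>w. (- K) *\<^sub>R wedge (\<sigma> x) (dd A \<sigma> x X) w) \<in> wedge_space (f x) (perp (f x))"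
    by (intro wedge_space_scaleR wedge_in_wedge_space \<sigma>D d\<sigma>_perp_f x f_subspace)
  have "eta x X = (\<lambda>w. 2 *\<^sub>R chi x X w + (- K) *\<^sub>R wedge (\<sigma> x) (dd A \<sigma> x X) w)"
    by (rule ext) (simp add: eta_def)
  then show "eta x X \<in> wedge_space (f x) (perp (f x))" using wedge_space_add[OF 1 2] by simp
  show "linear (\<lambda>X. eta x X w)" for w by (rule eta_linear(2)[OF x])
next
  fix c v and w :: R42 assume c: "c \<in> A"
  show "smooth_map A (U \<inter> fst c) (\<lambda>y. eta y (coord_field A c v y) w)"
    using smooth_map_iff[OF open_Int[OF U open_chart[OF c]]] eta_smooth[OF c] by blast
qed

text \<open>Modulo \<open>f x\<close> the derivative of a section of \<open>f\<close> depends only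
  on its value at \<open>x\<close>. The remainder \<open>e\<close> lies in \<open>f x\<close>, where
  \<open>eta\<close> vanishes.\<close>

lemma fsec_dd_expand:
  assumes x: "x \<in> U" and g: "gen x lam" and z: "fsec x \<zeta>" "\<zeta> x = r *\<^sub>R \<sigma> x + s *\<^sub>R lam x"
  obtains e where "\<And>X. e X \<in> f x" "\<And>X. dd A \<zeta> x X = r *\<^sub>R dd A \<sigma> x X + s *\<^sub>R dd A lam x X + e X"
proof -
  let ?h = "\<lambda>y. form42 (\<zeta> y) p"
  let ?l = "\<lambda>y. \<zeta> y - ?h y *\<^sub>R \<sigma> y"
  have zs: "smooth_at A x \<zeta>" "\<forall>\<^sub>F y in nhds x. \<zeta> y \<in> f y" using z(1) by (auto simp: fsec_def)
  have sh: "smooth_at A x ?h" by (intro smooth_at_form42 zs smooth_at_const)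
  have sl: "smooth_at A x ?l" by (intro smooth_at_diff zs smooth_at_scaleR sh \<sigma>D x)
  have lL: "\<forall>\<^sub>F y in nhds x. ?l y \<in> L y"
    using zs(2) evU[OF x] by eventually_elim (rule f_decompose[OF \<sigma>D(2,3)])
  obtain q h where qh: "?l x = q *\<^sub>R lam x" "\<And>X. dd A ?l x X = q *\<^sub>R dd A lam x X + h X *\<^sub>R lam x"
    by (rule Lsec_dd[OF g sl lL]) blast
  have hx: "?h x = r" unfolding z(2) using \<sigma>D(3)[OF x] L_p(1)[OF genD(4)[OF g]] by (simp add: form42_simps)
  then have "q *\<^sub>R lam x = s *\<^sub>R lam x" using qh(1) z(2) by auto
  then have q: "q = s" using genD(2)[OF g] by simp
  have "dd A \<zeta> x X = r *\<^sub>R dd A \<sigma> x X + s *\<^sub>R dd A lam x X + (h X *\<^sub>R lam x + dd A ?h x X *\<^sub>R \<sigma> x)" for X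
  proof -
    have "dd A \<zeta> x X = dd A (\<lambda>y. ?l y + ?h y *\<^sub>R \<sigma> y) x X" by simp
    also have "\<dots> = dd A ?l x X + (?h x *\<^sub>R dd A \<sigma> x X + dd A ?h x X *\<^sub>R \<sigma> x)"
      by (simp only: dd_add[OF sl smooth_at_scaleR[OF sh \<sigma>D(1)[OF x]]] dd_scaleR[OF sh \<sigma>D(1)[OF x]])
    finally show ?thesis unfolding qh(2) hx q by simp
  qed
  moreover have "h X *\<^sub>R lam x + dd A ?h x X *\<^sub>R \<sigma> x \<in> f x" for X
    using Lf_in[OF genD(4)[OF g]] \<sigma>D(2)[OF x] f_subspace by (intro subspace_add subspace_scale)
  ultimately show ?thesis by (intro that[of "\<lambda>X. h X *\<^sub>R lam x + dd A ?h x X *\<^sub>R \<sigma> x"])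
qed

text \<open>In the frame \<open>\<sigma> x, lam x\<close> the endomorphism has the diagonal entries
  \<open>K (d\<sigma>, d\<sigma>)\<close> and \<open>2 r\<close>, which are the two summands of
  \<open>guichard_quad_diff_eq\<close>.\<close>

lemma quad_diff_eq:
  assumes x: "x \<in> U" and \<eta>: "\<And>X w. \<eta> x X w = eta x X w"
  shows "quad_diff A f \<eta> x X Y = guichard_quad_diff A L V chi x X Y"
proof -
  obtain lam where g: "gen x lam" by (rule L_gen)
  interpret null_triple p "\<sigma> x" "lam x" by (rule nt[OF x g])
  obtain r where r: "chi x X (dd A lam x Y) = r *\<^sub>R lam x" by (rule chi_dlam[OF x g])
  have "chi x X (dd A \<sigma> x Y) \<in> L x"
    using chi_in_L[OF x] d\<sigma>(4)[OF x Lf_in] by (simp add: perp_def)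
  then obtain t where t: "chi x X (dd A \<sigma> x Y) = t *\<^sub>R lam x" using genD(3)[OF g] by (auto simp: span_singleton)
  let ?c = "form42 (dd A \<sigma> x X) (dd A \<sigma> x Y)"
  have e1: "eta x X (dd A \<sigma> x Y) = (K * ?c) *\<^sub>R \<sigma> x + (2 * t) *\<^sub>R lam x"
    unfolding eta_def t using d\<sigma>(6)[OF x] by (simp add: wedge_def)
  have e2: "eta x X (dd A lam x Y) = (K * form42 (dd A \<sigma> x X) (dd A lam x Y)) *\<^sub>R \<sigma> x + (2 * r) *\<^sub>R lam x"
    unfolding eta_def r using fsec_dd_orth(2)[OF gen_fsec[OF g] \<sigma>D(2)[OF x]] by (simp add: wedge_def)
  have "section_trace A f x (\<lambda>\<zeta>. \<eta> x X (dd A \<zeta> x Y)) = K * ?c + 2 * r"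
    unfolding section_trace_def f_span[OF \<sigma>D(2,3)[OF x] g]
  proof (rule trace_on_2)
    show "\<sigma> x \<notin> span {lam x}" using ps lp by (auto simp: span_singleton form42_simps)
    show "lam x \<noteq> 0" by (rule l0)
    fix y z
    let ?w = "y *\<^sub>R \<sigma> x + z *\<^sub>R lam x"
    let ?\<zeta> = "SOME \<zeta>. \<zeta> \<in> sections A f x \<and> \<zeta> x = ?w"
    have "\<forall>\<^sub>F q in nhds x. y *\<^sub>R \<sigma> q + z *\<^sub>R lam q \<in> f q"
      using evU[OF x] genD(5)[OF g]
      by eventually_elim (intro subspace_add[OF f_subspace] subspace_scale[OF f_subspace] \<sigma>D Lf_in)
    then have "(\<lambda>q. y *\<^sub>R \<sigma> q + z *\<^sub>R lam q) \<in> sections A f x"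
      unfolding sections_iff by (intro conjI smooth_at_add smooth_at_scaleR smooth_at_const \<sigma>D x genD(1)[OF g])
    then have "\<exists>\<zeta>. \<zeta> \<in> sections A f x \<and> \<zeta> x = ?w" by (intro exI[of _ "\<lambda>q. y *\<^sub>R \<sigma> q + z *\<^sub>R lam q"]) simp
    from someI_ex[OF this] have \<zeta>: "fsec x ?\<zeta>" "?\<zeta> x = ?w" by (auto simp: sections_iff fsec_def)
    obtain e where e: "\<And>X. e X \<in> f x" "\<And>X. dd A ?\<zeta> x X = y *\<^sub>R dd A \<sigma> x X + z *\<^sub>R dd A lam x X + e X"
      by (rule fsec_dd_expand[OF x g \<zeta>]) blast
    show "\<eta> x X (dd A ?\<zeta> x Y) = y *\<^sub>R ((K * ?c) *\<^sub>R \<sigma> x + (2 * t) *\<^sub>R lam x) +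
        z *\<^sub>R ((K * form42 (dd A \<sigma> x X) (dd A lam x Y)) *\<^sub>R \<sigma> x + (2 * r) *\<^sub>R lam x)"
      unfolding \<eta> e(2) linear_add[OF eta_linear(1)[OF x]] linear_cmul[OF eta_linear(1)[OF x]] eta_f[OF x e(1)] e1 e2 by simp
  qed
  then show ?thesis unfolding quad_diff_def guichard_quad_diff_eq[OF x g r] by simp
qed

text \<open>In \<open>wedge (lam x) b\<close> the vector \<open>b\<close> matters only modulo
  \<open>lam x\<close>, and its pairings with the derivatives of \<open>lam\<close> are what the
  quadratic differential records. This identifies the form of any other enveloped sphere congruence
  once its quadratic differential is prescribed.\<close>

lemma chi_unique:
  assumes chi2: "form1 A U (\<lambda>x. wedge_space (L x) (derived A L x)) chi2"
    and q: "\<And>x X Y. x \<in> U \<Longrightarrow> guichard_quad_diff A L V chi2 x X Y = guichard_quad_diff A L V chi x X Y"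
    and x: "x \<in> U"
  shows "chi2 x X w = chi x X w"
proof -
  interpret P2: potential A p L f U V \<sigma> chi2 using chi2 by unfold_locales
  obtain lam where g: "gen x lam" by (rule L_gen)
  obtain b where b: "b \<in> perp {p, \<sigma> x, lam x}" "chi x X = wedge (lam x) b" by (rule chi_wedge[OF x g])
  obtain b2 where b2: "b2 \<in> perp {p, \<sigma> x, lam x}" "chi2 x X = wedge (lam x) b2" by (rule P2.chi_wedge[OF x g])
  have "form42 (b2 - b) (dd A lam x Y) = 0" for Y
  proof -
    have o: "form42 (lam x) (dd A lam x Y) = 0"
      using fsec_dd_orth(2)[OF gen_fsec[OF g] Lf_in[OF genD(4)[OF g]]] .
    have "chi x X (dd A lam x Y) = (- form42 b (dd A lam x Y)) *\<^sub>R lam x"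
      "chi2 x X (dd A lam x Y) = (- form42 b2 (dd A lam x Y)) *\<^sub>R lam x"
      unfolding b b2 using o by (simp_all add: wedge_def)
    from guichard_quad_diff_eq[OF x g this(1)] P2.guichard_quad_diff_eq[OF x g this(2)] q[OF x, of X Y]
    show ?thesis by (simp add: form42_simps)
  qed
  moreover have "b2 - b \<in> perp {p, \<sigma> x, lam x}" using b(1) b2(1) subspace_diff[OF subspace_perp] by blast
  ultimately have "b2 - b \<in> span {lam x}" using orth_dlam[OF x g] by blast
  then obtain k where "b2 - b = k *\<^sub>R lam x" by (auto simp: span_singleton)
  then have "b2 = b + k *\<^sub>R lam x" by (simp add: diff_eq_eq add.commute)
  then show ?thesis unfolding b b2 by (simp add: wedge_def form42_simps algebra_simps)
qed

text \<open>On sections \<open>\<zeta>\<close> of \<open>M\<close> both connections are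
  \<open>d\<zeta> + (m^2 - 1) chi \<zeta>\<close> plus a multiple of
  \<open>(d\<sigma>, \<zeta>)\<close>, directed along \<open>p - K \<sigma>\<close> in one case and
  along \<open>\<sigma>\<close> in the other. Enveloping means that
  \<open>(d\<sigma>, \<zeta>)\<close> vanishes, and then the connections agree. Conversely, if
  \<open>M\<close> is parallel for the Darboux connection, pairing with \<open>p\<close> isolates
  this multiple, so enveloping is a consequence of parallelism.\<close>

lemma parallel_iff:
  assumes M: "null_line_bundle A U M" "\<And>x. x \<in> U \<Longrightarrow> M x \<subseteq> V x" and m: "m\<^sup>2 \<noteq> 1"
    and \<eta>: "\<And>x X w. x \<in> U \<Longrightarrow> \<eta> x X w = eta x X w"
  shows "envelops A U M V \<and> parallel A U (guichard_connection A V chi m) M \<longleftrightarrow>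
    parallel A U (darboux_connection A \<eta> ((m\<^sup>2 - 1) / 2)) M"
proof -
  let ?m = "(m\<^sup>2 - 1) / 2"
  have basic: "smooth_at A x \<zeta>" "form42 p (dd A \<zeta> x X) = 0" "form42 (dd A \<sigma> x X) (\<zeta> x) = - form42 (\<sigma> x) (dd A \<zeta> x X)"
    "\<zeta> x \<in> M x" "form42 (\<zeta> x) p = 0" "form42 p (\<zeta> x) = 0" "form42 (\<sigma> x) (\<zeta> x) = 0"
    if x: "x \<in> U" and z: "\<zeta> \<in> sections A M x" for x X \<zeta>
  proof -
    show s: "smooth_at A x \<zeta>" using z by (simp add: sections_iff)
    have ev: "\<forall>\<^sub>F y in nhds x. \<zeta> y \<in> M y" using z by (simp add: sections_iff)
    show "\<zeta> x \<in> M x" using eventually_nhds_x_imp_x[OF ev] .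
    have ev2: "\<forall>\<^sub>F y in nhds x. form42 p (\<zeta> y) = 0 \<and> form42 (\<sigma> y) (\<zeta> y) = 0"
      using ev evU[OF x] by eventually_elim (use M(2) V in \<open>auto simp: perp_def\<close>)
    show 1: "form42 p (\<zeta> x) = 0" "form42 (\<sigma> x) (\<zeta> x) = 0" using eventually_nhds_x_imp_x[OF ev2] by auto
    show "form42 (\<zeta> x) p = 0" using 1 by (simp add: form42_commute)
    have "\<forall>\<^sub>F y in nhds x. form42 p (\<zeta> y) = 0" using ev2 by eventually_elim simp
    from dd_form42_const[OF smooth_at_const s this] show "form42 p (dd A \<zeta> x X) = 0" by (simp add: dd_const form42_zero)
    have "\<forall>\<^sub>F y in nhds x. form42 (\<sigma> y) (\<zeta> y) = 0" using ev2 by eventually_elim simp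
    from dd_form42_const[OF \<sigma>D(1)[OF x] s this] show "form42 (dd A \<sigma> x X) (\<zeta> x) = - form42 (\<sigma> x) (dd A \<zeta> x X)" by simp
  qed
  have G: "guichard_connection A V chi m \<zeta> x X = dd A \<zeta> x X + (m\<^sup>2 - 1) *\<^sub>R chi x X (\<zeta> x) - ((m - 1) * form42 (dd A \<sigma> x X) (\<zeta> x)) *\<^sub>R (p - K *\<^sub>R \<sigma> x)"
    if x: "x \<in> U" and z: "\<zeta> \<in> sections A M x" for x X \<zeta>
    using guichard_connection_eq[OF x basic(1)[OF x z], of m X] basic(5-7)[OF x z] by (simp add: wedge_def form42_simps)
  have D: "darboux_connection A \<eta> ?m \<zeta> x X = dd A \<zeta> x X + (m\<^sup>2 - 1) *\<^sub>R chi x X (\<zeta> x) + (?m * K * form42 (dd A \<sigma> x X) (\<zeta> x)) *\<^sub>R \<sigma> x"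
    if x: "x \<in> U" and z: "\<zeta> \<in> sections A M x" for x X \<zeta>
  proof -
    have gen: "z + k *\<^sub>R (2 *\<^sub>R c - K *\<^sub>R (r *\<^sub>R a - t *\<^sub>R s)) = z + (2 * k) *\<^sub>R c + (k * K * t) *\<^sub>R s"
      if "r = 0" for z c a s :: R42 and k r t by (simp add: that algebra_simps)
    show ?thesis
      unfolding darboux_connection_def \<eta>[OF x] eta_def wedge_def gen[OF basic(7)[OF x z]] by simp
  qed
  have V_iff: "dd A \<zeta> x X \<in> V x \<longleftrightarrow> form42 (dd A \<sigma> x X) (\<zeta> x) = 0" if x: "x \<in> U" and z: "\<zeta> \<in> sections A M x" for x X \<zeta>
    using basic(2,3)[OF x z] V[OF x] by (auto simp: perp_def)
  show ?thesis
  proof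
    assume *: "envelops A U M V \<and> parallel A U (guichard_connection A V chi m) M"
    show "parallel A U (darboux_connection A \<eta> ?m) M"
      unfolding parallel_def
    proof (intro ballI allI)
      fix x \<zeta> X assume x: "x \<in> U" and z: "\<zeta> \<in> sections A M x"
      have "dd A \<zeta> x X \<in> derived A M x" unfolding derived_def using z by (intro span_base) blast
      then have "dd A \<zeta> x X \<in> V x" using * x unfolding envelops_def by blast
      then have "form42 (dd A \<sigma> x X) (\<zeta> x) = 0" using V_iff[OF x z] by blast
      moreover have "guichard_connection A V chi m \<zeta> x X \<in> M x" using * x z unfolding parallel_def by blast
      ultimately show "darboux_connection A \<eta> ?m \<zeta> x X \<in> M x" unfolding G[OF x z] D[OF x z] by simp
    qed
  next
    assume *: "parallel A U (darboux_connection A \<eta> ?m) M"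
    have zero: "form42 (dd A \<sigma> x X) (\<zeta> x) = 0" if x: "x \<in> U" and z: "\<zeta> \<in> sections A M x" for x X \<zeta>
    proof -
      have "darboux_connection A \<eta> ?m \<zeta> x X \<in> M x" using * x z unfolding parallel_def by blast
      then have "form42 p (darboux_connection A \<eta> ?m \<zeta> x X) = 0" using M(2)[OF x] V[OF x] by (auto simp: perp_def)
      then have "?m * K * form42 (dd A \<sigma> x X) (\<zeta> x) = 0"
        unfolding D[OF x z] using basic(2)[OF x z] chi_range[OF x, of p] \<sigma>D(4)[OF x] by (simp add: form42_simps)
      then show ?thesis using m pp by simp
    qed
    have "derived A M x \<subseteq> V x" if x: "x \<in> U" for x
      unfolding derived_def
    proof (rule span_minimal)
      show "subspace (V x)" using V[OF x] subspace_perp by simp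
      show "{\<sigma> x |\<sigma>. \<sigma> \<in> sections A M x} \<union> {dd A \<sigma> x X |\<sigma> X. \<sigma> \<in> sections A M x} \<subseteq> V x"
        using V_iff[OF x] zero[OF x] basic(4)[OF x] M(2)[OF x] by blast
    qed
    moreover have "parallel A U (guichard_connection A V chi m) M"
      unfolding parallel_def
    proof (intro ballI allI)
      fix x \<zeta> X assume x: "x \<in> U" and z: "\<zeta> \<in> sections A M x"
      have "darboux_connection A \<eta> ?m \<zeta> x X \<in> M x" using * x z unfolding parallel_def by blast
      then show "guichard_connection A V chi m \<zeta> x X \<in> M x" unfolding G[OF x z] D[OF x z] zero[OF x z] by simp
    qed
    ultimately show "envelops A U M V \<and> parallel A U (guichard_connection A V chi m) M"
      unfolding envelops_def by blast
  qed
qed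

end

section \<open>Consequences of flatness\<close>

locale guichard = potential A p L f U V \<sigma> chi for A :: "'a::t2_space chart set" and p L f U V \<sigma> chi +
  assumes sc: "sphere_congruence A U p V"
    and fl: "\<And>t. flat A U (guichard_connection A V chi t)"
begin

lemma dchi:
  assumes "c \<in> A" "x \<in> U" "x \<in> fst c"
  shows "dd A (\<lambda>y. chi y (coord_field A c v y) w) x (coord_field A c u x) -
          dd A (\<lambda>y. chi y (coord_field A c u y) w) x (coord_field A c v x) =
          K *\<^sub>R wedge (dd A \<sigma> x (coord_field A c u x)) (dd A \<sigma> x (coord_field A c v x)) w"
  using flat_iff[THEN iffD1, OF allI[OF fl]] assms by blast

lemma chi_sym: assumes x: "x \<in> U" shows "chi x X (dd A \<sigma> x Y) = chi x Y (dd A \<sigma> x X)"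
  using flat_iff[THEN iffD1, OF allI[OF fl], rule_format, OF chart_at(1)[of x], of x X Y] chart_at(2)[of x] x
  by (simp add: coord_field_chart_at)

text \<open>Differentiate \<open>chi ell = 0\<close>. The antisymmetrised derivative of
  \<open>chi\<close> is a multiple of \<open>wedge d\<sigma> d\<sigma>\<close>, which kills
  \<open>ell\<close>, so the terms with \<open>d ell\<close> must agree.\<close>

lemma chi_ell_sym:
  assumes x: "x \<in> U" and l: "smooth_at A x ell" "\<forall>\<^sub>F y in nhds x. ell y \<in> L y"
  shows "chi x X (dd A ell x Y) = chi x Y (dd A ell x X)"
proof -
  let ?E = "coord_field A (chart_at A x)"
  have d: "dd A (\<lambda>y. chi y (?E v y) (ell x)) x (?E u x) = - chi x (?E v x) (dd A ell x (?E u x))" for u v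
  proof -
    have evl: "\<forall>\<^sub>F y in nhds x. linear (chi y (?E v y))" using evU[OF x] by eventually_elim (rule chi_linear)
    have "\<forall>\<^sub>F y in nhds x. chi y (?E v y) (ell y) = 0"
      using evU[OF x] l(2) by eventually_elim (rule chi_zero(2)[OF _ Lf_in])
    from dd_cong[OF this] have "dd A (\<lambda>y. chi y (?E v y) (ell y)) x (?E u x) = 0" by (simp add: dd_const)
    then show ?thesis
      using dd_apply[where a = "\<lambda>y. chi y (?E v y)" and X = "?E u x", OF chi_smooth[OF chart_at(1) x chart_at(2)] evl l(1)] by (simp add: eq_neg_iff_add_eq_0)
  qed
  have lf: "ell x \<in> f x" using Lf_in[OF eventually_nhds_x_imp_x[OF l(2)]] .
  have "wedge (dd A \<sigma> x (?E u x)) (dd A \<sigma> x (?E v x)) (ell x) = 0" for u v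
    using d\<sigma>(3)[OF x lf] by (simp add: wedge_def)
  then have "chi x (?E u x) (dd A ell x (?E v x)) = chi x (?E v x) (dd A ell x (?E u x))" for u v
    using dchi[OF chart_at(1) x chart_at(2), of v "ell x" u] unfolding d by simp
  from this[of X Y] show ?thesis by (simp add: coord_field_chart_at)
qed

text \<open>On a pair of coordinate fields the exterior derivatives of \<open>2 chi\<close> and of
  \<open>K \<sigma> \<and> d\<sigma>\<close> are the same element, \<open>2 K\<close> times the
  wedge of the two derivatives of \<open>\<sigma>\<close>.\<close>

lemma eta_closed: "closed_form A U eta"
  unfolding closed_form_def
proof (intro ballI allI)
  fix c x u v and w :: R42 assume c: "c \<in> A" and "x \<in> U \<inter> fst c"
  then have x: "x \<in> U" "x \<in> fst c" by auto
  let ?E = "coord_field A c"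
  have d: "dd A (\<lambda>y. eta y (?E v y) w) x (?E u x) = 2 *\<^sub>R dd A (\<lambda>y. chi y (?E v y) w) x (?E u x) -
    K *\<^sub>R (wedge (dd A \<sigma> x (?E u x)) (dd A \<sigma> x (?E v x)) w + wedge (\<sigma> x) (dd A (\<lambda>y. dd A \<sigma> y (?E v y)) x (?E u x)) w)" for u v
  proof -
    have s1: "smooth_at A x (\<lambda>y. chi y (?E v y) w)" by (rule chi_smooth[OF c x])
    have s2: "smooth_at A x (\<lambda>y. dd A \<sigma> y (?E v y))" by (rule smooth_at_dd[OF c x(2) \<sigma>D(1)[OF x(1)]])
    have s3: "smooth_at A x (\<lambda>y. wedge (\<sigma> y) (dd A \<sigma> y (?E v y)) w)"
      by (intro smooth_at_wedge \<sigma>D x s2 smooth_at_const)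
    show ?thesis unfolding eta_def
      by (simp only: dd_diff[OF smooth_at_scaleR[OF smooth_at_const s1] smooth_at_scaleR[OF smooth_at_const s3]]
        dd_scaleR_const[OF s1] dd_scaleR_const[OF s3] dd_wedge[OF \<sigma>D(1)[OF x(1)] s2])
  qed
  have e: "dd A (\<lambda>y. chi y (?E v y) w) x (?E u x) = dd A (\<lambda>y. chi y (?E u y) w) x (?E v x) +
      K *\<^sub>R wedge (dd A \<sigma> x (?E u x)) (dd A \<sigma> x (?E v x)) w"
    using dchi[OF c x, of v w u] by (simp add: diff_eq_eq add.commute)
  show "dd A (\<lambda>y. eta y (?E v y) w) x (?E u x) = dd A (\<lambda>y. eta y (?E u y) w) x (?E v x)"
    unfolding d dd_commute[OF c x(2) \<sigma>D(1)[OF x(1)], of v u] e wedge_swap[of "dd A \<sigma> x (?E v x)" "dd A \<sigma> x (?E u x)"]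
    by (rule euclidean_eqI) (simp add: inner_add_left inner_diff_left algebra_simps)
qed

text \<open>Products of like terms are symmetric in \<open>X\<close> and \<open>Y\<close>. The mixed
  products differ by a multiple of \<open>wedge (\<sigma> x) (lam x)\<close> whose coefficient
  vanishes by \<open>chi_sym\<close>.\<close>

lemma eta_comm: assumes x: "x \<in> U" shows "eta x X (eta x Y w) = eta x Y (eta x X w)"
proof -
  obtain lam where g: "gen x lam" by (rule L_gen)
  interpret null_triple p "\<sigma> x" "lam x" by (rule nt[OF x g])
  obtain b1 where b1: "b1 \<in> perp {p, \<sigma> x, lam x}" "chi x X = wedge (lam x) b1" by (rule chi_wedge[OF x g])
  obtain b2 where b2: "b2 \<in> perp {p, \<sigma> x, lam x}" "chi x Y = wedge (lam x) b2" by (rule chi_wedge[OF x g])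
  have a: "dd A \<sigma> x X \<in> perp {p, \<sigma> x, lam x}" "dd A \<sigma> x Y \<in> perp {p, \<sigma> x, lam x}" by (rule d\<sigma>_perp[OF x g])+
  let ?a = "dd A \<sigma> x X" and ?b = "dd A \<sigma> x Y" and ?l = "lam x" and ?s = "\<sigma> x"
  have o: "form42 ?s ?a = 0" "form42 ?l ?a = 0" "form42 ?s ?b = 0" "form42 ?l ?b = 0"
    "form42 ?s b1 = 0" "form42 ?l b1 = 0" "form42 ?s b2 = 0" "form42 ?l b2 = 0"
    "form42 ?a ?s = 0" "form42 ?a ?l = 0" "form42 ?b ?s = 0" "form42 ?b ?l = 0"
    "form42 b1 ?s = 0" "form42 b1 ?l = 0" "form42 b2 ?s = 0" "form42 b2 ?l = 0"
    "form42 ?l ?l = 0" "form42 ?s ?s = 0" "form42 ?l ?s = 0" "form42 ?s ?l = 0"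
    using a b1(1) b2(1) ll ss ls by (simp_all add: perp_def form42_commute)
  have "chi x X ?b = chi x Y ?a" by (rule chi_sym[OF x])
  then have s: "form42 b1 ?b = form42 b2 ?a"
    unfolding b1(2) b2(2) using o l0 by (simp add: wedge_def)
  show ?thesis
    unfolding eta_def b1(2) b2(2)
    by (simp add: wedge_def form42_simps o s form42_commute[of ?b ?a] form42_commute[of ?a b2] form42_commute[of ?b b1]
       form42_commute[of b2 b1])
qed

end

section \<open>Change of the enveloped sphere congruence\<close>

locale shifted = guichard A p L f U V \<sigma> chi for A :: "'a::t2_space chart set" and p L f U V \<sigma> chi +
  fixes ell :: "'a \<Rightarrow> R42" and V' :: "'a vbundle"
  assumes ell: "\<And>x. x \<in> U \<Longrightarrow> smooth_at A x ell" "\<And>x. x \<in> U \<Longrightarrow> ell x \<in> L x"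
    and V': "\<And>x. x \<in> U \<Longrightarrow> V' x = perp {p, \<sigma> x + ell x}"
begin

text \<open>With \<open>\<chi>'\<close> in place of \<open>\<chi>\<close> and \<open>\<sigma> + l\<close> in place of \<open>\<sigma>\<close>, the form \<open>2 \<chi> - K \<sigma> \<and> d\<sigma>\<close> changes by
  \<open>- d(K \<sigma> \<and> l)\<close>.\<close>

definition chi' :: "'a end_form" where
  "chi' x X w = chi x X w + (K *\<^sub>R wedge (ell x) (dd A \<sigma> x X) w + (K / 2) *\<^sub>R wedge (ell x) (dd A ell x X) w)"

lemma evell: "x \<in> U \<Longrightarrow> \<forall>\<^sub>F y in nhds x. ell y \<in> L y"
  "x \<in> U \<Longrightarrow> \<forall>\<^sub>F y in nhds x. smooth_at A y ell \<and> ell y \<in> L y"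
  using evU[of x] ell by (auto elim: eventually_mono)

lemma dell: assumes x: "x \<in> U"
  shows "form42 p (dd A ell x X) = 0" "b \<in> f x \<Longrightarrow> form42 b (dd A ell x X) = 0" "b \<in> f x \<Longrightarrow> form42 (dd A ell x X) b = 0"
  using Lsec_dd_p(2)[OF ell(1)[OF x] evell(1)[OF x]] fsec_dd_orth[OF Lsec_fsec[OF ell(1)[OF x] evell(1)[OF x]]] by blast+

lemma dsum: "x \<in> U \<Longrightarrow> dd A (\<lambda>x. \<sigma> x + ell x) x X = dd A \<sigma> x X + dd A ell x X"
  by (rule dd_add[OF \<sigma>D(1) ell(1)])

lemma in_derived: assumes x: "x \<in> U" shows "dd A \<sigma> x X \<in> derived A L x" "dd A ell x X \<in> derived A L x"
proof -
  obtain lam where g: "gen x lam" by (rule L_gen)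
  show "dd A \<sigma> x X \<in> derived A L x" "dd A ell x X \<in> derived A L x"
    unfolding derived_eq_L1[OF g] L1_perp[OF x g]
    using d\<sigma>_perp[OF x g] dell_perp[OF x g ell(1)[OF x] evell(1)[OF x]] by blast+
qed

lemma chi'_form1: "form1 A U (\<lambda>x. wedge_space (L x) (derived A L x)) chi'"
  unfolding form1_def
proof (intro conjI ballI allI)
  fix x X assume x: "x \<in> U"
  have 1: "chi x X \<in> wedge_space (L x) (derived A L x)" using chi x by (simp add: form1_def)
  have 2: "(\<lambda>w. K *\<^sub>R wedge (ell x) (dd A \<sigma> x X) w) \<in> wedge_space (L x) (derived A L x)"
    by (intro wedge_space_scaleR wedge_in_wedge_space ell in_derived x L_subspace)
  have 3: "(\<lambda>w. (K / 2) *\<^sub>R wedge (ell x) (dd A ell x X) w) \<in> wedge_space (L x) (derived A L x)"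
    by (intro wedge_space_scaleR wedge_in_wedge_space ell in_derived x L_subspace)
  have "chi' x X = (\<lambda>w. chi x X w + (K *\<^sub>R wedge (ell x) (dd A \<sigma> x X) w + (K / 2) *\<^sub>R wedge (ell x) (dd A ell x X) w))"
    by (rule ext) (simp add: chi'_def)
  then show "chi' x X \<in> wedge_space (L x) (derived A L x)" using wedge_space_add[OF 1 wedge_space_add[OF 2 3]] by simp
  have lw: "linear (\<lambda>X. wedge (ell x) (dd A h x X) w)" if "smooth_at A x h" for h w
    using linear_dd[OF that] by (intro linearI) (simp_all add: linear_add linear_cmul wedge_linear_right)
  show "linear (\<lambda>X. chi' x X w)" for w
    unfolding chi'_def by (intro linear_compose_add linear_compose_scale_right chi_linear x lw \<sigma>D ell)
next
  fix c v and w :: R42 assume c: "c \<in> A"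
  have "smooth_at A x (\<lambda>y. chi' y (coord_field A c v y) w)" if "x \<in> U" "x \<in> fst c" for x
    unfolding chi'_def
    by (intro smooth_at_add smooth_at_scaleR smooth_at_const smooth_at_wedge smooth_at_dd \<sigma>D ell chi_smooth c that)
  then show "smooth_map A (U \<inter> fst c) (\<lambda>y. chi' y (coord_field A c v y) w)"
    using smooth_map_iff[OF open_Int[OF U open_chart[OF c]]] by auto
qed

sublocale S: potential A p L f U V' "\<lambda>x. \<sigma> x + ell x" chi'
proof unfold_locales
  show "open U" by (rule U)
  show "normalized U (\<lambda>x. \<sigma> x + ell x)"
    unfolding normalized_def
    using smooth_at_add[OF \<sigma>D(1) ell(1)] subspace_add[OF f_subspace \<sigma>D(2) Lf_in[OF ell(2)]] \<sigma>D(3) L_p(1)[OF ell(2)]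
    by (simp add: form42_simps)
  show "\<And>x. x \<in> U \<Longrightarrow> V' x = perp {p, \<sigma> x + ell x}" by (rule V')
  show "form1 A U (\<lambda>x. wedge_space (L x) (derived A L x)) chi'" by (rule chi'_form1)
qed

lemma sym: "x \<in> U \<Longrightarrow> form42 (dd A \<sigma> x X) (dd A ell x Y) = form42 (dd A \<sigma> x Y) (dd A ell x X)"
  by (rule Lsec_sym[OF _ ell(1) evell(2)])

text \<open>Both conditions of \<open>flat_iff\<close> are checked for the new data. The derivatives
  of the correction terms supply the missing mixed wedges, and the symmetry of \<open>chi'\<close>
  rests on \<open>chi_sym\<close>, \<open>chi_ell_sym\<close> and \<open>Lsec_sym\<close>.\<close>

lemma chi'_flat: "flat A U (guichard_connection A V' chi' t)"
proof -
  have "\<forall>t. flat A U (guichard_connection A V' chi' t)"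
    unfolding S.flat_iff
  proof (intro ballI allI conjI)
    fix c x u v assume c: "c \<in> A" and "x \<in> U \<inter> fst c"
    then have x: "x \<in> U" "x \<in> fst c" by auto
    let ?E = "coord_field A c"
    show "dd A (\<lambda>y. chi' y (?E v y) w) x (?E u x) - dd A (\<lambda>y. chi' y (?E u y) w) x (?E v x) =
        K *\<^sub>R wedge (dd A (\<lambda>x. \<sigma> x + ell x) x (?E u x)) (dd A (\<lambda>x. \<sigma> x + ell x) x (?E v x)) w" for w
    proof -
      have d: "dd A (\<lambda>y. chi' y (?E v y) w) x (?E u x) = dd A (\<lambda>y. chi y (?E v y) w) x (?E u x) +
         (K *\<^sub>R (wedge (dd A ell x (?E u x)) (dd A \<sigma> x (?E v x)) w + wedge (ell x) (dd A (\<lambda>y. dd A \<sigma> y (?E v y)) x (?E u x)) w) +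
         (K / 2) *\<^sub>R (wedge (dd A ell x (?E u x)) (dd A ell x (?E v x)) w + wedge (ell x) (dd A (\<lambda>y. dd A ell y (?E v y)) x (?E u x)) w))" for u v
      proof -
        have s1: "smooth_at A x (\<lambda>y. chi y (?E v y) w)" by (rule chi_smooth[OF c x])
        have s2: "smooth_at A x (\<lambda>y. dd A \<sigma> y (?E v y))" by (rule smooth_at_dd[OF c x(2) \<sigma>D(1)[OF x(1)]])
        have s3: "smooth_at A x (\<lambda>y. dd A ell y (?E v y))" by (rule smooth_at_dd[OF c x(2) ell(1)[OF x(1)]])
        have s4: "smooth_at A x (\<lambda>y. wedge (ell y) (dd A \<sigma> y (?E v y)) w)"
          by (intro smooth_at_wedge ell x s2 smooth_at_const)
        have s5: "smooth_at A x (\<lambda>y. wedge (ell y) (dd A ell y (?E v y)) w)"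
          by (intro smooth_at_wedge ell x s3 smooth_at_const)
        have s6: "smooth_at A x (\<lambda>y. K *\<^sub>R wedge (ell y) (dd A \<sigma> y (?E v y)) w)"
          "smooth_at A x (\<lambda>y. (K / 2) *\<^sub>R wedge (ell y) (dd A ell y (?E v y)) w)"
          by (intro smooth_at_scaleR s4 s5 smooth_at_const)+
        show ?thesis unfolding chi'_def
          by (simp only: dd_add[OF s1 smooth_at_add[OF s6]] dd_add[OF s6] dd_scaleR_const[OF s4] dd_scaleR_const[OF s5]
              dd_wedge[OF ell(1)[OF x(1)] s2] dd_wedge[OF ell(1)[OF x(1)] s3])
      qed
      have e: "dd A (\<lambda>y. chi y (?E v y) w) x (?E u x) = dd A (\<lambda>y. chi y (?E u y) w) x (?E v x) +
          K *\<^sub>R wedge (dd A \<sigma> x (?E u x)) (dd A \<sigma> x (?E v x)) w"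
        using dchi[OF c x, of v w u] by (simp add: diff_eq_eq add.commute)
      show ?thesis
        unfolding d e dd_commute[OF c x(2) \<sigma>D(1)[OF x(1)], of v u] dd_commute[OF c x(2) ell(1)[OF x(1)], of v u]
          dsum[OF x(1)] wedge_linear_left wedge_linear_right
          wedge_swap[of "dd A ell x (?E v x)" "dd A \<sigma> x (?E u x)"] wedge_swap[of "dd A ell x (?E v x)" "dd A ell x (?E u x)"]
        by (rule euclidean_eqI) (simp add: inner_add_left inner_diff_left algebra_simps)
    qed
    let ?X = "?E u x" and ?Y = "?E v x"
    have val: "chi' x X (dd A (\<lambda>x. \<sigma> x + ell x) x Y) = chi x X (dd A \<sigma> x Y) + chi x X (dd A ell x Y)
      - (K * (form42 (dd A \<sigma> x X) (dd A \<sigma> x Y) + form42 (dd A \<sigma> x X) (dd A ell x Y) + form42 (dd A ell x X) (dd A \<sigma> x Y) / 2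
        + form42 (dd A ell x X) (dd A ell x Y) / 2)) *\<^sub>R ell x" for X Y
    proof -
      have lf: "ell x \<in> f x" by (rule Lf_in[OF ell(2)[OF x(1)]])
      show ?thesis unfolding chi'_def dsum[OF x(1)] linear_add[OF chi_linear(1)[OF x(1)]]
        using d\<sigma>(4)[OF x(1) lf] dell(2)[OF x(1) lf]
        by (simp add: wedge_def form42_simps) (simp add: algebra_simps add_divide_distrib)
    qed
    show "chi' x ?X (dd A (\<lambda>x. \<sigma> x + ell x) x ?Y) = chi' x ?Y (dd A (\<lambda>x. \<sigma> x + ell x) x ?X)"
      unfolding val chi_sym[OF x(1), of ?X ?Y] chi_ell_sym[OF x(1) ell(1)[OF x(1)] evell(1)[OF x(1)], of ?X ?Y]
      using sym[OF x(1), of ?X ?Y] form42_commute[of "dd A ell x ?X" "dd A \<sigma> x ?Y"] form42_commute[of "dd A ell x ?Y" "dd A \<sigma> x ?X"]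
        form42_commute[of "dd A \<sigma> x ?X" "dd A \<sigma> x ?Y"] form42_commute[of "dd A ell x ?X" "dd A ell x ?Y"] by simp
  qed
  then show ?thesis by blast
qed

text \<open>The change of \<open>chi\<close> lowers twice the first trace by
  \<open>2 K (d\<sigma>, d ell) + K (d ell, d ell)\<close>, which is exactly what the second trace
  gains.\<close>

lemma quad_eq: assumes x: "x \<in> U"
  shows "guichard_quad_diff A L V' chi' x X Y = guichard_quad_diff A L V chi x X Y"
proof -
  obtain lam where g: "gen x lam" by (rule L_gen)
  obtain r where r: "chi x X (dd A lam x Y) = r *\<^sub>R lam x" by (rule chi_dlam[OF x g])
  obtain q h where qh: "ell x = q *\<^sub>R lam x" "\<And>X. dd A ell x X = q *\<^sub>R dd A lam x X + h X *\<^sub>R lam x"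
    by (rule Lsec_dd[OF g ell(1)[OF x] evell(1)[OF x]]) blast
  have lf: "lam x \<in> f x" by (rule Lf_in[OF genD(4)[OF g]])
  let ?r = "r - q * K * form42 (dd A \<sigma> x X) (dd A lam x Y) - q * (K / 2) * form42 (dd A ell x X) (dd A lam x Y)"
  have "chi' x X (dd A lam x Y) = ?r *\<^sub>R lam x"
    unfolding chi'_def r qh(1) using fsec_dd_orth(2)[OF gen_fsec[OF g] lf, of Y]
    by (simp add: wedge_def form42_simps) (simp add: algebra_simps)
  from S.guichard_quad_diff_eq[OF x g this]
  have "guichard_quad_diff A L V' chi' x X Y = 2 * ?r + K * form42 (dd A \<sigma> x X + dd A ell x X) (dd A \<sigma> x Y + dd A ell x Y)"
    unfolding dsum[OF x] .
  also have "2 * ?r = 2 * r - 2 * K * (q * form42 (dd A \<sigma> x X) (dd A lam x Y)) - K * (q * form42 (dd A ell x X) (dd A lam x Y))"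
    by (simp add: algebra_simps)
  also have "q * form42 (dd A \<sigma> x X) (dd A lam x Y) = form42 (dd A \<sigma> x X) (dd A ell x Y)"
    unfolding qh(2) using d\<sigma>(3)[OF x lf] by (simp add: form42_simps)
  also have "q * form42 (dd A ell x X) (dd A lam x Y) = form42 (dd A ell x X) (dd A ell x Y)"
    unfolding qh(2)[of Y] using dell(3)[OF x lf] by (simp add: form42_simps)
  finally show ?thesis
    unfolding guichard_quad_diff_eq[OF x g r] using sym[OF x, of X Y] form42_commute[of "dd A ell x X" "dd A \<sigma> x Y"]
    by (simp add: form42_simps algebra_simps)
qed

lemma eta_shift: assumes x: "x \<in> U"
  shows "S.eta x X w = eta x X w - dd A (\<lambda>y. K *\<^sub>R wedge (\<sigma> y) (ell y) w) x X"
proof -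
  have "dd A (\<lambda>y. K *\<^sub>R wedge (\<sigma> y) (ell y) w) x X = K *\<^sub>R (wedge (dd A \<sigma> x X) (ell x) w + wedge (\<sigma> x) (dd A ell x X) w)"
    using dd_scaleR_const[OF smooth_at_wedge[OF \<sigma>D(1)[OF x] ell(1)[OF x] smooth_at_const[of x w]], of K X]
      dd_wedge[OF \<sigma>D(1)[OF x] ell(1)[OF x]] by simp
  then show ?thesis
    unfolding S.eta_def eta_def chi'_def dsum[OF x] wedge_linear_left wedge_linear_right
      wedge_swap[of "ell x" "dd A \<sigma> x X"]
    by (simp add: algebra_simps) (rule euclidean_eqI, simp add: inner_add_left inner_diff_left algebra_simps)
qed

text \<open>Signature and smooth frames are transported by an isometry. On \<open>V y\<close> the
  map \<open>T y\<close> agrees with the null rotation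
  \<open>exp (wedge (p - K \<sigma>) ell)\<close>, which fixes \<open>p\<close> and carries
  \<open>\<sigma>\<close> to \<open>\<sigma> + ell\<close>. The exponential series ends with the
  square, and terms containing \<open>(p - K \<sigma>, v)\<close> are absent because they vanish on
  \<open>V y\<close>.\<close>

lemma sphere_congruence_shift: "sphere_congruence A U p V'"
proof -
  define T where "T = (\<lambda>y v. v - form42 v (ell y) *\<^sub>R (p - K *\<^sub>R \<sigma> y) + ((K / 2) * form42 v (ell y)) *\<^sub>R ell y)"
  have lin: "linear (T y)" for y
    unfolding T_def by (rule linearI) (simp_all add: form42_simps algebra_simps)
  have lo: "form42 (ell y) (ell y) = 0" "form42 (ell y) (\<sigma> y) = 0" "form42 (\<sigma> y) (ell y) = 0" "form42 (ell y) p = 0" "form42 p (ell y) = 0"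
    if "y \<in> U" for y
    using isotropic_f[OF Lf_in[OF ell(2)[OF that]]] isotropic_f[OF \<sigma>D(2)[OF that]] Lf_in[OF ell(2)[OF that]] \<sigma>D(2)[OF that]
      L_p[OF ell(2)[OF that]] by auto
  have inj: "inj_on (T y) (V y)" if y: "y \<in> U" for y
  proof (rule linear_inj_on_iff_eq_0[THEN iffD2, rule_format, OF lin])
    show "subspace (V y)" using V[OF y] subspace_perp by simp
    fix v assume "v \<in> V y" and T0: "T y v = 0"
    \<comment> \<open>The pairing with \<open>ell y\<close> is preserved, so it vanishes on the
      kernel, and there \<open>T y\<close> is the identity.\<close>
    have "form42 (T y v) (ell y) = form42 v (ell y)" unfolding T_def using lo[OF y] by (simp add: form42_simps)
    then show "v = 0" using T0 unfolding T_def by (simp add: form42_zero)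
  qed
  have img: "T y ` V y = V' y" if y: "y \<in> U" for y
  proof -
    have sub: "T y ` V y \<subseteq> V' y"
    proof (rule image_subsetI)
      fix v assume v: "v \<in> V y"
      then have "form42 p v = 0" "form42 (\<sigma> y) v = 0" using V[OF y] by (auto simp: perp_def)
      then show "T y v \<in> V' y"
        unfolding V'[OF y] T_def perp_def using lo[OF y] \<sigma>D(3-5)[OF y] by (simp add: form42_simps form42_commute[of v])
    qed
    have sV: "subspace (V y)" using V[OF y] subspace_perp by simp
    have "dim (T y ` V y) = dim (V y)"
      using dim_image_eq[OF lin[of y], of "V y"] inj[OF y] span_eq_iff[THEN iffD2, OF sV] by simp
    also have "\<dots> = dim (V' y)"
      using null_pair.dim_perp_ps[OF np[OF y]] null_pair.dim_perp_ps[OF S.np[OF y]] V[OF y] V'[OF y] by simp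
    finally show ?thesis
      using subspace_dim_equal[OF linear_subspace_image[OF lin[of y] sV] _ sub] V'[OF y] subspace_perp by simp
  qed
  have sig: "signature form42 (V' y) = signature form42 (V y)" if y: "y \<in> U" for y
  proof (rule signature_isometry[OF lin _ inj[OF y] img[OF y]])
    show "subspace (V y)" using V[OF y] subspace_perp by simp
    fix v assume v: "v \<in> V y"
    then have "form42 p v = 0" "form42 (\<sigma> y) v = 0" "form42 v p = 0" "form42 v (\<sigma> y) = 0"
      using V[OF y] by (auto simp: perp_def form42_commute)
    then show "form42 (T y v) (T y v) = form42 v v"
      unfolding T_def using lo[OF y] \<sigma>D(3-5)[OF y] by (simp add: form42_simps form42_commute[of "ell y" v])
  qed
  have "subbundle A U 4 V'"
    unfolding subbundle_def
  proof
    fix x assume x: "x \<in> U"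
    obtain N and e :: "nat \<Rightarrow> 'a \<Rightarrow> R42" where N: "open N" "x \<in> N" "N \<subseteq> U" "\<forall>i<4. smooth_map A N (e i)"
      "\<forall>y\<in>N. V y = span ((\<lambda>i. e i y) ` {..<4}) \<and> dim (V y) = 4"
      using sc x unfolding sphere_congruence_def subbundle_def by metis
    show "\<exists>N (e :: nat \<Rightarrow> 'a \<Rightarrow> R42). open N \<and> x \<in> N \<and> N \<subseteq> U \<and> (\<forall>i<4. smooth_map A N (e i)) \<and>
     (\<forall>y\<in>N. V' y = span ((\<lambda>i. e i y) ` {..<4}) \<and> dim (V' y) = 4)"
    proof (intro exI[of _ N] exI[of _ "\<lambda>i y. T y (e i y)"] conjI N(1-3) allI impI ballI)
      fix i :: nat assume "i < 4"
      then have "smooth_at A y (e i)" if "y \<in> N" for y using N(4) smooth_map_iff[OF N(1)] that by blast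
      moreover have "y \<in> U" if "y \<in> N" for y using that N(3) by blast
      ultimately have "smooth_at A y (\<lambda>y. T y (e i y))" if "y \<in> N" for y
        unfolding T_def using that
        by (intro smooth_at_add smooth_at_diff smooth_at_scaleR smooth_at_mult smooth_at_form42 smooth_at_const \<sigma>D ell)
      then show "smooth_map A N (\<lambda>y. T y (e i y))" using smooth_map_iff[OF N(1)] by blast
    next
      fix y assume y: "y \<in> N"
      then have yU: "y \<in> U" using N(3) by blast
      have "V' y = T y ` span ((\<lambda>i. e i y) ` {..<4})" using N(5) y img[OF yU] by metis
      then show "V' y = span ((\<lambda>i. T y (e i y)) ` {..<4})"
        using linear_span_image[OF lin[of y], of "(\<lambda>i. e i y) ` {..<4}"] by (simp add: image_image)
      show "dim (V' y) = 4" using null_pair.dim_perp_ps[OF S.np[OF yU]] V'[OF yU] by simp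
    qed
  qed
  moreover have "V' x \<subseteq> perp {p}" if "x \<in> U" for x using V'[OF that] by (auto simp: perp_def)
  ultimately show ?thesis using sig sc unfolding sphere_congruence_def by metis
qed

lemma envelops_shift: "envelops A U L V'"
  unfolding envelops_def
proof
  fix x assume x: "x \<in> U"
  obtain lam where g: "gen x lam" by (rule L_gen)
  have "L1 x lam \<subseteq> V' x" unfolding S.L1_perp[OF x g] V'[OF x] by (auto simp: perp_def)
  then show "derived A L x \<subseteq> V' x" using derived_eq_L1[OF g] by simp
qed

lemma guichard_potential_shift: "guichard_potential A U p L V' chi'"
  unfolding guichard_potential_def using sphere_congruence_shift envelops_shift chi'_form1 chi'_flat by blast

end

subsection \<open>Gauge transformations and curvature spheres\<close>

lemma vec2_expand: "v = (v $ 1) *\<^sub>R axis 1 1 + (v $ 2) *\<^sub>R (axis 2 1 :: real^2)"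
  by (simp add: vec_eq_iff forall_2 axis_def)

text \<open>This turns a vanishing determinant into a tangent direction: one that makes a line a
  curvature sphere, or one in the radical of the quadratic differential.\<close>

lemma singular_2x2:
  fixes a b c d :: real
  assumes "a * d - b * c = 0"
  obtains v :: "real^2" where "v \<noteq> 0" "v $ 1 * a + v $ 2 * c = 0" "v $ 1 * b + v $ 2 * d = 0"
proof (cases "a = 0 \<and> c = 0")
  case True
  show ?thesis
  proof (cases "b = 0 \<and> d = 0")
    case True
    then show ?thesis using that[of "axis 1 1"] \<open>a = 0 \<and> c = 0\<close> by (simp add: axis_def vec_eq_iff)
  next
    case False
    let ?v = "(- d) *\<^sub>R axis 1 1 + b *\<^sub>R (axis 2 1 :: real^2)"
    have c: "?v $ 1 = - d" "?v $ 2 = b" by (simp_all add: axis_def)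
    then have "?v \<noteq> 0" using False by (metis neg_0_equal_iff_equal zero_index)
    then show ?thesis using that[of ?v] True unfolding c by simp
  qed
next
  case False
  let ?v = "(- c) *\<^sub>R axis 1 1 + a *\<^sub>R (axis 2 1 :: real^2)"
  have c: "?v $ 1 = - c" "?v $ 2 = a" by (simp_all add: axis_def)
  then have "?v \<noteq> 0" using False by (metis neg_0_equal_iff_equal zero_index)
  then show ?thesis using that[of ?v] assms unfolding c by (simp add: algebra_simps)
qed

lemma nonsingular_2x2:
  fixes a b c d :: real and v :: "real^2"
  assumes "a * d - b * c \<noteq> 0" "v $ 1 * a + v $ 2 * c = 0" "v $ 1 * b + v $ 2 * d = 0"
  shows "v = 0"
proof -
  have "v $ 1 * (a * d - b * c) = (v $ 1 * a + v $ 2 * c) * d - (v $ 1 * b + v $ 2 * d) * c" by algebra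
  moreover have "v $ 2 * (a * d - b * c) = (v $ 1 * b + v $ 2 * d) * a - (v $ 1 * a + v $ 2 * c) * b" by algebra
  ultimately have "v $ 1 = 0" "v $ 2 = 0" using assms by auto
  then show ?thesis by (simp add: vec_eq_iff forall_2)
qed

context smooth_surface begin

lemma subbundle_restrict:
  assumes S: "subbundle A U k M" and W: "open W" "W \<subseteq> U" shows "subbundle A W k M"
  unfolding subbundle_def
proof
  fix x assume x: "x \<in> W"
  then have "x \<in> U" using W(2) by blast
  then obtain N and e :: "nat \<Rightarrow> 'a \<Rightarrow> R42" where N: "open N" "x \<in> N" "N \<subseteq> U" "\<forall>i<k. smooth_map A N (e i)"
    "\<forall>y\<in>N. M y = span ((\<lambda>i. e i y) ` {..<k}) \<and> dim (M y) = k"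
    using S unfolding subbundle_def by metis
  have "smooth_map A (N \<inter> W) (e i)" if "i < k" for i
    using N(4) that smooth_map_mono[OF _ Int_lower1] by blast
  then show "\<exists>N (e :: nat \<Rightarrow> 'a \<Rightarrow> R42). open N \<and> x \<in> N \<and> N \<subseteq> W \<and> (\<forall>i<k. smooth_map A N (e i)) \<and>
     (\<forall>y\<in>N. M y = span ((\<lambda>i. e i y) ` {..<k}) \<and> dim (M y) = k)"
    using N(2,5) x open_Int[OF N(1) W(1)] by (intro exI[of _ "N \<inter> W"] exI[of _ e]) blast
qed

end

context legendre_lift begin

text \<open>The properties of the values of forms in \<open>f \<and> f\<^sup>\<bottom>\<close> on which gauge transformations rest.\<close>

definition nil_form :: "'a set \<Rightarrow> 'a end_form \<Rightarrow> bool" where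
  "nil_form U \<eta> \<longleftrightarrow> (\<forall>x\<in>U. \<forall>X. linear (\<eta> x X) \<and> (\<forall>a\<in>f x. \<eta> x X a = 0) \<and> (\<forall>w. \<eta> x X w \<in> perp (f x)))"

definition gauge_field :: "'a set \<Rightarrow> ('a \<Rightarrow> R42 \<Rightarrow> R42) \<Rightarrow> bool" where
  "gauge_field U \<tau> \<longleftrightarrow> (\<forall>x\<in>U. \<tau> x \<in> wedge_space (f x) (f x)) \<and> (\<forall>w. smooth_map A U (\<lambda>x. \<tau> x w))"

definition gauge_form :: "'a end_form \<Rightarrow> ('a \<Rightarrow> R42 \<Rightarrow> R42) \<Rightarrow> 'a end_form" where
  "gauge_form \<eta> \<tau> x X w = \<eta> x X w - dd A (\<lambda>y. \<tau> y w) x X"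

text \<open>The image of \<open>s\<close> under \<open>exp (m \<tau>)\<close>; the series stops
  after the linear term because values in \<open>f \<and> f\<close> square to zero.\<close>

definition gauge_line :: "real \<Rightarrow> ('a \<Rightarrow> R42 \<Rightarrow> R42) \<Rightarrow> 'a vbundle \<Rightarrow> 'a vbundle" where
  "gauge_line m \<tau> s x = (\<lambda>w. w + m *\<^sub>R \<tau> x w) ` s x"

lemma gauge_fieldD:
  assumes "gauge_field U \<tau>" "open U" "x \<in> U"
  shows "linear (\<tau> x)" "\<tau> x w \<in> f x" "w \<in> perp (f x) \<Longrightarrow> \<tau> x w = 0" "form42 (\<tau> x v) w = - form42 v (\<tau> x w)"
    "smooth_at A x (\<lambda>y. \<tau> y w)"
proof -
  have t: "\<tau> x \<in> wedge_space (f x) (f x)" using assms unfolding gauge_field_def by blast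
  show "linear (\<tau> x)" by (rule wedge_space_linear[OF t])
  show "\<tau> x w \<in> f x" by (rule wedge_space_range[OF t f_subspace order_refl order_refl])
  show "w \<in> perp (f x) \<Longrightarrow> \<tau> x w = 0" by (rule wedge_space_kernel[OF t])
  show "form42 (\<tau> x v) w = - form42 v (\<tau> x w)" by (rule wedge_space_skew[OF t])
  show "smooth_at A x (\<lambda>y. \<tau> y w)" using assms smooth_map_iff[OF assms(2)] unfolding gauge_field_def by blast
qed

lemma gauge_field_diff:
  assumes "gauge_field U \<tau>" "gauge_field U \<tau>'" "open U"
  shows "gauge_field U (\<lambda>x w. \<tau> x w - \<tau>' x w)"
  unfolding gauge_field_def
proof (intro conjI ballI allI)
  fix x assume x: "x \<in> U"
  have "(\<lambda>w. (-1) *\<^sub>R \<tau>' x w) \<in> wedge_space (f x) (f x)"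
    using assms(2) x by (intro wedge_space_scaleR[OF _ f_subspace]) (simp add: gauge_field_def)
  then show "(\<lambda>w. \<tau> x w - \<tau>' x w) \<in> wedge_space (f x) (f x)"
    using wedge_space_add[of "\<tau> x" "f x" "f x" "\<lambda>w. (-1) *\<^sub>R \<tau>' x w"] assms(1) x by (simp add: gauge_field_def)
next
  fix w show "smooth_map A U (\<lambda>x. \<tau> x w - \<tau>' x w)"
    using smooth_at_diff gauge_fieldD(5)[OF assms(1,3)] gauge_fieldD(5)[OF assms(2,3)] smooth_map_iff[OF assms(3)] by blast
qed

lemma fsec_extend:
  assumes "a \<in> f x" obtains \<zeta> where "fsec x \<zeta>" "\<zeta> x = a"
proof -
  from f_subbundle obtain N and e :: "nat \<Rightarrow> 'a \<Rightarrow> R42" where N: "open N" "x \<in> N"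
      "\<forall>i<2. smooth_map A N (e i)" "\<forall>y\<in>N. f y = span ((\<lambda>i. e i y) ` {..<2}) \<and> dim (f y) = 2"
    unfolding subbundle_def by (metis UNIV_I)
  have im: "(\<lambda>i. e i y) ` {..<2::nat} = {e 0 y, e 1 y}" for y by (auto simp: less_2_cases_iff)
  obtain r s where rs: "a = r *\<^sub>R e 0 x + s *\<^sub>R e 1 x" using assms N(2,4) unfolding im by (auto simp: in_span_2)
  have "fsec x (\<lambda>y. r *\<^sub>R e 0 y + s *\<^sub>R e 1 y)"
    unfolding fsec_def
  proof
    have "smooth_at A x (e i)" if "i < 2" for i using N smooth_map_iff[OF N(1)] that by blast
    then have "smooth_at A x (e 0)" "smooth_at A x (e 1)" by simp_all
    then show "smooth_at A x (\<lambda>y. r *\<^sub>R e 0 y + s *\<^sub>R e 1 y)" by (intro smooth_at_add smooth_at_scaleR smooth_at_const)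
    show "\<forall>\<^sub>F y in nhds x. r *\<^sub>R e 0 y + s *\<^sub>R e 1 y \<in> f y"
      using eventually_nhds_in_open[OF N(1,2)] by eventually_elim (use N(4) im in \<open>auto simp: in_span_2\<close>)
  qed
  then show ?thesis using that rs by simp
qed

text \<open>Differentiate \<open>\<tau> \<zeta> = 0\<close> and
  \<open>(\<zeta>, \<tau> w) = 0\<close> for sections \<open>\<zeta>\<close> of \<open>f\<close>.
  The terms with \<open>d\<zeta>\<close> vanish because \<open>d\<zeta>\<close> lies in
  \<open>perp (f x)\<close>, which \<open>\<tau>\<close> kills and which is orthogonal to the values
  of \<open>\<tau>\<close>.\<close>

lemma nil_form_dtau:
  assumes t: "gauge_field U \<tau>" and U: "open U"
  shows "nil_form U (\<lambda>x X w. dd A (\<lambda>y. \<tau> y w) x X)"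
  unfolding nil_form_def
proof (intro ballI allI conjI)
  fix x X assume x: "x \<in> U"
  note T = gauge_fieldD[OF t U]
  have evU: "\<forall>\<^sub>F y in nhds x. y \<in> U" by (rule eventually_nhds_in_open[OF U x])
  have evl: "\<forall>\<^sub>F y in nhds x. linear (\<tau> y)" using evU by eventually_elim (rule T)
  show "linear (\<lambda>w. dd A (\<lambda>y. \<tau> y w) x X)"
  proof (rule linearI)
    fix v w
    have ad: "\<forall>\<^sub>F y in nhds x. \<tau> y (v + w) = \<tau> y v + \<tau> y w" using evl by eventually_elim (rule linear_add)
    show "dd A (\<lambda>y. \<tau> y (v + w)) x X = dd A (\<lambda>y. \<tau> y v) x X + dd A (\<lambda>y. \<tau> y w) x X"
      unfolding dd_cong[OF ad] by (rule dd_add[OF T(5)[OF x] T(5)[OF x]])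
  next
    fix r v
    have sc: "\<forall>\<^sub>F y in nhds x. \<tau> y (r *\<^sub>R v) = r *\<^sub>R \<tau> y v" using evl by eventually_elim (rule linear_cmul)
    show "dd A (\<lambda>y. \<tau> y (r *\<^sub>R v)) x X = r *\<^sub>R dd A (\<lambda>y. \<tau> y v) x X"
      unfolding dd_cong[OF sc] by (rule dd_scaleR_const[OF T(5)[OF x]])
  qed
  show "dd A (\<lambda>y. \<tau> y a) x X = 0" if a: "a \<in> f x" for a
  proof -
    obtain \<zeta> where \<zeta>: "fsec x \<zeta>" "\<zeta> x = a" by (rule fsec_extend[OF a])
    have s: "smooth_at A x \<zeta>" "\<forall>\<^sub>F y in nhds x. \<zeta> y \<in> f y" using \<zeta>(1) by (auto simp: fsec_def)
    have "\<forall>\<^sub>F y in nhds x. \<tau> y (\<zeta> y) = 0" using s(2) evU by eventually_elim (rule T(3)[OF _ f_subset_perp])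
    from dd_cong[OF this] have "dd A (\<lambda>y. \<tau> y (\<zeta> y)) x X = 0" by (simp add: dd_const)
    then show ?thesis
      using dd_apply[where a = \<tau> and X = X, OF T(5)[OF x] evl s(1)] T(3)[OF x fsec_dd[OF \<zeta>(1)], of X] \<zeta>(2) by simp
  qed
  show "dd A (\<lambda>y. \<tau> y w) x X \<in> perp (f x)" for w
    unfolding perp_def
  proof (intro CollectI ballI)
    fix a assume "a \<in> f x"
    then obtain \<zeta> where \<zeta>: "fsec x \<zeta>" "\<zeta> x = a" by (rule fsec_extend)
    have s: "smooth_at A x \<zeta>" "\<forall>\<^sub>F y in nhds x. \<zeta> y \<in> f y" using \<zeta>(1) by (auto simp: fsec_def)
    have "\<forall>\<^sub>F y in nhds x. form42 (\<zeta> y) (\<tau> y w) = 0" using s(2) evU by eventually_elim (rule isotropic_f[OF _ T(2)])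
    from dd_form42_const[OF s(1) T(5)[OF x] this, of X]
    show "form42 a (dd A (\<lambda>y. \<tau> y w) x X) = 0" using fsec_dd_orth(1)[OF \<zeta>(1) T(2)[OF x]] \<zeta>(2) by simp
  qed
qed

lemma nil_form_gauge:
  assumes "nil_form U \<eta>" "gauge_field U \<tau>" "open U" shows "nil_form U (gauge_form \<eta> \<tau>)"
  using assms(1) nil_form_dtau[OF assms(2,3)] subspace_diff[OF subspace_perp]
  unfolding nil_form_def gauge_form_def by (auto intro: linear_compose_sub)

lemma darboux_line_cong:
  assumes "\<And>x X w. x \<in> U \<Longrightarrow> \<eta> x X w = \<eta>' x X w"
  shows "darboux_line A U f \<eta> m s \<longleftrightarrow> darboux_line A U f \<eta>' m s"
  unfolding darboux_line_def parallel_def darboux_connection_def using assms by auto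

lemma gauge_line_in:
  assumes t: "gauge_field U \<tau>" and U: "open U" and x: "x \<in> U"
  shows "z \<in> gauge_line m \<tau> s x \<longleftrightarrow> z - m *\<^sub>R \<tau> x z \<in> s x"
proof -
  note T = gauge_fieldD[OF t U x]
  have tt: "\<tau> x (\<tau> x w) = 0" for w by (rule T(3)[OF f_subset_perp[OF T(2)]])
  show ?thesis
  proof
    assume "z \<in> gauge_line m \<tau> s x"
    then obtain w where w: "w \<in> s x" "z = w + m *\<^sub>R \<tau> x w" unfolding gauge_line_def by blast
    have eq: "z - m *\<^sub>R \<tau> x z = w" unfolding w(2) by (simp add: linear_add[OF T(1)] linear_cmul[OF T(1)] tt)
    show "z - m *\<^sub>R \<tau> x z \<in> s x" unfolding eq by (rule w(1))
  next
    assume *: "z - m *\<^sub>R \<tau> x z \<in> s x"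
    have "z = (z - m *\<^sub>R \<tau> x z) + m *\<^sub>R \<tau> x (z - m *\<^sub>R \<tau> x z)"
      by (simp add: linear_diff[OF T(1)] linear_cmul[OF T(1)] tt)
    then show "z \<in> gauge_line m \<tau> s x" unfolding gauge_line_def using * by blast
  qed
qed

text \<open>\<open>exp (m \<tau>)\<close> intertwines the connections of \<open>\<eta>\<close> and
  \<open>\<eta> - d\<tau>\<close>, since \<open>\<eta>\<close> and \<open>d\<tau>\<close> kill the
  values of \<open>\<tau>\<close>, and \<open>\<tau>\<close> kills the values of
  \<open>\<eta>\<close>. Pairings with \<open>f\<close> do not change because \<open>\<tau>\<close>
  has values in the isotropic \<open>f\<close>, so the condition on curvature spheres is
  kept.\<close>

lemma gauge_darboux_line:
  assumes U: "open U" and n: "nil_form U \<eta>" and t: "gauge_field U \<tau>" and d: "darboux_line A U f \<eta> m s"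
  shows "darboux_line A U f (gauge_form \<eta> \<tau>) m (gauge_line m \<tau> s)"
proof -
  note T = gauge_fieldD[OF t U]
  have tt: "\<tau> x (\<tau> x w) = 0" if "x \<in> U" for x w by (rule T(3)[OF that f_subset_perp[OF T(2)[OF that]]])
  have N: "linear (\<eta> x X)" "a \<in> f x \<Longrightarrow> \<eta> x X a = 0" "\<eta> x X w \<in> perp (f x)" if "x \<in> U" for x X a w
    using n that unfolding nil_form_def by blast+
  have dn: "linear (\<lambda>w. dd A (\<lambda>y. \<tau> y w) x X)" "a \<in> f x \<Longrightarrow> dd A (\<lambda>y. \<tau> y a) x X = 0" if "x \<in> U" for x X a
    using nil_form_dtau[OF t U] that unfolding nil_form_def by blast+
  have sub: "subspace (s x)" if "x \<in> U" for x using d that by (auto simp: darboux_line_def null_line_bundle_def null_line_def)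
  have lin: "linear (\<lambda>w. w + m *\<^sub>R \<tau> x w)" if "x \<in> U" for x
    by (intro linear_compose_add linear_compose_scale_right T that linear_id[unfolded id_def])
  have ev: "\<forall>\<^sub>F y in nhds x. linear (\<tau> y)" if "x \<in> U" for x
    using eventually_nhds_in_open[OF U that] by eventually_elim (rule T)
  have nb: "null_line_bundle A U s" using d by (simp add: darboux_line_def)
  have E: "\<exists>N e. open N \<and> x \<in> N \<and> N \<subseteq> U \<and> (\<forall>y\<in>N. smooth_at A y e \<and> e y \<noteq> 0 \<and> s y = span {e y} \<and> form42 (e y) (e y) = 0)"
    if x: "x \<in> U" for x
  proof -
    obtain e where e: "smooth_at A x e" "\<forall>\<^sub>F y in nhds x. e y \<noteq> 0 \<and> s y = span {e y} \<and> form42 (e y) (e y) = 0"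
      by (rule line_bundle_gen[OF nb U x])
    have "\<forall>\<^sub>F y in nhds x. y \<in> U \<and> smooth_at A y e \<and> e y \<noteq> 0 \<and> s y = span {e y} \<and> form42 (e y) (e y) = 0"
      using e(2) smooth_at_eventually[OF e(1)] eventually_nhds_in_open[OF U x] by eventually_elim simp
    then show ?thesis unfolding eventually_nhds by (meson subsetI)
  qed
  have line: "gauge_line m \<tau> s y = span {e y + m *\<^sub>R \<tau> y (e y)} \<and> e y + m *\<^sub>R \<tau> y (e y) \<noteq> 0 \<and> null_line (gauge_line m \<tau> s y)"
    if y: "y \<in> U" and e: "e y \<noteq> 0" "s y = span {e y}" "form42 (e y) (e y) = 0" for e :: "'a \<Rightarrow> R42" and y
  proof -
    let ?z = "e y + m *\<^sub>R \<tau> y (e y)"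
    have 1: "gauge_line m \<tau> s y = span {?z}"
      unfolding gauge_line_def e(2) using linear_span_image[OF lin[OF y], of "{e y}"] by simp
    have 2: "?z \<noteq> 0"
    proof
      assume "?z = 0"
      then have "?z - m *\<^sub>R \<tau> y ?z = 0" by (simp add: linear_0[OF T(1)[OF y]])
      then show False using e(1) by (simp add: linear_add[OF T(1)[OF y]] linear_cmul[OF T(1)[OF y]] tt[OF y])
    qed
    have "form42 (\<tau> y (e y)) (e y) = 0" using T(4)[OF y, of "e y" "e y"] by (simp add: form42_commute)
    moreover have "form42 (\<tau> y (e y)) (\<tau> y (e y)) = 0" by (rule isotropic_f[OF T(2)[OF y] T(2)[OF y]])
    ultimately have "form42 ?z ?z = 0" using e(3) by (simp add: form42_simps form42_commute[of "e y" "\<tau> y (e y)"])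
    then show ?thesis using 1 2 null_line_span by simp
  qed
  have nlb: "null_line_bundle A U (gauge_line m \<tau> s)"
    unfolding null_line_bundle_def subbundle_def
  proof (intro conjI ballI)
    fix x assume x: "x \<in> U"
    obtain N e where N: "open N" "x \<in> N" "N \<subseteq> U" and e: "\<And>y. y \<in> N \<Longrightarrow> smooth_at A y e \<and> e y \<noteq> 0 \<and> s y = span {e y} \<and> form42 (e y) (e y) = 0"
      using E[OF x] by blast
    show "\<exists>N (e :: nat \<Rightarrow> 'a \<Rightarrow> R42). open N \<and> x \<in> N \<and> N \<subseteq> U \<and> (\<forall>i<1. smooth_map A N (e i)) \<and>
      (\<forall>y\<in>N. gauge_line m \<tau> s y = span ((\<lambda>i. e i y) ` {..<1}) \<and> dim (gauge_line m \<tau> s y) = 1)"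
    proof (intro exI[of _ N] exI[of _ "\<lambda>i y. e y + m *\<^sub>R \<tau> y (e y)"] conjI N allI impI ballI)
      have "smooth_at A y (\<lambda>y. e y + m *\<^sub>R \<tau> y (e y))" if "y \<in> N" for y
        using N(3) that e
        by (intro smooth_at_add smooth_at_scaleR smooth_at_const smooth_at_apply[OF T(5) ev]) auto
      then show "smooth_map A N (\<lambda>y. e y + m *\<^sub>R \<tau> y (e y))" using smooth_map_iff[OF N(1)] by blast
      fix y assume y: "y \<in> N"
      have im: "(\<lambda>i. e y + m *\<^sub>R \<tau> y (e y)) ` {..<1::nat} = {e y + m *\<^sub>R \<tau> y (e y)}" by auto
      have l: "gauge_line m \<tau> s y = span {e y + m *\<^sub>R \<tau> y (e y)}" "e y + m *\<^sub>R \<tau> y (e y) \<noteq> 0"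
        using line[of y e] e[OF y] y N(3) by blast+
      show "gauge_line m \<tau> s y = span ((\<lambda>i. e y + m *\<^sub>R \<tau> y (e y)) ` {..<1::nat})" unfolding im l(1) ..
      show "dim (gauge_line m \<tau> s y) = 1" unfolding l(1) by (rule dim_span_singleton[OF l(2)])
    qed
    show "null_line (gauge_line m \<tau> s x)" using line[OF x] e[OF N(2)] by blast
  qed
  have par: "parallel A U (darboux_connection A (gauge_form \<eta> \<tau>) m) (gauge_line m \<tau> s)"
    unfolding parallel_def
  proof (intro ballI allI)
    fix x \<zeta> X assume x: "x \<in> U" and "\<zeta> \<in> sections A (gauge_line m \<tau> s) x"
    then have z: "smooth_at A x \<zeta>" "\<forall>\<^sub>F y in nhds x. \<zeta> y \<in> gauge_line m \<tau> s y" by (auto simp: sections_iff)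
    \<comment> \<open>The inverse \<open>exp (- m \<tau>)\<close> brings the section back to a
      section of \<open>s\<close>.\<close>
    define \<xi> where "\<xi> = (\<lambda>y. \<zeta> y - m *\<^sub>R \<tau> y (\<zeta> y))"
    have st: "smooth_at A x (\<lambda>y. \<tau> y (g y))" if "smooth_at A x g" for g by (rule smooth_at_apply[OF T(5)[OF x] ev[OF x] that])
    have s\<xi>: "smooth_at A x \<xi>" unfolding \<xi>_def by (intro smooth_at_diff smooth_at_scaleR smooth_at_const st z)
    have "\<forall>\<^sub>F y in nhds x. \<xi> y \<in> s y"
      using z(2) eventually_nhds_in_open[OF U x] by eventually_elim (simp add: \<xi>_def gauge_line_in[OF t U])
    then have "\<xi> \<in> sections A s x" using s\<xi> by (simp add: sections_iff)
    then have dx: "dd A \<xi> x X + m *\<^sub>R \<eta> x X (\<xi> x) \<in> s x"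
      using d x unfolding darboux_line_def parallel_def darboux_connection_def by blast
    have "\<forall>\<^sub>F y in nhds x. \<zeta> y = \<xi> y + m *\<^sub>R \<tau> y (\<xi> y)"
      using eventually_nhds_in_open[OF U x]
      by eventually_elim (simp add: \<xi>_def linear_diff[OF T(1)] linear_cmul[OF T(1)] tt)
    note ze = this
    have zx: "\<zeta> x = \<xi> x + m *\<^sub>R \<tau> x (\<xi> x)" by (rule eventually_nhds_x_imp_x[OF ze])
    have dz: "dd A \<zeta> x X = dd A \<xi> x X + m *\<^sub>R (dd A (\<lambda>y. \<tau> y (\<xi> x)) x X + \<tau> x (dd A \<xi> x X))"
      unfolding dd_cong[OF ze]
      by (simp only: dd_add[OF s\<xi> smooth_at_scaleR[OF smooth_at_const st[OF s\<xi>]]] dd_scaleR_const[OF st[OF s\<xi>]]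
          dd_apply[where a = \<tau>, OF T(5)[OF x] ev[OF x] s\<xi>])
    let ?w = "dd A \<xi> x X + m *\<^sub>R \<eta> x X (\<xi> x)"
    \<comment> \<open>Here \<open>?w\<close> is the derivative of the old section in the old
      connection; the new derivative is its image under the gauge transformation.\<close>
    have "darboux_connection A (gauge_form \<eta> \<tau>) m \<zeta> x X = ?w + m *\<^sub>R \<tau> x ?w"
      unfolding darboux_connection_def gauge_form_def dz zx linear_add[OF N(1)[OF x]] linear_cmul[OF N(1)[OF x]]
        linear_add[OF dn(1)[OF x]] linear_cmul[OF dn(1)[OF x]] N(2)[OF x T(2)[OF x]] dn(2)[OF x T(2)[OF x]]
        linear_add[OF T(1)[OF x]] linear_cmul[OF T(1)[OF x]] T(3)[OF x N(3)[OF x]]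
      by (simp add: algebra_simps)
    then show "darboux_connection A (gauge_form \<eta> \<tau>) m \<zeta> x X \<in> gauge_line m \<tau> s x"
      unfolding gauge_line_def using dx by blast
  qed
  have "nowhere_orthogonal A U f (gauge_line m \<tau> s)"
    unfolding nowhere_orthogonal_def
  proof (intro ballI allI impI notI)
    fix x c assume x: "x \<in> U" and c: "curvature_sphere A f x c" "c \<subseteq> perp (gauge_line m \<tau> s x)"
    have "c \<subseteq> perp (s x)"
    proof
      fix a assume a: "a \<in> c"
      then have af: "a \<in> f x" using c(1) unfolding curvature_sphere_def by blast
      have "form42 w a = 0" if "w \<in> s x" for w
      proof -
        have "form42 (w + m *\<^sub>R \<tau> x w) a = 0" using a c(2) that unfolding gauge_line_def perp_def by blast
        then show ?thesis using isotropic_f[OF T(2)[OF x] af] by (simp add: form42_simps)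
      qed
      then show "a \<in> perp (s x)" by (simp add: perp_def)
    qed
    then show False using d x c(1) unfolding darboux_line_def nowhere_orthogonal_def by blast
  qed
  then show ?thesis using nlb par by (simp add: darboux_line_def)
qed

text \<open>A vector \<open>w\<close> of the line moves by \<open>m \<tau> w\<close>, which lies in
  \<open>f x\<close> and, by skewness, is orthogonal to the line. The first summand of the transform
  absorbs it.\<close>

lemma transform_gauge:
  assumes U: "open U" and t: "gauge_field U \<tau>" and x: "x \<in> U" and s: "null_line (s x)"
  shows "transform_bundle f (gauge_line m \<tau> s) x = transform_bundle f s x"
proof -
  note T = gauge_fieldD[OF t U x]
  have ft: "form42 (\<tau> x w) b = 0" if "b \<in> f x" for w b by (rule isotropic_f[OF T(2) that])
  have meet: "f x \<inter> perp (gauge_line m \<tau> s x) = f x \<inter> perp (s x)"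
    unfolding gauge_line_def perp_def using ft by (auto simp: form42_simps)
  obtain e where e: "e \<noteq> 0" "form42 e e = 0" "s x = span {e}" by (rule null_line_obtain[OF s])
  have "form42 e (\<tau> x e) = 0" using T(4)[of e e] by (simp add: form42_commute)
  then have "form42 v (\<tau> x w) = 0" if "v \<in> s x" "w \<in> s x" for v w
    using that unfolding e(3) by (auto simp: span_singleton linear_cmul[OF T(1)] form42_simps)
  then have tw: "r *\<^sub>R \<tau> x w \<in> f x \<inter> perp (s x)" if "w \<in> s x" for w r
    using that subspace_scale[OF f_subspace T(2)] by (simp add: perp_def form42_simps)
  have sub: "subspace (f x \<inter> perp (s x))" by (rule subspace_inter[OF f_subspace subspace_perp])
  show ?thesis
  proof (intro set_eqI iffI)
    fix z assume "z \<in> transform_bundle f (gauge_line m \<tau> s) x"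
    then obtain a w where aw: "a \<in> f x \<inter> perp (s x)" "w \<in> s x" "z = a + (w + m *\<^sub>R \<tau> x w)"
      unfolding transform_bundle_def meet unfolding gauge_line_def by blast
    then have "z = (a + m *\<^sub>R \<tau> x w) + w" "a + m *\<^sub>R \<tau> x w \<in> f x \<inter> perp (s x)"
      using subspace_add[OF sub aw(1) tw[OF aw(2)]] by simp_all
    then show "z \<in> transform_bundle f s x" unfolding transform_bundle_def using aw(2) by blast
  next
    fix z assume "z \<in> transform_bundle f s x"
    then obtain a w where aw: "a \<in> f x \<inter> perp (s x)" "w \<in> s x" "z = a + w"
      unfolding transform_bundle_def by blast
    then have "z = (a - m *\<^sub>R \<tau> x w) + (w + m *\<^sub>R \<tau> x w)" "a - m *\<^sub>R \<tau> x w \<in> f x \<inter> perp (s x)"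
      using subspace_diff[OF sub aw(1) tw[OF aw(2)]] by simp_all
    then show "z \<in> transform_bundle f (gauge_line m \<tau> s) x"
      unfolding transform_bundle_def meet unfolding gauge_line_def using aw(2) by blast
  qed
qed

end

section \<open>Curvature spheres and uniqueness of parallel lines\<close>

context potential begin

text \<open>A section with value in the line of \<open>a x\<close> differs from a constant multiple
  of \<open>a\<close> by a section vanishing at \<open>x\<close>, whose derivative lies in
  \<open>f x\<close>. Hence a single section is enough to test the condition.\<close>

lemma curvature_sphereI:
  assumes x: "x \<in> U" and a: "fsec x a" "a x \<noteq> 0" and X: "X \<noteq> 0" "dd A a x X \<in> f x"
  shows "curvature_sphere A f x (span {a x})"
  unfolding curvature_sphere_def
proof (intro conjI exI[of _ "span {X}"] ballI impI)
  show "subspace (span {a x})" "subspace (span {X})" by simp_all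
  show "dim (span {a x}) = 1" by (rule dim_span_singleton[OF a(2)])
  show "span {a x} \<subseteq> f x" using fsec_in[OF a(1)] f_subspace by (intro span_minimal) auto
  show "span {X} \<noteq> {0}" using X(1) span_base[of X "{X}"] by auto
  fix X' \<zeta> assume X': "X' \<in> span {X}" and z: "\<zeta> \<in> sections A f x" "\<zeta> x \<in> span {a x}"
  obtain k where k: "\<zeta> x = k *\<^sub>R a x" using z(2) by (auto simp: span_singleton)
  obtain r where r: "X' = r *\<^sub>R X" using X' by (auto simp: span_singleton)
  have zs: "smooth_at A x \<zeta>" "\<forall>\<^sub>F y in nhds x. \<zeta> y \<in> f y" using z(1) by (auto simp: sections_iff)
  have as: "smooth_at A x a" "\<forall>\<^sub>F y in nhds x. a y \<in> f y" using a(1) by (auto simp: fsec_def)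
  obtain lam where g: "gen x lam" by (rule L_gen)
  let ?d = "\<lambda>y. \<zeta> y - k *\<^sub>R a y"
  have sd: "smooth_at A x (\<lambda>y. k *\<^sub>R a y)" by (intro smooth_at_scaleR smooth_at_const as)
  have "\<forall>\<^sub>F y in nhds x. ?d y \<in> f y"
    using zs(2) as(2) by eventually_elim (intro subspace_diff[OF f_subspace] subspace_scale[OF f_subspace])
  then have "fsec x ?d" unfolding fsec_def using smooth_at_diff[OF zs(1) sd] by blast
  moreover have "?d x = 0 *\<^sub>R \<sigma> x + 0 *\<^sub>R lam x" using k by simp
  ultimately obtain e where e: "\<And>X. e X \<in> f x" "\<And>X. dd A ?d x X = 0 *\<^sub>R dd A \<sigma> x X + 0 *\<^sub>R dd A lam x X + e X"
    using fsec_dd_expand[OF x g] by blast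
  have "dd A \<zeta> x X' = e X' + k *\<^sub>R dd A a x X'"
    using e(2)[of X'] dd_diff[OF zs(1) sd, of X'] dd_scaleR_const[OF as(1), of k X'] by (simp add: diff_eq_eq)
  also have "\<dots> = e X' + (k * r) *\<^sub>R dd A a x X" unfolding r linear_cmul[OF linear_dd[OF as(1)]] by simp
  finally show "dd A \<zeta> x X' \<in> f x" using subspace_add[OF f_subspace e(1) subspace_scale[OF f_subspace X(2)]] by simp
qed

lemma curvature_sphereD:
  assumes "curvature_sphere A f x c" "fsec x a" "a x \<in> c"
  obtains X where "X \<noteq> 0" "dd A a x X \<in> f x"
proof -
  obtain T where T: "subspace T" "T \<noteq> {0}" "\<And>X \<zeta>. X \<in> T \<Longrightarrow> \<zeta> \<in> sections A f x \<Longrightarrow> \<zeta> x \<in> c \<Longrightarrow> dd A \<zeta> x X \<in> f x"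
    using assms(1) unfolding curvature_sphere_def by blast
  obtain X where "X \<in> T" "X \<noteq> 0" using T(1,2) subspace_0 by blast
  then show ?thesis using that T(3) assms(2,3) unfolding fsec_def sections_iff by blast
qed

lemma line_parallel:
  assumes d: "darboux_line A U f \<eta> m s" and x: "x \<in> U" and e: "smooth_at A x e" "\<forall>\<^sub>F y in nhds x. e y \<in> s y"
  shows "dd A e x X + m *\<^sub>R \<eta> x X (e x) \<in> s x"
proof -
  have "e \<in> sections A s x" using e by (simp add: sections_iff)
  then show ?thesis using d x unfolding darboux_line_def parallel_def darboux_connection_def by blast
qed

lemma not_f_perp:
  assumes "nowhere_orthogonal A U f s" "x \<in> U" "\<exists>c. curvature_sphere A f x c"
  shows "\<not> f x \<subseteq> perp (s x)"
  using assms unfolding nowhere_orthogonal_def curvature_sphere_def by blast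

text \<open>Suitably normalised generators of the two lines differ by a section of \<open>f\<close>
  orthogonal to \<open>s1\<close>. Parallelism puts all its derivatives at \<open>x\<close> into
  \<open>f x\<close>, so a non-zero difference would span a curvature sphere orthogonal to
  \<open>s1\<close>.\<close>

lemma darboux_line_unique:
  assumes n: "nil_form U \<eta>" and s1: "darboux_line A U f \<eta> m s1" and s2: "darboux_line A U f \<eta> m s2"
    and cs: "\<And>x. x \<in> U \<Longrightarrow> \<exists>c. curvature_sphere A f x c"
    and eq: "\<And>x. x \<in> U \<Longrightarrow> transform_bundle f s1 x = transform_bundle f s2 x" and x: "x \<in> U"
  shows "s1 x = s2 x"
proof -
  have nb: "null_line_bundle A U s1" "null_line_bundle A U s2" and no: "nowhere_orthogonal A U f s1" "nowhere_orthogonal A U f s2"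
    using s1 s2 by (auto simp: darboux_line_def)
  obtain e1 where e1: "smooth_at A x e1" "\<forall>\<^sub>F y in nhds x. e1 y \<noteq> 0 \<and> s1 y = span {e1 y} \<and> form42 (e1 y) (e1 y) = 0"
    by (rule line_bundle_gen[OF nb(1) U x])
  obtain e2 where e2: "smooth_at A x e2" "\<forall>\<^sub>F y in nhds x. e2 y \<noteq> 0 \<and> s2 y = span {e2 y} \<and> form42 (e2 y) (e2 y) = 0"
    by (rule line_bundle_gen[OF nb(2) U x])
  note e1x = eventually_nhds_x_imp_x[OF e1(2)] and e2x = eventually_nhds_x_imp_x[OF e2(2)]
  have "\<exists>a0\<in>f x. form42 (e1 x) a0 \<noteq> 0"
  proof (rule ccontr)
    assume "\<not> ?thesis"
    then have "f x \<subseteq> perp (s1 x)" using e1x perp_span[of "{e1 x}"] by (auto simp: perp_def)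
    then show False using not_f_perp[OF no(1) x cs[OF x]] by blast
  qed
  then obtain a0 where a0: "a0 \<in> f x" "form42 (e1 x) a0 \<noteq> 0" by blast
  obtain a where a: "fsec x a" "a x = a0" by (rule fsec_extend[OF a0(1)])
  have as: "smooth_at A x a" "\<forall>\<^sub>F y in nhds x. a y \<in> f y" using a(1) by (auto simp: fsec_def)
  have sea: "smooth_at A x (\<lambda>y. form42 (e1 y) (a y))" "smooth_at A x (\<lambda>y. form42 (e2 y) (a y))"
    by (intro smooth_at_form42 e1 e2 as)+
  have key: "form42 (e2 y) (a y) \<noteq> 0 \<and>
      (1 / form42 (e2 y) (a y)) *\<^sub>R e2 y - (1 / form42 (e1 y) (a y)) *\<^sub>R e1 y \<in> f y \<inter> perp (s1 y)"
    if y: "y \<in> U" "a y \<in> f y" "form42 (e1 y) (a y) \<noteq> 0" "e1 y \<noteq> 0 \<and> s1 y = span {e1 y} \<and> form42 (e1 y) (e1 y) = 0"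
       "e2 y \<noteq> 0 \<and> s2 y = span {e2 y} \<and> form42 (e2 y) (e2 y) = 0" for y
  proof -
    have "e2 y \<in> transform_bundle f s2 y"
      unfolding transform_bundle_def using y(5) subspace_0[OF f_subspace] subspace_0[OF subspace_perp]
      by (intro CollectI exI[of _ 0] exI[of _ "e2 y"]) (auto simp: span_base)
    then have "e2 y \<in> transform_bundle f s1 y" using eq[OF y(1)] by simp
    then obtain b w where bw: "b \<in> f y \<inter> perp (s1 y)" "w \<in> s1 y" "e2 y = b + w" unfolding transform_bundle_def by blast
    then obtain k where k: "w = k *\<^sub>R e1 y" using y(4) by (auto simp: span_singleton)
    have e2a: "form42 (e2 y) (a y) = k * form42 (e1 y) (a y)"
      unfolding bw(3) k using isotropic_f[of b y "a y"] bw(1) y(2) by (simp add: form42_simps)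
    have "k \<noteq> 0"
    proof
      assume "k = 0"
      then have "e2 y \<in> f y" using bw k by simp
      then have "f y \<subseteq> perp (s2 y)"
        unfolding conjunct1[OF conjunct2[OF y(5)]] perp_span using isotropic_f by (simp add: perp_def subset_eq)
      then show False using not_f_perp[OF no(2) y(1) cs[OF y(1)]] by blast
    qed
    then have ne: "form42 (e2 y) (a y) \<noteq> 0" using e2a y(3) by simp
    have "(1 / form42 (e2 y) (a y)) *\<^sub>R e2 y - (1 / form42 (e1 y) (a y)) *\<^sub>R e1 y = (1 / form42 (e2 y) (a y)) *\<^sub>R b"
      unfolding e2a unfolding bw(3) k using \<open>k \<noteq> 0\<close> y(3) by (simp add: scaleR_add_right)
    then show ?thesis using ne bw(1) subspace_scale[OF subspace_inter[OF f_subspace subspace_perp]] by metis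
  qed
  have ev: "\<forall>\<^sub>F y in nhds x. y \<in> U \<and> a y \<in> f y \<and> form42 (e1 y) (a y) \<noteq> 0 \<and>
      (e1 y \<noteq> 0 \<and> s1 y = span {e1 y} \<and> form42 (e1 y) (e1 y) = 0) \<and> (e2 y \<noteq> 0 \<and> s2 y = span {e2 y} \<and> form42 (e2 y) (e2 y) = 0)"
  proof -
    have "form42 (e1 x) (a x) \<noteq> 0" using a0(2) a(2) by simp
    from eventually_conj[OF evU[OF x] eventually_conj[OF as(2) eventually_conj[OF smooth_at_nonzero[OF sea(1) this]
          eventually_conj[OF e1(2) e2(2)]]]]
    show ?thesis .
  qed
  note evx = eventually_nhds_x_imp_x[OF ev]
  \<comment> \<open>Both generators have pairing 1 with the same section \<open>a\<close> of
    \<open>f\<close>; the difference then has no component along \<open>s1\<close> and lies in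
    \<open>f\<close>.\<close>
  define g1 where "g1 = (\<lambda>y. (1 / form42 (e1 y) (a y)) *\<^sub>R e1 y)"
  define g2 where "g2 = (\<lambda>y. (1 / form42 (e2 y) (a y)) *\<^sub>R e2 y)"
  have nz: "form42 (e1 x) (a x) \<noteq> 0" "form42 (e2 x) (a x) \<noteq> 0" using key[of x] evx by blast+
  have sg: "smooth_at A x g1" "smooth_at A x g2"
    unfolding g1_def g2_def by (intro smooth_at_scaleR smooth_at_divide smooth_at_const sea nz e1 e2)+
  have gs: "\<forall>\<^sub>F y in nhds x. g1 y \<in> s1 y" "\<forall>\<^sub>F y in nhds x. g2 y \<in> s2 y"
    using ev by (eventually_elim, auto simp: g1_def g2_def intro: span_scale span_base)+
  have ds: "\<forall>\<^sub>F y in nhds x. g2 y - g1 y \<in> f y \<inter> perp (s1 y)"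
    using ev by eventually_elim (use key in \<open>auto simp: g1_def g2_def\<close>)
  note dx = eventually_nhds_x_imp_x[OF ds]
  have sd: "smooth_at A x (\<lambda>y. g2 y - g1 y)" by (intro smooth_at_diff sg)
  have fd: "fsec x (\<lambda>y. g2 y - g1 y)" unfolding fsec_def using sd ds by (auto elim: eventually_mono)
  have g1x: "g1 x \<noteq> 0" "s1 x = span {g1 x}" "form42 (g1 x) (a x) = 1" and g2x: "g2 x \<noteq> 0" "s2 x = span {g2 x}" "form42 (g2 x) (a x) = 1"
  proof -
    show 1: "form42 (g1 x) (a x) = 1" "form42 (g2 x) (a x) = 1" using nz by (simp_all add: g1_def g2_def form42_simps)
    then show 2: "g1 x \<noteq> 0" "g2 x \<noteq> 0" by (auto simp: form42_zero)
    show "s1 x = span {g1 x}" "s2 x = span {g2 x}"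
      using span_singleton_eqI[OF _ 2(1), of "e1 x"] span_singleton_eqI[OF _ 2(2), of "e2 x"] evx
        eventually_nhds_x_imp_x[OF gs(1)] eventually_nhds_x_imp_x[OF gs(2)] by auto
  qed
  have "g2 x - g1 x = 0"
  proof (rule ccontr)
    assume d0: "g2 x - g1 x \<noteq> 0"
    have "dd A (\<lambda>y. g2 y - g1 y) x X \<in> f x" for X
    proof -
      obtain r1 where r1: "dd A g1 x X + m *\<^sub>R \<eta> x X (g1 x) = r1 *\<^sub>R g1 x"
        using line_parallel[OF s1 x sg(1) gs(1), of X] unfolding g1x(2) by (auto simp: span_singleton)
      obtain r2 where r2: "dd A g2 x X + m *\<^sub>R \<eta> x X (g2 x) = r2 *\<^sub>R g2 x"
        using line_parallel[OF s2 x sg(2) gs(2), of X] unfolding g2x(2) by (auto simp: span_singleton)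
      \<comment> \<open>The terms with \<open>\<eta>\<close> agree because \<open>\<eta>\<close>
        kills \<open>f\<close>. Pairing with \<open>a\<close> then equates the factors
        \<open>r1\<close> and \<open>r2\<close>.\<close>
      have "\<eta> x X (g2 x - g1 x) = 0" using n x dx unfolding nil_form_def by blast
      then have "\<eta> x X (g2 x) = \<eta> x X (g1 x)" using n x linear_diff[of "\<eta> x X"] unfolding nil_form_def by auto
      then have dd: "dd A (\<lambda>y. g2 y - g1 y) x X = r2 *\<^sub>R g2 x - r1 *\<^sub>R g1 x"
        unfolding dd_diff[OF sg(2,1)] r1[symmetric] r2[symmetric] by simp
      have "form42 (dd A (\<lambda>y. g2 y - g1 y) x X) (a x) = 0" by (rule fsec_dd_orth(1)[OF fd fsec_in[OF a(1)]])
      then have "r2 = r1" unfolding dd using g1x(3) g2x(3) by (simp add: form42_simps)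
      then have "dd A (\<lambda>y. g2 y - g1 y) x X = r1 *\<^sub>R (g2 x - g1 x)" unfolding dd by (simp add: scaleR_diff_right)
      then show ?thesis using dx subspace_scale[OF f_subspace] by auto
    qed
    then have "curvature_sphere A f x (span {g2 x - g1 x})"
      using curvature_sphereI[OF x fd d0, of "axis 1 1"] by (simp add: axis_eq_0_iff)
    moreover have "span {g2 x - g1 x} \<subseteq> perp (s1 x)" using dx subspace_perp by (intro span_minimal) auto
    ultimately show False using no(1) x unfolding nowhere_orthogonal_def by blast
  qed
  then show ?thesis using g1x(2) g2x(2) by simp
qed

text \<open>Curvature spheres are defined point by point, without any statement on how they vary, so
  openness needs a determinant. Near \<open>x\<close> exactly one line of \<open>f y\<close> is
  orthogonal to \<open>\<xi> y\<close>, and it is a curvature sphere only where a determinant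
  vanishes that depends smoothly on \<open>y\<close>.\<close>

lemma eventually_not_orthogonal:
  assumes x: "x \<in> U" and \<xi>: "smooth_at A x \<xi>" and g: "gen x lam" and nz: "form42 (lam x) (\<xi> x) \<noteq> 0"
    and no: "\<And>c. curvature_sphere A f x c \<Longrightarrow> \<not> c \<subseteq> perp {\<xi> x}"
  shows "\<forall>\<^sub>F y in nhds x. \<forall>c. curvature_sphere A f y c \<longrightarrow> \<not> c \<subseteq> perp {\<xi> y}"
proof -
  let ?E = "coord_field A (chart_at A x)"
  let ?e = "\<lambda>i. axis i 1 :: real^2"
  \<comment> \<open>The coefficient that makes \<open>t\<close> orthogonal to \<open>\<xi>\<close>,
    so that \<open>t y\<close> spans the only line of \<open>f y\<close> orthogonal to
    \<open>\<xi> y\<close>.\<close>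
  define k where "k = (\<lambda>y. form42 (\<sigma> y) (\<xi> y) / form42 (lam y) (\<xi> y))"
  define t where "t = (\<lambda>y. \<sigma> y - k y *\<^sub>R lam y)"
  have sk: "smooth_at A x k" unfolding k_def by (intro smooth_at_divide smooth_at_form42 \<sigma>D x genD(1)[OF g] \<xi> nz)
  have st: "smooth_at A x t" unfolding t_def by (intro smooth_at_diff smooth_at_scaleR sk \<sigma>D x genD(1)[OF g])
  have snz: "\<forall>\<^sub>F y in nhds x. form42 (lam y) (\<xi> y) \<noteq> 0"
    by (intro smooth_at_nonzero smooth_at_form42 genD(1)[OF g] \<xi> nz)
  have evg: "\<forall>\<^sub>F y in nhds x. gen y lam"
  proof -
    have "\<forall>\<^sub>F y in nhds x. \<forall>\<^sub>F z in nhds y. lam z \<noteq> 0 \<and> L z = span {lam z}"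
      using g by (simp add: gen_def eventually_eventually)
    then show ?thesis using smooth_at_eventually[OF genD(1)[OF g]] by eventually_elim (simp add: gen_def)
  qed
  have evt: "\<forall>\<^sub>F y in nhds x. t y \<in> f y"
    using evU[OF x] genD(5)[OF g] unfolding t_def
    by eventually_elim (intro subspace_diff[OF f_subspace] subspace_scale[OF f_subspace] \<sigma>D Lf_in)
  have evft: "\<forall>\<^sub>F y in nhds x. fsec y t"
  proof -
    have "\<forall>\<^sub>F y in nhds x. \<forall>\<^sub>F z in nhds y. t z \<in> f z" using evt by (simp add: eventually_eventually)
    then show ?thesis using smooth_at_eventually[OF st] by eventually_elim (simp add: fsec_def)
  qed
  have tx: "t y \<noteq> 0 \<and> form42 (\<xi> y) (t y) = 0 \<and> form42 (t y) p = 1 \<and> (\<forall>a\<in>f y. form42 (\<xi> y) a = 0 \<longrightarrow> a \<in> span {t y})"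
    if y: "y \<in> U" "gen y lam" "form42 (lam y) (\<xi> y) \<noteq> 0" for y
  proof -
    have tp: "form42 (t y) p = 1" unfolding t_def using \<sigma>D(3)[OF y(1)] L_p(1)[OF genD(4)[OF y(2)]] by (simp add: form42_simps)
    have xt: "form42 (\<xi> y) (t y) = 0"
      unfolding t_def k_def using y(3) by (simp add: form42_simps form42_commute[of "\<xi> y"])
    have "a \<in> span {t y}" if aa: "a \<in> f y" "form42 (\<xi> y) a = 0" for a
    proof -
      obtain r s where a: "a = r *\<^sub>R \<sigma> y + s *\<^sub>R lam y" using f_span[OF \<sigma>D(2,3)[OF y(1)] y(2)] aa(1) by (auto simp: in_span_2)
      have a': "a = r *\<^sub>R t y + (s + r * k y) *\<^sub>R lam y" unfolding a t_def by (simp add: algebra_simps)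
      have "(s + r * k y) * form42 (\<xi> y) (lam y) = 0"
        using aa(2) unfolding a' using xt by (simp add: form42_simps)
      then have "s + r * k y = 0" using y(3) by (simp add: form42_commute[of "lam y"])
      then show ?thesis unfolding a' by (simp add: span_scale span_base)
    qed
    then show ?thesis using tp xt by (auto simp: form42_zero)
  qed
  \<comment> \<open>Pairings of the derivatives of \<open>t\<close> with those of
    \<open>lam\<close>. A kernel vector of this matrix is a direction in which the derivative of
    \<open>t\<close> lies in \<open>f\<close>, so singularity means that \<open>t\<close> spans a
    curvature sphere.\<close>
  define H where "H = (\<lambda>i j y. form42 (dd A t y (?E (?e i) y)) (dd A lam y (?E (?e j) y)))"
  have sH: "smooth_at A x (H i j)" for i j
    unfolding H_def by (intro smooth_at_form42 smooth_at_dd chart_at st genD(1)[OF g])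
  define det where "det = (\<lambda>y. H 1 1 y * H 2 2 y - H 1 2 y * H 2 1 y)"
  have comb: "form42 (dd A t y (?E v y)) (dd A lam y (?E (?e j) y)) = v $ 1 * H 1 j y + v $ 2 * H 2 j y"
    if y: "smooth_at A y t" "y \<in> fst (chart_at A x)" for y v j
  proof -
    have "?E v y = v $ 1 *\<^sub>R ?E (?e 1) y + v $ 2 *\<^sub>R ?E (?e 2) y"
      using linear_add[OF linear_coord_field[OF chart_at(1) y(2)]] linear_cmul[OF linear_coord_field[OF chart_at(1) y(2)]]
      by (subst vec2_expand) simp
    then show ?thesis unfolding H_def
      by (simp add: linear_add[OF linear_dd[OF y(1)]] linear_cmul[OF linear_dd[OF y(1)]] form42_simps)
  qed
  have comb2: "form42 b (dd A lam y Y) = 0"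
    if y: "smooth_at A y lam" "y \<in> fst (chart_at A x)" and b: "form42 b (dd A lam y (?E (?e 1) y)) = 0" "form42 b (dd A lam y (?E (?e 2) y)) = 0"
    for y b Y
  proof -
    obtain v where "?E v y = Y" by (rule coord_field_surj[OF chart_at(1) y(2)])
    moreover have "?E v y = v $ 1 *\<^sub>R ?E (?e 1) y + v $ 2 *\<^sub>R ?E (?e 2) y"
      using linear_add[OF linear_coord_field[OF chart_at(1) y(2)]] linear_cmul[OF linear_coord_field[OF chart_at(1) y(2)]]
      by (subst vec2_expand) simp
    ultimately show ?thesis using b
      by (metis (no_types) linear_add[OF linear_dd[OF y(1)]] linear_cmul[OF linear_dd[OF y(1)]] form42_simps(2,6) mult_zero_right add_0)
  qed
  have dx: "det x \<noteq> 0"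
  proof
    assume "det x = 0"
    then obtain v :: "real^2" where v: "v \<noteq> 0" "v $ 1 * H 1 1 x + v $ 2 * H 2 1 x = 0" "v $ 1 * H 1 2 x + v $ 2 * H 2 2 x = 0"
      unfolding det_def by (rule singular_2x2)
    let ?b = "dd A t x (?E v x)"
    have ft: "fsec x t" by (rule eventually_nhds_x_imp_x[OF evft])
    note T = tx[OF x g nz]
    have "form42 ?b (dd A lam x Y) = 0" for Y
      by (rule comb2[OF genD(1)[OF g] chart_at(2)]) (simp_all add: comb[OF st chart_at(2)] v)
    moreover have "?b \<in> perp {p, \<sigma> x, lam x}"
    proof -
      have "\<forall>\<^sub>F y in nhds x. form42 p (t y) = 1"
        using evU[OF x] evg snz by eventually_elim (use tx in \<open>simp add: form42_commute[of p]\<close>)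
      from dd_form42_const[OF smooth_at_const st this, of "?E v x"]
      have "form42 p ?b = 0" by (simp add: dd_const form42_zero)
      then show ?thesis
        using fsec_dd_orth(2)[OF ft \<sigma>D(2)[OF x], of "?E v x"] fsec_dd_orth(2)[OF ft Lf_in[OF genD(4)[OF g]], of "?E v x"] by (simp add: perp_def)
    qed
    ultimately have "?b \<in> span {lam x}" by (intro orth_dlam[OF x g])
    then have "?b \<in> f x" using genD(3)[OF g] Lf_in by blast
    moreover have "?E v x \<noteq> 0" using coord_field_inj[OF chart_at] v(1) by blast
    ultimately have "curvature_sphere A f x (span {t x})" using curvature_sphereI[OF x ft] T by blast
    moreover have "span {t x} \<subseteq> perp {\<xi> x}" by (intro span_minimal subspace_perp) (use T in \<open>simp add: perp_def\<close>)
    ultimately show False using no by blast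
  qed
  have "\<forall>\<^sub>F y in nhds x. det y \<noteq> 0"
    using dx by (intro smooth_at_nonzero) (auto simp: det_def intro!: smooth_at_diff smooth_at_mult sH)
  then show ?thesis
    using evU[OF x] evg snz evft eventually_nhds_in_open[OF open_chart[OF chart_at(1)] chart_at(2)[of x]]
  proof eventually_elim
    case (elim y)
    show ?case
    proof (intro allI impI notI)
      fix c assume c: "curvature_sphere A f y c" "c \<subseteq> perp {\<xi> y}"
      obtain a where a: "a \<noteq> 0" "c = span {a}" using c(1) dim1_obtain unfolding curvature_sphere_def by metis
      have af: "a \<in> f y" "form42 (\<xi> y) a = 0" using c a(2) span_base[of a "{a}"] unfolding curvature_sphere_def perp_def by blast+
      note T = tx[OF elim(2-4)]
      have "a \<in> span {t y}" using T af by blast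
      then have "c = span {t y}" using span_singleton_eqI[OF _ a(1)] a(2) by blast
      then obtain X where X: "X \<noteq> 0" "dd A t y X \<in> f y"
        using curvature_sphereD[OF c(1) elim(5)] span_base[of "t y" "{t y}"] by blast
      obtain v where v: "?E v y = X" by (rule coord_field_surj[OF chart_at(1) elim(6)])
      have ty: "smooth_at A y t" using elim(5) by (simp add: fsec_def)
      have z: "form42 (dd A t y X) (dd A lam y Y) = 0" for Y
        using fsec_dd_orth(2)[OF gen_fsec[OF elim(3)] X(2)] .
      have "v = 0"
        by (rule nonsingular_2x2[of "H 1 1 y" "H 2 2 y" "H 1 2 y" "H 2 1 y"])
          (use elim(1) z comb[OF ty elim(6), of v, symmetric] v in \<open>simp_all add: det_def\<close>)
      then show False using X(1) v linear_0[OF linear_coord_field[OF chart_at(1) elim(6)]] by simp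
    qed
  qed
qed

end

context guichard begin

lemma restrict:
  assumes W: "open W" "W \<subseteq> U" shows "guichard A p L f W V \<sigma> chi"
proof unfold_locales
  show "open W" by (rule W)
  show "normalized W \<sigma>" using norm\<sigma> W(2) unfolding normalized_def by blast
  show "\<And>x. x \<in> W \<Longrightarrow> V x = perp {p, \<sigma> x}" using V W(2) by blast
  show "form1 A W (\<lambda>x. wedge_space (L x) (derived A L x)) chi"
    using chi W(2) smooth_map_mono[OF _ Int_mono[OF W(2) order_refl]] unfolding form1_def by blast
  have "subbundle A W 4 V"
    using subbundle_restrict[OF _ W] sc unfolding sphere_congruence_def by blast
  then show "sphere_congruence A W p V" using sc W(2) unfolding sphere_congruence_def by blast
  show "flat A W (guichard_connection A V chi t)" for t using fl[of t] W(2) unfolding flat_def by blast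
qed

end

subsection \<open>Eisenhart transforms as Darboux transforms\<close>

locale umbilic_free_guichard = guichard A p L f UNIV V \<sigma> chi for A :: "'a::t2_space chart set" and p L f V \<sigma> chi +
  assumes umb: "umbilic_free A UNIV f"
    and nd: "\<And>x. nondegenerate (guichard_quad_diff A L V chi x)"
begin

definition tau :: "('a \<Rightarrow> R42) \<Rightarrow> 'a \<Rightarrow> R42 \<Rightarrow> R42" where
  "tau ell x w = K *\<^sub>R wedge (\<sigma> x) (ell x) w"

abbreviation q where "q \<equiv> guichard_quad_diff A L V chi"

lemma curvature_sphere_exists: "\<exists>c. curvature_sphere A f x c"
  and curvature_spheres_finite: "finite {c. curvature_sphere A f x c}"
proof -
  have c: "card {c. curvature_sphere A f x c} = 2" using umb by (simp add: umbilic_free_def)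
  show "finite {c. curvature_sphere A f x c}" by (rule card_ge_0_finite) (simp add: c)
  show "\<exists>c. curvature_sphere A f x c" using c by (metis card.empty empty_Collect_eq zero_neq_numeral)
qed

lemma nil_form_eta: "nil_form U eta"
  unfolding nil_form_def using eta_linear(1) eta_f eta_perp by blast

lemma gauge_field_tau:
  assumes U: "open U" and ell: "\<And>x. x \<in> U \<Longrightarrow> smooth_at A x ell" "\<And>x. x \<in> U \<Longrightarrow> ell x \<in> L x"
  shows "gauge_field U (tau ell)"
  unfolding gauge_field_def
proof (intro conjI ballI allI)
  fix x assume x: "x \<in> U"
  have "tau ell x = (\<lambda>w. K *\<^sub>R wedge (\<sigma> x) (ell x) w)" by (rule ext) (simp add: tau_def)
  then show "tau ell x \<in> wedge_space (f x) (f x)"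
    using wedge_space_scaleR[OF wedge_in_wedge_space[OF \<sigma>D(2)[OF UNIV_I] Lf_in[OF ell(2)[OF x]]] f_subspace] by simp
next
  fix w
  have "smooth_at A x (\<lambda>y. tau ell y w)" if "x \<in> U" for x
    unfolding tau_def by (intro smooth_at_scaleR smooth_at_const smooth_at_wedge \<sigma>D ell that UNIV_I)
  then show "smooth_map A U (\<lambda>x. tau ell x w)" using smooth_map_iff[OF U] by blast
qed

lemma gauge_orbit_iff:
  "\<eta>' \<in> gauge_orbit A U f \<eta> \<longleftrightarrow> (\<exists>\<tau>. gauge_field U \<tau> \<and> (\<forall>x\<in>U. \<forall>X w. \<eta>' x X w = gauge_form \<eta> \<tau> x X w))"
  unfolding gauge_orbit_def gauge_field_def gauge_form_def by auto

text \<open>Every enveloped sphere congruence over \<open>U\<close> comes from some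
  \<open>\<sigma> + ell\<close>, and by \<open>chi_unique\<close> the prescribed quadratic
  differential leaves the form of \<open>shifted\<close> as the only one. Then
  \<open>parallel_iff\<close> replaces the Guichard connection by the Darboux connection in the
  gauge of \<open>ell\<close>. On the right the value of \<open>m\<close> enters only through its
  square, apart from the excluded values.\<close>

lemma eisenhart_iff:
  assumes U: "open U"
  shows "eisenhart_transform A U p L f q m M \<longleftrightarrow> m \<noteq> 0 \<and> m \<noteq> 1 \<and> m \<noteq> -1 \<and>
    (\<exists>ell. (\<forall>x\<in>U. smooth_at A x ell \<and> ell x \<in> L x \<and> M x \<subseteq> perp {p, \<sigma> x + ell x}) \<and>
      darboux_line A U f (gauge_form eta (tau ell)) ((m\<^sup>2 - 1) / 2) M)" (is "?l \<longleftrightarrow> ?r")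
proof -
  interpret R: guichard A p L f U V \<sigma> chi by (rule restrict[OF U subset_UNIV])
  have form_eq: "gauge_form eta (tau ell) x X w = eta x X w - dd A (\<lambda>y. K *\<^sub>R wedge (\<sigma> y) (ell y) w) x X" for ell x X w
    by (simp add: gauge_form_def tau_def)
  have msq: "m\<^sup>2 \<noteq> 1" if "m \<noteq> 1" "m \<noteq> -1" using that by (simp add: power2_eq_1_iff)
  show ?thesis
  proof
    assume l: ?l
    then obtain V1 chi1 where m: "m \<noteq> 0" "m \<noteq> 1" "m \<noteq> -1" and nb: "null_line_bundle A U M" and no: "nowhere_orthogonal A U f M"
      and gp: "guichard_potential A U p L V1 chi1" and q1: "\<And>x X Y. x \<in> U \<Longrightarrow> guichard_quad_diff A L V1 chi1 x X Y = q x X Y"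
      and env: "envelops A U M V1" and par: "parallel A U (guichard_connection A V1 chi1 m) M"
      unfolding eisenhart_transform_def by blast
    have sc1: "sphere_congruence A U p V1" "envelops A U L V1" using gp by (auto simp: guichard_potential_def)
    obtain \<sigma>1 where s1: "normalized U \<sigma>1" "\<And>x. x \<in> U \<Longrightarrow> V1 x = perp {p, \<sigma>1 x}"
      by (rule normal_section_exists[OF U sc1]) blast
    define ell where "ell = (\<lambda>x. \<sigma>1 x - \<sigma> x)"
    have s1D: "smooth_at A x \<sigma>1" "\<sigma>1 x \<in> f x" "form42 (\<sigma>1 x) p = 1" if "x \<in> U" for x
      using s1(1) that by (auto simp: normalized_def)
    have ell: "smooth_at A x ell" "ell x \<in> L x" if "x \<in> U" for x
      unfolding ell_def using s1D[OF that] \<sigma>D(1)[of x] f_decompose[OF \<sigma>D(2,3)[of x] s1D(2)[OF that]]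
      by (auto intro: smooth_at_diff)
    have V1: "V1 x = perp {p, \<sigma> x + ell x}" if "x \<in> U" for x using s1(2)[OF that] by (simp add: ell_def)
    interpret S: shifted A p L f U V \<sigma> chi ell V1 using ell V1 by unfold_locales
    have f1: "form1 A U (\<lambda>x. wedge_space (L x) (derived A L x)) chi1" using gp by (simp add: guichard_potential_def)
    interpret P1: potential A p L f U V1 "\<lambda>x. \<sigma> x + ell x" chi1 using f1 by unfold_locales
    have chieq: "chi1 x X w = S.chi' x X w" if "x \<in> U" for x X w
      using S.S.chi_unique[OF f1 _ that] q1 S.quad_eq by simp
    have eq: "gauge_form eta (tau ell) x X w = P1.eta x X w" if "x \<in> U" for x X w
    proof -
      have "P1.eta x X w = S.S.eta x X w" unfolding P1.eta_def S.S.eta_def chieq[OF that] ..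
      then show ?thesis unfolding form_eq S.eta_shift[OF that] by simp
    qed
    have MV: "M x \<subseteq> V1 x" if x: "x \<in> U" for x
    proof -
      obtain e where e: "smooth_at A x e" "\<forall>\<^sub>F y in nhds x. e y \<noteq> 0 \<and> M y = span {e y} \<and> form42 (e y) (e y) = 0"
        by (rule line_bundle_gen[OF nb U x])
      have "\<forall>\<^sub>F y in nhds x. e y \<in> M y" using e(2) by eventually_elim (simp add: span_base)
      then have "e \<in> sections A M x" using e(1) by (simp add: sections_iff)
      then have "e x \<in> derived A M x" unfolding derived_def by (intro span_base) blast
      then have "e x \<in> V1 x" using env x unfolding envelops_def by blast
      then show ?thesis using eventually_nhds_x_imp_x[OF e(2)] V1[OF x] subspace_perp by (simp add: span_minimal)
    qed
    have "parallel A U (darboux_connection A (gauge_form eta (tau ell)) ((m\<^sup>2 - 1) / 2)) M"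
      using P1.parallel_iff[OF nb MV msq[OF m(2,3)] eq] env par by blast
    then show ?r using m nb no ell MV V1 unfolding darboux_line_def by blast
  next
    assume r: ?r
    then obtain ell where m: "m \<noteq> 0" "m \<noteq> 1" "m \<noteq> -1"
      and ell: "\<And>x. x \<in> U \<Longrightarrow> smooth_at A x ell" "\<And>x. x \<in> U \<Longrightarrow> ell x \<in> L x"
      and MV: "\<And>x. x \<in> U \<Longrightarrow> M x \<subseteq> perp {p, \<sigma> x + ell x}"
      and d: "darboux_line A U f (gauge_form eta (tau ell)) ((m\<^sup>2 - 1) / 2) M" by blast
    interpret S: shifted A p L f U V \<sigma> chi ell "\<lambda>x. perp {p, \<sigma> x + ell x}" using ell by unfold_locales auto
    have eq: "gauge_form eta (tau ell) x X w = S.S.eta x X w" if "x \<in> U" for x X w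
      unfolding form_eq S.eta_shift[OF that] ..
    have "envelops A U M (\<lambda>x. perp {p, \<sigma> x + ell x}) \<and> parallel A U (guichard_connection A (\<lambda>x. perp {p, \<sigma> x + ell x}) S.chi' m) M"
      using S.S.parallel_iff[OF _ MV msq[OF m(2,3)] eq] d unfolding darboux_line_def by blast
    then show ?l unfolding eisenhart_transform_def
      using m d S.guichard_potential_shift S.quad_eq unfolding darboux_line_def by blast
  qed
qed

lemma quad_diff_q: "quad_diff A f eta x X Y = q x X Y"
  by (rule quad_diff_eq) simp_all

text \<open>The quadratic differential with the trace on \<open>L\<close> extracted by pairing with
  a fixed vector \<open>w\<close>. In contrast to a trace over chosen sections, this expression is
  visibly smooth in the point.\<close>

definition Q :: "('a \<Rightarrow> R42) \<Rightarrow> R42 \<Rightarrow> 'a \<Rightarrow> real^2 \<Rightarrow> real^2 \<Rightarrow> real" where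
  "Q lam w y X Y = 2 * (form42 (chi y X (dd A lam y Y)) w / form42 (lam y) w) + K * form42 (dd A \<sigma> y X) (dd A \<sigma> y Y)"

lemma q_eq_Q: assumes g: "gen x lam" and w: "form42 (lam x) w \<noteq> 0" shows "q x X Y = Q lam w x X Y"
proof -
  obtain r where r: "chi x X (dd A lam x Y) = r *\<^sub>R lam x" by (rule chi_dlam[OF UNIV_I g])
  have "form42 (chi x X (dd A lam x Y)) w / form42 (lam x) w = r" unfolding r using w by (simp add: form42_simps)
  then show ?thesis using guichard_quad_diff_eq[OF UNIV_I g r] by (simp add: Q_def)
qed

text \<open>Bilinearity is read off from \<open>Q\<close>; symmetry is \<open>chi_ell_sym\<close>
  applied to the generator \<open>lam\<close>.\<close>

lemma q_bilinear: "bilinear (q x)" and q_sym: "q x X Y = q x Y X"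
proof -
  obtain lam where g: "gen x lam" by (rule L_gen)
  obtain w where w: "form42 (lam x) w \<noteq> 0" using form42_nondegenerate genD(2)[OF g] by blast
  note eq = q_eq_Q[OF g w]
  note l1 = chi_linear(1)[OF UNIV_I, of x] and l2 = chi_linear(2)[OF UNIV_I, of x]
    and l3 = linear_dd[OF genD(1)[OF g]] and l4 = linear_dd[OF \<sigma>D(1)[OF UNIV_I], of x]
  show "bilinear (q x)"
    unfolding bilinear_def eq Q_def
    by (intro conjI allI linearI)
      (simp_all add: linear_add[OF l1] linear_cmul[OF l1] linear_add[OF l2] linear_cmul[OF l2] linear_add[OF l3] linear_cmul[OF l3]
        linear_add[OF l4] linear_cmul[OF l4] form42_simps algebra_simps add_divide_distrib)
  show "q x X Y = q x Y X"
    unfolding eq Q_def using chi_ell_sym[OF UNIV_I genD(1,5)[OF g], of X Y] by (simp add: form42_commute)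
qed

text \<open>In a coordinate frame the determinant \<open>D\<close> of the quadratic differential is
  smooth and, by non-degeneracy, non-zero. Its sign, and for positive \<open>D\<close> also the sign
  of the first diagonal entry, persists nearby and fixes the signature.\<close>

lemma q_signature:
  "\<forall>\<^sub>F y in nhds x. signature (q y) UNIV = signature (q x) UNIV"
proof -
  let ?c = "chart_at A x"
  let ?E = "coord_field A ?c"
  let ?e = "axis 1 1 :: real^2" and ?f = "axis 2 1 :: real^2"
  obtain lam where g: "gen x lam" by (rule L_gen)
  obtain w where w: "form42 (lam x) w \<noteq> 0" using form42_nondegenerate genD(2)[OF g] by blast
  define b where "b = (\<lambda>y v w. q y (?E v y) (?E w y))"
  have sb: "smooth_at A x (\<lambda>y. Q lam w y (?E u y) (?E v y))" for u v
  proof -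
    have slw: "smooth_at A x (\<lambda>y. form42 (lam y) w)" by (intro smooth_at_form42 smooth_at_const genD(1)[OF g])
    have "smooth_at A x (\<lambda>y. chi y (?E u y) (dd A lam y (?E v y)))"
      by (rule smooth_at_apply[OF chi_smooth[OF chart_at(1) UNIV_I chart_at(2)] _ smooth_at_dd[OF chart_at genD(1)[OF g]]])
        (simp add: chi_linear)
    then show ?thesis unfolding Q_def
      by (intro smooth_at_add smooth_at_mult smooth_at_divide smooth_at_form42 smooth_at_const slw w smooth_at_dd chart_at \<sigma>D UNIV_I)
  qed
  have evg: "\<forall>\<^sub>F y in nhds x. gen y lam \<and> form42 (lam y) w \<noteq> 0"
  proof -
    have "\<forall>\<^sub>F y in nhds x. \<forall>\<^sub>F z in nhds y. lam z \<noteq> 0 \<and> L z = span {lam z}"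
      using g by (simp add: gen_def eventually_eventually)
    moreover have "\<forall>\<^sub>F y in nhds x. form42 (lam y) w \<noteq> 0"
      by (intro smooth_at_nonzero smooth_at_form42 smooth_at_const genD(1)[OF g] w)
    ultimately show ?thesis using smooth_at_eventually[OF genD(1)[OF g]] by eventually_elim (simp add: gen_def)
  qed
  have sm: "smooth_at A x (\<lambda>y. b y u v)" for u v
    by (rule smooth_at_cong[OF sb[of u v]]) (use evg in \<open>eventually_elim, simp add: b_def q_eq_Q[where lam = lam and w = w]\<close>)
  define D where "D = (\<lambda>y. b y ?e ?e * b y ?f ?f - (b y ?e ?f)\<^sup>2)"
  have sD: "smooth_at A x D" unfolding D_def power2_eq_square by (intro smooth_at_diff smooth_at_mult sm)
  have evc: "\<forall>\<^sub>F y in nhds x. y \<in> fst ?c" by (rule eventually_nhds_in_open[OF open_chart[OF chart_at(1)] chart_at(2)])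
  have bl: "bilinear (b y)" if "y \<in> fst ?c" for y
    unfolding bilinear_def b_def
    using linear_compose[OF linear_coord_field[OF chart_at(1) that]] q_bilinear[of y]
    unfolding bilinear_def comp_def by blast
  have bs: "b y u v = b y v u" for y u v unfolding b_def by (rule q_sym)
  have sig: "signature (q y) UNIV = signature (b y) UNIV" if y: "y \<in> fst ?c" for y
  proof (rule signature_isometry[where T = "\<lambda>v. ?E v y"])
    show "linear (\<lambda>v. ?E v y)" by (rule linear_coord_field[OF chart_at(1) y])
    then show "inj_on (\<lambda>v. ?E v y) UNIV"
      using linear_injective_0 coord_field_inj[OF chart_at(1) y] by blast
    show "(\<lambda>v. ?E v y) ` UNIV = UNIV" using coord_field_surj[OF chart_at(1) y] by (metis UNIV_eq_I rangeI)
  qed (simp_all add: b_def)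
  have basis: "\<exists>r s. v = r *\<^sub>R ?e + s *\<^sub>R ?f" for v using vec2_expand by blast
  have ind: "r = 0 \<and> s = 0" if "r *\<^sub>R ?e + s *\<^sub>R ?f = 0" for r s
    using that by (simp add: vec_eq_iff forall_2 axis_def)
  have plane: "D y > 0 \<Longrightarrow> b y ?e ?e > 0 \<Longrightarrow> signature (q y) UNIV = (2, 0)"
    "D y > 0 \<Longrightarrow> b y ?e ?e < 0 \<Longrightarrow> signature (q y) UNIV = (0, 2)"
    "D y < 0 \<Longrightarrow> signature (q y) UNIV = (1, 1)" if y: "y \<in> fst ?c" for y
    using signature_plane[OF bl[OF y] bs basis ind] sig[OF y] unfolding D_def by auto
  have xc: "x \<in> fst ?c" by (rule chart_at(2))
  have "D x \<noteq> 0"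
  proof
    assume "D x = 0"
    then have "b x ?e ?e * b x ?f ?f - b x ?e ?f * b x ?f ?e = 0" unfolding D_def using bs[of x ?f ?e] by (simp add: power2_eq_square)
    then obtain v :: "real^2" where v: "v \<noteq> 0" "v $ 1 * b x ?e ?e + v $ 2 * b x ?f ?e = 0" "v $ 1 * b x ?e ?f + v $ 2 * b x ?f ?f = 0"
      by (rule singular_2x2)
    have bv: "b x v ?e = 0" "b x v ?f = 0"
      using v(2,3) by (subst vec2_expand[of v], simp add: bilinear_ladd[OF bl[OF xc]] bilinear_lmul[OF bl[OF xc]])+
    have "b x v u = 0" for u
      by (subst vec2_expand[of u]) (simp add: bilinear_radd[OF bl[OF xc]] bilinear_rmul[OF bl[OF xc]] bv)
    then have "q x (?E v x) Y = 0" for Y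
      using coord_field_surj[OF chart_at(1) xc, of Y] unfolding b_def by metis
    then have "?E v x = 0" using nd[of x] unfolding nondegenerate_def by blast
    then show False using coord_field_inj[OF chart_at(1) xc] v(1) by blast
  qed
  then consider "D x < 0" | "D x > 0" "b x ?e ?e > 0" | "D x > 0" "b x ?e ?e < 0"
  proof -
    have "b x ?e ?e \<noteq> 0" if "D x > 0" using that unfolding D_def by (metis diff_0 less_numeral_extra(3) mult_zero_left neg_0_less_iff_less not_less zero_le_power2)
    then show ?thesis using \<open>D x \<noteq> 0\<close> that by linarith
  qed
  then show ?thesis
  proof cases
    case 1
    show ?thesis using order_tendstoD(2)[OF smooth_at_tendsto[OF sD] 1] evc
      by eventually_elim (simp add: plane(3) 1 xc)
  next
    case 2
    show ?thesis using order_tendstoD(1)[OF smooth_at_tendsto[OF sD] 2(1)] order_tendstoD(1)[OF smooth_at_tendsto[OF sm] 2(2)] evc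
      by eventually_elim (simp add: plane(1) 2 xc)
  next
    case 3
    show ?thesis using order_tendstoD(1)[OF smooth_at_tendsto[OF sD] 3(1)] order_tendstoD(2)[OF smooth_at_tendsto[OF sm] 3(2)] evc
      by eventually_elim (simp add: plane(2) 3 xc)
  qed
qed

lemma Omega: assumes U: "open U" shows "Omega_surface A U f eta"
proof -
  have l: "legendre_map A U f"
    using leg subbundle_restrict[OF f_subbundle U subset_UNIV] unfolding legendre_map_def by blast
  have f1: "form1 A U (\<lambda>x. wedge_space (f x) (perp (f x))) eta"
    using eta_form1 smooth_map_mono[OF _ Int_mono[OF subset_UNIV order_refl]] unfolding form1_def by blast
  have cl: "closed_form A U eta" using eta_closed unfolding closed_form_def by blast
  have qd: "quad_diff A f eta x = q x" for x by (intro ext quad_diff_q)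
  have ne: "\<exists>X Y. q x X Y \<noteq> 0" for x
  proof (rule ccontr)
    assume "\<not> ?thesis"
    then have "(axis 1 1 :: real^2) = 0" using nd[of x] unfolding nondegenerate_def by blast
    then show False by (simp add: axis_eq_0_iff)
  qed
  have sg: "\<exists>N. open N \<and> x \<in> N \<and> N \<subseteq> U \<and> (\<forall>y\<in>N. signature (q y) UNIV = signature (q x) UNIV)" if x: "x \<in> U" for x
  proof -
    have "\<forall>\<^sub>F y in nhds x. y \<in> U \<and> signature (q y) UNIV = signature (q x) UNIV"
      by (intro eventually_conj eventually_nhds_in_open[OF U x] q_signature)
    then obtain N where N: "open N" "x \<in> N" "\<forall>y\<in>N. y \<in> U \<and> signature (q y) UNIV = signature (q x) UNIV"
      unfolding eventually_nhds by (elim exE conjE) (rule that)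
    from N(3) have "N \<subseteq> U" "\<forall>y\<in>N. signature (q y) UNIV = signature (q x) UNIV" by simp_all blast
    then show ?thesis using N(1,2) by (intro exI[of _ N] conjI)
  qed
  have "gauge_potential A U f eta"
    unfolding gauge_potential_def qd using f1 cl ne sg eta_comm by blast
  \<comment> \<open>The dense open set on which the quadratic differential is non-degenerate is
    \<open>U\<close> itself.\<close>
  then show ?thesis unfolding Omega_surface_def qd using l nd U closure_subset by blast
qed

abbreviation F where "F \<equiv> eisenhart_family A p L f q (\<lambda>m. (m\<^sup>2 - 1) / 2)"

lemma family_darboux:
  assumes U: "open U" and fh: "fhat \<in> F U m'"
  shows "darboux_transform A U f eta m' fhat"
proof -
  obtain m M where m: "(m\<^sup>2 - 1) / 2 = m'" and e: "eisenhart_transform A U p L f q m M"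
    and t: "\<forall>x\<in>U. fhat x = transform_bundle f M x" using fh unfolding eisenhart_family_def by blast
  from e obtain ell where m1: "m \<noteq> 1" "m \<noteq> -1" and ell: "\<And>x. x \<in> U \<Longrightarrow> smooth_at A x ell" "\<And>x. x \<in> U \<Longrightarrow> ell x \<in> L x"
    and d: "darboux_line A U f (gauge_form eta (tau ell)) ((m\<^sup>2 - 1) / 2) M" unfolding eisenhart_iff[OF U] by blast
  have "gauge_form eta (tau ell) \<in> gauge_orbit A U f eta"
    unfolding gauge_orbit_iff using gauge_field_tau[OF U ell] by blast
  moreover have "m' \<noteq> 0" using m m1 by (auto simp: power2_eq_1_iff)
  ultimately show ?thesis unfolding darboux_transform_def using Omega[OF U] d t m by blast
qed

end

section \<open>The quadric of initial values\<close>

text \<open>Two equations in dimension 6. A relation between their differentials at \<open>x\<close>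
  says that a combination of \<open>x\<close> and \<open>P0\<close> vanishes; pairing it with
  \<open>P0\<close>, which is orthogonal to \<open>x\<close> and not null, removes
  \<open>P0\<close>, and \<open>x \<noteq> 0\<close> removes the rest. The inequalities are open and
  finite in number.\<close>

lemma submanifold_null_cone:
  assumes P0: "form42 P0 P0 \<noteq> 0" and G: "finite G"
  shows "submanifold 4 {v. form42 v v = 0 \<and> form42 P0 v = 0 \<and> v \<noteq> 0 \<and> (\<forall>a\<in>G. form42 a v \<noteq> 0)}" (is "submanifold 4 ?C")
  unfolding submanifold_def
proof (intro conjI ballI)
  show "4 \<le> DIM(R42)" by simp
  fix x assume x: "x \<in> ?C"
  define W where "W = {v. v \<noteq> 0 \<and> (\<forall>a\<in>G. form42 a v \<noteq> 0)}"
  define g where "g = (\<lambda>i::nat. \<lambda>v::R42. if i = 0 then form42 v v else form42 P0 v)"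
  have cont: "continuous_on UNIV (\<lambda>v. form42 a v)" for a
    using linear_continuous_on[OF bounded_bilinear.bounded_linear_right[OF bounded_bilinear_form42]] .
  have "W = (- {0}) \<inter> (\<Inter>a\<in>G. {v. form42 a v \<noteq> 0})" unfolding W_def by auto
  moreover have "open {v. form42 a v \<noteq> 0}" for a
    using open_Collect_neq[OF cont continuous_on_const] .
  ultimately have oW: "open W" using G by (auto intro!: open_INT)
  have dim: "DIM(R42) - 4 = 2" by simp
  have sm: "smooth_on W (g i)" for i
    using smooth_on_bilinear[OF oW bounded_bilinear_form42 smooth_on_ident[OF oW] smooth_on_ident[OF oW]]
      smooth_on_bilinear[OF oW bounded_bilinear_form42 smooth_on_const smooth_on_ident[OF oW]]
    by (cases "i = 0") (simp_all add: g_def)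
  have d0: "frechet_derivative (g 0) (at x) v = 2 * form42 x v" for v
  proof -
    have "((\<lambda>y. form42 y y) has_derivative (\<lambda>v. form42 x v + form42 v x)) (at x)"
      by (rule bounded_bilinear.FDERIV[OF bounded_bilinear_form42 has_derivative_ident has_derivative_ident])
    from fun_cong[OF frechet_derivative_at[OF this], of v] show ?thesis by (simp add: g_def form42_commute[of v x])
  qed
  have d1: "frechet_derivative (g 1) (at x) v = form42 P0 v" for v
  proof -
    have "((\<lambda>y. form42 P0 y) has_derivative (\<lambda>v. form42 P0 v + form42 0 x)) (at x)"
      by (rule bounded_bilinear.FDERIV[OF bounded_bilinear_form42 has_derivative_const has_derivative_ident])
    from fun_cong[OF frechet_derivative_at[OF this], of v] show ?thesis by (simp add: g_def form42_zero)
  qed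
  show "\<exists>W (g :: nat \<Rightarrow> R42 \<Rightarrow> real). open W \<and> x \<in> W \<and> (\<forall>i < DIM(R42) - 4. smooth_on W (g i)) \<and>
        ?C \<inter> W = {y \<in> W. \<forall>i < DIM(R42) - 4. g i y = 0} \<and>
        (\<forall>a :: nat \<Rightarrow> real. (\<forall>v. (\<Sum>i < DIM(R42) - 4. a i * frechet_derivative (g i) (at x) v) = 0)
           \<longrightarrow> (\<forall>i < DIM(R42) - 4. a i = 0))"
    unfolding dim
  proof (intro exI[of _ W] exI[of _ g] conjI allI impI oW sm)
    show "x \<in> W" using x by (simp add: W_def)
    have "(\<forall>i<2. g i y = 0) \<longleftrightarrow> form42 y y = 0 \<and> form42 P0 y = 0" for y
      by (auto simp: g_def less_2_cases_iff)
    then show "?C \<inter> W = {y \<in> W. \<forall>i<2. g i y = 0}" unfolding W_def by auto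
    fix a :: "nat \<Rightarrow> real" and i :: nat
    assume a: "\<forall>v. (\<Sum>i<2. a i * frechet_derivative (g i) (at x) v) = 0" and i: "i < 2"
    have s: "form42 ((a 0 * 2) *\<^sub>R x + a 1 *\<^sub>R P0) v = 0" for v
    proof -
      have "a 0 * frechet_derivative (g 0) (at x) v + a 1 * frechet_derivative (g 1) (at x) v = 0"
        using a[rule_format, of v] by (simp add: numeral_2_eq_2)
      then show ?thesis unfolding d0 d1 by (simp add: form42_simps mult.assoc)
    qed
    have "form42 P0 x = 0" "x \<noteq> 0" using x by auto
    then have "a 1 = 0" using s[of P0] P0 by (simp add: form42_simps form42_commute[of x])
    moreover from this have "a 0 = 0" using form42_nondegenerate[OF s] \<open>x \<noteq> 0\<close> by simp
    ultimately show "a i = 0" using i by (auto simp: less_2_cases_iff)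
  qed
qed

context umbilic_free_guichard begin

text \<open>The parallel vector \<open>p + m K \<sigma>\<close>, transported to another member of the gauge orbit.\<close>

definition conserved :: "('a \<Rightarrow> R42 \<Rightarrow> R42) \<Rightarrow> real \<Rightarrow> 'a \<Rightarrow> R42" where
  "conserved \<tau> m x = p + (m * K) *\<^sub>R \<sigma> x + m *\<^sub>R \<tau> x p"

text \<open>\<open>conserved\<close> is \<open>exp (m \<tau>)\<close> applied to
  \<open>p + m K \<sigma>\<close>, as \<open>\<tau>\<close> kills \<open>\<sigma>\<close>, and
  \<open>exp (m \<tau>)\<close> preserves \<open>form42\<close>.\<close>

lemma conserved_pairing:
  assumes t: "gauge_field U \<tau>" and U: "open U" and x: "x \<in> U"
  shows "form42 (w + m *\<^sub>R \<tau> x w) (conserved \<tau> m x) = form42 w (p + (m * K) *\<^sub>R \<sigma> x)"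
proof -
  note T = gauge_fieldD[OF t U x]
  have 1: "form42 (\<tau> x w) (\<sigma> x) = 0" "form42 (\<tau> x w) (\<tau> x p) = 0"
    using isotropic_f T(2) \<sigma>D(2) by blast+
  show ?thesis unfolding conserved_def using 1 T(4)[of w p] by (simp add: form42_simps algebra_simps)
qed

lemma conserved_norm:
  assumes "gauge_field U \<tau>" "open U" "x \<in> U"
  shows "form42 (conserved \<tau> m x) (conserved \<tau> m x) = K * (1 + 2 * m)"
proof -
  note T = gauge_fieldD[OF assms]
  have "\<tau> x (\<sigma> x) = 0" by (rule T(3)[OF f_subset_perp[OF \<sigma>D(2)[OF UNIV_I]]])
  then have c: "conserved \<tau> m x = (p + (m * K) *\<^sub>R \<sigma> x) + m *\<^sub>R \<tau> x (p + (m * K) *\<^sub>R \<sigma> x)"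
    by (simp add: conserved_def linear_add[OF T(1)] linear_cmul[OF T(1)])
  have "form42 (conserved \<tau> m x) (conserved \<tau> m x) = form42 (p + (m * K) *\<^sub>R \<sigma> x) (p + (m * K) *\<^sub>R \<sigma> x)"
    by (subst c) (rule conserved_pairing[OF assms])
  then show ?thesis using \<sigma>D(3-5)[OF UNIV_I, of x] by (simp add: form42_simps algebra_simps)
qed

text \<open>The orthogonality cuts out the quadric. The non-orthogonality to \<open>L x\<close> is
  what allows \<open>ell\<close> to be solved for near \<open>x\<close>; together with the condition
  on curvature spheres it is open.\<close>

definition initial :: "('a \<Rightarrow> R42 \<Rightarrow> R42) \<Rightarrow> real \<Rightarrow> 'a \<Rightarrow> R42 set \<Rightarrow> bool" where
  "initial \<tau> m x l \<longleftrightarrow> null_line l \<and> l \<subseteq> perp {conserved \<tau> m x} \<and> \<not> l \<subseteq> perp (L x) \<and>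
    (\<forall>c. curvature_sphere A f x c \<longrightarrow> \<not> c \<subseteq> perp l)"

text \<open>The transform comes from an Eisenhart line \<open>M\<close> in the gauge of some
  \<open>ell\<close>. Moved to the gauge of \<open>\<tau>0\<close>, this line has the same transform
  and therefore equals \<open>s\<close> by uniqueness. Orthogonality of \<open>M\<close> to
  \<open>p\<close> and \<open>\<sigma> + ell\<close> then becomes orthogonality of \<open>s\<close>
  to \<open>conserved\<close>.\<close>

lemma initial_necessary:
  assumes t0: "gauge_field UNIV \<tau>0" and U: "open U" and x: "x \<in> U"
    and d: "darboux_line A U f (gauge_form eta \<tau>0) m' s"
    and fh: "fhat \<in> F U m'" "\<forall>x\<in>U. fhat x = transform_bundle f s x"
  shows "initial \<tau>0 m' x (s x)"
proof -
  obtain m M where m: "(m\<^sup>2 - 1) / 2 = m'" and e: "eisenhart_transform A U p L f q m M"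
    and fM: "\<forall>x\<in>U. fhat x = transform_bundle f M x" using fh(1) unfolding eisenhart_family_def by blast
  from e obtain ell where ell: "\<And>x. x \<in> U \<Longrightarrow> smooth_at A x ell" "\<And>x. x \<in> U \<Longrightarrow> ell x \<in> L x"
    and MV: "\<And>x. x \<in> U \<Longrightarrow> M x \<subseteq> perp {p, \<sigma> x + ell x}"
    and dM: "darboux_line A U f (gauge_form eta (tau ell)) m' M" unfolding eisenhart_iff[OF U] m by blast
  have tU: "gauge_field U \<tau>0"
    using t0 smooth_map_mono[OF _ subset_UNIV] unfolding gauge_field_def by blast
  have te: "gauge_field U (tau ell)" by (rule gauge_field_tau[OF U ell])
  \<comment> \<open>Since \<open>dd\<close> is additive, gauge changes add; this one leads from the
    gauge of \<open>ell\<close> to that of \<open>\<tau>0\<close>.\<close>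
  define \<tau> where "\<tau> = (\<lambda>x w. \<tau>0 x w - tau ell x w)"
  have t: "gauge_field U \<tau>" unfolding \<tau>_def by (rule gauge_field_diff[OF tU te U])
  have nU: "nil_form U eta" using nil_form_eta unfolding nil_form_def by blast
  have "darboux_line A U f (gauge_form (gauge_form eta (tau ell)) \<tau>) m' (gauge_line m' \<tau> M)"
    by (rule gauge_darboux_line[OF U nil_form_gauge[OF nU te U] t dM])
  moreover have "gauge_form (gauge_form eta (tau ell)) \<tau> y X w = gauge_form eta \<tau>0 y X w" if "y \<in> U" for y X w
    unfolding gauge_form_def \<tau>_def
    using dd_diff[OF gauge_fieldD(5)[OF tU U that] gauge_fieldD(5)[OF te U that]] by simp
  ultimately have dg: "darboux_line A U f (gauge_form eta \<tau>0) m' (gauge_line m' \<tau> M)"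
    using darboux_line_cong by blast
  have nM: "null_line (M y)" if "y \<in> U" for y using dM that by (simp add: darboux_line_def null_line_bundle_def)
  interpret R: guichard A p L f U V \<sigma> chi by (rule restrict[OF U subset_UNIV])
  have eqT: "transform_bundle f s y = transform_bundle f (gauge_line m' \<tau> M) y" if "y \<in> U" for y
    using fh(2)[rule_format, OF that] fM[rule_format, OF that] transform_gauge[where s = M and m = m', OF U t that nM[OF that]] by simp
  have sx: "s x = gauge_line m' \<tau> M x"
    by (rule R.darboux_line_unique[OF nil_form_gauge[OF nU tU U] d dg curvature_sphere_exists eqT x])
  note T = gauge_fieldD[OF t U x] and T0 = gauge_fieldD[OF tU U x] and Te = gauge_fieldD[OF te U x]
  obtain e where e0: "e \<noteq> 0" "form42 e e = 0" "M x = span {e}" using null_line_obtain[OF nM[OF x]] .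
  have eM: "e \<in> M x" using e0 by (simp add: span_base)
  define z where "z = e + m' *\<^sub>R \<tau> x e"
  have lin: "linear (\<lambda>w. w + m' *\<^sub>R \<tau> x w)"
    by (intro linear_compose_add linear_compose_scale_right T linear_id[unfolded id_def])
  have sz: "s x = span {z}"
    unfolding sx gauge_line_def e0(3) z_def using linear_span_image[OF lin, of "{e}"] by simp
  have ns: "null_line (s x)" using d x by (simp add: darboux_line_def null_line_bundle_def)
  have lx: "form42 a z = form42 a e" if "a \<in> f x" for a
    unfolding z_def using isotropic_f[OF that T(2)] by (simp add: form42_simps)
  have ortho: "form42 e p = 0" "form42 e (\<sigma> x) + form42 e (ell x) = 0"
    using MV[OF x] eM by (auto simp: perp_def form42_commute[of e] form42_simps)
  have "form42 z (conserved \<tau>0 m' x) = 0"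
  proof -
    \<comment> \<open>The vector of the line in the gauge of \<open>eta\<close> itself. The two
      gauge transformations compose additively because products of values in
      \<open>f \<and> f\<close> vanish.\<close>
    let ?y = "e - m' *\<^sub>R tau ell x e"
    have "\<tau>0 x (tau ell x e) = 0" by (rule T0(3)[OF f_subset_perp[OF Te(2)]])
    then have "z = ?y + m' *\<^sub>R \<tau>0 x ?y"
      unfolding z_def \<tau>_def by (simp add: linear_diff[OF T0(1)] linear_cmul[OF T0(1)] algebra_simps)
    then have "form42 z (conserved \<tau>0 m' x) = form42 ?y (p + (m' * K) *\<^sub>R \<sigma> x)"
      using conserved_pairing[OF tU U x] by simp
    also have "\<dots> = (m' * K) * (form42 e (\<sigma> x) + form42 e (ell x))"
      unfolding tau_def wedge_def using ortho(1) \<sigma>D(3-5)[OF UNIV_I, of x] L_p(1)[OF ell(2)[OF x]]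
        isotropic_f[OF Lf_in[OF ell(2)[OF x]] \<sigma>D(2)[OF UNIV_I]]
      by (simp add: form42_simps form42_commute[of "\<sigma> x" e] form42_commute[of "ell x" e]) (simp add: algebra_simps)
    finally show ?thesis using ortho(2) by simp
  qed
  then have 1: "s x \<subseteq> perp {conserved \<tau>0 m' x}"
    unfolding sz by (intro span_minimal subspace_perp) (simp add: perp_def form42_commute)
  \<comment> \<open>Otherwise \<open>M x\<close> and \<open>L x\<close> would be orthogonal null
    lines in a space of signature (3,1), hence equal. Then \<open>M x\<close> would lie in
    \<open>f x\<close> and be orthogonal to all of it.\<close>
  have 2: "\<not> s x \<subseteq> perp (L x)"
  proof
    assume *: "s x \<subseteq> perp (L x)"
    obtain lam where g: "gen x lam" by (rule L_gen)
    have "z \<in> perp (L x)" using * sz by (auto simp: span_base)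
    then have "form42 (lam x) z = 0" using genD(4)[OF g] by (simp add: perp_def)
    then have le: "form42 (lam x) e = 0" using lx[OF Lf_in[OF genD(4)[OF g]]] by simp
    interpret S: shifted A p L f U V \<sigma> chi ell "\<lambda>x. perp {p, \<sigma> x + ell x}" using ell by unfold_locales auto
    have scV: "signature form42 (perp {p, \<sigma> x + ell x}) = (3, 1)"
      using S.sphere_congruence_shift x unfolding sphere_congruence_def by blast
    have lV: "lam x \<in> perp {p, \<sigma> x + ell x}"
      using L_p(2)[OF genD(4)[OF g]] isotropic_f[OF _ Lf_in[OF genD(4)[OF g]]] \<sigma>D(2)[of x] Lf_in[OF ell(2)[OF x]]
      by (simp add: perp_def form42_simps)
    have "e \<in> span {lam x}"
      by (rule signature_31(2)[OF scV subspace_perp null_pair.dim_perp_ps[OF S.S.np[OF x]] lV _ genD(2)[OF g] _ e0(2) le])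
        (use MV[OF x] eM isotropic_f[OF Lf_in Lf_in] genD(4)[OF g] in auto)
    then have "e \<in> L x" using genD(3)[OF g] by simp
    then have "e \<in> f x" by (rule Lf_in)
    then have "f x \<subseteq> perp (M x)"
      unfolding e0(3) perp_span using isotropic_f by (simp add: perp_def subset_eq)
    moreover have "nowhere_orthogonal A U f M" using dM by (simp add: darboux_line_def)
    ultimately show False using not_f_perp[of f] R.not_f_perp[OF _ x curvature_sphere_exists] by blast
  qed
  have "\<forall>c. curvature_sphere A f x c \<longrightarrow> \<not> c \<subseteq> perp (s x)"
    using d x unfolding darboux_line_def nowhere_orthogonal_def by blast
  then show ?thesis unfolding initial_def using ns 1 2 by blast
qed

text \<open>The gauge is undone at \<open>x\<close> and the vector is continued as a parallel
  section \<open>\<xi>\<close> for \<open>eta\<close>. Constant pairings keep \<open>\<xi>\<close>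
  null and orthogonal to the parallel vector; the remaining conditions are open and hold on a
  smaller \<open>U\<close>. There \<open>ell\<close> can be solved for, which gives the gauge in
  which the line is an Eisenhart transform.\<close>

lemma initial_sufficient:
  assumes t0: "gauge_field UNIV \<tau>0" and m: "m' > - 1/2" "m' \<noteq> 0" and l: "initial \<tau>0 m' x l"
  obtains U s fhat where "open U" "x \<in> U" "darboux_line A U f (gauge_form eta \<tau>0) m' s" "s x = l"
    "fhat \<in> F U m'" "\<forall>x\<in>U. fhat x = transform_bundle f s x"
proof -
  obtain v' where v': "v' \<noteq> 0" "form42 v' v' = 0" "l = span {v'}" using l null_line_obtain unfolding initial_def by metis
  note T0 = gauge_fieldD[OF t0 open_UNIV UNIV_I]
  define v where "v = v' - m' *\<^sub>R \<tau>0 x v'"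
  have tt: "\<tau>0 y (\<tau>0 y w) = 0" for y w by (rule T0(3)[OF f_subset_perp[OF T0(2)]])
  have vv': "v' = v + m' *\<^sub>R \<tau>0 x v"
    unfolding v_def by (simp add: linear_diff[OF T0(1)] linear_cmul[OF T0(1)] tt)
  have fv: "form42 a v = form42 a v'" if "a \<in> f x" for a
    unfolding v_def using isotropic_f[OF that T0(2)] by (simp add: form42_simps)
  have vnull: "form42 v v = 0"
  proof -
    have "form42 v' (\<tau>0 x v') = 0" using T0(4)[of x v' v'] by (simp add: form42_commute)
    then show ?thesis unfolding v_def using v'(2) isotropic_f[OF T0(2) T0(2), of x v' v']
      by (simp add: form42_simps form42_commute[of "\<tau>0 x v'" v'])
  qed
  have "v' \<in> perp {conserved \<tau>0 m' x}" using l v'(3) unfolding initial_def by (auto simp: span_base)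
  then have "form42 v' (conserved \<tau>0 m' x) = 0" by (simp add: perp_def form42_commute)
  then have vP: "form42 v (p + (m' * K) *\<^sub>R \<sigma> x) = 0"
    using conserved_pairing[OF t0 open_UNIV UNIV_I, of v m' x] vv' by simp
  obtain lam where g: "gen x lam" by (rule L_gen)
  have "\<not> l \<subseteq> perp (span {lam x})" using l genD(3)[OF g] unfolding initial_def by simp
  then have lv: "form42 (lam x) v \<noteq> 0"
    using fv[OF Lf_in[OF genD(4)[OF g]]] v'(3) subspace_perp unfolding perp_span
    by (auto simp: perp_def subset_eq span_singleton form42_simps)
  have csv: "\<not> c \<subseteq> perp {v}" if c: "curvature_sphere A f x c" for c
  proof
    assume *: "c \<subseteq> perp {v}"
    have "c \<subseteq> perp l"
    proof
      fix a assume a: "a \<in> c"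
      then have af: "a \<in> f x" using c unfolding curvature_sphere_def by blast
      have "form42 a v = 0" using a * by (auto simp: perp_def form42_commute)
      then have "form42 v' a = 0" using fv[OF af] by (simp add: form42_commute)
      then show "a \<in> perp l" unfolding v'(3) perp_span by (simp add: perp_def)
    qed
    then show False using l c unfolding initial_def by blast
  qed
  define \<eta> where "\<eta> = (\<lambda>x X w. m' *\<^sub>R eta x X w)"
  obtain N \<xi> where N: "open N" "x \<in> N" "\<xi> x = v"
    "\<And>y. y \<in> N \<Longrightarrow> smooth_at A y \<xi>" "\<And>y X. y \<in> N \<Longrightarrow> dd A \<xi> y X = - \<eta> y X (\<xi> y)"
    and const: "\<And>(h :: 'a \<Rightarrow> real) y. (\<And>y. y \<in> N \<Longrightarrow> smooth_at A y h) \<Longrightarrow> (\<And>y X. y \<in> N \<Longrightarrow> dd A h y X = 0) \<Longrightarrow>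
      y \<in> N \<Longrightarrow> h y = h x"
  proof (rule parallel_section_exists[of \<eta> x v])
    show "smooth_at A y (\<lambda>y. \<eta> y (coord_field A c u y) w)" if "c \<in> A" "y \<in> fst c" for c u w y
      unfolding \<eta>_def by (intro smooth_at_scaleR smooth_at_const eta_smooth that UNIV_I)
    show "linear (\<lambda>X. \<eta> y X w)" "linear (\<eta> y X)" for y w X
      unfolding \<eta>_def by (intro linear_compose_scale_right eta_linear UNIV_I)+
    show "closed_form A UNIV \<eta>"
      unfolding closed_form_def \<eta>_def
    proof (intro ballI allI)
      fix c y u v and w :: R42 assume c: "c \<in> A" and y: "y \<in> UNIV \<inter> fst c"
      then have y': "y \<in> fst c" by simp
      show "dd A (\<lambda>y. m' *\<^sub>R eta y (coord_field A c v y) w) y (coord_field A c u y) =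
        dd A (\<lambda>y. m' *\<^sub>R eta y (coord_field A c u y) w) y (coord_field A c v y)"
        unfolding dd_scaleR_const[OF eta_smooth[OF c UNIV_I y']]
        using eta_closed[unfolded closed_form_def, rule_format, OF c y, where u = u and v = v and w = w] by (rule arg_cong)
    qed
    show "\<eta> y X (\<eta> y Y w) = \<eta> y Y (\<eta> y X w)" for y X Y w
      unfolding \<eta>_def by (simp add: linear_cmul[OF eta_linear(1)[OF UNIV_I]] eta_comm[OF UNIV_I, of y X Y])
  qed blast
  have skew: "form42 (\<eta> y X a) b = - form42 a (\<eta> y X b)" for y X a b
    unfolding \<eta>_def by (simp add: form42_simps eta_skew[OF UNIV_I])
  have null: "form42 (\<xi> y) (\<xi> y) = 0" if y: "y \<in> N" for y
  proof -
    have "form42 (\<xi> y) (\<xi> y) = form42 (\<xi> x) (\<xi> x)"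
    proof (rule const[OF _ _ y])
      show "smooth_at A y (\<lambda>y. form42 (\<xi> y) (\<xi> y))" if "y \<in> N" for y by (intro smooth_at_form42 N(4) that)
      show "dd A (\<lambda>y. form42 (\<xi> y) (\<xi> y)) y X = 0" if "y \<in> N" for y X
        unfolding dd_form42[OF N(4)[OF that] N(4)[OF that]] N(5)[OF that] using skew by (simp add: form42_simps)
    qed
    then show ?thesis using vnull N(3) by simp
  qed
  have cons: "form42 (\<xi> y) (p + (m' * K) *\<^sub>R \<sigma> y) = 0" if y: "y \<in> N" for y
  proof -
    have sP: "smooth_at A y (\<lambda>y. p + (m' * K) *\<^sub>R \<sigma> y)" for y by (intro smooth_at_add smooth_at_scaleR smooth_at_const \<sigma>D UNIV_I)
    \<comment> \<open>\<open>eta\<close> sends \<open>p\<close> to \<open>- K d\<sigma>\<close> and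
      kills \<open>\<sigma>\<close>, so the derivative of the term \<open>m' K \<sigma>\<close> is
      cancelled.\<close>
    have dP: "dd A (\<lambda>y. p + (m' * K) *\<^sub>R \<sigma> y) y X = - \<eta> y X (p + (m' * K) *\<^sub>R \<sigma> y)" for y X
    proof -
      have "eta y X p = - K *\<^sub>R dd A \<sigma> y X"
        unfolding eta_def chi_zero(1)[OF UNIV_I] using \<sigma>D(3)[OF UNIV_I] d\<sigma>(1)[OF UNIV_I] by (simp add: wedge_def)
      moreover have "eta y X (\<sigma> y) = 0" by (rule eta_f[OF UNIV_I \<sigma>D(2)[OF UNIV_I]])
      moreover have "dd A (\<lambda>y. p + (m' * K) *\<^sub>R \<sigma> y) y X = (m' * K) *\<^sub>R dd A \<sigma> y X"
      proof -
        have "dd A (\<lambda>y. p + (m' * K) *\<^sub>R \<sigma> y) y X = dd A (\<lambda>y. p) y X + dd A (\<lambda>y. (m' * K) *\<^sub>R \<sigma> y) y X"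
          by (rule dd_add[OF smooth_at_const smooth_at_scaleR[OF smooth_at_const \<sigma>D(1)[OF UNIV_I]]])
        then show ?thesis unfolding dd_const dd_scaleR_const[OF \<sigma>D(1)[OF UNIV_I]] by simp
      qed
      ultimately show ?thesis unfolding \<eta>_def
        by (simp add: linear_add[OF eta_linear(1)[OF UNIV_I]] linear_cmul[OF eta_linear(1)[OF UNIV_I]])
    qed
    have "form42 (\<xi> y) (p + (m' * K) *\<^sub>R \<sigma> y) = form42 (\<xi> x) (p + (m' * K) *\<^sub>R \<sigma> x)"
    proof (rule const[OF _ _ y])
      show "smooth_at A y (\<lambda>y. form42 (\<xi> y) (p + (m' * K) *\<^sub>R \<sigma> y))" if "y \<in> N" for y by (intro smooth_at_form42 N(4) that sP)
      show "dd A (\<lambda>y. form42 (\<xi> y) (p + (m' * K) *\<^sub>R \<sigma> y)) y X = 0" if "y \<in> N" for y X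
        unfolding dd_form42[OF N(4)[OF that] sP] N(5)[OF that] dP using skew by (simp add: form42_minus)
    qed
    then show ?thesis using vP N(3) by simp
  qed
  have s\<xi>: "smooth_at A x \<xi>" by (rule N(4)[OF N(2)])
  have evg: "\<forall>\<^sub>F y in nhds x. gen y lam"
  proof -
    have "\<forall>\<^sub>F y in nhds x. \<forall>\<^sub>F z in nhds y. lam z \<noteq> 0 \<and> L z = span {lam z}"
      using g by (simp add: gen_def eventually_eventually)
    then show ?thesis using smooth_at_eventually[OF genD(1)[OF g]] by eventually_elim (simp add: gen_def)
  qed
  have lx: "form42 (lam x) (\<xi> x) \<noteq> 0" using lv N(3) by simp
  have evl: "\<forall>\<^sub>F y in nhds x. form42 (lam y) (\<xi> y) \<noteq> 0" by (intro smooth_at_nonzero smooth_at_form42 genD(1)[OF g] s\<xi> lx)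
  have evc: "\<forall>\<^sub>F y in nhds x. \<forall>c. curvature_sphere A f y c \<longrightarrow> \<not> c \<subseteq> perp {\<xi> y}"
    by (rule eventually_not_orthogonal[OF UNIV_I s\<xi> g lx]) (use csv N(3) in simp)
  have "\<forall>\<^sub>F y in nhds x. y \<in> N \<and> gen y lam \<and> form42 (lam y) (\<xi> y) \<noteq> 0 \<and> (\<forall>c. curvature_sphere A f y c \<longrightarrow> \<not> c \<subseteq> perp {\<xi> y})"
    by (intro eventually_conj eventually_nhds_in_open[OF N(1,2)] evg evl evc)
  then obtain U where U: "open U" "x \<in> U"
    "\<forall>y\<in>U. y \<in> N \<and> gen y lam \<and> form42 (lam y) (\<xi> y) \<noteq> 0 \<and> (\<forall>c. curvature_sphere A f y c \<longrightarrow> \<not> c \<subseteq> perp {\<xi> y})"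
    unfolding eventually_nhds by (elim exE conjE) (rule that)
  have UD: "y \<in> N" "gen y lam" "form42 (lam y) (\<xi> y) \<noteq> 0" "\<xi> y \<noteq> 0" "smooth_at A y \<xi>"
    "curvature_sphere A f y c \<Longrightarrow> \<not> c \<subseteq> perp {\<xi> y}" if y: "y \<in> U" for y c
  proof -
    show 1: "y \<in> N" "gen y lam" "form42 (lam y) (\<xi> y) \<noteq> 0" "curvature_sphere A f y c \<Longrightarrow> \<not> c \<subseteq> perp {\<xi> y}" using U(3) y by blast+
    show "\<xi> y \<noteq> 0" using 1(3) by (auto simp: form42_zero)
    show "smooth_at A y \<xi>" by (rule N(4)[OF 1(1)])
  qed
  define s0 where "s0 = (\<lambda>y. span {\<xi> y})"
  have nl0: "null_line (s0 y)" if "y \<in> U" for y unfolding s0_def using null_line_span UD(4)[OF that] null[OF UD(1)[OF that]] by blast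
  have d0: "darboux_line A U f eta m' s0"
    unfolding darboux_line_def
  proof (intro conjI)
    show "null_line_bundle A U s0"
      unfolding null_line_bundle_def subbundle_def
    proof (intro conjI ballI)
      fix y assume y: "y \<in> U"
      show "null_line (s0 y)" by (rule nl0[OF y])
      have "smooth_map A U \<xi>" using UD(5) smooth_map_iff[OF U(1)] by blast
      moreover have im: "(\<lambda>i. \<xi> z) ` {..<1::nat} = {\<xi> z}" for z by auto
      moreover have "dim (s0 z) = 1" if "z \<in> U" for z unfolding s0_def by (rule dim_span_singleton[OF UD(4)[OF that]])
      ultimately show "\<exists>N (e :: nat \<Rightarrow> 'a \<Rightarrow> R42). open N \<and> y \<in> N \<and> N \<subseteq> U \<and> (\<forall>i<1. smooth_map A N (e i)) \<and>
        (\<forall>y\<in>N. s0 y = span ((\<lambda>i. e i y) ` {..<1}) \<and> dim (s0 y) = 1)"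
        using U(1) y by (intro exI[of _ U] exI[of _ "\<lambda>i. \<xi>"]) (simp add: s0_def)
    qed
    show "parallel A U (darboux_connection A eta m') s0"
      unfolding parallel_def darboux_connection_def
    proof (intro ballI allI)
      fix y \<zeta> X assume y: "y \<in> U" and "\<zeta> \<in> sections A s0 y"
      then have z: "smooth_at A y \<zeta>" "\<forall>\<^sub>F z in nhds y. \<zeta> z \<in> s0 z" by (auto simp: sections_iff)
      define k where "k = (\<lambda>z. form42 (lam z) (\<zeta> z) / form42 (lam z) (\<xi> z))"
      have sk: "smooth_at A y k" unfolding k_def
        by (intro smooth_at_divide smooth_at_form42 genD(1)[OF UD(2)[OF y]] z(1) UD[OF y])
      have ev: "\<forall>\<^sub>F z in nhds y. \<zeta> z = k z *\<^sub>R \<xi> z"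
        using z(2) eventually_nhds_in_open[OF U(1) y]
      proof eventually_elim
        case (elim z)
        then obtain r where "\<zeta> z = r *\<^sub>R \<xi> z" unfolding s0_def by (auto simp: span_singleton)
        then show ?case using UD(3)[OF elim(2)] by (simp add: k_def form42_simps)
      qed
      have "dd A \<zeta> y X = k y *\<^sub>R dd A \<xi> y X + dd A k y X *\<^sub>R \<xi> y"
        unfolding dd_cong[OF ev] by (rule dd_scaleR[OF sk UD(5)[OF y]])
      then have "dd A \<zeta> y X + m' *\<^sub>R eta y X (\<zeta> y) = dd A k y X *\<^sub>R \<xi> y"
        unfolding N(5)[OF UD(1)[OF y]] eventually_nhds_x_imp_x[OF ev] \<eta>_def
        by (simp add: linear_cmul[OF eta_linear(1)[OF UNIV_I]])
      then show "dd A \<zeta> y X + m' *\<^sub>R eta y X (\<zeta> y) \<in> s0 y" unfolding s0_def by (simp add: span_scale span_base)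
    qed
    show "nowhere_orthogonal A U f s0"
      unfolding nowhere_orthogonal_def s0_def perp_span using UD(6) by blast
  qed
  \<comment> \<open>Chosen so that \<open>(\<sigma> + ell, \<xi>) = 0\<close>. The gauge
    transformation by \<open>tau ell\<close> then changes \<open>(p, \<xi>)\<close> by
    \<open>m' K (\<sigma>, \<xi>)\<close>, which makes it zero because \<open>\<xi>\<close> is
    orthogonal to \<open>p + m' K \<sigma>\<close>.\<close>
  define ell where "ell = (\<lambda>y. (- (form42 (\<sigma> y) (\<xi> y) / form42 (lam y) (\<xi> y))) *\<^sub>R lam y)"
  have ell: "smooth_at A y ell" "ell y \<in> L y" if y: "y \<in> U" for y
  proof -
    show "smooth_at A y ell" unfolding ell_def
      by (intro smooth_at_scaleR smooth_at_minus smooth_at_divide smooth_at_form42 \<sigma>D UNIV_I genD(1)[OF UD(2)[OF y]] UD[OF y])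
    show "ell y \<in> L y" unfolding ell_def by (rule subspace_scale[OF L_subspace genD(4)[OF UD(2)[OF y]]])
  qed
  have te: "gauge_field U (tau ell)" by (rule gauge_field_tau[OF U(1) ell])
  have tU: "gauge_field U \<tau>0"
    using t0 smooth_map_mono[OF _ subset_UNIV] unfolding gauge_field_def by blast
  have nU: "nil_form U eta" using nil_form_eta unfolding nil_form_def by blast
  define M where "M = gauge_line m' (tau ell) s0"
  define s where "s = gauge_line m' \<tau>0 s0"
  have dM: "darboux_line A U f (gauge_form eta (tau ell)) m' M" unfolding M_def by (rule gauge_darboux_line[OF U(1) nU te d0])
  have ds: "darboux_line A U f (gauge_form eta \<tau>0) m' s" unfolding s_def by (rule gauge_darboux_line[OF U(1) nU tU d0])
  have MV: "M y \<subseteq> perp {p, \<sigma> y + ell y}" if y: "y \<in> U" for y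
  proof
    fix z assume "z \<in> M y"
    then obtain k where z: "z = k *\<^sub>R \<xi> y + m' *\<^sub>R tau ell y (k *\<^sub>R \<xi> y)"
      unfolding M_def gauge_line_def s0_def by (auto simp: span_singleton)
    have le: "form42 (ell y) (\<xi> y) = - form42 (\<sigma> y) (\<xi> y)" unfolding ell_def using UD(3)[OF y] by (simp add: form42_simps)
    have lo: "form42 p (ell y) = 0" "form42 (ell y) (ell y) = 0" "form42 (\<sigma> y) (ell y) = 0" "form42 (ell y) (\<sigma> y) = 0"
      using L_p(2)[OF ell(2)[OF y]] isotropic_f Lf_in[OF ell(2)[OF y]] \<sigma>D(2)[OF UNIV_I] by blast+
    have c: "form42 p (\<xi> y) = - (m' * K * form42 (\<sigma> y) (\<xi> y))"
      using cons[OF UD(1)[OF y]] by (simp add: form42_simps form42_commute[of "\<xi> y"])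
    show "z \<in> perp {p, \<sigma> y + ell y}"
      unfolding z tau_def wedge_def perp_def using le lo c \<sigma>D(3-5)[OF UNIV_I, of y]
      by (simp add: form42_simps)
  qed
  \<comment> \<open>This solves \<open>(m^2 - 1) / 2 = m'\<close>. The bound on \<open>m'\<close>
    makes the root real and non-zero, \<open>m' \<noteq> 0\<close> excludes 1 and -1, and the
    opposite sign would serve as well.\<close>
  define m where "m = sqrt (1 + 2 * m')"
  have msq: "m\<^sup>2 = 1 + 2 * m'" unfolding m_def using m(1) by simp
  then have mm: "(m\<^sup>2 - 1) / 2 = m'" by simp
  have mne: "m \<noteq> 0" "m \<noteq> 1" "m \<noteq> -1" using msq m by auto
  have "eisenhart_transform A U p L f q m M"
    unfolding eisenhart_iff[OF U(1)] mm using mne ell MV dM by blast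
  then have "transform_bundle f M \<in> F U m'" unfolding eisenhart_family_def using mm by blast
  moreover have "\<forall>y\<in>U. transform_bundle f M y = transform_bundle f s y"
    unfolding M_def s_def using transform_gauge[OF U(1) te _ nl0] transform_gauge[OF U(1) tU _ nl0] by simp
  moreover have "s x = l"
  proof -
    have lin: "linear (\<lambda>w. w + m' *\<^sub>R \<tau>0 x w)"
      by (intro linear_compose_add linear_compose_scale_right T0 linear_id[unfolded id_def])
    show ?thesis unfolding s_def gauge_line_def s0_def N(3) v'(3)
      using linear_span_image[OF lin, of "{v}"] vv' by simp
  qed
  ultimately show ?thesis using that U(1,2) ds by blast
qed

text \<open>The vector is sought as \<open>\<nu> + r P'\<close> plus a multiple of
  \<open>lam x\<close>, with its pairing \<open>r\<close> with \<open>\<sigma> x\<close> left free.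
  Each curvature sphere rules out at most one value of \<open>r\<close>, and there are finitely many
  curvature spheres.\<close>

lemma initial_exists:
  assumes t0: "gauge_field UNIV \<tau>0" obtains l where "initial \<tau>0 m' x l"
proof -
  note T0 = gauge_fieldD[OF t0 open_UNIV UNIV_I]
  obtain lam where g: "gen x lam" by (rule L_gen)
  interpret null_triple p "\<sigma> x" "lam x" by (rule nt[OF UNIV_I g])
  obtain \<nu> where \<nu>: "form42 \<nu> p = 0" "form42 \<nu> (\<sigma> x) = 0" "form42 \<nu> \<nu> = 0" "form42 \<nu> (lam x) = 1" by (rule null_partner)
  let ?CS = "{c. curvature_sphere A f x c}"
  have "\<exists>a b. c = span {a *\<^sub>R \<sigma> x + b *\<^sub>R lam x} \<and> (a \<noteq> 0 \<or> b \<noteq> 0)" if c: "c \<in> ?CS" for c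
  proof -
    obtain e where e: "e \<noteq> 0" "c = span {e}" using c dim1_obtain unfolding curvature_sphere_def by blast
    then have "e \<in> f x" using c span_base[of e "{e}"] unfolding curvature_sphere_def by blast
    then obtain a b where ab: "e = a *\<^sub>R \<sigma> x + b *\<^sub>R lam x"
      using f_span[OF \<sigma>D(2,3)[OF UNIV_I] g] by (auto simp: in_span_2)
    then have "a \<noteq> 0 \<or> b \<noteq> 0" using e(1) by auto
    then show ?thesis using e(2) ab by blast
  qed
  then obtain a b where ab: "\<And>c. c \<in> ?CS \<Longrightarrow> c = span {a c *\<^sub>R \<sigma> x + b c *\<^sub>R lam x} \<and> (a c \<noteq> 0 \<or> b c \<noteq> 0)" by metis
  \<comment> \<open>For \<open>a c = 0\<close> the quotient is 0 by convention and excludes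
    \<open>r = 0\<close> without harm; in that case \<open>b c \<noteq> 0\<close> gives what is
    wanted.\<close>
  obtain r :: real where r: "r \<notin> (\<lambda>c. - b c / a c) ` ?CS"
    using ex_new_if_finite[OF infinite_UNIV_char_0 finite_imageI[OF curvature_spheres_finite]] by blast
  have rn: "a c * r + b c \<noteq> 0" if "c \<in> ?CS" for c
  proof
    assume z: "a c * r + b c = 0"
    then have "a c \<noteq> 0" using ab[OF that] by auto
    then have "r = - b c / a c" using z by (simp add: field_simps)
    then show False using r that by blast
  qed
  \<comment> \<open>The vector of the plane of \<open>p\<close> and \<open>\<sigma> x\<close> that
    is orthogonal to \<open>p + m' K \<sigma> x\<close> and has pairing 1 with
    \<open>\<sigma> x\<close>. Its square is \<open>- K (1 + 2 m')\<close>, which the coefficient of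
    \<open>lam x\<close> in \<open>v\<close> compensates.\<close>
  define P' where "P' = p - (K * (1 + m')) *\<^sub>R \<sigma> x"
  define v where "v = \<nu> + r *\<^sub>R P' + (K * (1 + 2 * m') * r\<^sup>2 / 2) *\<^sub>R lam x"
  have o: "form42 (lam x) \<nu> = 1" "form42 p \<nu> = 0" "form42 (\<sigma> x) \<nu> = 0" "form42 p (lam x) = 0" "form42 (\<sigma> x) (lam x) = 0"
    using \<nu> lp ls by (simp_all add: form42_commute)
  have vv: "form42 v v = 0"
    unfolding v_def P'_def using o \<nu> ll ls lp ps ps' ss by (simp add: form42_simps) (simp add: algebra_simps power2_eq_square)
  have vl: "form42 (lam x) v = 1" unfolding v_def P'_def using o ll ls lp by (simp add: form42_simps)
  have vs: "form42 (\<sigma> x) v = r" unfolding v_def P'_def using o ps ss by (simp add: form42_simps)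
  have vP: "form42 v (p + (m' * K) *\<^sub>R \<sigma> x) = 0"
    unfolding v_def P'_def using o \<nu> ll ls lp ps ps' ss by (simp add: form42_simps) (simp add: algebra_simps)
  define z where "z = v + m' *\<^sub>R \<tau>0 x v"
  have fz: "form42 a z = form42 a v" if "a \<in> f x" for a
    unfolding z_def using isotropic_f[OF that T0(2)] by (simp add: form42_simps)
  have zz: "form42 z z = 0"
  proof -
    have "form42 v (\<tau>0 x v) = 0" using T0(4)[of x v v] by (simp add: form42_commute)
    then show ?thesis unfolding z_def using vv isotropic_f[OF T0(2) T0(2), of x v v]
      by (simp add: form42_simps form42_commute[of "\<tau>0 x v" v])
  qed
  have zl: "form42 (lam x) z = 1" using fz[OF Lf_in[OF genD(4)[OF g]]] vl by simp
  have z0: "z \<noteq> 0" using zl by (auto simp: form42_zero)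
  have "initial \<tau>0 m' x (span {z})"
    unfolding initial_def
  proof (intro conjI allI impI)
    show "null_line (span {z})" by (rule null_line_span[OF z0 zz])
    have "form42 z (conserved \<tau>0 m' x) = 0" unfolding z_def conserved_pairing[OF t0 open_UNIV UNIV_I] by (rule vP)
    then show "span {z} \<subseteq> perp {conserved \<tau>0 m' x}"
      by (intro span_minimal subspace_perp) (simp add: perp_def form42_commute)
    show "\<not> span {z} \<subseteq> perp (L x)"
    proof
      assume "span {z} \<subseteq> perp (L x)"
      then have "z \<in> perp (L x)" by (auto simp: span_base)
      then show False using zl genD(4)[OF g] by (simp add: perp_def)
    qed
    fix c assume c: "curvature_sphere A f x c"
    let ?e = "a c *\<^sub>R \<sigma> x + b c *\<^sub>R lam x"
    have cc: "c = span {?e}" using ab c by blast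
    have "?e \<in> f x" using c cc span_base[of ?e "{?e}"] unfolding curvature_sphere_def by blast
    then have "form42 ?e z = a c * r + b c" using fz[of ?e] vs vl by (simp only: form42_simps)
    then have "form42 ?e z \<noteq> 0" using rn c by simp
    then show "\<not> c \<subseteq> perp (span {z})"
      unfolding perp_span using cc span_base[of ?e "{?e}"] by (auto simp: perp_def form42_commute)
  qed
  then show ?thesis by (rule that)
qed

text \<open>Each curvature sphere is a line and there are finitely many of them, so all open
  conditions become finitely many inequalities on a vector of \<open>l\<close>. The bound on
  \<open>m'\<close> keeps the square \<open>K (1 + 2 m')\<close> of \<open>conserved\<close> away
  from zero.\<close>

lemma initial_submanifold:
  assumes t0: "gauge_field UNIV \<tau>0" and m: "m' > - 1/2"
  shows "lightcone_submanifold 3 {l. initial \<tau>0 m' x l}"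
  unfolding lightcone_submanifold_def
proof (intro conjI)
  show "{l. initial \<tau>0 m' x l} \<noteq> {}" using initial_exists[OF t0] by blast
  show "\<forall>l\<in>{l. initial \<tau>0 m' x l}. null_line l" by (simp add: initial_def)
  obtain lam where g: "gen x lam" by (rule L_gen)
  let ?CS = "{c. curvature_sphere A f x c}"
  have "\<exists>e. c = span {e}" if c: "c \<in> ?CS" for c
  proof -
    have "subspace c" "dim c = 1" using c unfolding curvature_sphere_def by blast+
    then obtain e where "c = span {e}" by (rule dim1_obtain)
    then show ?thesis ..
  qed
  then obtain e where e: "\<And>c. c \<in> ?CS \<Longrightarrow> c = span {e c}" by metis
  define G where "G = insert (lam x) (e ` ?CS)"
  have fG: "finite G" unfolding G_def using curvature_spheres_finite by simp
  let ?P = "conserved \<tau>0 m' x"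
  have line: "initial \<tau>0 m' x (span {v}) \<longleftrightarrow> form42 v v = 0 \<and> form42 ?P v = 0 \<and> (\<forall>a\<in>G. form42 a v \<noteq> 0)" if v: "v \<noteq> 0" for v
  proof -
    have 1: "null_line (span {v}) \<longleftrightarrow> form42 v v = 0"
      using null_line_span[OF v] by (auto simp: null_line_def isotropic_def span_base)
    have sub: "span {a} \<subseteq> perp S \<longleftrightarrow> a \<in> perp S" for a S
      using span_minimal[OF _ subspace_perp, of "{a}" S] span_base[of a "{a}"] by blast
    have 2: "span {v} \<subseteq> perp {?P} \<longleftrightarrow> form42 ?P v = 0" unfolding sub by (simp add: perp_def)
    have 3: "span {v} \<subseteq> perp (L x) \<longleftrightarrow> form42 (lam x) v = 0"
      unfolding sub genD(3)[OF g] perp_span by (simp add: perp_def)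
    have 4: "c \<subseteq> perp (span {v}) \<longleftrightarrow> form42 (e c) v = 0" if "c \<in> ?CS" for c
      by (subst e[OF that]) (simp add: sub perp_span, simp add: perp_def form42_commute)
    show ?thesis unfolding initial_def 1 2 3 G_def using 4 by auto
  qed
  have "\<Union> {l. initial \<tau>0 m' x l} - {0} = {v. form42 v v = 0 \<and> form42 ?P v = 0 \<and> v \<noteq> 0 \<and> (\<forall>a\<in>G. form42 a v \<noteq> 0)}" (is "?L = ?R")
  proof (intro set_eqI iffI)
    fix v assume "v \<in> ?L"
    then obtain l where l: "initial \<tau>0 m' x l" "v \<in> l" "v \<noteq> 0" by blast
    then have "l = span {v}" using dim1_span unfolding initial_def null_line_def by blast
    then show "v \<in> ?R" using l line by simp
  next
    fix v assume "v \<in> ?R"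
    then show "v \<in> ?L" using line[of v] span_base[of v "{v}"] by blast
  qed
  moreover have "form42 ?P ?P \<noteq> 0" using conserved_norm[OF t0 open_UNIV UNIV_I, of m' x] pp m by simp
  ultimately show "submanifold (3 + 1) (\<Union> {l. initial \<tau>0 m' x l} - {0})"
    using submanifold_null_cone[OF _ fG] by simp
qed

text \<open>The right side is the image of the admissible \<open>m\<close> under
  \<open>(m^2 - 1) / 2\<close>. That every value occurs is seen from one transform near a single
  point, in the trivial gauge.\<close>

lemma parameters_eq: "{m'. \<exists>U. open U \<and> U \<noteq> {} \<and> F U m' \<noteq> {}} = {m'. m' > - 1/2 \<and> m' \<noteq> 0}"
proof (intro set_eqI iffI)
  fix m' assume "m' \<in> {m'. \<exists>U. open U \<and> U \<noteq> {} \<and> F U m' \<noteq> {}}"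
  then obtain U fhat where "fhat \<in> F U m'" by blast
  then obtain m where m: "(m\<^sup>2 - 1) / 2 = m'" "m \<noteq> 0" "m \<noteq> 1" "m \<noteq> -1"
    unfolding eisenhart_family_def eisenhart_transform_def by blast
  have "0 < m\<^sup>2 / 2" "m\<^sup>2 \<noteq> 1" using m by (auto simp: power2_eq_1_iff)
  moreover have "m' = m\<^sup>2 / 2 - 1 / 2" unfolding m(1)[symmetric] by (simp add: diff_divide_distrib)
  ultimately show "m' \<in> {m'. m' > - 1/2 \<and> m' \<noteq> 0}" by auto
next
  fix m' :: real assume m: "m' \<in> {m'. m' > - 1/2 \<and> m' \<noteq> 0}"
  have t0: "gauge_field UNIV (tau (\<lambda>_. 0))"
    by (rule gauge_field_tau[OF open_UNIV smooth_at_const]) (rule subspace_0[OF L_subspace])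
  \<comment> \<open>\<open>undefined\<close> stands for an arbitrary point of the surface.\<close>
  obtain l where l: "initial (tau (\<lambda>_. 0)) m' undefined l" by (rule initial_exists[OF t0])
  obtain U s fhat where "open U" "undefined \<in> U" "fhat \<in> F U m'"
    by (rule initial_sufficient[OF t0 _ _ l]) (use m in auto)
  then show "m' \<in> {m'. \<exists>U. open U \<and> U \<noteq> {} \<and> F U m' \<noteq> {}}" by blast
qed

text \<open>For each member of the gauge orbit, \<open>initial_necessary\<close> and
  \<open>initial_sufficient\<close> identify the initial values of the parallel lines at any base
  point with the set described by \<open>initial\<close>, to which the quadric lemma
  applies.\<close>

lemma family: "darboux_family A f eta 4 F"
  unfolding darboux_family_def
proof (intro conjI allI impI ballI)
  show "darboux_transform A U f eta m' fhat" if "open U" "fhat \<in> F U m'" for U m' fhat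
    by (rule family_darboux[OF that])
  have "open {m'::real. m' > - 1/2 \<and> m' \<noteq> 0}"
    by (intro open_Collect_conj open_Collect_less open_Collect_neq continuous_intros)
  moreover have "{m'::real. m' > - 1/2 \<and> m' \<noteq> 0} \<noteq> {}"
  proof -
    have "1 \<in> {m'::real. m' > - 1/2 \<and> m' \<noteq> 0}" by simp
    then show ?thesis by blast
  qed
  moreover have "lightcone_submanifold 3 {s x0 |U s. open U \<and> x0 \<in> U \<and> darboux_line A U f \<eta>' m' s \<and>
              (\<exists>fhat \<in> F U m'. \<forall>x\<in>U. fhat x = transform_bundle f s x)}"
    if "\<eta>' \<in> gauge_orbit A UNIV f eta" and m': "m' > - 1/2" "m' \<noteq> 0" for \<eta>' m' x0
  proof -
    obtain \<tau>0 where t0: "gauge_field UNIV \<tau>0" and eq: "\<And>x X w. \<eta>' x X w = gauge_form eta \<tau>0 x X w"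
      using \<open>\<eta>' \<in> _\<close> unfolding gauge_orbit_iff by blast
    have dl: "darboux_line A U f \<eta>' m' s \<longleftrightarrow> darboux_line A U f (gauge_form eta \<tau>0) m' s" for U s
      by (rule darboux_line_cong[OF eq])
    have "{s x0 |U s. open U \<and> x0 \<in> U \<and> darboux_line A U f \<eta>' m' s \<and>
              (\<exists>fhat \<in> F U m'. \<forall>x\<in>U. fhat x = transform_bundle f s x)} = {l. initial \<tau>0 m' x0 l}"
      unfolding dl
    proof (intro set_eqI iffI)
      fix l assume "l \<in> {s x0 |U s. open U \<and> x0 \<in> U \<and> darboux_line A U f (gauge_form eta \<tau>0) m' s \<and>
              (\<exists>fhat \<in> F U m'. \<forall>x\<in>U. fhat x = transform_bundle f s x)}"
      then obtain U s fhat where "l = s x0" "open U" "x0 \<in> U" "darboux_line A U f (gauge_form eta \<tau>0) m' s"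
        "fhat \<in> F U m'" "\<forall>x\<in>U. fhat x = transform_bundle f s x" by blast
      then show "l \<in> {l. initial \<tau>0 m' x0 l}" using initial_necessary[OF t0] by blast
    next
      fix l assume "l \<in> {l. initial \<tau>0 m' x0 l}"
      then have l: "initial \<tau>0 m' x0 l" by simp
      obtain U s fhat where "open U" "x0 \<in> U" "darboux_line A U f (gauge_form eta \<tau>0) m' s" "s x0 = l"
        "fhat \<in> F U m'" "\<forall>x\<in>U. fhat x = transform_bundle f s x" by (rule initial_sufficient[OF t0 m' l])
      then show "l \<in> {s x0 |U s. open U \<and> x0 \<in> U \<and> darboux_line A U f (gauge_form eta \<tau>0) m' s \<and>
              (\<exists>fhat \<in> F U m'. \<forall>x\<in>U. fhat x = transform_bundle f s x)}" by blast
    qed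
    then show ?thesis using initial_submanifold[OF t0 m'(1)] by simp
  qed
  ultimately show "\<exists>k M. 4 = 1 + k \<and> M = {m'. \<exists>U. open U \<and> U \<noteq> {} \<and> F U m' \<noteq> {}} \<and>
        open M \<and> M \<noteq> {} \<and> 0 \<notin> M \<and>
        (\<forall>\<eta>' \<in> gauge_orbit A UNIV f eta. \<forall>m'\<in>M. \<forall>x0.
           lightcone_submanifold k {s x0 |U s. open U \<and> x0 \<in> U \<and> darboux_line A U f \<eta>' m' s \<and>
              (\<exists>fhat \<in> F U m'. \<forall>x\<in>U. fhat x = transform_bundle f s x)})"
    unfolding parameters_eq by (intro exI[of _ 3] exI[of _ "{m'. m' > - 1/2 \<and> m' \<noteq> 0}"]) auto
qed

end

theorem theorem5p10:
  fixes A :: "'a::{t2_space, second_countable_topology} chart set"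
    and p :: R42
    and \<Lambda> f V :: "'a vbundle"
    and chi :: "'a end_form"
  assumes "smooth_atlas A"
    and "form42 p p \<noteq> 0"
    and "conformal_surface A UNIV p \<Lambda>"
    and "guichard_potential A UNIV p \<Lambda> V chi"
    and "\<forall>x. nondegenerate (guichard_quad_diff A \<Lambda> V chi x)"
    and "legendre_map A UNIV f"
    and "\<forall>x. \<Lambda> x \<subseteq> f x"
    and "umbilic_free A UNIV f"
  shows "\<exists>\<mu> :: real \<Rightarrow> real.
    darboux_family A f (guichard_gauge_potential A f V chi) 4
      (eisenhart_family A p \<Lambda> f (guichard_quad_diff A \<Lambda> V chi) \<mu>)"
proof -
  interpret legendre_lift A p \<Lambda> f using assms by unfold_locales auto
  have gp: "sphere_congruence A UNIV p V" "envelops A UNIV \<Lambda> V" "form1 A UNIV (\<lambda>x. wedge_space (\<Lambda> x) (derived A \<Lambda> x)) chi"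
    "\<And>t. flat A UNIV (guichard_connection A V chi t)" using assms(4) by (auto simp: guichard_potential_def)
  obtain \<sigma> where \<sigma>: "normalized UNIV \<sigma>" "\<And>x. x \<in> UNIV \<Longrightarrow> V x = perp {p, \<sigma> x}"
    by (rule normal_section_exists[OF open_UNIV gp(1,2)]) blast
  interpret umbilic_free_guichard A p \<Lambda> f V \<sigma> chi
    using \<sigma> gp assms(5,8) by unfold_locales auto
  \<comment> \<open>Twice the factor \<open>- K / 2\<close> of \<open>N_tilde_eq\<close> is the
    coefficient \<open>- K\<close> in \<open>eta\<close>.\<close>
  have "guichard_gauge_potential A f V chi = eta"
    by (intro ext) (simp add: guichard_gauge_potential_def N_tilde_eq eta_def scaleR_diff_right)
  then show ?thesis using family by auto
qed

end
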